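(* (Fitting's lemma) Let $H$ be a Hopf algebra in $\mathcal B$, and let $f$ be a Hopf algebra endomorphism of $H$. Assume that $H$ satisfies both chain conditions, so that there is an $n\in\mathbb N$ such that $H\cong \operatorname{Im}(f^n)\otimes {}^{\operatorname{co} f^n}H$ is a Radford biproduct. If $f$ is normal, then the action of $\operatorname{Im}(f^n)$ on ${}^{\operatorname{co} f^n}H$ is trivial, so that, as an algebra, $H$ is the tensor product of $\operatorname{Im}(f^n)$ and ${}^{\operatorname{co} f^n}H$ in $\mathcal B$. Similarly, if $f$ is conormal, then the coalgebra $H$ is the tensor product of the coalgebras $\operatorname{Im}(f^n)$ and ${}^{\operatorname{co} f^n}H$ in $\mathcal B$. In particular, if $f$ is binormal, then $\operatorname{Im}(f^n)$ and ${}^{\operatorname{co} f^n}H$ are unbraided Hopf algebras in $\mathcal B$, and $H$ is isomorphic (as a Hopf algebra) to their tensor product.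
   Context: $\mathcal B$ is an abelian category that is a (strict) braided tensor category with unit object $I$, braiding $\tau$, and exact tensor products. Algebras, coalgebras, bialgebras, Hopf algebras are taken in $\mathcal B$, with structure maps $\nabla,\eta,\Delta,\epsilon,S$. The identity of an object $X$ is also written $X$. Convolution of $f,g\colon C\to A$ ($C$ a coalgebra, $A$ an algebra) is $f*g=\nabla(f\otimes g)\Delta$. Objects $V,W$ are unbraided if $\tau_{VW}=\tau_{WV}^{-1}$; the tensor product of two Hopf algebras is a Hopf algebra when they are unbraided. $\mathbb N$ denotes the positive integers, and $f^n$ is the $n$-fold composite. Chain conditions: a Hopf algebra satisfies both chain conditions if it satisfies the descending chain condition on Hopf subalgebras and the descending chain condition on quotient Hopf algebras (i.e. every sequence of quotient Hopf algebras $H\to Q_1\to Q_2\to\cdots$, each a quotient of the previous one, stabilizes). Coinvariants: for a Hopf algebra morphism $f\colon H\to G$, ${}^{\operatorname{co}f}H$ is the equalizer of $(f\otimes H)\Delta$ and $\eta\otimes H\colon H\to G\otimes H$. Radford biproduct: if $\pi$ is an idempotent Hopf algebra endomorphism of $H$, then $p=(\pi S)*\operatorname{id}_H$ is an idempotent endomorphism of the object $H$, $B:=\operatorname{Im}(p)\cong{}^{\operatorname{co}\pi}H$ is a subalgebra and a quotient coalgebra of $H$, and $H\cong\operatorname{Im}(\pi)\otimes B$, where the algebra structure on $\operatorname{Im}(\pi)\otimes B$ is a semidirect product with respect to a certain action of $\operatorname{Im}(\pi)$ on $B$ and the coalgebra structure is a cosemidirect product with respect to a certain coaction; such a decomposition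 is called a Radford biproduct. That $H\cong \operatorname{Im}(f^n)\otimes{}^{\operatorname{co}f^n}H$ is a Radford biproduct means that it is the decomposition arising from an idempotent Hopf algebra endomorphism $\pi$ of $H$ with $\operatorname{Im}(\pi)=\operatorname{Im}(f^n)$ and ${}^{\operatorname{co}\pi}H={}^{\operatorname{co}f^n}H$. Normality: the left adjoint action is $\mathrm{ad}=\nabla(H\otimes\nabla)(H\otimes H\otimes S)(H\otimes\tau_{H,H})(\Delta\otimes H)\colon H\otimes H\to H$, and the left coadjoint coaction is $\mathrm{coad}=(\nabla\otimes H)(H\otimes\tau_{H,H})(H\otimes H\otimes S)(H\otimes\Delta)\Delta\colon H\to H\otimes H$. A morphism $f\colon H\to H$ is normal if $f\circ\mathrm{ad}=\mathrm{ad}\circ(H\otimes f)$, conormal if $\mathrm{coad}\circ f=(H\otimes f)\circ\mathrm{coad}$, and binormal if it is both. *)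

theory Defs
  imports "HOL-Algebra.Group"
begin

section \<open>Abelian categories\<close>

text \<open>Hom-sets are pairwise disjoint, so a morphism determines its source and target.
  Composition is written in the usual order: \<open>g \<cdot> f\<close> is \<open>g\<close> after \<open>f\<close>.\<close>

record ('o, 'm) category =
  Obj :: "'o set"
  Hom :: "'o \<Rightarrow> 'o \<Rightarrow> 'm set"
  Ident :: "'o \<Rightarrow> 'm" ("\<iota>\<index>")
  Comp :: "'m \<Rightarrow> 'm \<Rightarrow> 'm" (infixl "\<cdot>\<index>" 65)

record ('o, 'm) ab_category = "('o, 'm) category" +
  Add :: "'m \<Rightarrow> 'm \<Rightarrow> 'm" (infixl "\<boxplus>\<index>" 60)
  Zero :: "'o \<Rightarrow> 'o \<Rightarrow> 'm"

locale category =
  fixes C :: "('o, 'm, 'e) category_scheme" (structure)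
  assumes Hom_Obj: "f \<in> Hom C X Y \<Longrightarrow> X \<in> Obj C \<and> Y \<in> Obj C"
    and Hom_disjoint: "\<lbrakk>f \<in> Hom C X Y; f \<in> Hom C X' Y'\<rbrakk> \<Longrightarrow> X = X' \<and> Y = Y'"
    and Ident_Hom: "X \<in> Obj C \<Longrightarrow> \<iota> X \<in> Hom C X X"
    and Comp_Hom: "\<lbrakk>g \<in> Hom C Y Z; f \<in> Hom C X Y\<rbrakk> \<Longrightarrow> g \<cdot> f \<in> Hom C X Z"
    and Ident_left: "f \<in> Hom C X Y \<Longrightarrow> \<iota> Y \<cdot> f = f"
    and Ident_right: "f \<in> Hom C X Y \<Longrightarrow> f \<cdot> \<iota> X = f"
    and Comp_assoc:
      "\<lbrakk>h \<in> Hom C Y Z; g \<in> Hom C X Y; f \<in> Hom C W X\<rbrakk> \<Longrightarrow> (h \<cdot> g) \<cdot> f = h \<cdot> (g \<cdot> f)"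

context
  fixes C :: "('o, 'm, 'e) category_scheme" (structure)
begin

definition inverse_arrows :: "'m \<Rightarrow> 'm \<Rightarrow> bool" where
  "inverse_arrows f g \<longleftrightarrow>
     (\<exists>X Y. f \<in> Hom C X Y \<and> g \<in> Hom C Y X \<and> g \<cdot> f = \<iota> X \<and> f \<cdot> g = \<iota> Y)"

definition is_isomorphism :: "'m \<Rightarrow> bool" where
  "is_isomorphism f \<longleftrightarrow> (\<exists>g. inverse_arrows f g)"

definition is_mono :: "'m \<Rightarrow> bool" where
  "is_mono f \<longleftrightarrow> (\<exists>X Y. f \<in> Hom C X Y \<and>
     (\<forall>T. \<forall>s \<in> Hom C T X. \<forall>t \<in> Hom C T X. f \<cdot> s = f \<cdot> t \<longrightarrow> s = t))"

definition is_epi :: "'m \<Rightarrow> bool" where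
  "is_epi f \<longleftrightarrow> (\<exists>X Y. f \<in> Hom C X Y \<and>
     (\<forall>T. \<forall>s \<in> Hom C Y T. \<forall>t \<in> Hom C Y T. s \<cdot> f = t \<cdot> f \<longrightarrow> s = t))"

definition is_equalizer :: "'m \<Rightarrow> 'm \<Rightarrow> 'm \<Rightarrow> bool" where
  "is_equalizer f g e \<longleftrightarrow> (\<exists>E X Y. f \<in> Hom C X Y \<and> g \<in> Hom C X Y \<and> e \<in> Hom C E X \<and>
     f \<cdot> e = g \<cdot> e \<and>
     (\<forall>T. \<forall>t \<in> Hom C T X. f \<cdot> t = g \<cdot> t \<longrightarrow> (\<exists>!u. u \<in> Hom C T E \<and> e \<cdot> u = t)))"

definition is_coequalizer :: "'m \<Rightarrow> 'm \<Rightarrow> 'm \<Rightarrow> bool" where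
  "is_coequalizer f g q \<longleftrightarrow> (\<exists>X Y Q. f \<in> Hom C X Y \<and> g \<in> Hom C X Y \<and> q \<in> Hom C Y Q \<and>
     q \<cdot> f = q \<cdot> g \<and>
     (\<forall>T. \<forall>t \<in> Hom C Y T. t \<cdot> f = t \<cdot> g \<longrightarrow> (\<exists>!u. u \<in> Hom C Q T \<and> u \<cdot> q = t)))"

primrec cpow :: "'o \<Rightarrow> 'm \<Rightarrow> nat \<Rightarrow> 'm" where
  "cpow X f 0 = \<iota> X"
| "cpow X f (Suc n) = f \<cdot> cpow X f n"

end

context
  fixes C :: "('o, 'm, 'e) ab_category_scheme" (structure)
begin

definition is_kernel :: "'m \<Rightarrow> 'm \<Rightarrow> bool" where
  "is_kernel f k \<longleftrightarrow> (\<exists>X Y. f \<in> Hom C X Y \<and> is_equalizer C f (Zero C X Y) k)"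

definition is_cokernel :: "'m \<Rightarrow> 'm \<Rightarrow> bool" where
  "is_cokernel f q \<longleftrightarrow> (\<exists>X Y. f \<in> Hom C X Y \<and> is_coequalizer C f (Zero C X Y) q)"

text \<open>Images in an abelian category: the kernel of the cokernel.\<close>

definition is_image :: "'m \<Rightarrow> 'm \<Rightarrow> bool" where
  "is_image f i \<longleftrightarrow> (\<exists>q. is_cokernel f q \<and> is_kernel q i)"

definition is_biproduct :: "'o \<Rightarrow> 'o \<Rightarrow> 'o \<Rightarrow> 'm \<Rightarrow> 'm \<Rightarrow> 'm \<Rightarrow> 'm \<Rightarrow> bool" where
  "is_biproduct X Y P i\<^sub>1 i\<^sub>2 p\<^sub>1 p\<^sub>2 \<longleftrightarrow>
     i\<^sub>1 \<in> Hom C X P \<and> i\<^sub>2 \<in> Hom C Y P \<and> p\<^sub>1 \<in> Hom C P X \<and> p\<^sub>2 \<in> Hom C P Y \<and>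
     p\<^sub>1 \<cdot> i\<^sub>1 = \<iota> X \<and> p\<^sub>2 \<cdot> i\<^sub>2 = \<iota> Y \<and> (i\<^sub>1 \<cdot> p\<^sub>1) \<boxplus> (i\<^sub>2 \<cdot> p\<^sub>2) = \<iota> P"

end

locale abelian_category = category C
  for C :: "('o, 'm, 'e) ab_category_scheme" (structure) +
  assumes Hom_group: "\<lbrakk>X \<in> Obj C; Y \<in> Obj C\<rbrakk> \<Longrightarrow>
      comm_group \<lparr>carrier = Hom C X Y, monoid.mult = Add C, one = Zero C X Y\<rparr>"
    and Comp_Add_right: "\<lbrakk>h \<in> Hom C Y Z; f \<in> Hom C X Y; g \<in> Hom C X Y\<rbrakk> \<Longrightarrow>
      h \<cdot> (f \<boxplus> g) = (h \<cdot> f) \<boxplus> (h \<cdot> g)"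
    and Comp_Add_left: "\<lbrakk>f \<in> Hom C Y Z; g \<in> Hom C Y Z; h \<in> Hom C X Y\<rbrakk> \<Longrightarrow>
      (f \<boxplus> g) \<cdot> h = (f \<cdot> h) \<boxplus> (g \<cdot> h)"
    and zero_object: "\<exists>Z \<in> Obj C. \<iota> Z = Zero C Z Z"
    and biproducts: "\<lbrakk>X \<in> Obj C; Y \<in> Obj C\<rbrakk> \<Longrightarrow>
      \<exists>P i\<^sub>1 i\<^sub>2 p\<^sub>1 p\<^sub>2. is_biproduct C X Y P i\<^sub>1 i\<^sub>2 p\<^sub>1 p\<^sub>2"
    and kernels: "f \<in> Hom C X Y \<Longrightarrow> \<exists>k. is_kernel C f k"
    and cokernels: "f \<in> Hom C X Y \<Longrightarrow> \<exists>q. is_cokernel C f q"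
    and mono_kernel: "is_mono C f \<Longrightarrow> \<exists>g. is_kernel C g f"
    and epi_cokernel: "is_epi C f \<Longrightarrow> \<exists>g. is_cokernel C g f"

section \<open>Strict braided tensor categories with exact tensor products\<close>

record ('o, 'm) tensor_category = "('o, 'm) ab_category" +
  TensO :: "'o \<Rightarrow> 'o \<Rightarrow> 'o" (infixr "\<odot>\<index>" 75)
  TensM :: "'m \<Rightarrow> 'm \<Rightarrow> 'm" (infixr "\<boxtimes>\<index>" 70)
  UnitO :: "'o"
  Braid :: "'o \<Rightarrow> 'o \<Rightarrow> 'm" ("\<tau>\<index>")

locale strict_tensor_category = category C
  for C :: "('o, 'm, 'e) tensor_category_scheme" (structure) +
  assumes TensO_Obj: "\<lbrakk>X \<in> Obj C; Y \<in> Obj C\<rbrakk> \<Longrightarrow> X \<odot> Y \<in> Obj C"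
    and UnitO_Obj: "UnitO C \<in> Obj C"
    and TensM_Hom: "\<lbrakk>f \<in> Hom C X Y; f' \<in> Hom C X' Y'\<rbrakk> \<Longrightarrow> f \<boxtimes> f' \<in> Hom C (X \<odot> X') (Y \<odot> Y')"
    and TensM_Ident: "\<lbrakk>X \<in> Obj C; Y \<in> Obj C\<rbrakk> \<Longrightarrow> \<iota> X \<boxtimes> \<iota> Y = \<iota> (X \<odot> Y)"
    and TensM_Comp: "\<lbrakk>g \<in> Hom C Y Z; f \<in> Hom C X Y; g' \<in> Hom C Y' Z'; f' \<in> Hom C X' Y'\<rbrakk> \<Longrightarrow>
      (g \<cdot> f) \<boxtimes> (g' \<cdot> f') = (g \<boxtimes> g') \<cdot> (f \<boxtimes> f')"
    and TensO_assoc: "\<lbrakk>X \<in> Obj C; Y \<in> Obj C; Z \<in> Obj C\<rbrakk> \<Longrightarrow> (X \<odot> Y) \<odot> Z = X \<odot> (Y \<odot> Z)"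
    and TensM_assoc: "\<lbrakk>f \<in> Hom C X X'; g \<in> Hom C Y Y'; h \<in> Hom C Z Z'\<rbrakk> \<Longrightarrow>
      (f \<boxtimes> g) \<boxtimes> h = f \<boxtimes> (g \<boxtimes> h)"
    and TensO_unit_left: "X \<in> Obj C \<Longrightarrow> UnitO C \<odot> X = X"
    and TensO_unit_right: "X \<in> Obj C \<Longrightarrow> X \<odot> UnitO C = X"
    and TensM_unit_left: "f \<in> Hom C X Y \<Longrightarrow> \<iota> (UnitO C) \<boxtimes> f = f"
    and TensM_unit_right: "f \<in> Hom C X Y \<Longrightarrow> f \<boxtimes> \<iota> (UnitO C) = f"

locale braided_tensor_category = strict_tensor_category C
  for C :: "('o, 'm, 'e) tensor_category_scheme" (structure) +
  assumes Braid_Hom: "\<lbrakk>X \<in> Obj C; Y \<in> Obj C\<rbrakk> \<Longrightarrow> \<tau> X Y \<in> Hom C (X \<odot> Y) (Y \<odot> X)"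
    and Braid_iso: "\<lbrakk>X \<in> Obj C; Y \<in> Obj C\<rbrakk> \<Longrightarrow> is_isomorphism C (\<tau> X Y)"
    and Braid_natural: "\<lbrakk>f \<in> Hom C X X'; g \<in> Hom C Y Y'\<rbrakk> \<Longrightarrow>
      \<tau> X' Y' \<cdot> (f \<boxtimes> g) = (g \<boxtimes> f) \<cdot> \<tau> X Y"
    and hexagon_right: "\<lbrakk>X \<in> Obj C; Y \<in> Obj C; Z \<in> Obj C\<rbrakk> \<Longrightarrow>
      \<tau> X (Y \<odot> Z) = (\<iota> Y \<boxtimes> \<tau> X Z) \<cdot> (\<tau> X Y \<boxtimes> \<iota> Z)"
    and hexagon_left: "\<lbrakk>X \<in> Obj C; Y \<in> Obj C; Z \<in> Obj C\<rbrakk> \<Longrightarrow>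
      \<tau> (X \<odot> Y) Z = (\<tau> X Z \<boxtimes> \<iota> Y) \<cdot> (\<iota> X \<boxtimes> \<tau> Y Z)"

text \<open>Exactness of the tensor product: the functors \<open>X \<odot> -\<close> and \<open>- \<odot> X\<close> are additive and
  preserve kernels and cokernels.\<close>

locale abelian_braided_category = abelian_category C + braided_tensor_category C
  for C :: "('o, 'm, 'e) tensor_category_scheme" (structure) +
  assumes TensM_Add_right: "\<lbrakk>X \<in> Obj C; f \<in> Hom C Y Z; g \<in> Hom C Y Z\<rbrakk> \<Longrightarrow>
      \<iota> X \<boxtimes> (f \<boxplus> g) = (\<iota> X \<boxtimes> f) \<boxplus> (\<iota> X \<boxtimes> g)"
    and TensM_Add_left: "\<lbrakk>X \<in> Obj C; f \<in> Hom C Y Z; g \<in> Hom C Y Z\<rbrakk> \<Longrightarrow>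
      (f \<boxplus> g) \<boxtimes> \<iota> X = (f \<boxtimes> \<iota> X) \<boxplus> (g \<boxtimes> \<iota> X)"
    and kernel_TensM_right: "\<lbrakk>X \<in> Obj C; is_kernel C f k\<rbrakk> \<Longrightarrow> is_kernel C (\<iota> X \<boxtimes> f) (\<iota> X \<boxtimes> k)"
    and kernel_TensM_left: "\<lbrakk>X \<in> Obj C; is_kernel C f k\<rbrakk> \<Longrightarrow> is_kernel C (f \<boxtimes> \<iota> X) (k \<boxtimes> \<iota> X)"
    and cokernel_TensM_right: "\<lbrakk>X \<in> Obj C; is_cokernel C f q\<rbrakk> \<Longrightarrow> is_cokernel C (\<iota> X \<boxtimes> f) (\<iota> X \<boxtimes> q)"
    and cokernel_TensM_left: "\<lbrakk>X \<in> Obj C; is_cokernel C f q\<rbrakk> \<Longrightarrow> is_cokernel C (f \<boxtimes> \<iota> X) (q \<boxtimes> \<iota> X)"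

section \<open>Hopf algebras in a braided category\<close>

text \<open>\<open>alg_coalg\<close> bundles the data of an algebra and of a coalgebra on the same object, without
  any compatibility: the second factor of a Radford biproduct is in general not a bialgebra.\<close>

record ('o, 'm) alg_coalg =
  ob :: 'o
  nabla :: 'm ("\<nabla>\<index>")
  eta :: 'm ("\<eta>\<index>")
  delta :: 'm ("\<Delta>\<index>")
  eps :: 'm ("\<epsilon>\<index>")

record ('o, 'm) hopf_data = "('o, 'm) alg_coalg" +
  antipode :: 'm

context
  fixes C :: "('o, 'm, 'e) tensor_category_scheme" (structure)
begin

definition is_algebra :: "('o, 'm, 'x) alg_coalg_scheme \<Rightarrow> bool" where
  "is_algebra A \<longleftrightarrow> ob A \<in> Obj C \<and>
     \<nabla>\<^bsub>A\<^esub> \<in> Hom C (ob A \<odot> ob A) (ob A) \<and> \<eta>\<^bsub>A\<^esub> \<in> Hom C (UnitO C) (ob A) \<and>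
     \<nabla>\<^bsub>A\<^esub> \<cdot> (\<nabla>\<^bsub>A\<^esub> \<boxtimes> \<iota> (ob A)) = \<nabla>\<^bsub>A\<^esub> \<cdot> (\<iota> (ob A) \<boxtimes> \<nabla>\<^bsub>A\<^esub>) \<and>
     \<nabla>\<^bsub>A\<^esub> \<cdot> (\<eta>\<^bsub>A\<^esub> \<boxtimes> \<iota> (ob A)) = \<iota> (ob A) \<and> \<nabla>\<^bsub>A\<^esub> \<cdot> (\<iota> (ob A) \<boxtimes> \<eta>\<^bsub>A\<^esub>) = \<iota> (ob A)"

definition is_coalgebra :: "('o, 'm, 'x) alg_coalg_scheme \<Rightarrow> bool" where
  "is_coalgebra A \<longleftrightarrow> ob A \<in> Obj C \<and>
     \<Delta>\<^bsub>A\<^esub> \<in> Hom C (ob A) (ob A \<odot> ob A) \<and> \<epsilon>\<^bsub>A\<^esub> \<in> Hom C (ob A) (UnitO C) \<and>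
     (\<Delta>\<^bsub>A\<^esub> \<boxtimes> \<iota> (ob A)) \<cdot> \<Delta>\<^bsub>A\<^esub> = (\<iota> (ob A) \<boxtimes> \<Delta>\<^bsub>A\<^esub>) \<cdot> \<Delta>\<^bsub>A\<^esub> \<and>
     (\<epsilon>\<^bsub>A\<^esub> \<boxtimes> \<iota> (ob A)) \<cdot> \<Delta>\<^bsub>A\<^esub> = \<iota> (ob A) \<and> (\<iota> (ob A) \<boxtimes> \<epsilon>\<^bsub>A\<^esub>) \<cdot> \<Delta>\<^bsub>A\<^esub> = \<iota> (ob A)"

definition algebra_hom ::
  "('o, 'm, 'x) alg_coalg_scheme \<Rightarrow> ('o, 'm, 'y) alg_coalg_scheme \<Rightarrow> 'm \<Rightarrow> bool" where
  "algebra_hom A A' f \<longleftrightarrow> f \<in> Hom C (ob A) (ob A') \<and>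
     f \<cdot> \<nabla>\<^bsub>A\<^esub> = \<nabla>\<^bsub>A'\<^esub> \<cdot> (f \<boxtimes> f) \<and> f \<cdot> \<eta>\<^bsub>A\<^esub> = \<eta>\<^bsub>A'\<^esub>"

definition coalgebra_hom ::
  "('o, 'm, 'x) alg_coalg_scheme \<Rightarrow> ('o, 'm, 'y) alg_coalg_scheme \<Rightarrow> 'm \<Rightarrow> bool" where
  "coalgebra_hom A A' f \<longleftrightarrow> f \<in> Hom C (ob A) (ob A') \<and>
     \<Delta>\<^bsub>A'\<^esub> \<cdot> f = (f \<boxtimes> f) \<cdot> \<Delta>\<^bsub>A\<^esub> \<and> \<epsilon>\<^bsub>A'\<^esub> \<cdot> f = \<epsilon>\<^bsub>A\<^esub>"

definition hopf_hom ::
  "('o, 'm, 'x) alg_coalg_scheme \<Rightarrow> ('o, 'm, 'y) alg_coalg_scheme \<Rightarrow> 'm \<Rightarrow> bool" where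
  "hopf_hom A A' f \<longleftrightarrow> algebra_hom A A' f \<and> coalgebra_hom A A' f"

definition tensor ::
  "('o, 'm, 'x) alg_coalg_scheme \<Rightarrow> ('o, 'm, 'y) alg_coalg_scheme \<Rightarrow> ('o, 'm) alg_coalg" where
  "tensor A A' = \<lparr>ob = ob A \<odot> ob A',
     nabla = (\<nabla>\<^bsub>A\<^esub> \<boxtimes> \<nabla>\<^bsub>A'\<^esub>) \<cdot> (\<iota> (ob A) \<boxtimes> \<tau> (ob A') (ob A) \<boxtimes> \<iota> (ob A')),
     eta = \<eta>\<^bsub>A\<^esub> \<boxtimes> \<eta>\<^bsub>A'\<^esub>,
     delta = (\<iota> (ob A) \<boxtimes> \<tau> (ob A) (ob A') \<boxtimes> \<iota> (ob A')) \<cdot> (\<Delta>\<^bsub>A\<^esub> \<boxtimes> \<Delta>\<^bsub>A'\<^esub>),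
     eps = \<epsilon>\<^bsub>A\<^esub> \<boxtimes> \<epsilon>\<^bsub>A'\<^esub>\<rparr>"

definition is_bialgebra :: "('o, 'm, 'x) alg_coalg_scheme \<Rightarrow> bool" where
  "is_bialgebra A \<longleftrightarrow> is_algebra A \<and> is_coalgebra A \<and>
     algebra_hom A (tensor A A) \<Delta>\<^bsub>A\<^esub> \<and>
     \<epsilon>\<^bsub>A\<^esub> \<cdot> \<nabla>\<^bsub>A\<^esub> = \<epsilon>\<^bsub>A\<^esub> \<boxtimes> \<epsilon>\<^bsub>A\<^esub> \<and> \<epsilon>\<^bsub>A\<^esub> \<cdot> \<eta>\<^bsub>A\<^esub> = \<iota> (UnitO C)"

definition convolution ::
  "('o, 'm, 'x) alg_coalg_scheme \<Rightarrow> ('o, 'm, 'y) alg_coalg_scheme \<Rightarrow> 'm \<Rightarrow> 'm \<Rightarrow> 'm" where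
  "convolution D A f g = \<nabla>\<^bsub>A\<^esub> \<cdot> (f \<boxtimes> g) \<cdot> \<Delta>\<^bsub>D\<^esub>"

definition is_hopf :: "('o, 'm, 'x) hopf_data_scheme \<Rightarrow> bool" where
  "is_hopf H \<longleftrightarrow> is_bialgebra H \<and> antipode H \<in> Hom C (ob H) (ob H) \<and>
     convolution H H (antipode H) (\<iota> (ob H)) = \<eta>\<^bsub>H\<^esub> \<cdot> \<epsilon>\<^bsub>H\<^esub> \<and>
     convolution H H (\<iota> (ob H)) (antipode H) = \<eta>\<^bsub>H\<^esub> \<cdot> \<epsilon>\<^bsub>H\<^esub>"

definition with_antipode :: "('o, 'm) alg_coalg \<Rightarrow> 'm \<Rightarrow> ('o, 'm) hopf_data" where
  "with_antipode A s = alg_coalg.extend A \<lparr>antipode = s\<rparr>"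

definition tensor_hopf :: "('o, 'm) hopf_data \<Rightarrow> ('o, 'm) hopf_data \<Rightarrow> ('o, 'm) hopf_data" where
  "tensor_hopf H H' = with_antipode (tensor H H') (antipode H \<boxtimes> antipode H')"

definition unbraided :: "'o \<Rightarrow> 'o \<Rightarrow> bool" where
  "unbraided V W \<longleftrightarrow> inverse_arrows C (\<tau> V W) (\<tau> W V)"

subsection \<open>Chain conditions\<close>

definition hopf_sub :: "('o, 'm) hopf_data \<Rightarrow> ('o, 'm) hopf_data \<Rightarrow> 'm \<Rightarrow> bool" where
  "hopf_sub H K i \<longleftrightarrow> is_hopf K \<and> hopf_hom K H i \<and> is_mono C i"

definition hopf_quotient :: "('o, 'm) hopf_data \<Rightarrow> ('o, 'm) hopf_data \<Rightarrow> 'm \<Rightarrow> bool" where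
  "hopf_quotient H Q q \<longleftrightarrow> is_hopf Q \<and> hopf_hom H Q q \<and> is_epi C q"

definition dcc_hopf_sub :: "('o, 'm) hopf_data \<Rightarrow> bool" where
  "dcc_hopf_sub H \<longleftrightarrow>
     (\<forall>K i. K 0 = H \<and> (\<forall>n::nat. hopf_sub (K n) (K (Suc n)) (i n)) \<longrightarrow>
        (\<exists>N. \<forall>n\<ge>N. is_isomorphism C (i n)))"

definition dcc_hopf_quotient :: "('o, 'm) hopf_data \<Rightarrow> bool" where
  "dcc_hopf_quotient H \<longleftrightarrow>
     (\<forall>Q q. Q 0 = H \<and> (\<forall>n::nat. hopf_quotient (Q n) (Q (Suc n)) (q n)) \<longrightarrow>
        (\<exists>N. \<forall>n\<ge>N. is_isomorphism C (q n)))"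

subsection \<open>Normality\<close>

definition ad :: "('o, 'm) hopf_data \<Rightarrow> 'm" where
  "ad H = \<nabla>\<^bsub>H\<^esub> \<cdot> (\<iota> (ob H) \<boxtimes> \<nabla>\<^bsub>H\<^esub>) \<cdot> (\<iota> (ob H) \<boxtimes> \<iota> (ob H) \<boxtimes> antipode H)
     \<cdot> (\<iota> (ob H) \<boxtimes> \<tau> (ob H) (ob H)) \<cdot> (\<Delta>\<^bsub>H\<^esub> \<boxtimes> \<iota> (ob H))"

definition coad :: "('o, 'm) hopf_data \<Rightarrow> 'm" where
  "coad H = (\<nabla>\<^bsub>H\<^esub> \<boxtimes> \<iota> (ob H)) \<cdot> (\<iota> (ob H) \<boxtimes> \<tau> (ob H) (ob H))
     \<cdot> (\<iota> (ob H) \<boxtimes> \<iota> (ob H) \<boxtimes> antipode H) \<cdot> (\<iota> (ob H) \<boxtimes> \<Delta>\<^bsub>H\<^esub>) \<cdot> \<Delta>\<^bsub>H\<^esub>"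

definition normal :: "('o, 'm) hopf_data \<Rightarrow> 'm \<Rightarrow> bool" where
  "normal H f \<longleftrightarrow> f \<cdot> ad H = ad H \<cdot> (\<iota> (ob H) \<boxtimes> f)"

definition conormal :: "('o, 'm) hopf_data \<Rightarrow> 'm \<Rightarrow> bool" where
  "conormal H f \<longleftrightarrow> coad H \<cdot> f = (\<iota> (ob H) \<boxtimes> f) \<cdot> coad H"

definition binormal :: "('o, 'm) hopf_data \<Rightarrow> 'm \<Rightarrow> bool" where
  "binormal H f \<longleftrightarrow> normal H f \<and> conormal H f"

subsection \<open>Radford biproducts\<close>

text \<open>\<open>j\<close> is the inclusion of the object of left coinvariants of \<open>f : H \<rightarrow> G\<close>.\<close>

definition is_coinvariants ::
  "('o, 'm) hopf_data \<Rightarrow> ('o, 'm) hopf_data \<Rightarrow> 'm \<Rightarrow> 'm \<Rightarrow> bool" where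
  "is_coinvariants H G f j \<longleftrightarrow>
     is_equalizer C ((f \<boxtimes> \<iota> (ob H)) \<cdot> \<Delta>\<^bsub>H\<^esub>) (\<eta>\<^bsub>G\<^esub> \<boxtimes> \<iota> (ob H)) j"

text \<open>Since the decomposition is \<open>H \<cong> Im \<pi> \<otimes> B\<close> with \<open>Im \<pi>\<close> on the left, \<open>K = Im \<pi>\<close> acts and
  coacts on \<open>B\<close> from the right.\<close>

definition module_algebra ::
  "('o, 'm) hopf_data \<Rightarrow> ('o, 'm) alg_coalg \<Rightarrow> 'm \<Rightarrow> bool" where
  "module_algebra K B \<alpha> \<longleftrightarrow> \<alpha> \<in> Hom C (ob B \<odot> ob K) (ob B) \<and>
     \<alpha> \<cdot> (\<alpha> \<boxtimes> \<iota> (ob K)) = \<alpha> \<cdot> (\<iota> (ob B) \<boxtimes> \<nabla>\<^bsub>K\<^esub>) \<and>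
     \<alpha> \<cdot> (\<iota> (ob B) \<boxtimes> \<eta>\<^bsub>K\<^esub>) = \<iota> (ob B) \<and>
     \<alpha> \<cdot> (\<nabla>\<^bsub>B\<^esub> \<boxtimes> \<iota> (ob K)) =
       \<nabla>\<^bsub>B\<^esub> \<cdot> (\<alpha> \<boxtimes> \<alpha>) \<cdot> (\<iota> (ob B) \<boxtimes> \<tau> (ob B) (ob K) \<boxtimes> \<iota> (ob K))
         \<cdot> (\<iota> (ob B) \<boxtimes> \<iota> (ob B) \<boxtimes> \<Delta>\<^bsub>K\<^esub>) \<and>
     \<alpha> \<cdot> (\<eta>\<^bsub>B\<^esub> \<boxtimes> \<iota> (ob K)) = \<eta>\<^bsub>B\<^esub> \<cdot> \<epsilon>\<^bsub>K\<^esub>"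

definition comodule_coalgebra ::
  "('o, 'm) hopf_data \<Rightarrow> ('o, 'm) alg_coalg \<Rightarrow> 'm \<Rightarrow> bool" where
  "comodule_coalgebra K B \<rho> \<longleftrightarrow> \<rho> \<in> Hom C (ob B) (ob B \<odot> ob K) \<and>
     (\<rho> \<boxtimes> \<iota> (ob K)) \<cdot> \<rho> = (\<iota> (ob B) \<boxtimes> \<Delta>\<^bsub>K\<^esub>) \<cdot> \<rho> \<and>
     (\<iota> (ob B) \<boxtimes> \<epsilon>\<^bsub>K\<^esub>) \<cdot> \<rho> = \<iota> (ob B) \<and>
     (\<Delta>\<^bsub>B\<^esub> \<boxtimes> \<iota> (ob K)) \<cdot> \<rho> =
       (\<iota> (ob B) \<boxtimes> \<iota> (ob B) \<boxtimes> \<nabla>\<^bsub>K\<^esub>) \<cdot> (\<iota> (ob B) \<boxtimes> \<tau> (ob K) (ob B) \<boxtimes> \<iota> (ob K))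
         \<cdot> (\<rho> \<boxtimes> \<rho>) \<cdot> \<Delta>\<^bsub>B\<^esub> \<and>
     (\<epsilon>\<^bsub>B\<^esub> \<boxtimes> \<iota> (ob K)) \<cdot> \<rho> = \<eta>\<^bsub>K\<^esub> \<cdot> \<epsilon>\<^bsub>B\<^esub>"

definition trivial_action ::
  "('o, 'm) hopf_data \<Rightarrow> ('o, 'm) alg_coalg \<Rightarrow> 'm \<Rightarrow> bool" where
  "trivial_action K B \<alpha> \<longleftrightarrow> \<alpha> = \<iota> (ob B) \<boxtimes> \<epsilon>\<^bsub>K\<^esub>"

definition trivial_coaction ::
  "('o, 'm) hopf_data \<Rightarrow> ('o, 'm) alg_coalg \<Rightarrow> 'm \<Rightarrow> bool" where
  "trivial_coaction K B \<rho> \<longleftrightarrow> \<rho> = \<iota> (ob B) \<boxtimes> \<eta>\<^bsub>K\<^esub>"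

text \<open>\<open>K \<otimes> B\<close> with the semidirect product algebra structure, in elements
  \<open>(k \<otimes> b) (k' \<otimes> b') = k k'\<^sub>1 \<otimes> (b \<triangleleft> k'\<^sub>2) b'\<close> up to braiding, and the cosemidirect product
  coalgebra structure, \<open>k \<otimes> b \<mapsto> k\<^sub>1 \<otimes> b\<^sub>1\<^sub>0 \<otimes> k\<^sub>2 b\<^sub>1\<^sub>1 \<otimes> b\<^sub>2\<close> up to braiding, where
  \<open>\<rho> b = b\<^sub>0 \<otimes> b\<^sub>1\<close> is the coaction.\<close>

definition semidirect ::
  "('o, 'm) hopf_data \<Rightarrow> ('o, 'm) alg_coalg \<Rightarrow> 'm \<Rightarrow> 'm \<Rightarrow> ('o, 'm) alg_coalg" where
  "semidirect K B \<alpha> \<rho> = \<lparr>ob = ob K \<odot> ob B,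
     nabla = (\<nabla>\<^bsub>K\<^esub> \<boxtimes> \<nabla>\<^bsub>B\<^esub>) \<cdot>
       (\<iota> (ob K)
         \<boxtimes> ((\<iota> (ob K) \<boxtimes> \<alpha>) \<cdot> (\<tau> (ob B) (ob K) \<boxtimes> \<iota> (ob K)) \<cdot> (\<iota> (ob B) \<boxtimes> \<Delta>\<^bsub>K\<^esub>))
         \<boxtimes> \<iota> (ob B)),
     eta = \<eta>\<^bsub>K\<^esub> \<boxtimes> \<eta>\<^bsub>B\<^esub>,
     delta =
       (\<iota> (ob K)
         \<boxtimes> ((\<iota> (ob B) \<boxtimes> \<nabla>\<^bsub>K\<^esub>) \<cdot> (\<tau> (ob K) (ob B) \<boxtimes> \<iota> (ob K)) \<cdot> (\<iota> (ob K) \<boxtimes> \<rho>))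
         \<boxtimes> \<iota> (ob B)) \<cdot> (\<Delta>\<^bsub>K\<^esub> \<boxtimes> \<Delta>\<^bsub>B\<^esub>),
     eps = \<epsilon>\<^bsub>K\<^esub> \<boxtimes> \<epsilon>\<^bsub>B\<^esub>\<rparr>"

text \<open>The comparison map \<open>K \<otimes> B \<rightarrow> H\<close>, \<open>k \<otimes> b \<mapsto> k b\<close>.\<close>

definition mult_map :: "('o, 'm) hopf_data \<Rightarrow> 'm \<Rightarrow> 'm \<Rightarrow> 'm" where
  "mult_map H i j = \<nabla>\<^bsub>H\<^esub> \<cdot> (i \<boxtimes> j)"

text \<open>The Radford biproduct decomposition of \<open>H\<close> arising from the idempotent \<open>\<pi>\<close>:
  \<open>i\<close> is the inclusion of \<open>K = Im \<pi>\<close>, and \<open>j\<close> the inclusion of \<open>B = Im p\<close>, the coinvariants of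
  \<open>\<pi>\<close>. The structures of \<open>K\<close> and \<open>B\<close> are those making \<open>K\<close> a Hopf subalgebra and \<open>B\<close> a
  subalgebra and (through the corestriction \<open>q\<close> of \<open>p\<close>) a quotient coalgebra of \<open>H\<close>. All data
  after \<open>\<pi>\<close> are determined by \<open>\<pi>\<close> and the choice of \<open>i\<close> and \<open>j\<close>; in particular the action is
  \<open>\<alpha> = (\<epsilon> \<otimes> B) m\<^sup>-\<^sup>1 \<nabla> (j \<otimes> i)\<close> for \<open>m\<close> the comparison map.\<close>

definition radford_biproduct ::
  "('o, 'm) hopf_data \<Rightarrow> 'm \<Rightarrow> ('o, 'm) hopf_data \<Rightarrow> 'm \<Rightarrow> ('o, 'm) alg_coalg \<Rightarrow> 'm
    \<Rightarrow> 'm \<Rightarrow> 'm \<Rightarrow> bool" where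
  "radford_biproduct H \<pi> K i B j \<alpha> \<rho> \<longleftrightarrow>
     (let p = convolution H H (\<pi> \<cdot> antipode H) (\<iota> (ob H)); m = mult_map H i j in
      hopf_hom H H \<pi> \<and> \<pi> \<cdot> \<pi> = \<pi> \<and>
      is_image C \<pi> i \<and> is_hopf K \<and> hopf_hom K H i \<and>
      is_image C p j \<and> is_coinvariants H H \<pi> j \<and>
      is_algebra B \<and> algebra_hom B H j \<and>
      is_coalgebra B \<and> (\<exists>q. coalgebra_hom H B q \<and> j \<cdot> q = p) \<and>
      module_algebra K B \<alpha> \<and> comodule_coalgebra K B \<rho> \<and>
      is_isomorphism C m \<and> algebra_hom (semidirect K B \<alpha> \<rho>) H m \<and> coalgebra_hom (semidirect K B \<alpha> \<rho>) H m)"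

text \<open>\<open>H \<cong> Im f\<^sup>n \<otimes> \<^sup>c\<^sup>o\<^sup>f\<^sup>nH\<close> is a Radford biproduct: equality of subobjects is expressed by \<open>i\<close>
  being an image of both \<open>\<pi>\<close> and \<open>f\<^sup>n\<close>, and \<open>j\<close> being coinvariants of both.\<close>

definition fitting_biproduct ::
  "('o, 'm) hopf_data \<Rightarrow> 'm \<Rightarrow> nat \<Rightarrow> 'm \<Rightarrow> ('o, 'm) hopf_data \<Rightarrow> 'm \<Rightarrow> ('o, 'm) alg_coalg \<Rightarrow> 'm
    \<Rightarrow> 'm \<Rightarrow> 'm \<Rightarrow> bool" where
  "fitting_biproduct H f n \<pi> K i B j \<alpha> \<rho> \<longleftrightarrow> radford_biproduct H \<pi> K i B j \<alpha> \<rho> \<and>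
     is_image C (cpow C (ob H) f n) i \<and> is_coinvariants H H (cpow C (ob H) f n) j"

end

end

(* By the chain conditions the images of the powers of f stabilise, so f^n = i e with e i invertible on
   K = Im(f^n), and (e i)^-1 e is a Hopf retraction of i. For a split Hopf projection the map
   p = (pi S) * id is determined by pi * p = id; hence p(hx) = pi S(x_1) p(h) x_2 up to braiding, and
   this one formula yields the subalgebra B = Im p, the action b <| k = S(k_1) b k_2 of K on B, and the
   semidirect product structure of H. Everything about coalgebras is the same statement in the opposite
   category. If f is normal, then for b in B the identity h x = ad(h_1, x) h_2 gives b f^n(x) = f^n(x) b
   up to braiding, because f^n is trivial on B; so the action is trivial. In the binormal case B and K
   are unbraided because (q (x) e) Delta mul (j (x) i) is on the one hand the identity of B (x) K and
   on the other hand the double braiding, where j, q are the inclusion of and the projection onto B.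

   Identities in the braided category are proved by rewriting string diagrams. *)

theory Submission
  imports Defs
begin

section \<open>Planar diagrams\<close>

text \<open>The conclusions are asserted for every biproduct decomposition attached to a power of
  \<open>f\<close>, whereas the construction yields only one. So the given data must be shown to be
  forced: \<open>B\<close> with its structure, \<alpha> and \<rho> are determined by
  \<open>i\<close>, \<open>e\<close>, \<open>j\<close>, \<open>q\<close>. The idempotent \<pi> of a
  given decomposition shares only its image and its coinvariants with the power g = f^n. These yield
  g = g \<pi>, so g induces an epimorphic endomorphism of the image, and the chain condition on
  quotients, applied to a chain repeating this endomorphism, makes it invertible. Hence g and \<pi>
  factor through each other, and \<open>i\<close> gets the form g w in which normality can be used.
  Duality shapes the middle part: a split projection is described by equations between morphisms,
  without kernels or images, so that the opposite braided category satisfies the same description.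
  Exactness of the tensor product enters through images: tensor powers of the epi-mono factorization
  of a Hopf morphism must again consist of epis and monos for the image to carry a Hopf algebra
  structure.\<close>

text \<open>A gate is a morphism together with its input and output wires, which are objects; a slice
  \<open>(n, G)\<close> is the gate \<open>G\<close> with \<open>n\<close> wires to its left. A diagram lists its slices in order of
  application, opposite to the order of composition.\<close>

type_synonym ('o, 'm) gate = "'o list \<times> 'm \<times> 'o list"
type_synonym ('o, 'm) diagram = "(nat \<times> ('o, 'm) gate) list"

definition shift :: "nat \<Rightarrow> ('o, 'm) diagram \<Rightarrow> ('o, 'm) diagram" where
  "shift k d = map (\<lambda>(n, G). (k + n, G)) d"

lemma shift_simps [simp]:
  "shift k [] = []" "shift k ((n, G) # d) = (k + n, G) # shift k d"
  "shift k (d @ d') = shift k d @ shift k d'"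
  by (simp_all add: shift_def)

text \<open>The normal form applies gates further to the left first, as far as sliding allows. Only its soundness
  matters: gates without inputs or without outputs may slide in more than one way, so that the normal
  form is not a complete invariant.\<close>

fun insert_slice :: "nat \<times> ('o, 'm) gate \<Rightarrow> ('o, 'm) diagram \<Rightarrow> ('o, 'm) diagram" where
  "insert_slice s [] = [s]"
| "insert_slice (n, G) ((m, (ds, f, cs)) # d) =
     (if m + length ds \<le> n then (m, (ds, f, cs)) # insert_slice (n - length ds + length cs, G) d
      else (n, G) # (m, (ds, f, cs)) # d)"

primrec normal_form :: "('o, 'm) diagram \<Rightarrow> ('o, 'm) diagram" where
  "normal_form [] = []"
| "normal_form (s # d) = insert_slice s (normal_form d)"

named_theorems reading

section \<open>Interpretation of diagrams in a strict tensor category\<close>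

context strict_tensor_category
begin

definition obs :: "'o list \<Rightarrow> 'o" where
  "obs ws = foldr (\<lambda>X Y. X \<odot> Y) ws (UnitO C)"

lemma obs_simps [simp]: "obs [] = UnitO C" "obs (X # ws) = X \<odot> obs ws"
  by (simp_all add: obs_def)

lemma obs_Obj: "set ws \<subseteq> Obj C \<Longrightarrow> obs ws \<in> Obj C"
  by (induction ws) (auto simp: UnitO_Obj TensO_Obj)

lemma obs_append:
  "\<lbrakk>set us \<subseteq> Obj C; set vs \<subseteq> Obj C\<rbrakk> \<Longrightarrow> obs (us @ vs) = obs us \<odot> obs vs"
  by (induction us) (auto simp: TensO_unit_left TensO_assoc obs_Obj)

fun wf_gate :: "('o, 'm) gate \<Rightarrow> bool" where
  "wf_gate (ds, f, cs) \<longleftrightarrow> set ds \<subseteq> Obj C \<and> set cs \<subseteq> Obj C \<and> f \<in> Hom C (obs ds) (obs cs)"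

fun step :: "'o list \<Rightarrow> nat \<Rightarrow> ('o, 'm) gate \<Rightarrow> 'o list" where
  "step ws n (ds, f, cs) = take n ws @ cs @ drop (n + length ds) ws"

fun slice :: "'o list \<Rightarrow> nat \<Rightarrow> ('o, 'm) gate \<Rightarrow> 'm" where
  "slice ws n (ds, f, cs) = \<iota> (obs (take n ws)) \<boxtimes> f \<boxtimes> \<iota> (obs (drop (n + length ds) ws))"

fun fits :: "'o list \<Rightarrow> nat \<Rightarrow> ('o, 'm) gate \<Rightarrow> bool" where
  "fits ws n (ds, f, cs) \<longleftrightarrow> n + length ds \<le> length ws \<and> take (length ds) (drop n ws) = ds"

fun sem :: "'o list \<Rightarrow> ('o, 'm) diagram \<Rightarrow> 'm" where
  "sem ws [] = \<iota> (obs ws)"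
| "sem ws ((n, G) # d) = sem (step ws n G) d \<cdot> slice ws n G"

fun valid :: "'o list \<Rightarrow> ('o, 'm) diagram \<Rightarrow> bool" where
  "valid ws [] \<longleftrightarrow> set ws \<subseteq> Obj C"
| "valid ws ((n, G) # d) \<longleftrightarrow> set ws \<subseteq> Obj C \<and> wf_gate G \<and> fits ws n G \<and> valid (step ws n G) d"

fun out :: "'o list \<Rightarrow> ('o, 'm) diagram \<Rightarrow> 'o list" where
  "out ws [] = ws"
| "out ws ((n, G) # d) = out (step ws n G) d"

text \<open>Equal morphisms determine only the tensor product of the output wires, not the list of
  wires. Equality of \<open>out\<close> is therefore demanded separately; without it further slices
  could not be appended to both sides.\<close>

definition eqn :: "'o list \<Rightarrow> ('o, 'm) diagram \<Rightarrow> ('o, 'm) diagram \<Rightarrow> bool" where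
  "eqn ws d d' \<longleftrightarrow> valid ws d \<and> valid ws d' \<and> out ws d = out ws d' \<and> sem ws d = sem ws d'"

lemma fitsE:
  assumes "fits ws n (ds, f, cs)"
  obtains xs ys where "ws = xs @ ds @ ys" "length xs = n"
proof
  show "ws = take n ws @ ds @ drop (n + length ds) ws"
    using assms by (metis add.commute append_take_drop_id drop_drop fits.simps)
  show "length (take n ws) = n" using assms by simp
qed

lemma valid_Obj: "valid ws d \<Longrightarrow> set ws \<subseteq> Obj C"
  by (cases "(ws, d)" rule: valid.cases) auto

lemma slice_Hom:
  assumes "set ws \<subseteq> Obj C" "wf_gate G" "fits ws n G"
  shows "slice ws n G \<in> Hom C (obs ws) (obs (step ws n G))"
proof -
  obtain ds f cs where G: "G = (ds, f, cs)" by (cases G)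
  obtain xs ys where ws: "ws = xs @ ds @ ys" "length xs = n"
    using assms(3) unfolding G by (rule fitsE)
  show ?thesis
    using assms by (auto simp: G ws obs_append obs_Obj intro!: TensM_Hom Ident_Hom)
qed

lemma sem_Hom: "valid ws d \<Longrightarrow> sem ws d \<in> Hom C (obs ws) (obs (out ws d))"
  by (induction ws d rule: sem.induct) (auto intro: Ident_Hom obs_Obj Comp_Hom slice_Hom)

lemma out_Obj: "valid ws d \<Longrightarrow> set (out ws d) \<subseteq> Obj C"
  by (induction ws d rule: sem.induct) auto

lemma out_append: "out ws (d @ d') = out (out ws d) d'"
  by (induction ws d rule: out.induct) auto

lemma valid_append: "valid ws (d @ d') \<longleftrightarrow> valid ws d \<and> valid (out ws d) d'"
  by (induction ws d rule: out.induct) (auto dest: valid_Obj)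

lemma sem_append: "valid ws (d @ d') \<Longrightarrow> sem ws (d @ d') = sem (out ws d) d' \<cdot> sem ws d"
proof (induction ws d rule: out.induct)
  case (1 ws)
  then show ?case by (simp add: Ident_right[OF sem_Hom])
next
  case (2 ws n G d)
  then show ?case
    by (auto simp: valid_append intro!: Comp_assoc sem_Hom slice_Hom)
qed

lemma whisker:
  assumes "A \<in> Obj C" "B \<in> Obj C" "f \<in> Hom C X Y" "g \<in> Hom C Y Z"
  shows "\<iota> A \<boxtimes> (g \<cdot> f) \<boxtimes> \<iota> B = (\<iota> A \<boxtimes> g \<boxtimes> \<iota> B) \<cdot> (\<iota> A \<boxtimes> f \<boxtimes> \<iota> B)"
proof -
  have "\<iota> A \<boxtimes> (g \<cdot> f) \<boxtimes> \<iota> B = (\<iota> A \<cdot> \<iota> A) \<boxtimes> ((g \<cdot> f) \<boxtimes> (\<iota> B \<cdot> \<iota> B))"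
    using assms by (simp add: Ident_left[OF Ident_Hom])
  also have "\<dots> = (\<iota> A \<cdot> \<iota> A) \<boxtimes> ((g \<boxtimes> \<iota> B) \<cdot> (f \<boxtimes> \<iota> B))"
    using TensM_Comp[OF assms(4,3) Ident_Hom Ident_Hom] assms by simp
  also have "\<dots> = (\<iota> A \<boxtimes> g \<boxtimes> \<iota> B) \<cdot> (\<iota> A \<boxtimes> f \<boxtimes> \<iota> B)"
    by (rule TensM_Comp[OF Ident_Hom Ident_Hom TensM_Hom TensM_Hom])
      (use assms in \<open>auto intro: Ident_Hom\<close>)
  finally show ?thesis .
qed

lemma context_slice:
  assumes "set (xs @ us @ ys) \<subseteq> Obj C" "wf_gate G" "fits us n G"
  shows "fits (xs @ us @ ys) (length xs + n) G"
    and "step (xs @ us @ ys) (length xs + n) G = xs @ step us n G @ ys"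
    and "slice (xs @ us @ ys) (length xs + n) G = \<iota> (obs xs) \<boxtimes> slice us n G \<boxtimes> \<iota> (obs ys)"
proof -
  obtain ds f cs where G: "G = (ds, f, cs)" by (cases G)
  obtain zs vs where us: "us = zs @ ds @ vs" "length zs = n"
    using assms(3) unfolding G by (rule fitsE)
  show "fits (xs @ us @ ys) (length xs + n) G"
    and "step (xs @ us @ ys) (length xs + n) G = xs @ step us n G @ ys"
    using us by (auto simp: G)
  have o: "obs xs \<in> Obj C" "obs ys \<in> Obj C" "obs zs \<in> Obj C" "obs vs \<in> Obj C"
    using assms(1) us by (auto intro: obs_Obj)
  have f: "f \<in> Hom C (obs ds) (obs cs)" using assms(2) by (simp add: G)
  have "\<iota> (obs (xs @ zs)) \<boxtimes> f \<boxtimes> \<iota> (obs (vs @ ys))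
      = (\<iota> (obs xs) \<boxtimes> \<iota> (obs zs)) \<boxtimes> f \<boxtimes> \<iota> (obs vs) \<boxtimes> \<iota> (obs ys)"
    using o assms(1) us by (auto simp: obs_append TensM_Ident)
  also have "\<dots> = \<iota> (obs xs) \<boxtimes> (\<iota> (obs zs) \<boxtimes> f \<boxtimes> \<iota> (obs vs)) \<boxtimes> \<iota> (obs ys)"
    using TensM_assoc[OF Ident_Hom[OF o(1)] Ident_Hom[OF o(3)]
        TensM_Hom[OF f TensM_Hom[OF Ident_Hom[OF o(4)] Ident_Hom[OF o(2)]]]]
      TensM_assoc[OF Ident_Hom[OF o(3)] TensM_Hom[OF f Ident_Hom[OF o(4)]] Ident_Hom[OF o(2)]]
      TensM_assoc[OF f Ident_Hom[OF o(4)] Ident_Hom[OF o(2)]]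
    by simp
  finally show "slice (xs @ us @ ys) (length xs + n) G
      = \<iota> (obs xs) \<boxtimes> slice us n G \<boxtimes> \<iota> (obs ys)"
    by (simp add: G us)
qed

text \<open>Tensoring with idle wires on both sides is functorial (\<open>whisker\<close>), so the
  claim for one slice, \<open>context_slice\<close>, propagates along the diagram.\<close>

lemma context_diagram:
  assumes "valid us d" "set xs \<subseteq> Obj C" "set ys \<subseteq> Obj C"
  shows "valid (xs @ us @ ys) (shift (length xs) d)
    \<and> out (xs @ us @ ys) (shift (length xs) d) = xs @ out us d @ ys
    \<and> sem (xs @ us @ ys) (shift (length xs) d) = \<iota> (obs xs) \<boxtimes> sem us d \<boxtimes> \<iota> (obs ys)"
  using assms(1)
proof (induction us d rule: valid.induct)
  case (1 us)
  then show ?case using assms(2,3) by (simp add: obs_append TensM_Ident obs_Obj TensO_Obj)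
next
  case (2 us n G d)
  let ?us = "step us n G"
  have ob: "set (xs @ us @ ys) \<subseteq> Obj C" "wf_gate G" "fits us n G" "valid ?us d"
    using 2(2) assms(2,3) by auto
  note IH = 2(1)[OF ob(4)]
  have "sem (xs @ us @ ys) (shift (length xs) ((n, G) # d))
      = (\<iota> (obs xs) \<boxtimes> sem ?us d \<boxtimes> \<iota> (obs ys)) \<cdot> (\<iota> (obs xs) \<boxtimes> slice us n G \<boxtimes> \<iota> (obs ys))"
    using IH by (simp add: context_slice[OF ob(1-3)])
  also have "\<dots> = \<iota> (obs xs) \<boxtimes> sem us ((n, G) # d) \<boxtimes> \<iota> (obs ys)"
    using whisker[OF obs_Obj[OF assms(2)] obs_Obj[OF assms(3)]
        slice_Hom[OF _ ob(2,3)] sem_Hom[OF ob(4)]] ob(1) by simp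
  finally show ?case using IH ob by (simp add: context_slice[OF ob(1-3)])
qed

text \<open>Two diagrams side by side may be executed in either order, and both orders denote the
  tensor product of the two morphisms. This is the interchange law from which sliding of gates
  follows.\<close>

lemma tensor_diagram:
  assumes "valid us d" "valid vs d'"
  shows "valid (us @ vs) (d @ shift (length (out us d)) d')"
    and "out (us @ vs) (d @ shift (length (out us d)) d') = out us d @ out vs d'"
    and "sem (us @ vs) (d @ shift (length (out us d)) d') = sem us d \<boxtimes> sem vs d'"
    and "valid (us @ vs) (shift (length us) d' @ d)"
    and "out (us @ vs) (shift (length us) d' @ d) = out us d @ out vs d'"
    and "sem (us @ vs) (shift (length us) d' @ d) = sem us d \<boxtimes> sem vs d'"
proof -
  have o: "set us \<subseteq> Obj C" "set vs \<subseteq> Obj C" "set (out us d) \<subseteq> Obj C" "set (out vs d') \<subseteq> Obj C"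
    using assms by (auto dest: valid_Obj out_Obj)
  have sh: "shift 0 d = d" by (simp add: shift_def)
  have A: "valid (us @ ws) d" "out (us @ ws) d = out us d @ ws"
      "sem (us @ ws) d = sem us d \<boxtimes> \<iota> (obs ws)" if "set ws \<subseteq> Obj C" for ws
    using that context_diagram[OF assms(1), of "[]" ws]
      TensM_unit_left[OF TensM_Hom[OF sem_Hom[OF assms(1)] Ident_Hom[OF obs_Obj[OF that]]]]
    by (auto simp: sh)
  have B: "valid (ws @ vs) (shift (length ws) d')"
      "out (ws @ vs) (shift (length ws) d') = ws @ out vs d'"
      "sem (ws @ vs) (shift (length ws) d') = \<iota> (obs ws) \<boxtimes> sem vs d'" if "set ws \<subseteq> Obj C" for ws
    using that context_diagram[OF assms(2), of ws "[]"] TensM_unit_right[OF sem_Hom[OF assms(2)]]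
    by auto
  note h = sem_Hom[OF assms(1)] sem_Hom[OF assms(2)]
  show v: "valid (us @ vs) (d @ shift (length (out us d)) d')"
      "valid (us @ vs) (shift (length us) d' @ d)"
    using A B o by (simp_all add: valid_append)
  show "out (us @ vs) (d @ shift (length (out us d)) d') = out us d @ out vs d'"
    "out (us @ vs) (shift (length us) d' @ d) = out us d @ out vs d'"
    using A B o by (simp_all add: out_append)
  have "sem (us @ vs) (d @ shift (length (out us d)) d')
      = (\<iota> (obs (out us d)) \<boxtimes> sem vs d') \<cdot> (sem us d \<boxtimes> \<iota> (obs vs))"
    using sem_append[OF v(1)] A B o by simp
  also have "\<dots> = (\<iota> (obs (out us d)) \<cdot> sem us d) \<boxtimes> (sem vs d' \<cdot> \<iota> (obs vs))"
    by (rule TensM_Comp[symmetric]) (use h o in \<open>auto intro: Ident_Hom obs_Obj\<close>)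
  also have "\<dots> = sem us d \<boxtimes> sem vs d'"
    using h by (simp add: Ident_left Ident_right)
  finally show "sem (us @ vs) (d @ shift (length (out us d)) d') = sem us d \<boxtimes> sem vs d'" .
  have "sem (us @ vs) (shift (length us) d' @ d)
      = (sem us d \<boxtimes> \<iota> (obs (out vs d'))) \<cdot> (\<iota> (obs us) \<boxtimes> sem vs d')"
    using sem_append[OF v(2)] A B o by simp
  also have "\<dots> = (sem us d \<cdot> \<iota> (obs us)) \<boxtimes> (\<iota> (obs (out vs d')) \<cdot> sem vs d')"
    by (rule TensM_Comp[symmetric]) (use h o in \<open>auto intro: Ident_Hom obs_Obj\<close>)
  also have "\<dots> = sem us d \<boxtimes> sem vs d'"
    using h by (simp add: Ident_left Ident_right)
  finally show "sem (us @ vs) (shift (length us) d' @ d) = sem us d \<boxtimes> sem vs d'" .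
qed

section \<open>Congruence, sliding and rewriting of diagrams\<close>

lemma eqn_refl: "valid ws d \<Longrightarrow> eqn ws d d"
  by (simp add: eqn_def)

lemma eqn_sym: "eqn ws d d' \<Longrightarrow> eqn ws d' d"
  by (simp add: eqn_def)

lemma eqn_trans [trans]: "eqn ws d d' \<Longrightarrow> eqn ws d' d'' \<Longrightarrow> eqn ws d d''"
  by (simp add: eqn_def)

lemma eqn_append:
  assumes "valid ws c" "eqn (out ws c) d d'" "valid (out (out ws c) d) e"
  shows "eqn ws (c @ d @ e) (c @ d' @ e)"
  using assms by (auto simp: eqn_def valid_append out_append sem_append)

lemma eqn_context:
  assumes "eqn us d d'" "set xs \<subseteq> Obj C" "set ys \<subseteq> Obj C"
  shows "eqn (xs @ us @ ys) (shift (length xs) d) (shift (length xs) d')"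
  using assms context_diagram[of us d xs ys] context_diagram[of us d' xs ys] by (simp add: eqn_def)

text \<open>Both sides are the tensor product of the two gates with idle wires between and around
  them. Once the left gate acts earlier, its outputs \<open>cs\<close> have replaced its inputs
  \<open>ds\<close> to the left of \<open>G\<close>, whence the new position of
  \<open>G\<close>.\<close>

lemma eqn_swap:
  assumes v: "valid ws [(n, G), (m, (ds, f, cs))]" and le: "m + length ds \<le> n"
  shows "eqn ws [(n, G), (m, (ds, f, cs))] [(m, (ds, f, cs)), (n - length ds + length cs, G)]"
proof -
  obtain ds' g cs' where G: "G = (ds', g, cs')" by (cases G)
  have "fits ws n (ds', g, cs')" using v by (simp add: G)
  then obtain us zs where us: "ws = us @ ds' @ zs" "length us = n" by (rule fitsE)
  have w: "wf_gate (ds, f, cs)" "wf_gate G" "set ws \<subseteq> Obj C" using v by simp_all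
  have "fits (us @ cs' @ zs) m (ds, f, cs)" using v us by (simp add: G)
  then have "fits us m (ds, f, cs)" using le us(2) by simp
  then obtain xs ys where xs: "us = xs @ ds @ ys" "length xs = m" by (rule fitsE)
  have n: "n = length xs + length ds + length ys" using us(2) xs by simp
  have F: "valid ds [(0, (ds, f, cs))]" "valid (ys @ ds') [(length ys, G)]"
    using w by (simp_all add: G us xs)
  have "eqn (ds @ ys @ ds') [(length ds + length ys, G), (0, (ds, f, cs))]
     [(0, (ds, f, cs)), (length cs + length ys, G)]"
    using tensor_diagram[OF F] by (simp add: eqn_def)
  from eqn_context[OF this, of xs zs] show ?thesis
    using w(3) by (simp add: us xs n G add.commute add.left_commute)
qed

lemma eqn_insert_slice:
  "valid ws (s # d) \<Longrightarrow> eqn ws (s # d) (insert_slice s d)"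
proof (induction s d arbitrary: ws rule: insert_slice.induct)
  case (1 s)
  then show ?case by (simp add: eqn_refl)
next
  case (2 n G m ds f cs d)
  show ?case
  proof (cases "m + length ds \<le> n")
    case True
    let ?F = "(ds, f, cs)" and ?n = "n - length ds + length cs"
    have "valid ws [(n, G), (m, ?F)]"
      using 2(2) valid_append[of ws "[(n, G), (m, ?F)]" d] by simp
    note sw = eqn_swap[OF this True]
    have "eqn ws ([] @ [(n, G), (m, ?F)] @ d) ([] @ [(m, ?F), (?n, G)] @ d)"
      by (rule eqn_append) (use sw 2(2) valid_Obj[OF 2(2)] in auto)
    moreover from this have "valid ws ((m, ?F) # (?n, G) # d)" by (simp add: eqn_def)
    then have v: "valid (step ws m ?F) ((?n, G) # d)" "valid ws [(m, ?F)]"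
      using valid_append[of ws "[(m, ?F)]" "(?n, G) # d"] by auto
    then have "eqn ws ([(m, ?F)] @ ((?n, G) # d) @ []) ([(m, ?F)] @ insert_slice (?n, G) d @ [])"
      by (intro eqn_append) (use 2(1)[OF True v(1)] in \<open>auto simp: eqn_def dest: out_Obj\<close>)
    ultimately show ?thesis using True by (auto intro: eqn_trans)
  next
    case False
    then show ?thesis using 2(2) by (simp add: eqn_refl)
  qed
qed

lemma eqn_normal_form: "valid ws d \<Longrightarrow> eqn ws d (normal_form d)"
proof (induction d arbitrary: ws)
  case Nil
  then show ?case by (simp add: eqn_refl)
next
  case (Cons s d)
  obtain n G where s: "s = (n, G)" by (cases s)
  have v: "valid (step ws n G) d" "valid ws [s]" using Cons(2) by (auto simp: s dest: valid_Obj)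
  have "eqn ws ([s] @ d @ []) ([s] @ normal_form d @ [])"
    by (intro eqn_append) (use Cons(1)[OF v(1)] v in \<open>auto simp: s eqn_def dest: out_Obj\<close>)
  moreover from this have "eqn ws (s # normal_form d) (insert_slice s (normal_form d))"
    by (intro eqn_insert_slice) (simp add: eqn_def)
  ultimately show ?case by (auto intro: eqn_trans)
qed

lemma eqn_by_normal_form:
  assumes "valid ws d" "valid ws d'" "normal_form d = normal_form d'"
  shows "eqn ws d d'"
  using assms eqn_normal_form eqn_sym eqn_trans by metis

text \<open>The workhorse: rewriting with a known equation at horizontal position \<open>n\<close> below the first \<open>k\<close>
  gates; the result is displayed up to sliding gates past each other.\<close>

lemma eqn_at:
  assumes E: "eqn us l r"
    and m: "normal_form (shift n l) = normal_form (take (length l) (drop k d))"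
    and p: "n + length us \<le> length (out ws (take k d))" "take (length us) (drop n (out ws (take k d))) = us"
    and v: "valid ws d" "valid ws d'"
    and d': "normal_form d' = normal_form (take k d @ shift n r @ drop (k + length l) d)"
  shows "eqn ws d d'"
proof -
  let ?c = "take k d" and ?m = "take (length l) (drop k d)" and ?e = "drop (k + length l) d"
  have d: "d = ?c @ ?m @ ?e" by (metis append_take_drop_id drop_drop add.commute)
  have c: "valid ws ?c" "valid (out ws ?c) ?m" "valid (out (out ws ?c) ?m) ?e"
    using v(1) d by (metis valid_append)+
  \<comment> \<open>\<open>fits\<close> does not look at the morphism of a gate, so
    \<open>undefined\<close> suffices; the dummy gate only serves to cut the wires into three pieces
    with \<open>fitsE\<close>.\<close>
  have "fits (out ws ?c) n (us, undefined, us)" using p by simp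
  then obtain xs ys where w: "out ws ?c = xs @ us @ ys" "length xs = n" by (rule fitsE)
  have o: "set xs \<subseteq> Obj C" "set ys \<subseteq> Obj C" using out_Obj[OF c(1)] w by auto
  have lr: "eqn (out ws ?c) (shift n l) (shift n r)"
    using eqn_context[OF E o] w by simp
  then have "eqn (out ws ?c) ?m (shift n l)"
    using c(2) m by (intro eqn_by_normal_form) (auto simp: eqn_def)
  then have "eqn (out ws ?c) ?m (shift n r)" using lr by (rule eqn_trans)
  from eqn_append[OF c(1) this c(3)] have "eqn ws d (?c @ shift n r @ ?e)"
    using d by simp
  moreover from this have "eqn ws (?c @ shift n r @ ?e) d'"
    using v(2) d' by (intro eqn_by_normal_form) (auto simp: eqn_def)
  ultimately show ?thesis by (rule eqn_trans)
qed

text \<open>The rules collected in \<open>reading\<close> translate a morphism, by recursion on its structure, into a diagram.\<close>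

definition reads :: "'o list \<Rightarrow> 'm \<Rightarrow> ('o, 'm) diagram \<Rightarrow> 'o list \<Rightarrow> bool" where
  "reads ws t d us \<longleftrightarrow> valid ws d \<and> out ws d = us \<and> sem ws d = t"

lemma reads_gate:
  assumes "set ds \<subseteq> Obj C" "set cs \<subseteq> Obj C" "f \<in> Hom C (obs ds) (obs cs)"
  shows "reads ds f [(0, (ds, f, cs))] cs"
proof -
  have "\<iota> (UnitO C) \<boxtimes> f \<boxtimes> \<iota> (UnitO C) = f"
    using assms(3) TensM_unit_left TensM_unit_right by metis
  then show ?thesis using assms by (simp add: reads_def Ident_left)
qed

lemma reads_Ident: "X \<in> Obj C \<Longrightarrow> reads [X] (\<iota> X) [] [X]"
  by (simp add: reads_def TensO_unit_right)

lemma reads_Ident_tensor: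
  "X \<in> Obj C \<Longrightarrow> Y \<in> Obj C \<Longrightarrow> reads [X, Y] (\<iota> (X \<odot> Y)) [] [X, Y]"
  by (simp add: reads_def TensO_unit_right)

lemma reads_Comp [reading]:
  "reads ws t d us \<Longrightarrow> reads us' t' d' vs \<Longrightarrow> us = us' \<Longrightarrow> reads ws (t' \<cdot> t) (d @ d') vs"
  by (auto simp: reads_def valid_append out_append sem_append)

lemma reads_TensM [reading]:
  "reads ws t d us \<Longrightarrow> reads ws' t' d' us' \<Longrightarrow>
    reads (ws @ ws') (t \<boxtimes> t') (d @ shift (length us) d') (us @ us')"
  by (auto simp: reads_def tensor_diagram)

text \<open>Wires and diagrams are tied to the stated ones by separate equations, so that resolution
  with \<open>reading\<close> can first compute them as unknowns and simplification compares them
  afterwards. The converse \<open>eq_if_eqn\<close> compares normal forms instead, which allows the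
  computed diagram to differ from the stated one by sliding.\<close>

lemma eqn_if_eq:
  "\<lbrakk>t = t'; reads ws\<^sub>1 t d\<^sub>1 us\<^sub>1; reads ws\<^sub>2 t' d\<^sub>2 us\<^sub>2; ws\<^sub>1 = ws; ws\<^sub>2 = ws; us\<^sub>1 = us\<^sub>2;
    d\<^sub>1 = d; d\<^sub>2 = d'\<rbrakk> \<Longrightarrow> eqn ws d d'"
  by (auto simp: reads_def eqn_def)

lemma eq_if_eqn:
  "\<lbrakk>eqn ws d d'; reads ws\<^sub>1 t d\<^sub>1 us\<^sub>1; reads ws\<^sub>2 t' d\<^sub>2 us\<^sub>2; ws\<^sub>1 = ws; ws\<^sub>2 = ws;
    normal_form d\<^sub>1 = normal_form d; normal_form d\<^sub>2 = normal_form d'\<rbrakk> \<Longrightarrow> t = t'"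
  unfolding reads_def by (metis eqn_def eqn_normal_form)

lemma eq_if_reads:
  "\<lbrakk>reads ws\<^sub>1 t d\<^sub>1 us\<^sub>1; reads ws\<^sub>2 t' d\<^sub>2 us\<^sub>2; ws\<^sub>1 = ws\<^sub>2; normal_form d\<^sub>1 = normal_form d\<^sub>2\<rbrakk> \<Longrightarrow> t = t'"
  unfolding reads_def by (metis eqn_def eqn_normal_form)

lemma reads_Hom: "reads ws t d us \<Longrightarrow> t \<in> Hom C (obs ws) (obs us)"
  using sem_Hom by (auto simp: reads_def)

lemma Hom_if_reads: "\<lbrakk>reads ws t d us; obs ws = X; obs us = Y\<rbrakk> \<Longrightarrow> t \<in> Hom C X Y"
  using reads_Hom by auto

lemma reads_arrow:
  "\<lbrakk>f \<in> Hom C X Y; X \<in> Obj C; Y \<in> Obj C\<rbrakk> \<Longrightarrow> reads [X] f [(0, ([X], f, [Y]))] [Y]"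
  by (rule reads_gate) (auto simp: TensO_unit_right)

lemma reads_arrow2:
  "\<lbrakk>f \<in> Hom C (X \<odot> Y) Z; X \<in> Obj C; Y \<in> Obj C; Z \<in> Obj C\<rbrakk>
    \<Longrightarrow> reads [X, Y] f [(0, ([X, Y], f, [Z]))] [Z]"
  by (rule reads_gate) (auto simp: TensO_unit_right)

lemma reads_coarrow2:
  "\<lbrakk>f \<in> Hom C X (Y \<odot> Z); X \<in> Obj C; Y \<in> Obj C; Z \<in> Obj C\<rbrakk>
    \<Longrightarrow> reads [X] f [(0, ([X], f, [Y, Z]))] [Y, Z]"
  by (rule reads_gate) (auto simp: TensO_unit_right)

end

section \<open>The braiding in diagrams\<close>

context braided_tensor_category
begin

declare TensO_unit_left [simp] TensO_unit_right [simp] TensO_assoc [simp] TensO_Obj [simp]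
  UnitO_Obj [simp] Ident_Hom [simp]

lemma Braid_Hom' [simp]:
  "\<lbrakk>X \<in> Obj C; Y \<in> Obj C\<rbrakk> \<Longrightarrow> \<tau> X Y \<in> Hom C (X \<odot> Y) (Y \<odot> X)"
  by (rule Braid_Hom)

lemma iso_cancel:
  assumes "is_isomorphism C t" "t \<in> Hom C X Y" "f \<in> Hom C Z X" "g \<in> Hom C Z X" "t \<cdot> f = t \<cdot> g"
  shows "f = g"
proof -
  obtain s where s: "s \<in> Hom C Y X" "s \<cdot> t = \<iota> X"
    using assms(1,2) Hom_disjoint unfolding is_isomorphism_def inverse_arrows_def by metis
  have "(s \<cdot> t) \<cdot> f = (s \<cdot> t) \<cdot> g"
    using assms s Comp_assoc by metis
  then show ?thesis using s assms Ident_left by metis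
qed

text \<open>The hexagon with two unit objects makes this braiding idempotent; an invertible
  idempotent is the identity.\<close>

lemma Braid_unit_left [simp]: "X \<in> Obj C \<Longrightarrow> \<tau> (UnitO C) X = \<iota> X"
proof (rule iso_cancel[OF Braid_iso, of "UnitO C" X X X])
  assume X: "X \<in> Obj C"
  note h = Braid_Hom[OF UnitO_Obj X]
  show "\<tau> (UnitO C) X \<cdot> \<tau> (UnitO C) X = \<tau> (UnitO C) X \<cdot> \<iota> X"
    using hexagon_left[OF UnitO_Obj UnitO_Obj X] h X
    by (simp add: TensM_unit_left TensM_unit_right Ident_right)
qed (use Braid_Hom[OF UnitO_Obj] in auto)

lemma Braid_unit_right [simp]: "X \<in> Obj C \<Longrightarrow> \<tau> X (UnitO C) = \<iota> X"
proof (rule iso_cancel[OF Braid_iso, of X "UnitO C" X X])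
  assume X: "X \<in> Obj C"
  note h = Braid_Hom[OF X UnitO_Obj]
  show "\<tau> X (UnitO C) \<cdot> \<tau> X (UnitO C) = \<tau> X (UnitO C) \<cdot> \<iota> X"
    using hexagon_right[OF X UnitO_Obj UnitO_Obj] h X
    by (simp add: TensM_unit_left TensM_unit_right Ident_right)
qed (use Braid_Hom[OF _ UnitO_Obj] in auto)

abbreviation braid_gate :: "'o \<Rightarrow> 'o \<Rightarrow> ('o, 'm) gate" where
  "braid_gate X Y \<equiv> ([X, Y], \<tau> X Y, [Y, X])"

text \<open>Iterated hexagons: the braiding of a whole block of wires with \<open>Z\<close>,
  resolved into crossings of two wires. An empty block gives the empty diagram, in accordance with
  the triviality of the braiding with the unit object.\<close>

primrec braid_left :: "'o list \<Rightarrow> 'o \<Rightarrow> ('o, 'm) diagram" where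
  "braid_left [] Z = []"
| "braid_left (X # xs) Z = shift 1 (braid_left xs Z) @ [(0, braid_gate X Z)]"

primrec braid_right :: "'o \<Rightarrow> 'o list \<Rightarrow> ('o, 'm) diagram" where
  "braid_right Z [] = []"
| "braid_right Z (X # xs) = (0, braid_gate Z X) # shift 1 (braid_right Z xs)"

lemma reads_braid [reading]: "X \<in> Obj C \<Longrightarrow> Y \<in> Obj C \<Longrightarrow> reads [X, Y] (\<tau> X Y) [(0, braid_gate X Y)] [Y, X]"
  by (rule reads_gate) auto

lemma reads_braid_left:
  assumes Z: "Z \<in> Obj C" and "set ds \<subseteq> Obj C"
  shows "reads (ds @ [Z]) (\<tau> (obs ds) Z) (braid_left ds Z) (Z # ds)"
  using assms(2)
proof (induction ds)
  case Nil
  then show ?case using Z by (simp add: reads_Ident)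
next
  case (Cons X xs)
  then have o: "X \<in> Obj C" "obs xs \<in> Obj C" "reads xs (\<iota> (obs xs)) [] xs"
    by (auto simp: obs_Obj reads_def)
  have "reads ([X] @ (xs @ [Z])) (\<iota> X \<boxtimes> \<tau> (obs xs) Z) ([] @ shift 1 (braid_left xs Z)) ([X] @ Z # xs)"
    using reads_TensM[OF reads_Ident[OF o(1)] Cons.IH] Cons.prems by simp
  from reads_Comp[OF this reads_TensM[OF reads_braid[OF o(1) Z] o(3)]]
  show ?case using hexagon_left[OF o(1,2) Z] by simp
qed

lemma reads_braid_right:
  assumes Z: "Z \<in> Obj C" and "set ds \<subseteq> Obj C"
  shows "reads (Z # ds) (\<tau> Z (obs ds)) (braid_right Z ds) (ds @ [Z])"
  using assms(2)
proof (induction ds)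
  case Nil
  then show ?case using Z by (simp add: reads_Ident)
next
  case (Cons X xs)
  then have o: "X \<in> Obj C" "obs xs \<in> Obj C" "reads xs (\<iota> (obs xs)) [] xs"
    by (auto simp: obs_Obj reads_def)
  have "reads ([X] @ (Z # xs)) (\<iota> X \<boxtimes> \<tau> Z (obs xs)) ([] @ shift 1 (braid_right Z xs)) ([X] @ xs @ [Z])"
    using reads_TensM[OF reads_Ident[OF o(1)] Cons.IH] Cons.prems by simp
  from reads_Comp[OF reads_TensM[OF reads_braid[OF Z o(1)] o(3)] this]
  show ?case using hexagon_right[OF Z o(1,2)] by simp
qed

text \<open>Naturality of the braiding for a gate with any number of wires: the gate slides through
  the strand \<open>Z\<close>. With \<open>ds\<close> or \<open>cs\<close> empty it lets units and
  counits pass a strand without leaving a crossing.\<close>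

lemma eqn_braid_left:
  assumes Z: "Z \<in> Obj C" and F: "wf_gate (ds, f, cs)"
  shows "eqn (ds @ [Z]) ((0, (ds, f, cs)) # braid_left cs Z) (braid_left ds Z @ [(1, (ds, f, cs))])"
proof (rule eqn_if_eq[OF Braid_natural])
  have f: "reads ds f [(0, (ds, f, cs))] cs" using F by (intro reads_gate) auto
  show "reads (ds @ [Z]) (\<tau> (obs cs) Z \<cdot> (f \<boxtimes> \<iota> Z)) ((0, (ds, f, cs)) # braid_left cs Z) (Z # cs)"
    using reads_Comp[OF reads_TensM[OF f reads_Ident[OF Z]] reads_braid_left[OF Z]] F by simp
  show "reads (ds @ [Z]) ((\<iota> Z \<boxtimes> f) \<cdot> \<tau> (obs ds) Z) (braid_left ds Z @ [(1, (ds, f, cs))]) (Z # cs)"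
    using reads_Comp[OF reads_braid_left[OF Z] reads_TensM[OF reads_Ident[OF Z] f]] F by simp
qed (use assms in auto)

lemma eqn_braid_right:
  assumes Z: "Z \<in> Obj C" and F: "wf_gate (ds, f, cs)"
  shows "eqn (Z # ds) ((1, (ds, f, cs)) # braid_right Z cs) (braid_right Z ds @ [(0, (ds, f, cs))])"
proof (rule eqn_if_eq[OF Braid_natural])
  have f: "reads ds f [(0, (ds, f, cs))] cs" using F by (intro reads_gate) auto
  show "reads (Z # ds) (\<tau> Z (obs cs) \<cdot> (\<iota> Z \<boxtimes> f)) ((1, (ds, f, cs)) # braid_right Z cs) (cs @ [Z])"
    using reads_Comp[OF reads_TensM[OF reads_Ident[OF Z] f] reads_braid_right[OF Z]] F by simp
  show "reads (Z # ds) ((f \<boxtimes> \<iota> Z) \<cdot> \<tau> Z (obs ds)) (braid_right Z ds @ [(0, (ds, f, cs))]) (cs @ [Z])"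
    using reads_Comp[OF reads_braid_right[OF Z] reads_TensM[OF f reads_Ident[OF Z]]] F by simp
qed (use assms in auto)

abbreviation mul_gate :: "('o, 'm, 'x) alg_coalg_scheme \<Rightarrow> ('o, 'm) gate" where
  "mul_gate A \<equiv> ([ob A, ob A], \<nabla>\<^bsub>A\<^esub>, [ob A])"
abbreviation unit_gate :: "('o, 'm, 'x) alg_coalg_scheme \<Rightarrow> ('o, 'm) gate" where
  "unit_gate A \<equiv> ([], \<eta>\<^bsub>A\<^esub>, [ob A])"
abbreviation comul_gate :: "('o, 'm, 'x) alg_coalg_scheme \<Rightarrow> ('o, 'm) gate" where
  "comul_gate A \<equiv> ([ob A], \<Delta>\<^bsub>A\<^esub>, [ob A, ob A])"
abbreviation counit_gate :: "('o, 'm, 'x) alg_coalg_scheme \<Rightarrow> ('o, 'm) gate" where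
  "counit_gate A \<equiv> ([ob A], \<epsilon>\<^bsub>A\<^esub>, [])"

end

section \<open>Algebras and Hopf algebras\<close>

locale braided_algebra = braided_tensor_category C
  for C :: "('o, 'm, 'e) tensor_category_scheme" (structure) +
  fixes A :: "('o, 'm, 'x) alg_coalg_scheme"
  assumes algebra: "is_algebra C A"
begin

lemma algebra_typing [simp]:
  "ob A \<in> Obj C" "\<nabla>\<^bsub>A\<^esub> \<in> Hom C (ob A \<odot> ob A) (ob A)" "\<eta>\<^bsub>A\<^esub> \<in> Hom C (UnitO C) (ob A)"
  using algebra by (auto simp: is_algebra_def)

lemma reads_algebra [reading]:
  "reads [ob A, ob A] \<nabla>\<^bsub>A\<^esub> [(0, mul_gate A)] [ob A]" "reads [] \<eta>\<^bsub>A\<^esub> [(0, unit_gate A)] [ob A]"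
  "reads [ob A] (\<iota> (ob A)) [] [ob A]"
  by (auto intro: reads_gate reads_Ident)

lemma mul_assoc:
  "eqn [ob A, ob A, ob A] [(0, mul_gate A), (0, mul_gate A)] [(1, mul_gate A), (0, mul_gate A)]"
  by (rule eqn_if_eq[of "\<nabla>\<^bsub>A\<^esub> \<cdot> (\<nabla>\<^bsub>A\<^esub> \<boxtimes> \<iota> (ob A))" "\<nabla>\<^bsub>A\<^esub> \<cdot> (\<iota> (ob A) \<boxtimes> \<nabla>\<^bsub>A\<^esub>)"],
     use algebra in \<open>simp add: is_algebra_def\<close>) (rule reading | simp)+

lemma mul_unit_left: "eqn [ob A] [(0, unit_gate A), (0, mul_gate A)] []"
  by (rule eqn_if_eq[of "\<nabla>\<^bsub>A\<^esub> \<cdot> (\<eta>\<^bsub>A\<^esub> \<boxtimes> \<iota> (ob A))" "\<iota> (ob A)"],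
     use algebra in \<open>simp add: is_algebra_def\<close>) (rule reading | simp)+

lemma mul_unit_right: "eqn [ob A] [(1, unit_gate A), (0, mul_gate A)] []"
  by (rule eqn_if_eq[of "\<nabla>\<^bsub>A\<^esub> \<cdot> (\<iota> (ob A) \<boxtimes> \<eta>\<^bsub>A\<^esub>)" "\<iota> (ob A)"],
     use algebra in \<open>simp add: is_algebra_def\<close>) (rule reading | simp)+

end

locale braided_coalgebra = braided_tensor_category C
  for C :: "('o, 'm, 'e) tensor_category_scheme" (structure) +
  fixes A :: "('o, 'm, 'x) alg_coalg_scheme"
  assumes coalgebra: "is_coalgebra C A"
begin

lemma coalgebra_typing [simp]:
  "ob A \<in> Obj C" "\<Delta>\<^bsub>A\<^esub> \<in> Hom C (ob A) (ob A \<odot> ob A)" "\<epsilon>\<^bsub>A\<^esub> \<in> Hom C (ob A) (UnitO C)"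
  using coalgebra by (auto simp: is_coalgebra_def)

lemma reads_coalgebra [reading]:
  "reads [ob A] \<Delta>\<^bsub>A\<^esub> [(0, comul_gate A)] [ob A, ob A]" "reads [ob A] \<epsilon>\<^bsub>A\<^esub> [(0, counit_gate A)] []"
  "reads [ob A] (\<iota> (ob A)) [] [ob A]"
  by (auto intro: reads_gate reads_Ident)

lemma comul_assoc:
  "eqn [ob A] [(0, comul_gate A), (0, comul_gate A)] [(0, comul_gate A), (1, comul_gate A)]"
  by (rule eqn_if_eq[of "(\<Delta>\<^bsub>A\<^esub> \<boxtimes> \<iota> (ob A)) \<cdot> \<Delta>\<^bsub>A\<^esub>" "(\<iota> (ob A) \<boxtimes> \<Delta>\<^bsub>A\<^esub>) \<cdot> \<Delta>\<^bsub>A\<^esub>"],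
     use coalgebra in \<open>simp add: is_coalgebra_def\<close>) (rule reading | simp)+

lemma comul_counit_left: "eqn [ob A] [(0, comul_gate A), (0, counit_gate A)] []"
  by (rule eqn_if_eq[of "(\<epsilon>\<^bsub>A\<^esub> \<boxtimes> \<iota> (ob A)) \<cdot> \<Delta>\<^bsub>A\<^esub>" "\<iota> (ob A)"],
     use coalgebra in \<open>simp add: is_coalgebra_def\<close>) (rule reading | simp)+

lemma comul_counit_right: "eqn [ob A] [(0, comul_gate A), (1, counit_gate A)] []"
  by (rule eqn_if_eq[of "(\<iota> (ob A) \<boxtimes> \<epsilon>\<^bsub>A\<^esub>) \<cdot> \<Delta>\<^bsub>A\<^esub>" "\<iota> (ob A)"],
     use coalgebra in \<open>simp add: is_coalgebra_def\<close>) (rule reading | simp)+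

end

section \<open>Convolution with parameters\<close>

locale convolution_algebra = braided_tensor_category C + D: braided_coalgebra C D + A: braided_algebra C A
  for C :: "('o, 'm, 'e) tensor_category_scheme" (structure)
    and D :: "('o, 'm, 'x) alg_coalg_scheme" and A :: "('o, 'm, 'y) alg_coalg_scheme"
begin

text \<open>Convolution of \<open>Y : X \<otimes> D \<rightarrow> A\<close> and \<open>Z : X' \<otimes> D \<rightarrow> A\<close> over the coalgebra \<open>D\<close>, with parameters in
  the objects \<open>X\<close> and \<open>X'\<close>; for \<open>X = X' = I\<close> it is the usual convolution.\<close>

definition pconv :: "'o \<Rightarrow> 'o \<Rightarrow> 'm \<Rightarrow> 'm \<Rightarrow> 'm" where
  "pconv X X' Y Z = \<nabla>\<^bsub>A\<^esub> \<cdot> (Y \<boxtimes> Z) \<cdot> (\<iota> X \<boxtimes> \<tau> X' (ob D) \<boxtimes> \<iota> (ob D)) \<cdot> (\<iota> X \<boxtimes> \<iota> X' \<boxtimes> \<Delta>\<^bsub>D\<^esub>)"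

lemma reads_pconv:
  assumes "X \<in> Obj C" "X' \<in> Obj C" "Y \<in> Hom C (X \<odot> ob D) (ob A)" "Z \<in> Hom C (X' \<odot> ob D) (ob A)"
  shows "reads [X, X', ob D] (pconv X X' Y Z)
    [(2, comul_gate D), (1, braid_gate X' (ob D)), (0, ([X, ob D], Y, [ob A])),
     (1, ([X', ob D], Z, [ob A])), (0, mul_gate A)] [ob A]"
proof -
  have r: "reads [X, ob D] Y [(0, ([X, ob D], Y, [ob A]))] [ob A]"
    "reads [X', ob D] Z [(0, ([X', ob D], Z, [ob A]))] [ob A]"
    by (simp_all add: assms reads_arrow2)
  show ?thesis unfolding pconv_def
    by (rule back_subst[of "\<lambda>d. reads _ _ d _"],
        (rule back_subst[of "\<lambda>ws. reads ws _ _ _"]),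
        (rule r reading reads_Ident reads_braid | simp add: assms)+)
qed

text \<open>Coassociativity and associativity as for ordinary convolution. The additional ingredient
  is that the parameter \<open>X''\<close> crosses both legs of the comultiplication, which is
  naturality of the braiding combined with the hexagon for \<open>X' \<odot> X''\<close>.\<close>

lemma pconv_assoc:
  assumes o: "X \<in> Obj C" "X' \<in> Obj C" "X'' \<in> Obj C"
    and h: "Y \<in> Hom C (X \<odot> ob D) (ob A)" "Z \<in> Hom C (X' \<odot> ob D) (ob A)"
      "W \<in> Hom C (X'' \<odot> ob D) (ob A)"
  shows "pconv (X \<odot> X') X'' (pconv X X' Y Z) W = pconv X (X' \<odot> X'') Y (pconv X' X'' Z W)"
proof -
  let ?d = "ob D" and ?a = "ob A"
  let ?Y = "([X, ?d], Y, [?a])" and ?Z = "([X', ?d], Z, [?a])" and ?W = "([X'', ?d], W, [?a])"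
  let ?c = "comul_gate D" and ?m = "mul_gate A" and ?t' = "braid_gate X' ?d" and ?t'' = "braid_gate X'' ?d"
  have r: "reads [X, ?d] Y [(0, ?Y)] [?a]" "reads [X', ?d] Z [(0, ?Z)] [?a]"
    "reads [X'', ?d] W [(0, ?W)] [?a]"
    by (simp_all add: o h reads_arrow2)
  have t: "\<tau> (X' \<odot> X'') ?d = (\<tau> X' ?d \<boxtimes> \<iota> X'') \<cdot> (\<iota> X' \<boxtimes> \<tau> X'' ?d)"
    using o by (intro hexagon_left) auto
  have n: "eqn [X'', ?d] [(1, ?c), (0, ?t''), (1, ?t'')] [(0, ?t''), (0, ?c)]"
    using eqn_braid_right[of X'' "[?d]" "\<Delta>\<^bsub>D\<^esub>" "[?d, ?d]"] o by simp
  let ?ws = "[X, X', X'', ?d]"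
  let ?e = "[(2, ?t''), (1, ?t'), (3, ?t''), (0, ?Y), (1, ?Z), (2, ?W)]"
  have "eqn ?ws [(3, ?c), (2, ?t''), (2, ?c), (1, ?t'), (0, ?Y), (1, ?Z), (0, ?m), (1, ?W), (0, ?m)]
     ([(3, ?c), (3, ?c)] @ ?e @ [(0, ?m), (0, ?m)])"
    by (rule eqn_at[OF eqn_sym[OF n], of 2 1]) (simp_all add: o h)
  also have "eqn ?ws \<dots> ([(3, ?c), (4, ?c)] @ ?e @ [(0, ?m), (0, ?m)])"
    by (rule eqn_at[OF D.comul_assoc, of 3 0]) (simp_all add: o h)
  also have "eqn ?ws \<dots> ([(3, ?c), (4, ?c)] @ ?e @ [(1, ?m), (0, ?m)])"
    by (rule eqn_at[OF A.mul_assoc, of 0 8]) (simp_all add: o h)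
  finally have E: "eqn ?ws [(3, ?c), (2, ?t''), (2, ?c), (1, ?t'), (0, ?Y), (1, ?Z), (0, ?m), (1, ?W), (0, ?m)]
     ([(3, ?c), (4, ?c)] @ ?e @ [(1, ?m), (0, ?m)])" .
  note i = TensM_Ident[OF o(1,2), symmetric] TensM_Ident[OF o(2,3), symmetric]
  show ?thesis
    unfolding pconv_def i t
    by (rule eq_if_eqn[OF E],
        (rule r reading reads_Ident reads_braid | simp add: o)+)
qed

lemma pconv_unit_left_param:
  assumes "X \<in> Obj C" "u \<in> Hom C (ob D) (ob A)" "Z \<in> Hom C (X \<odot> ob D) (ob A)"
  shows "pconv (UnitO C) X u Z = \<nabla>\<^bsub>A\<^esub> \<cdot> (u \<boxtimes> Z) \<cdot> (\<tau> X (ob D) \<boxtimes> \<iota> (ob D)) \<cdot> (\<iota> X \<boxtimes> \<Delta>\<^bsub>D\<^esub>)"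
  using assms TensM_unit_left[OF TensM_Hom[OF Braid_Hom' Ident_Hom], of X "ob D" "ob D"]
    TensM_unit_left[OF TensM_Hom[OF Ident_Hom D.coalgebra_typing(2)], of X]
  by (simp add: pconv_def)

lemma pconv_unit_right_param:
  assumes "X \<in> Obj C" "Y \<in> Hom C (X \<odot> ob D) (ob A)" "u \<in> Hom C (ob D) (ob A)"
  shows "pconv X (UnitO C) Y u = \<nabla>\<^bsub>A\<^esub> \<cdot> (Y \<boxtimes> u) \<cdot> (\<iota> X \<boxtimes> \<Delta>\<^bsub>D\<^esub>)"
proof -
  have "\<nabla>\<^bsub>A\<^esub> \<cdot> (Y \<boxtimes> u) \<in> Hom C (X \<odot> ob D \<odot> ob D) (ob A)"
    using Comp_Hom[OF A.algebra_typing(2) TensM_Hom[OF assms(2,3)]] assms by simp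
  then show ?thesis
    using assms TensM_unit_left[OF D.coalgebra_typing(2)]
    by (simp add: pconv_def TensM_Ident Ident_right)
qed

lemma convolution_eq_pconv:
  assumes "f \<in> Hom C (ob D) (ob A)" "g \<in> Hom C (ob D) (ob A)"
  shows "convolution C D A f g = pconv (UnitO C) (UnitO C) f g"
  using assms pconv_unit_right_param[OF UnitO_Obj _ assms(2), of f]
    TensM_unit_left[OF D.coalgebra_typing(2)]
  by (simp add: convolution_def)

lemma pconv_Hom:
  assumes "X \<in> Obj C" "X' \<in> Obj C" "Y \<in> Hom C (X \<odot> ob D) (ob A)" "Z \<in> Hom C (X' \<odot> ob D) (ob A)"
  shows "pconv X X' Y Z \<in> Hom C ((X \<odot> X') \<odot> ob D) (ob A)"
  using reads_Hom[OF reads_pconv[OF assms]] assms by simp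

lemma counit_unit_Hom [simp]: "\<eta>\<^bsub>A\<^esub> \<cdot> \<epsilon>\<^bsub>D\<^esub> \<in> Hom C (ob D) (ob A)"
  by (rule Comp_Hom[OF A.algebra_typing(3) D.coalgebra_typing(3)])

lemma pconv_unit_left:
  assumes X: "X \<in> Obj C" and Z: "Z \<in> Hom C (X \<odot> ob D) (ob A)"
  shows "pconv (UnitO C) X (\<eta>\<^bsub>A\<^esub> \<cdot> \<epsilon>\<^bsub>D\<^esub>) Z = Z"
proof -
  let ?c = "comul_gate D" and ?m = "mul_gate A" and ?t = "braid_gate X (ob D)"
    and ?Z = "([X, ob D], Z, [ob A])" and ?u = "unit_gate A" and ?e = "counit_gate D"
  have r: "reads [X, ob D] Z [(0, ?Z)] [ob A]"
    by (simp add: X Z reads_arrow2)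
  have n: "eqn [X, ob D] [(1, ?e)] [(0, ?t), (0, ?e)]"
    using eqn_braid_right[of X "[ob D]" "\<epsilon>\<^bsub>D\<^esub>" "[]"] X by simp
  have "eqn [X, ob D] [(1, ?c), (0, ?t), (0, ?e), (0, ?u), (1, ?Z), (0, ?m)] [(1, ?c), (1, ?e), (0, ?u),
      (1, ?Z), (0, ?m)]"
    by (rule eqn_at[OF eqn_sym[OF n], of 0 1]) (simp_all add: X Z)
  also have "eqn [X, ob D] \<dots> [(0, ?Z), (0, ?u), (0, ?m)]"
    by (rule eqn_at[OF D.comul_counit_left, of 1 0]) (simp_all add: X Z)
  also have "eqn [X, ob D] \<dots> [(0, ?Z)]"
    by (rule eqn_at[OF A.mul_unit_left, of 0 1]) (simp_all add: X Z)
  finally have E: "eqn [X, ob D] [(1, ?c), (0, ?t), (0, ?e), (0, ?u), (1, ?Z), (0, ?m)] [(0, ?Z)]" .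
  show ?thesis unfolding pconv_unit_left_param[OF X counit_unit_Hom Z]
    by (rule eq_if_eqn[OF E],
        (rule r reading reads_Ident reads_braid | simp add: X)+)
qed

lemma pconv_unit_right:
  assumes X: "X \<in> Obj C" and Y: "Y \<in> Hom C (X \<odot> ob D) (ob A)"
  shows "pconv X (UnitO C) Y (\<eta>\<^bsub>A\<^esub> \<cdot> \<epsilon>\<^bsub>D\<^esub>) = Y"
proof -
  let ?c = "comul_gate D" and ?m = "mul_gate A"
    and ?Y = "([X, ob D], Y, [ob A])" and ?u = "unit_gate A" and ?e = "counit_gate D"
  have r: "reads [X, ob D] Y [(0, ?Y)] [ob A]"
    by (simp add: X Y reads_arrow2)
  have "eqn [X, ob D] [(1, ?c), (2, ?e), (2, ?u), (0, ?Y), (0, ?m)] [(0, ?Y), (1, ?u), (0, ?m)]"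
    by (rule eqn_at[OF D.comul_counit_right, of 1 0]) (simp_all add: X Y)
  also have "eqn [X, ob D] \<dots> [(0, ?Y)]"
    by (rule eqn_at[OF A.mul_unit_right, of 0 1]) (simp_all add: X Y)
  finally have E: "eqn [X, ob D] [(1, ?c), (2, ?e), (2, ?u), (0, ?Y), (0, ?m)] [(0, ?Y)]" .
  show ?thesis unfolding pconv_unit_right_param[OF X Y counit_unit_Hom]
    by (rule eq_if_eqn[OF E],
        (rule r reading reads_Ident reads_braid | simp add: X)+)
qed

lemma convolution_assoc:
  assumes "f \<in> Hom C (ob D) (ob A)" "g \<in> Hom C (ob D) (ob A)" "h \<in> Hom C (ob D) (ob A)"
  shows "convolution C D A (convolution C D A f g) h = convolution C D A f (convolution C D A g h)"
  using pconv_assoc[of "UnitO C" "UnitO C" "UnitO C" f g h] assms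
    pconv_Hom[of "UnitO C" "UnitO C" f g] pconv_Hom[of "UnitO C" "UnitO C" g h]
  by (simp add: convolution_eq_pconv)

lemma convolution_Hom:
  assumes "f \<in> Hom C (ob D) (ob A)" "g \<in> Hom C (ob D) (ob A)"
  shows "convolution C D A f g \<in> Hom C (ob D) (ob A)"
  using assms pconv_Hom[of "UnitO C" "UnitO C" f g] by (simp add: convolution_eq_pconv)

lemma convolution_unit:
  assumes "f \<in> Hom C (ob D) (ob A)"
  shows "convolution C D A (\<eta>\<^bsub>A\<^esub> \<cdot> \<epsilon>\<^bsub>D\<^esub>) f = f" "convolution C D A f (\<eta>\<^bsub>A\<^esub> \<cdot> \<epsilon>\<^bsub>D\<^esub>) = f"
  using assms by (simp_all add: convolution_eq_pconv pconv_unit_left pconv_unit_right)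

text \<open>A left and a right convolution inverse of \<open>g\<close> agree: f = f * (g * h) = (f *
  g) * h = h. All compatibilities of antipodes with other maps are derived in this way.\<close>

lemma convolution_inverse_unique:
  assumes "f \<in> Hom C (ob D) (ob A)" "g \<in> Hom C (ob D) (ob A)" "h \<in> Hom C (ob D) (ob A)"
    and "convolution C D A f g = \<eta>\<^bsub>A\<^esub> \<cdot> \<epsilon>\<^bsub>D\<^esub>" "convolution C D A g h = \<eta>\<^bsub>A\<^esub> \<cdot> \<epsilon>\<^bsub>D\<^esub>"
  shows "f = h"
  using convolution_assoc[OF assms(1-3)] assms by (simp add: convolution_unit)

end

section \<open>Hopf algebras and properties of the antipode\<close>

locale braided_hopf = braided_tensor_category C
  for C :: "('o, 'm, 'e) tensor_category_scheme" (structure) +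
  fixes H :: "('o, 'm, 'x) hopf_data_scheme"
  assumes hopf: "is_hopf C H"
begin

sublocale braided_algebra C H
  by unfold_locales (use hopf in \<open>simp add: is_hopf_def is_bialgebra_def\<close>)

sublocale braided_coalgebra C H
  by unfold_locales (use hopf in \<open>simp add: is_hopf_def is_bialgebra_def\<close>)

sublocale convolution_algebra C H H
  by unfold_locales

lemma antipode_Hom [simp]: "antipode H \<in> Hom C (ob H) (ob H)"
  using hopf by (simp add: is_hopf_def)

abbreviation antipode_gate :: "('o, 'm) gate" where
  "antipode_gate \<equiv> ([ob H], antipode H, [ob H])"

lemma reads_antipode [reading]: "reads [ob H] (antipode H) [(0, antipode_gate)] [ob H]"
  by (simp add: reads_arrow)

lemma comul_mul: "eqn [ob H, ob H] [(0, mul_gate H), (0, comul_gate H)]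
   [(0, comul_gate H), (2, comul_gate H), (1, braid_gate (ob H) (ob H)), (0, mul_gate H), (1, mul_gate H)]"
  by (rule eqn_if_eq[of "\<Delta>\<^bsub>H\<^esub> \<cdot> \<nabla>\<^bsub>H\<^esub>"],
      use hopf in \<open>simp add: is_hopf_def is_bialgebra_def algebra_hom_def tensor_def; fail\<close>)
    (rule reading | simp)+

lemma comul_unit: "eqn [] [(0, unit_gate H), (0, comul_gate H)] [(0, unit_gate H), (1, unit_gate H)]"
  by (rule eqn_if_eq[of "\<Delta>\<^bsub>H\<^esub> \<cdot> \<eta>\<^bsub>H\<^esub>"],
      use hopf in \<open>simp add: is_hopf_def is_bialgebra_def algebra_hom_def tensor_def; fail\<close>)
    (rule reading | simp)+

lemma counit_mul: "eqn [ob H, ob H] [(0, mul_gate H), (0, counit_gate H)] [(0, counit_gate H),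
    (0, counit_gate H)]"
  by (rule eqn_if_eq[of "\<epsilon>\<^bsub>H\<^esub> \<cdot> \<nabla>\<^bsub>H\<^esub>"],
      use hopf in \<open>simp add: is_hopf_def is_bialgebra_def algebra_hom_def tensor_def; fail\<close>)
    (rule reading | simp)+

lemma counit_unit: "eqn [] [(0, unit_gate H), (0, counit_gate H)] []"
proof (rule eqn_if_eq[of "\<epsilon>\<^bsub>H\<^esub> \<cdot> \<eta>\<^bsub>H\<^esub>"])
  show "\<epsilon>\<^bsub>H\<^esub> \<cdot> \<eta>\<^bsub>H\<^esub> = \<iota> (UnitO C)"
    using hopf by (simp add: is_hopf_def is_bialgebra_def)
  show "reads [] (\<iota> (UnitO C)) [] []" by (simp add: reads_def)
qed (rule reading | simp)+

lemma antipode_left: "eqn [ob H] [(0, comul_gate H), (0, antipode_gate), (0, mul_gate H)]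
  [(0, counit_gate H), (0, unit_gate H)]"
  by (rule eqn_if_eq[of "convolution C H H (antipode H) (\<iota> (ob H))"],
      use hopf in \<open>simp add: is_hopf_def; fail\<close>, unfold convolution_def)
    (rule reading | simp)+

lemma antipode_right: "eqn [ob H] [(0, comul_gate H), (1, antipode_gate), (0, mul_gate H)]
  [(0, counit_gate H), (0, unit_gate H)]"
  by (rule eqn_if_eq[of "convolution C H H (\<iota> (ob H)) (antipode H)"],
      use hopf in \<open>simp add: is_hopf_def; fail\<close>, unfold convolution_def)
    (rule reading | simp)+

end

context braided_tensor_category
begin

text \<open>Makes convolution over \<open>tensor C H H\<close> available, in which the antipode of a
  product is computed.\<close>

lemma tensor_coalgebra:
  assumes "is_coalgebra C A" "is_coalgebra C A'"
  shows "is_coalgebra C (tensor C A A')"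
proof -
  interpret A: braided_coalgebra C A by unfold_locales fact
  interpret A': braided_coalgebra C A' by unfold_locales fact
  let ?a = "ob A" and ?b = "ob A'"
  let ?c = "comul_gate A" and ?c' = "comul_gate A'" and ?t = "braid_gate ?a ?b"
  have n: "eqn [?a, ?b] [(0, ?c), (1, ?t), (0, ?t)] [(0, ?t), (1, ?c)]"
    using eqn_braid_left[of ?b "[?a]" "\<Delta>\<^bsub>A\<^esub>" "[?a, ?a]"] by simp
  have n': "eqn [?a, ?b] [(1, ?c'), (0, ?t), (1, ?t)] [(0, ?t), (0, ?c')]"
    using eqn_braid_right[of ?a "[?b]" "\<Delta>\<^bsub>A'\<^esub>" "[?b, ?b]"] by simp
  have e: "eqn [?a, ?b] [(0, ?t), (1, counit_gate A)] [(0, counit_gate A)]"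
    using eqn_sym[OF eqn_braid_left[of ?b "[?a]" "\<epsilon>\<^bsub>A\<^esub>" "[]"]] by simp
  have e': "eqn [?a, ?b] [(0, ?t), (0, counit_gate A')] [(1, counit_gate A')]"
    using eqn_sym[OF eqn_braid_right[of ?a "[?b]" "\<epsilon>\<^bsub>A'\<^esub>" "[]"]] by simp
  have "eqn [?a, ?b] [(0, ?c), (2, ?c'), (1, ?t), (1, ?c'), (0, ?c), (1, ?t)] [(0, ?c), (0, ?c), (3, ?c'),
      (3, ?c'), (2, ?t), (3, ?t), (1, ?t)]"
    by (rule eqn_at[OF eqn_sym[OF n'], of 1 2]) simp_all
  also have "eqn [?a, ?b] \<dots> [(0, ?c), (1, ?c), (3, ?c'), (3, ?c'), (2, ?t), (3, ?t), (1, ?t)]"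
    by (rule eqn_at[OF A.comul_assoc, of 0 0]) simp_all
  also have "eqn [?a, ?b] \<dots> [(0, ?c), (2, ?c'), (1, ?c), (2, ?t), (1, ?t), (4, ?c'), (3, ?t)]"
    by (rule eqn_at[OF A'.comul_assoc, of 3 2]) simp_all
  also have "eqn [?a, ?b] \<dots> [(0, ?c), (2, ?c'), (1, ?t), (2, ?c), (4, ?c'), (3, ?t)]"
    by (rule eqn_at[OF n, of 1 2]) simp_all
  finally have assoc: "eqn [?a, ?b] [(0, ?c), (2, ?c'), (1, ?t), (1, ?c'), (0, ?c), (1, ?t)] [(0, ?c),
      (2, ?c'), (1, ?t), (2, ?c), (4, ?c'), (3, ?t)]" .
  have "eqn [?a, ?b] [(0, ?c), (2, ?c'), (1, ?t), (1, counit_gate A'), (0, counit_gate A)] [(0, ?c),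
      (0, counit_gate A), (1, ?c'), (1, counit_gate A')]"
    by (rule eqn_at[OF e', of 1 2]) simp_all
  also have "eqn [?a, ?b] \<dots> [(1, ?c'), (1, counit_gate A')]"
    by (rule eqn_at[OF A.comul_counit_left, of 0 0]) simp_all
  also have "eqn [?a, ?b] \<dots> []"
    by (rule eqn_at[OF A'.comul_counit_left, of 1 0]) simp_all
  finally have left: "eqn [?a, ?b] [(0, ?c), (2, ?c'), (1, ?t), (1, counit_gate A'), (0, counit_gate A)] []" .
  have "eqn [?a, ?b] [(0, ?c), (2, ?c'), (1, ?t), (2, counit_gate A), (2, counit_gate A')] [(0, ?c),
      (1, counit_gate A), (1, ?c'), (2, counit_gate A')]"
    by (rule eqn_at[OF e, of 1 2]) simp_all
  also have "eqn [?a, ?b] \<dots> [(1, ?c'), (2, counit_gate A')]"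
    by (rule eqn_at[OF A.comul_counit_right, of 0 0]) simp_all
  also have "eqn [?a, ?b] \<dots> []"
    by (rule eqn_at[OF A'.comul_counit_right, of 1 0]) simp_all
  finally have right: "eqn [?a, ?b] [(0, ?c), (2, ?c'), (1, ?t), (2, counit_gate A), (2, counit_gate A')] []" .
  have d: "reads [?a, ?b] ((\<iota> ?a \<boxtimes> \<tau> ?a ?b \<boxtimes> \<iota> ?b) \<cdot> (\<Delta>\<^bsub>A\<^esub> \<boxtimes> \<Delta>\<^bsub>A'\<^esub>)) [(0, ?c), (2, ?c'), (1, ?t)] [?a, ?b, ?a, ?b]"
    by (rule back_subst[of "\<lambda>d. reads _ _ d _"], rule back_subst[of "\<lambda>ws. reads ws _ _ _"],
        rule back_subst[of "\<lambda>us. reads _ _ _ us"])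
      (rule reading reads_Ident reads_braid | simp)+
  note i = reads_Ident_tensor[of ?a ?b]
  show ?thesis
    unfolding is_coalgebra_def tensor_def alg_coalg.simps
  proof (intro conjI)
    show "(\<iota> ?a \<boxtimes> \<tau> ?a ?b \<boxtimes> \<iota> ?b) \<cdot> (\<Delta>\<^bsub>A\<^esub> \<boxtimes> \<Delta>\<^bsub>A'\<^esub>) \<in> Hom C (?a \<odot> ?b) ((?a \<odot> ?b) \<odot> (?a \<odot> ?b))"
      using reads_Hom[OF d] by simp
    show "\<epsilon>\<^bsub>A\<^esub> \<boxtimes> \<epsilon>\<^bsub>A'\<^esub> \<in> Hom C (?a \<odot> ?b) (UnitO C)"
      using TensM_Hom[OF A.coalgebra_typing(3) A'.coalgebra_typing(3)] by simp
  qed (simp, (rule eq_if_eqn[OF assoc], (rule d i reading | simp)+)[],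
       (rule eq_if_eqn[OF left], (rule d i reading | simp)+)[],
       (rule eq_if_eqn[OF right], (rule d i reading | simp)+)[])
qed

end

locale braided_hopf_morphism = braided_tensor_category C + H: braided_hopf C H + G: braided_hopf C G
  for C :: "('o, 'm, 'e) tensor_category_scheme" (structure)
    and H :: "('o, 'm, 'x) hopf_data_scheme" and G :: "('o, 'm, 'y) hopf_data_scheme" +
  fixes f :: 'm
  assumes hom: "hopf_hom C H G f"
begin

lemma hom_Hom [simp]: "f \<in> Hom C (ob H) (ob G)"
  using hom by (simp add: hopf_hom_def algebra_hom_def)

abbreviation hom_gate :: "('o, 'm) gate" where
  "hom_gate \<equiv> ([ob H], f, [ob G])"

lemma reads_hom [reading]: "reads [ob H] f [(0, hom_gate)] [ob G]"
  by (simp add: reads_arrow)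

lemma hom_mul: "eqn [ob H, ob H] [(0, mul_gate H), (0, hom_gate)]
   [(0, hom_gate), (1, hom_gate), (0, mul_gate G)]"
  by (rule eqn_if_eq[of "f \<cdot> \<nabla>\<^bsub>H\<^esub>"], use hom in \<open>simp add: hopf_hom_def algebra_hom_def; fail\<close>)
    (rule reading | simp)+

lemma hom_unit: "eqn [] [(0, unit_gate H), (0, hom_gate)] [(0, unit_gate G)]"
  by (rule eqn_if_eq[of "f \<cdot> \<eta>\<^bsub>H\<^esub>"], use hom in \<open>simp add: hopf_hom_def algebra_hom_def; fail\<close>)
    (rule reading | simp)+

lemma hom_comul: "eqn [ob H] [(0, hom_gate), (0, comul_gate G)]
   [(0, comul_gate H), (0, hom_gate), (1, hom_gate)]"
  by (rule eqn_if_eq[of "\<Delta>\<^bsub>G\<^esub> \<cdot> f"], use hom in \<open>simp add: hopf_hom_def coalgebra_hom_def; fail\<close>)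
    (rule reading | simp)+

lemma hom_counit: "eqn [ob H] [(0, hom_gate), (0, counit_gate G)] [(0, counit_gate H)]"
  by (rule eqn_if_eq[of "\<epsilon>\<^bsub>G\<^esub> \<cdot> f"], use hom in \<open>simp add: hopf_hom_def coalgebra_hom_def; fail\<close>)
    (rule reading | simp)+

text \<open>In the convolution algebra of maps from \<open>H\<close> to \<open>G\<close>, the left
  side is a left inverse of \<open>f\<close> and the right side is a right inverse.\<close>

lemma hom_antipode_eq: "f \<cdot> antipode H = antipode G \<cdot> f"
proof -
  interpret convolution_algebra C H G by unfold_locales
  let ?h = "ob H" and ?g = "ob G" and ?f = "hom_gate"
  have "eqn [?h] [(0, comul_gate H), (0, H.antipode_gate), (0, ?f), (1, ?f), (0, mul_gate G)]
      [(0, comul_gate H), (0, H.antipode_gate), (0, mul_gate H), (0, ?f)]"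
    by (rule eqn_at[OF eqn_sym[OF hom_mul], of 0 2]) simp_all
  also have "eqn [?h] \<dots> [(0, counit_gate H), (0, unit_gate H), (0, ?f)]"
    by (rule eqn_at[OF H.antipode_left, of 0 0]) simp_all
  also have "eqn [?h] \<dots> [(0, counit_gate H), (0, unit_gate G)]"
    by (rule eqn_at[OF hom_unit, of 0 1]) simp_all
  finally have L: "convolution C H G (f \<cdot> antipode H) f = \<eta>\<^bsub>G\<^esub> \<cdot> \<epsilon>\<^bsub>H\<^esub>"
    unfolding convolution_def
    by (rule eq_if_eqn) (rule reading | simp)+
  have "eqn [?h] [(0, comul_gate H), (0, ?f), (1, ?f), (1, G.antipode_gate), (0, mul_gate G)] [(0, ?f),
      (0, comul_gate G), (1, G.antipode_gate), (0, mul_gate G)]"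
    by (rule eqn_at[OF eqn_sym[OF hom_comul], of 0 0]) simp_all
  also have "eqn [?h] \<dots> [(0, ?f), (0, counit_gate G), (0, unit_gate G)]"
    by (rule eqn_at[OF G.antipode_right, of 0 1]) simp_all
  also have "eqn [?h] \<dots> [(0, counit_gate H), (0, unit_gate G)]"
    by (rule eqn_at[OF hom_counit, of 0 0]) simp_all
  finally have R: "convolution C H G f (antipode G \<cdot> f) = \<eta>\<^bsub>G\<^esub> \<cdot> \<epsilon>\<^bsub>H\<^esub>"
    unfolding convolution_def
    by (rule eq_if_eqn) (rule reading | simp)+
  show ?thesis
    by (rule convolution_inverse_unique[OF _ _ _ L R])
      (rule hom_Hom Comp_Hom[OF hom_Hom H.antipode_Hom] Comp_Hom[OF G.antipode_Hom hom_Hom])+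
qed

lemma hom_antipode: "eqn [ob H] [(0, H.antipode_gate), (0, hom_gate)] [(0, hom_gate), (0, G.antipode_gate)]"
  by (rule eqn_if_eq[OF hom_antipode_eq]) (rule reading | simp)+

end

context braided_hopf
begin

text \<open>Both sides are convolution inverses of the multiplication, regarded as a map from the
  coalgebra \<open>tensor C H H\<close> to the algebra \<open>H\<close>: the left side from the
  left, by the bialgebra axiom, the right side from the right, by cancelling the inner factor and
  then the outer one.\<close>

lemma antipode_mul_eq:
  "antipode H \<cdot> \<nabla>\<^bsub>H\<^esub> = \<nabla>\<^bsub>H\<^esub> \<cdot> (antipode H \<boxtimes> antipode H) \<cdot> \<tau> (ob H) (ob H)"
proof -
  let ?h = "ob H" and ?c = "comul_gate H" and ?m = "mul_gate H" and ?t = "braid_gate (ob H) (ob H)"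
    and ?S = antipode_gate and ?e = "counit_gate H" and ?u = "unit_gate H"
  interpret T: convolution_algebra C "tensor C H H" H
    by unfold_locales (rule tensor_coalgebra[OF coalgebra coalgebra])
  have n: "eqn [?h, ?h] [(1, ?c), (0, ?t), (1, ?t)] [(0, ?t), (0, ?c)]"
    using eqn_braid_right[of ?h "[?h]" "\<Delta>\<^bsub>H\<^esub>" "[?h, ?h]"] by simp
  have e: "eqn [?h, ?h] [(0, ?t), (0, ?e)] [(1, ?e)]"
    using eqn_sym[OF eqn_braid_right[of ?h "[?h]" "\<epsilon>\<^bsub>H\<^esub>" "[]"]] by simp
  have u: "reads [?h, ?h] (\<eta>\<^bsub>H\<^esub> \<cdot> \<epsilon>\<^bsub>tensor C H H\<^esub>) [(0, ?e), (0, ?e), (0, ?u)] [?h]"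
    unfolding tensor_def alg_coalg.simps
    by (rule back_subst[of "\<lambda>d. reads _ _ d _"], rule back_subst[of "\<lambda>ws. reads ws _ _ _"])
      (rule reading reads_Ident reads_braid | simp)+
  have "eqn [?h, ?h] [(0, ?c), (2, ?c), (1, ?t), (0, ?m), (1, ?m), (0, ?S), (0, ?m)] [(0, ?m), (0, ?c),
      (0, ?S), (0, ?m)]"
    by (rule eqn_at[OF eqn_sym[OF comul_mul], of 0 0]) simp_all
  also have "eqn [?h, ?h] \<dots> [(0, ?m), (0, ?e), (0, ?u)]"
    by (rule eqn_at[OF antipode_left, of 0 1]) simp_all
  also have "eqn [?h, ?h] \<dots> [(0, ?e), (0, ?e), (0, ?u)]"
    by (rule eqn_at[OF counit_mul, of 0 0]) simp_all
  finally have L: "convolution C (tensor C H H) H (antipode H \<cdot> \<nabla>\<^bsub>H\<^esub>) \<nabla>\<^bsub>H\<^esub> = \<eta>\<^bsub>H\<^esub> \<cdot> \<epsilon>\<^bsub>tensor C H H\<^esub>"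
    unfolding convolution_def tensor_def alg_coalg.simps
    by (rule eq_if_eqn) (rule reading | simp)+
  have "eqn [?h, ?h] [(0, ?c), (2, ?c), (1, ?t), (2, ?t), (2, ?S), (3, ?S), (2, ?m), (0, ?m), (0, ?m)]
      [(0, ?c), (1, ?t), (1, ?c), (2, ?S), (3, ?S), (2, ?m), (0, ?m), (0, ?m)]"
    by (rule eqn_at[OF n, of 1 1]) simp_all
  also have "eqn [?h, ?h] \<dots> [(0, ?c), (1, ?t), (1, ?c), (2, ?S), (3, ?S), (2, ?m), (1, ?m), (0, ?m)]"
    by (rule eqn_at[OF mul_assoc, of 0 6]) simp_all
  also have "eqn [?h, ?h] \<dots> [(0, ?c), (1, ?t), (1, ?c), (2, ?S), (1, ?m), (2, ?S), (1, ?m), (0, ?m)]"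
    by (rule eqn_at[OF eqn_sym[OF mul_assoc], of 1 5]) simp_all
  also have "eqn [?h, ?h] \<dots> [(0, ?c), (1, ?t), (1, ?e), (1, ?S), (1, ?u), (1, ?m), (0, ?m)]"
    by (rule eqn_at[OF antipode_right, of 1 2]) simp_all
  also have "eqn [?h, ?h] \<dots> [(0, ?c), (1, ?t), (1, ?e), (1, ?S), (0, ?m)]"
    by (rule eqn_at[OF mul_unit_left, of 1 4]) simp_all
  also have "eqn [?h, ?h] \<dots> [(1, ?e), (0, ?c), (1, ?S), (0, ?m)]"
    by (rule eqn_at[OF e, of 1 1]) simp_all
  also have "eqn [?h, ?h] \<dots> [(0, ?e), (0, ?e), (0, ?u)]"
    by (rule eqn_at[OF antipode_right, of 0 1]) simp_all
  finally have R: "convolution C (tensor C H H) H \<nabla>\<^bsub>H\<^esub>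
      (\<nabla>\<^bsub>H\<^esub> \<cdot> (antipode H \<boxtimes> antipode H) \<cdot> \<tau> (ob H) (ob H)) = \<eta>\<^bsub>H\<^esub> \<cdot> \<epsilon>\<^bsub>tensor C H H\<^esub>"
    unfolding convolution_def tensor_def alg_coalg.simps
    by (rule eq_if_eqn) (rule reading | simp)+
  have o: "ob (tensor C H H) = ?h \<odot> ?h" by (simp add: tensor_def)
  show ?thesis
    by (rule T.convolution_inverse_unique[OF _ _ _ L R]; rule Hom_if_reads,
        (rule reading | simp add: o)+)
qed

lemma antipode_mul: "eqn [ob H, ob H] [(0, mul_gate H), (0, antipode_gate)]
  [(0, braid_gate (ob H) (ob H)), (0, antipode_gate), (1, antipode_gate), (0, mul_gate H)]"
  by (rule eqn_if_eq[OF antipode_mul_eq]) (rule reading | simp)+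

text \<open>Insert a second counit through S(h1) \<epsilon>(h2), merge the two counits into the
  counit of a product, and apply the antipode axiom.\<close>

lemma antipode_counit: "eqn [ob H] [(0, antipode_gate), (0, counit_gate H)] [(0, counit_gate H)]"
proof -
  let ?h = "ob H" and ?c = "comul_gate H" and ?S = antipode_gate and ?e = "counit_gate H"
  have "eqn [?h] [(0, ?S), (0, ?e)] [(0, ?c), (0, ?S), (0, ?e), (0, ?e)]"
    by (rule eqn_at[OF eqn_sym[OF comul_counit_right], of 0 0]) simp_all
  also have "eqn [?h] \<dots> [(0, ?c), (0, ?S), (0, mul_gate H), (0, ?e)]"
    by (rule eqn_at[OF eqn_sym[OF counit_mul], of 0 2]) simp_all
  also have "eqn [?h] \<dots> [(0, ?e), (0, unit_gate H), (0, ?e)]"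
    by (rule eqn_at[OF antipode_left, of 0 0]) simp_all
  also have "eqn [?h] \<dots> [(0, ?e)]"
    by (rule eqn_at[OF counit_unit, of 0 1]) simp_all
  finally show ?thesis .
qed

lemma antipode_unit: "eqn [] [(0, unit_gate H), (0, antipode_gate)] [(0, unit_gate H)]"
proof -
  let ?u = "unit_gate H" and ?S = antipode_gate and ?m = "mul_gate H"
  have "eqn [] [(0, ?u), (0, ?S)] [(0, ?u), (1, ?u), (0, ?S), (0, ?m)]"
    by (rule eqn_at[OF eqn_sym[OF mul_unit_right], of 0 2]) simp_all
  also have "eqn [] \<dots> [(0, ?u), (0, comul_gate H), (0, ?S), (0, ?m)]"
    by (rule eqn_at[OF eqn_sym[OF comul_unit], of 0 0]) simp_all
  also have "eqn [] \<dots> [(0, ?u), (0, counit_gate H), (0, ?u)]"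
    by (rule eqn_at[OF antipode_left, of 0 1]) simp_all
  also have "eqn [] \<dots> [(0, ?u)]"
    by (rule eqn_at[OF counit_unit, of 0 0]) simp_all
  finally show ?thesis .
qed

end

section \<open>Split Hopf projections\<close>

locale hopf_projection = braided_tensor_category C + H: braided_hopf C H + K: braided_hopf C K
    + I: braided_hopf_morphism C K H i + E: braided_hopf_morphism C H K e
  for C :: "('o, 'm, 'e) tensor_category_scheme" (structure)
    and H :: "('o, 'm, 'x) hopf_data_scheme" and K :: "('o, 'm, 'y) hopf_data_scheme"
    and i e :: 'm +
  assumes retraction: "e \<cdot> i = \<iota> (ob K)"
begin

abbreviation h :: 'o where "h \<equiv> ob H"
abbreviation k :: 'o where "k \<equiv> ob K"

text \<open>The projector onto the coinvariants of the idempotent \<open>i \<cdot> e\<close>.\<close>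

definition p :: 'm where
  "p = convolution C H H (i \<cdot> e \<cdot> antipode H) (\<iota> (ob H))"

abbreviation p_gate :: "('o, 'm) gate" where
  "p_gate \<equiv> ([h], p, [h])"

lemma p_Hom [simp]: "p \<in> Hom C h h"
  unfolding p_def
  by (intro H.convolution_Hom Comp_Hom[OF Comp_Hom[OF I.hom_Hom E.hom_Hom] H.antipode_Hom]) simp

lemma reads_p [reading]: "reads [h] p [(0, p_gate)] [h]"
  by (simp add: reads_arrow)

lemma retraction_eqn: "eqn [k] [(0, I.hom_gate), (0, E.hom_gate)] []"
  by (rule eqn_if_eq[OF retraction]) (rule reading | simp)+

lemma p_unfold: "eqn [h] [(0, p_gate)]
  [(0, comul_gate H), (0, H.antipode_gate), (0, E.hom_gate), (0, I.hom_gate), (0, mul_gate H)]"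
  by (rule eqn_if_eq[OF p_def[unfolded convolution_def]])
    (rule reading | simp)+

text \<open>By the bialgebra axiom and the reversal of products by the antipode, p(hx) = \<pi>S(x1)
  \<pi>S(h1) h2 x2 up to braiding, where \<pi> = \<open>i \<cdot> e\<close>; the two middle factors
  form p(h).\<close>

lemma p_mul: "eqn [h, h] [(0, mul_gate H), (0, p_gate)]
  [(1, comul_gate H), (0, braid_gate h h), (0, H.antipode_gate), (0, E.hom_gate), (0, I.hom_gate),
   (1, p_gate), (1, mul_gate H), (0, mul_gate H)]"
proof -
  let ?m = "mul_gate H" and ?c = "comul_gate H" and ?t = "braid_gate h h"
    and ?S = H.antipode_gate and ?e = E.hom_gate and ?i = I.hom_gate
  have n: "eqn [h, h] [(0, ?c), (1, ?t), (0, ?t)] [(0, ?t), (1, ?c)]"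
    using eqn_braid_left[of h "[h]" "\<Delta>\<^bsub>H\<^esub>" "[h, h]"] by simp
  have "eqn [h, h] [(0, ?m), (0, p_gate)] [(0, ?m), (0, ?c), (0, ?S), (0, ?e), (0, ?i), (0, ?m)]"
    by (rule eqn_at[OF p_unfold, of 0 1]) simp_all
  also have "eqn [h, h] \<dots> [(0, ?c), (2, ?c), (1, ?t), (0, ?m), (0, ?S), (0, ?e), (0, ?i), (1, ?m),
      (0, ?m)]"
    by (rule eqn_at[OF H.comul_mul, of 0 0]) simp_all
  also have "eqn [h, h] \<dots> [(0, ?c), (2, ?c), (1, ?t), (0, ?t), (0, ?S), (1, ?S), (0, ?m), (0, ?e),
      (0, ?i), (1, ?m), (0, ?m)]"
    by (rule eqn_at[OF H.antipode_mul, of 0 3]) simp_all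
  also have "eqn [h, h] \<dots> [(0, ?c), (2, ?c), (1, ?t), (0, ?t), (0, ?S), (1, ?S), (0, ?e), (1, ?e),
      (0, mul_gate K), (0, ?i), (1, ?m), (0, ?m)]"
    by (rule eqn_at[OF E.hom_mul, of 0 6]) simp_all
  also have "eqn [h, h] \<dots> [(1, ?c), (0, ?c), (1, ?t), (0, ?t), (0, ?S), (1, ?S), (0, ?e), (1, ?e),
      (0, ?i), (1, ?i), (2, ?m), (0, ?m), (0, ?m)]"
    by (rule eqn_at[OF I.hom_mul, of 0 8]) simp_all
  also have "eqn [h, h] \<dots> [(1, ?c), (0, ?t), (1, ?c), (0, ?S), (1, ?S), (0, ?e), (1, ?e), (0, ?i),
      (1, ?i), (2, ?m), (0, ?m), (0, ?m)]"
    by (rule eqn_at[OF n, of 0 1]) simp_all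
  also have "eqn [h, h] \<dots> [(1, ?c), (0, ?t), (1, ?c), (0, ?S), (1, ?S), (0, ?e), (1, ?e), (0, ?i),
      (1, ?i), (2, ?m), (1, ?m), (0, ?m)]"
    by (rule eqn_at[OF H.mul_assoc, of 0 10]) simp_all
  also have "eqn [h, h] \<dots> [(1, ?c), (0, ?t), (0, ?S), (0, ?e), (0, ?i), (1, ?c), (1, ?S), (1, ?e),
      (1, ?i), (1, ?m), (1, ?m), (0, ?m)]"
    by (rule eqn_at[OF eqn_sym[OF H.mul_assoc], of 1 9]) simp_all
  also have "eqn [h, h] \<dots> [(1, ?c), (0, ?t), (0, ?S), (0, ?e), (0, ?i), (1, p_gate), (1, ?m), (0, ?m)]"
    by (rule eqn_at[OF eqn_sym[OF p_unfold], of 1 5]) simp_all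
  finally show ?thesis .
qed

text \<open>Since \<open>e\<close> retracts \<open>i\<close>, p(i(k)) is the image under
  \<open>i\<close> of S(k1) k2, and the antipode axiom of \<open>K\<close> applies.\<close>

lemma p_i: "eqn [k] [(0, I.hom_gate), (0, p_gate)] [(0, counit_gate K), (0, unit_gate H)]"
proof -
  let ?m = "mul_gate H" and ?c = "comul_gate H" and ?S = H.antipode_gate and ?e = E.hom_gate and ?i = I.hom_gate
  have "eqn [k] [(0, ?i), (0, p_gate)] [(0, ?i), (0, ?c), (0, ?S), (0, ?e), (0, ?i), (0, ?m)]"
    by (rule eqn_at[OF p_unfold, of 0 1]) simp_all
  also have "eqn [k] \<dots> [(0, ?i), (0, ?c), (0, ?e), (0, K.antipode_gate), (0, ?i), (0, ?m)]"
    by (rule eqn_at[OF E.hom_antipode, of 0 2]) simp_all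
  also have "eqn [k] \<dots> [(0, comul_gate K), (1, ?i), (0, ?i), (0, ?e), (0, K.antipode_gate), (0, ?i),
      (0, ?m)]"
    by (rule eqn_at[OF I.hom_comul, of 0 0]) simp_all
  also have "eqn [k] \<dots> [(0, comul_gate K), (0, K.antipode_gate), (0, ?i), (1, ?i), (0, ?m)]"
    by (rule eqn_at[OF retraction_eqn, of 0 2]) simp_all
  also have "eqn [k] \<dots> [(0, comul_gate K), (0, K.antipode_gate), (0, mul_gate K), (0, ?i)]"
    by (rule eqn_at[OF eqn_sym[OF I.hom_mul], of 0 2]) simp_all
  also have "eqn [k] \<dots> [(0, counit_gate K), (0, unit_gate K), (0, ?i)]"
    by (rule eqn_at[OF K.antipode_left, of 0 0]) simp_all
  also have "eqn [k] \<dots> [(0, counit_gate K), (0, unit_gate H)]"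
    by (rule eqn_at[OF I.hom_unit, of 0 1]) simp_all
  finally show ?thesis .
qed

text \<open>Invariance of \<open>p\<close> under multiplication by \<open>K\<close> from the left.
  In \<open>p_mul\<close> the factor p(i(k)) collapses to the counit, and what remains is
  \<open>p_unfold\<close>.\<close>

lemma p_mul_i: "eqn [k, h] [(0, I.hom_gate), (0, mul_gate H), (0, p_gate)] [(0, counit_gate K), (0, p_gate)]"
proof -
  let ?m = "mul_gate H" and ?c = "comul_gate H" and ?t = "braid_gate h h"
    and ?S = H.antipode_gate and ?e = E.hom_gate and ?i = I.hom_gate
  have n: "eqn [k, h] [(0, ?i), (0, ?t)] [(0, braid_gate k h), (1, ?i)]"
    using eqn_braid_left[of h "[k]" i "[h]"] by simp
  have n': "eqn [k, h] [(0, braid_gate k h), (1, counit_gate K)] [(0, counit_gate K)]"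
    using eqn_sym[OF eqn_braid_left[of h "[k]" "\<epsilon>\<^bsub>K\<^esub>" "[]"]] by simp
  have "eqn [k, h] [(0, ?i), (0, ?m), (0, p_gate)] [(1, ?c), (0, ?i), (0, ?t), (0, ?S), (0, ?e), (0, ?i),
      (1, p_gate), (1, ?m), (0, ?m)]"
    by (rule eqn_at[OF p_mul, of 0 1]) simp_all
  also have "eqn [k, h] \<dots> [(1, ?c), (0, braid_gate k h), (1, ?i), (1, p_gate), (0, ?S), (0, ?e),
      (0, ?i), (1, ?m), (0, ?m)]"
    by (rule eqn_at[OF n, of 0 1]) simp_all
  also have "eqn [k, h] \<dots> [(1, ?c), (0, braid_gate k h), (1, counit_gate K), (0, ?S), (0, ?e),
      (0, ?i), (1, unit_gate H), (1, ?m), (0, ?m)]"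
    by (rule eqn_at[OF p_i, of 1 2]) simp_all
  also have "eqn [k, h] \<dots> [(1, ?c), (0, braid_gate k h), (1, counit_gate K), (0, ?S), (0, ?e),
      (0, ?i), (0, ?m)]"
    by (rule eqn_at[OF H.mul_unit_left, of 1 6]) simp_all
  also have "eqn [k, h] \<dots> [(0, counit_gate K), (0, ?c), (0, ?S), (0, ?e), (0, ?i), (0, ?m)]"
    by (rule eqn_at[OF n', of 0 1]) simp_all
  also have "eqn [k, h] \<dots> [(0, counit_gate K), (0, p_gate)]"
    by (rule eqn_at[OF eqn_sym[OF p_unfold], of 0 1]) simp_all
  finally show ?thesis .
qed

text \<open>p(x) is a product with left factor \<pi>S(x1) in the image of \<open>i\<close>; by
  \<open>p_mul_i\<close> the outer \<open>p\<close> turns that factor into a counit.\<close>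

lemma p_idem: "p \<cdot> p = p"
proof -
  let ?m = "mul_gate H" and ?c = "comul_gate H"
    and ?S = H.antipode_gate and ?e = E.hom_gate and ?i = I.hom_gate
  have "eqn [h] [(0, p_gate), (0, p_gate)] [(0, ?c), (0, ?S), (0, ?e), (0, ?i), (0, ?m), (0, p_gate)]"
    by (rule eqn_at[OF p_unfold, of 0 0]) simp_all
  also have "eqn [h] \<dots> [(0, ?c), (0, ?S), (0, ?e), (0, counit_gate K), (0, p_gate)]"
    by (rule eqn_at[OF p_mul_i, of 0 3]) simp_all
  also have "eqn [h] \<dots> [(0, ?c), (0, ?S), (0, counit_gate H), (0, p_gate)]"
    by (rule eqn_at[OF E.hom_counit, of 0 2]) simp_all
  also have "eqn [h] \<dots> [(0, ?c), (0, counit_gate H), (0, p_gate)]"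
    by (rule eqn_at[OF H.antipode_counit, of 0 1]) simp_all
  also have "eqn [h] \<dots> [(0, p_gate)]"
    by (rule eqn_at[OF H.comul_counit_left, of 0 0]) simp_all
  finally show ?thesis
    by (rule eq_if_eqn) (rule reading | simp)+
qed

end

text \<open>Passing to the opposite category exchanges algebras and coalgebras, the actions \<open>ad\<close> and \<open>coad\<close>,
  and, for a split projection, \<open>i\<close> with \<open>e\<close> and \<open>j\<close> with \<open>q\<close>.\<close>

definition opc :: "('o, 'm, 'e) tensor_category_scheme \<Rightarrow> ('o, 'm, 'e) tensor_category_scheme" where
  "opc C = C\<lparr>Hom := \<lambda>X Y. Hom C Y X, Comp := \<lambda>g f. Comp C f g, Zero := \<lambda>X Y. Zero C Y X,
     Braid := \<lambda>X Y. Braid C Y X\<rparr>"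

lemma opc_simps [simp]:
  "Obj (opc C) = Obj C" "Hom (opc C) X Y = Hom C Y X" "Ident (opc C) = Ident C"
  "Comp (opc C) g f = Comp C f g" "TensO (opc C) = TensO C" "TensM (opc C) = TensM C"
  "UnitO (opc C) = UnitO C" "Braid (opc C) X Y = Braid C Y X"
  by (simp_all add: opc_def)

definition opa :: "('o, 'm, 'x) alg_coalg_scheme \<Rightarrow> ('o, 'm, 'x) alg_coalg_scheme" where
  "opa A = A\<lparr>nabla := delta A, eta := eps A, delta := nabla A, eps := eta A\<rparr>"

lemma opa_simps [simp]:
  "ob (opa A) = ob A" "nabla (opa A) = delta A" "eta (opa A) = eps A"
  "delta (opa A) = nabla A" "eps (opa A) = eta A" "antipode (opa H) = antipode H"
  by (simp_all add: opa_def)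

lemma is_isomorphism_op [simp]: "is_isomorphism (opc C) f \<longleftrightarrow> is_isomorphism C f"
  unfolding is_isomorphism_def inverse_arrows_def by auto

section \<open>Duality between algebras and coalgebras\<close>

context braided_tensor_category
begin

text \<open>The two hexagons change places. Only the braided structure is dualized; split
  projections are formulated without kernels and images so that this is enough.\<close>

lemma braided_op: "braided_tensor_category (opc C)"
proof unfold_locales
  fix X Y Z
  assume o: "X \<in> Obj (opc C)" "Y \<in> Obj (opc C)" "Z \<in> Obj (opc C)"
  let ?D = "opc C"
  show "Braid ?D X (TensO ?D Y Z) =
      Comp ?D (TensM ?D (Ident ?D Y) (Braid ?D X Z)) (TensM ?D (Braid ?D X Y) (Ident ?D Z))"
    using o by (simp add: hexagon_left)
  show "Braid ?D (TensO ?D X Y) Z =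
      Comp ?D (TensM ?D (Braid ?D X Z) (Ident ?D Y)) (TensM ?D (Ident ?D X) (Braid ?D Y Z))"
    using o by (simp add: hexagon_right)
qed (auto simp: Braid_iso Braid_natural dest: Hom_Obj Hom_disjoint
    intro: Ident_left Ident_right Comp_Hom Comp_assoc[symmetric] TensM_Hom TensM_Ident TensM_assoc
      TensM_Comp TensM_unit_left TensM_unit_right)

lemma algebra_op [simp]:
  "is_algebra (opc C) (opa A) \<longleftrightarrow> is_coalgebra C A"
  "is_coalgebra (opc C) (opa A) \<longleftrightarrow> is_algebra C A"
  "algebra_hom (opc C) (opa A) (opa A') f \<longleftrightarrow> coalgebra_hom C A' A f"
  "coalgebra_hom (opc C) (opa A) (opa A') f \<longleftrightarrow> algebra_hom C A' A f"
  by (auto simp: is_algebra_def is_coalgebra_def algebra_hom_def coalgebra_hom_def)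

lemma hopf_hom_op [simp]: "hopf_hom (opc C) (opa A) (opa A') f \<longleftrightarrow> hopf_hom C A' A f"
  by (auto simp: hopf_hom_def)

text \<open>Reversing a left nested composite gives a right nested one. The two agree by
  associativity, which in this setting requires the types of all factors.\<close>

lemma convolution_op:
  assumes "is_coalgebra C D" "is_algebra C A" "f \<in> Hom C (ob D) (ob A)" "g \<in> Hom C (ob D) (ob A)"
  shows "convolution (opc C) (opa A) (opa D) f g = convolution C D A f g"
  using assms Comp_assoc[OF _ TensM_Hom[OF assms(3,4)], of "\<nabla>\<^bsub>A\<^esub>" "ob A" "\<Delta>\<^bsub>D\<^esub>" "ob D"]
  by (simp add: convolution_def is_algebra_def is_coalgebra_def)

text \<open>The notion of a Hopf algebra is self-dual; apart from the nesting of composites, the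
  axioms for \<open>opa H\<close> are those for \<open>H\<close> in another order.\<close>

lemma hopf_op:
  assumes "is_hopf C H"
  shows "is_hopf (opc C) (opa H)"
proof -
  interpret braided_hopf C H by unfold_locales fact
  have "(\<nabla>\<^bsub>H\<^esub> \<boxtimes> \<nabla>\<^bsub>H\<^esub>) \<cdot> ((\<iota> (ob H) \<boxtimes> \<tau> (ob H) (ob H) \<boxtimes> \<iota> (ob H)) \<cdot> (\<Delta>\<^bsub>H\<^esub> \<boxtimes> \<Delta>\<^bsub>H\<^esub>)) = \<Delta>\<^bsub>H\<^esub> \<cdot> \<nabla>\<^bsub>H\<^esub>"
    by (rule eq_if_eqn[OF eqn_sym[OF comul_mul]])
      (rule reading | simp)+
  moreover have "\<epsilon>\<^bsub>H\<^esub> \<cdot> \<eta>\<^bsub>H\<^esub> = \<iota> (UnitO C)" "\<epsilon>\<^bsub>H\<^esub> \<cdot> \<nabla>\<^bsub>H\<^esub> = \<epsilon>\<^bsub>H\<^esub> \<boxtimes> \<epsilon>\<^bsub>H\<^esub>" "\<Delta>\<^bsub>H\<^esub> \<cdot> \<eta>\<^bsub>H\<^esub> = \<eta>\<^bsub>H\<^esub> \<boxtimes> \<eta>\<^bsub>H\<^esub>"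
    using hopf by (simp_all add: is_hopf_def is_bialgebra_def algebra_hom_def tensor_def)
  ultimately have "is_bialgebra (opc C) (opa H)"
    using algebra coalgebra algebra_typing(2)
    by (simp add: is_bialgebra_def algebra_hom_def[of "opc C"] tensor_def)
  then show ?thesis
    using hopf algebra coalgebra by (simp add: is_hopf_def convolution_op)
qed

end

context hopf_projection
begin

lemma p_mul_i_eq: "p \<cdot> \<nabla>\<^bsub>H\<^esub> \<cdot> (i \<boxtimes> \<iota> h) = \<epsilon>\<^bsub>K\<^esub> \<boxtimes> p"
  by (rule eq_if_eqn[OF p_mul_i]) (rule reading | simp)+

lemma projector_op: "i \<cdot> e \<cdot> antipode H = antipode H \<cdot> (i \<cdot> e)"
proof -
  have "eqn [h] [(0, H.antipode_gate), (0, E.hom_gate), (0, I.hom_gate)] [(0, E.hom_gate),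
      (0, K.antipode_gate), (0, I.hom_gate)]"
    by (rule eqn_at[OF E.hom_antipode, of 0 0]) simp_all
  also have "eqn [h] \<dots> [(0, E.hom_gate), (0, I.hom_gate), (0, H.antipode_gate)]"
    by (rule eqn_at[OF I.hom_antipode, of 0 1]) simp_all
  finally show ?thesis
    by (rule eq_if_eqn) (rule reading | simp)+
qed

lemma projection_op: "hopf_projection (opc C) (opa H) (opa K) e i"
  unfolding hopf_projection_def hopf_projection_axioms_def braided_hopf_morphism_def
    braided_hopf_morphism_axioms_def braided_hopf_def braided_hopf_axioms_def
  using braided_op hopf_op[OF H.hopf] hopf_op[OF K.hopf] I.hom E.hom retraction by simp

text \<open>The dual projector is built from \<open>i \<cdot> e\<close> after the antipode in the
  opposite order of composition; as \<open>i \<cdot> e\<close> commutes with the antipode, it is the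
  same morphism.\<close>

lemma p_op: "hopf_projection.p (opc C) (opa H) e i = p"
proof -
  have "i \<cdot> e \<cdot> antipode H \<in> Hom C h h"
    by (intro Comp_Hom[OF Comp_Hom[OF I.hom_Hom E.hom_Hom] H.antipode_Hom])
  then show ?thesis
    using H.algebra H.coalgebra
    by (simp add: hopf_projection.p_def[OF projection_op] p_def convolution_op projector_op)
qed

end

text \<open>A splitting of the idempotent \<open>p\<close>, in place of its image: two equations
  that the opposite category turns into each other, with \<open>j\<close> and \<open>q\<close>
  exchanged.\<close>

locale split_projection = hopf_projection C H K i e
  for C :: "('o, 'm, 'e) tensor_category_scheme" (structure)
    and H K :: "('o, 'm) hopf_data" and i e :: 'm +
  fixes b :: 'o and j q :: 'm
  assumes j_Hom [simp]: "j \<in> Hom C b (ob H)" and q_Hom [simp]: "q \<in> Hom C (ob H) b"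
    and section_p: "q \<cdot> j = \<iota> b" and split_p: "j \<cdot> q = p"
begin

lemma b_Obj [simp]: "b \<in> Obj C"
  using Hom_Obj[OF j_Hom] by simp

abbreviation j_gate :: "('o, 'm) gate" where "j_gate \<equiv> ([b], j, [h])"
abbreviation q_gate :: "('o, 'm) gate" where "q_gate \<equiv> ([h], q, [b])"

lemma reads_jq [reading]: "reads [b] j [(0, j_gate)] [h]" "reads [h] q [(0, q_gate)] [b]"
  "reads [b] (\<iota> b) [] [b]"
  by (simp_all add: reads_arrow reads_Ident)

lemma j_q: "eqn [b] [(0, j_gate), (0, q_gate)] []"
  by (rule eqn_if_eq[OF section_p]) (rule reading | simp)+

lemma q_j: "eqn [h] [(0, q_gate), (0, j_gate)] [(0, p_gate)]"
  by (rule eqn_if_eq[OF split_p]) (rule reading | simp)+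

lemma j_p: "eqn [b] [(0, j_gate), (0, p_gate)] [(0, j_gate)]"
proof -
  have "eqn [b] [(0, j_gate), (0, p_gate)] [(0, j_gate), (0, q_gate), (0, j_gate)]"
    by (rule eqn_at[OF eqn_sym[OF q_j], of 0 1]) simp_all
  also have "eqn [b] \<dots> [(0, j_gate)]"
    by (rule eqn_at[OF j_q, of 0 0]) simp_all
  finally show ?thesis .
qed

lemma p_q: "eqn [h] [(0, p_gate), (0, q_gate)] [(0, q_gate)]"
proof -
  have "eqn [h] [(0, p_gate), (0, q_gate)] [(0, q_gate), (0, j_gate), (0, q_gate)]"
    by (rule eqn_at[OF eqn_sym[OF q_j], of 0 0]) simp_all
  also have "eqn [h] \<dots> [(0, q_gate)]"
    by (rule eqn_at[OF j_q, of 0 1]) simp_all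
  finally show ?thesis .
qed

lemma q_mul_i: "eqn [k, h] [(0, I.hom_gate), (0, mul_gate H), (0, q_gate)] [(0, counit_gate K), (0, q_gate)]"
proof -
  have "eqn [k, h] [(0, I.hom_gate), (0, mul_gate H), (0, q_gate)] [(0, I.hom_gate), (0, mul_gate H),
      (0, p_gate), (0, q_gate)]"
    by (rule eqn_at[OF eqn_sym[OF p_q], of 0 2]) simp_all
  also have "eqn [k, h] \<dots> [(0, counit_gate K), (0, p_gate), (0, q_gate)]"
    by (rule eqn_at[OF p_mul_i, of 0 0]) simp_all
  also have "eqn [k, h] \<dots> [(0, counit_gate K), (0, q_gate)]"
    by (rule eqn_at[OF p_q, of 0 1]) simp_all
  finally show ?thesis .
qed

lemma q_mul_i_eq: "q \<cdot> \<nabla>\<^bsub>H\<^esub> \<cdot> (i \<boxtimes> \<iota> h) = \<epsilon>\<^bsub>K\<^esub> \<boxtimes> q"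
  by (rule eq_if_eqn[OF q_mul_i]) (rule reading | simp)+

lemma split_op: "split_projection (opc C) (opa H) (opa K) e i b q j"
  unfolding split_projection_def split_projection_axioms_def
  using projection_op section_p split_p by (simp add: p_op)

text \<open>The dual of \<open>q_mul_i_eq\<close>: elements of the split factor are left coinvariant
  under \<open>e\<close>.\<close>

lemma comul_j_eq: "(e \<boxtimes> \<iota> h) \<cdot> (\<Delta>\<^bsub>H\<^esub> \<cdot> j) = \<eta>\<^bsub>K\<^esub> \<boxtimes> j"
  using split_projection.q_mul_i_eq[OF split_op] by simp

lemma comul_j: "eqn [b] [(0, j_gate), (0, comul_gate H), (0, E.hom_gate)] [(0, unit_gate K), (1, j_gate)]"
  by (rule eqn_if_eq[OF comul_j_eq]) (rule reading | simp)+

text \<open>Linearity of \<open>p\<close> over the split factor from the right. In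
  \<open>p_mul\<close> only e(b1) and b2 occur for the second argument b, and coinvariance replaces
  them by 1 and b.\<close>

lemma p_mul_j: "eqn [h, b] [(1, j_gate), (0, mul_gate H), (0, p_gate)] [(0, p_gate), (1, j_gate),
    (0, mul_gate H)]"
proof -
  let ?m = "mul_gate H" and ?c = "comul_gate H" and ?t = "braid_gate h h"
    and ?e = E.hom_gate and ?i = I.hom_gate and ?S = K.antipode_gate
  have n: "eqn [h, h] [(0, ?t), (0, ?e)] [(1, ?e), (0, braid_gate h k)]"
    using eqn_sym[OF eqn_braid_right[of h "[h]" e "[k]"]] by simp
  have n': "eqn [h] [(1, unit_gate K), (0, braid_gate h k)] [(0, unit_gate K)]"
    using eqn_braid_right[of h "[]" "\<eta>\<^bsub>K\<^esub>" "[k]"] by simp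
  have "eqn [h, b] [(1, j_gate), (0, ?m), (0, p_gate)] [(1, j_gate), (1, ?c), (0, ?t), (0, H.antipode_gate),
      (0, ?e), (0, ?i), (1, p_gate), (1, ?m), (0, ?m)]"
    by (rule eqn_at[OF p_mul, of 0 1]) simp_all
  also have "eqn [h, b] \<dots> [(1, j_gate), (1, ?c), (0, ?t), (0, ?e), (0, ?S), (0, ?i), (1, p_gate),
      (1, ?m), (0, ?m)]"
    by (rule eqn_at[OF E.hom_antipode, of 0 3]) simp_all
  also have "eqn [h, b] \<dots> [(1, j_gate), (1, ?c), (1, ?e), (0, braid_gate h k), (0, ?S), (0, ?i),
      (1, p_gate), (1, ?m), (0, ?m)]"
    by (rule eqn_at[OF n, of 0 2]) simp_all
  also have "eqn [h, b] \<dots> [(1, unit_gate K), (0, braid_gate h k), (0, ?S), (0, ?i), (1, p_gate),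
      (2, j_gate), (1, ?m), (0, ?m)]"
    by (rule eqn_at[OF comul_j, of 1 0]) simp_all
  also have "eqn [h, b] \<dots> [(0, unit_gate K), (0, ?S), (0, ?i), (1, p_gate), (2, j_gate), (1, ?m),
      (0, ?m)]"
    by (rule eqn_at[OF n', of 0 0]) simp_all
  also have "eqn [h, b] \<dots> [(0, unit_gate K), (0, ?i), (1, p_gate), (2, j_gate), (1, ?m), (0, ?m)]"
    by (rule eqn_at[OF K.antipode_unit, of 0 0]) simp_all
  also have "eqn [h, b] \<dots> [(0, p_gate), (1, j_gate), (0, ?m), (0, unit_gate H), (0, ?m)]"
    by (rule eqn_at[OF I.hom_unit, of 0 0]) simp_all
  also have "eqn [h, b] \<dots> [(0, p_gate), (1, j_gate), (0, ?m)]"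
    by (rule eqn_at[OF H.mul_unit_left, of 0 3]) simp_all
  finally show ?thesis .
qed

lemma unit_p: "eqn [] [(0, unit_gate H), (0, p_gate)] [(0, unit_gate H)]"
proof -
  have "eqn [] [(0, unit_gate H), (0, p_gate)] [(0, unit_gate K), (0, I.hom_gate), (0, p_gate)]"
    by (rule eqn_at[OF eqn_sym[OF I.hom_unit], of 0 0]) simp_all
  also have "eqn [] \<dots> [(0, unit_gate K), (0, counit_gate K), (0, unit_gate H)]"
    by (rule eqn_at[OF p_i, of 0 1]) simp_all
  also have "eqn [] \<dots> [(0, unit_gate H)]"
    by (rule eqn_at[OF K.counit_unit, of 0 0]) simp_all
  finally show ?thesis .
qed

text \<open>The comultiplication is nested to the right because the multiplication is nested to the
  left; this makes \<open>B_op\<close> hold by unfolding alone.\<close>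

definition B :: "('o, 'm) alg_coalg" where
  "B = \<lparr>ob = b, nabla = q \<cdot> \<nabla>\<^bsub>H\<^esub> \<cdot> (j \<boxtimes> j), eta = q \<cdot> \<eta>\<^bsub>H\<^esub>,
     delta = (q \<boxtimes> q) \<cdot> (\<Delta>\<^bsub>H\<^esub> \<cdot> j), eps = \<epsilon>\<^bsub>H\<^esub> \<cdot> j\<rparr>"

lemma ob_B [simp]: "ob B = b"
  by (simp add: B_def)

lemma B_op: "split_projection.B (opc C) (opa H) b q j = opa B"
  by (simp add: split_projection.B_def[OF split_op]) (simp add: B_def opa_def)

abbreviation mulB :: "('o, 'm) gate" where "mulB \<equiv> ([b, b], \<nabla>\<^bsub>B\<^esub>, [b])"
abbreviation unitB :: "('o, 'm) gate" where "unitB \<equiv> ([], \<eta>\<^bsub>B\<^esub>, [b])"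

lemma mulB_read: "reads [b, b] \<nabla>\<^bsub>B\<^esub> [(0, j_gate), (1, j_gate), (0, mul_gate H), (0, q_gate)] [b]"
  unfolding B_def alg_coalg.simps
  by (rule back_subst[of "\<lambda>d. reads _ _ d _"], rule back_subst[of "\<lambda>ws. reads ws _ _ _"])
    (rule reading | simp)+

lemma unitB_read: "reads [] \<eta>\<^bsub>B\<^esub> [(0, unit_gate H), (0, q_gate)] [b]"
  unfolding B_def alg_coalg.simps
  by (rule back_subst[of "\<lambda>d. reads _ _ d _"], rule back_subst[of "\<lambda>ws. reads ws _ _ _"])
    (rule reading | simp)+

lemma B_typing [simp]: "\<nabla>\<^bsub>B\<^esub> \<in> Hom C (b \<odot> b) b" "\<eta>\<^bsub>B\<^esub> \<in> Hom C (UnitO C) b"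
  using reads_Hom[OF mulB_read] reads_Hom[OF unitB_read] by simp_all

lemma reads_B [reading]: "reads [b, b] \<nabla>\<^bsub>B\<^esub> [(0, mulB)] [b]" "reads [] \<eta>\<^bsub>B\<^esub> [(0, unitB)] [b]"
  by (rule reads_gate; simp)+

lemma mulB_unfold: "eqn [b, b] [(0, mulB)] [(0, j_gate), (1, j_gate), (0, mul_gate H), (0, q_gate)]"
  by (rule eqn_if_eq[OF refl reads_B(1) mulB_read]) simp_all

lemma unitB_unfold: "eqn [] [(0, unitB)] [(0, unit_gate H), (0, q_gate)]"
  by (rule eqn_if_eq[OF refl reads_B(2) unitB_read]) simp_all

text \<open>The multiplication was defined by projecting with \<open>q\<close>; by p(b b') = p(b) b'
  = b b' the projection changes nothing, so \<open>j\<close> embeds a subalgebra.\<close>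

lemma mulB_j: "eqn [b, b] [(0, mulB), (0, j_gate)] [(0, j_gate), (1, j_gate), (0, mul_gate H)]"
proof -
  let ?m = "mul_gate H"
  have "eqn [b, b] [(0, mulB), (0, j_gate)] [(0, j_gate), (1, j_gate), (0, ?m), (0, q_gate), (0, j_gate)]"
    by (rule eqn_at[OF mulB_unfold, of 0 0]) simp_all
  also have "eqn [b, b] \<dots> [(0, j_gate), (1, j_gate), (0, ?m), (0, p_gate)]"
    by (rule eqn_at[OF q_j, of 0 3]) simp_all
  also have "eqn [b, b] \<dots> [(0, j_gate), (0, p_gate), (1, j_gate), (0, ?m)]"
    by (rule eqn_at[OF p_mul_j, of 0 1]) simp_all
  also have "eqn [b, b] \<dots> [(0, j_gate), (1, j_gate), (0, ?m)]"
    by (rule eqn_at[OF j_p, of 0 0]) simp_all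
  finally show ?thesis .
qed

lemma unitB_j: "eqn [] [(0, unitB), (0, j_gate)] [(0, unit_gate H)]"
proof -
  have "eqn [] [(0, unitB), (0, j_gate)] [(0, unit_gate H), (0, q_gate), (0, j_gate)]"
    by (rule eqn_at[OF unitB_unfold, of 0 0]) simp_all
  also have "eqn [] \<dots> [(0, unit_gate H), (0, p_gate)]"
    by (rule eqn_at[OF q_j, of 0 1]) simp_all
  also note unit_p
  finally show ?thesis .
qed

lemma j_algebra_hom: "algebra_hom C B H j"
proof -
  have "j \<cdot> \<nabla>\<^bsub>B\<^esub> = \<nabla>\<^bsub>H\<^esub> \<cdot> (j \<boxtimes> j)"
    by (rule eq_if_eqn[OF mulB_j]) (rule reading | simp)+
  moreover have "j \<cdot> \<eta>\<^bsub>B\<^esub> = \<eta>\<^bsub>H\<^esub>"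
    by (rule eq_if_eqn[OF unitB_j]) (rule reading | simp)+
  ultimately show ?thesis by (simp add: algebra_hom_def)
qed

lemma B_algebra: "is_algebra C B"
proof -
  let ?m = "mul_gate H" and ?u = "unit_gate H"
  have "eqn [b, b, b] [(0, mulB), (0, mulB)] [(0, mulB), (0, j_gate), (1, j_gate), (0, ?m), (0, q_gate)]"
    by (rule eqn_at[OF mulB_unfold, of 0 1]) simp_all
  also have "eqn [b, b, b] \<dots> [(0, j_gate), (1, j_gate), (2, j_gate), (0, ?m), (0, ?m), (0, q_gate)]"
    by (rule eqn_at[OF mulB_j, of 0 0]) simp_all
  also have "eqn [b, b, b] \<dots> [(0, j_gate), (1, j_gate), (2, j_gate), (1, ?m), (0, ?m), (0, q_gate)]"
    by (rule eqn_at[OF H.mul_assoc, of 0 3]) simp_all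
  also have "eqn [b, b, b] \<dots> [(1, mulB), (0, j_gate), (1, j_gate), (0, ?m), (0, q_gate)]"
    by (rule eqn_at[OF eqn_sym[OF mulB_j], of 1 1]) simp_all
  also have "eqn [b, b, b] \<dots> [(1, mulB), (0, mulB)]"
    by (rule eqn_at[OF eqn_sym[OF mulB_unfold], of 0 1]) simp_all
  finally have A: "eqn [b, b, b] [(0, mulB), (0, mulB)] [(1, mulB), (0, mulB)]" .
  have "eqn [b] [(0, unitB), (0, mulB)] [(0, unitB), (0, j_gate), (1, j_gate), (0, ?m), (0, q_gate)]"
    by (rule eqn_at[OF mulB_unfold, of 0 1]) simp_all
  also have "eqn [b] \<dots> [(0, j_gate), (0, ?u), (0, ?m), (0, q_gate)]"
    by (rule eqn_at[OF unitB_j, of 0 0]) simp_all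
  also have "eqn [b] \<dots> [(0, j_gate), (0, q_gate)]"
    by (rule eqn_at[OF H.mul_unit_left, of 0 1]) simp_all
  also note j_q
  finally have L: "eqn [b] [(0, unitB), (0, mulB)] []" .
  have "eqn [b] [(1, unitB), (0, mulB)] [(0, j_gate), (1, unitB), (1, j_gate), (0, ?m), (0, q_gate)]"
    by (rule eqn_at[OF mulB_unfold, of 0 1]) simp_all
  also have "eqn [b] \<dots> [(0, j_gate), (1, ?u), (0, ?m), (0, q_gate)]"
    by (rule eqn_at[OF unitB_j, of 1 1]) simp_all
  also have "eqn [b] \<dots> [(0, j_gate), (0, q_gate)]"
    by (rule eqn_at[OF H.mul_unit_right, of 0 1]) simp_all
  also note j_q
  finally have R: "eqn [b] [(1, unitB), (0, mulB)] []" .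
  have "\<nabla>\<^bsub>B\<^esub> \<cdot> (\<nabla>\<^bsub>B\<^esub> \<boxtimes> \<iota> b) = \<nabla>\<^bsub>B\<^esub> \<cdot> (\<iota> b \<boxtimes> \<nabla>\<^bsub>B\<^esub>)"
    by (rule eq_if_eqn[OF A]) (rule reading | simp)+
  moreover have "\<nabla>\<^bsub>B\<^esub> \<cdot> (\<eta>\<^bsub>B\<^esub> \<boxtimes> \<iota> b) = \<iota> b"
    by (rule eq_if_eqn[OF L]) (rule reading | simp)+
  moreover have "\<nabla>\<^bsub>B\<^esub> \<cdot> (\<iota> b \<boxtimes> \<eta>\<^bsub>B\<^esub>) = \<iota> b"
    by (rule eq_if_eqn[OF R]) (rule reading | simp)+
  ultimately show ?thesis by (simp add: is_algebra_def)
qed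

lemma B_coalgebra: "is_coalgebra C B"
  using split_projection.B_algebra[OF split_op] by (simp add: B_op)

lemma q_coalgebra_hom: "coalgebra_hom C H B q"
  using split_projection.j_algebra_hom[OF split_op] by (simp add: B_op)

text \<open>p(h) = \<pi>S(h1) h2, and \<open>q\<close> turns a left factor from \<open>K\<close>
  into its counit; hence h may be replaced by p(h) under \<open>q\<close>.\<close>

lemma q_p_mul: "eqn [h, h] [(0, p_gate), (0, mul_gate H), (0, q_gate)] [(0, mul_gate H), (0, q_gate)]"
proof -
  let ?m = "mul_gate H" and ?c = "comul_gate H" and ?S = H.antipode_gate and ?e = E.hom_gate and ?i = I.hom_gate
  have "eqn [h, h] [(0, p_gate), (0, ?m), (0, q_gate)] [(0, ?c), (0, ?S), (0, ?e), (0, ?i), (0, ?m),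
      (0, ?m), (0, q_gate)]"
    by (rule eqn_at[OF p_unfold, of 0 0]) simp_all
  also have "eqn [h, h] \<dots> [(0, ?c), (0, ?S), (0, ?e), (1, ?m), (0, ?i), (0, ?m), (0, q_gate)]"
    by (rule eqn_at[OF H.mul_assoc, of 0 4]) simp_all
  also have "eqn [h, h] \<dots> [(0, ?c), (0, ?S), (0, ?e), (0, counit_gate K), (0, ?m), (0, q_gate)]"
    by (rule eqn_at[OF q_mul_i, of 0 4]) simp_all
  also have "eqn [h, h] \<dots> [(0, ?c), (0, ?S), (0, counit_gate H), (0, ?m), (0, q_gate)]"
    by (rule eqn_at[OF E.hom_counit, of 0 2]) simp_all
  also have "eqn [h, h] \<dots> [(0, ?c), (0, counit_gate H), (0, ?m), (0, q_gate)]"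
    by (rule eqn_at[OF H.antipode_counit, of 0 1]) simp_all
  also have "eqn [h, h] \<dots> [(0, ?m), (0, q_gate)]"
    by (rule eqn_at[OF H.comul_counit_left, of 0 0]) simp_all
  finally show ?thesis .
qed

lemma i_q: "eqn [k] [(0, I.hom_gate), (0, q_gate)] [(0, counit_gate K), (0, unitB)]"
proof -
  have "eqn [k] [(0, I.hom_gate), (0, q_gate)] [(0, I.hom_gate), (0, p_gate), (0, q_gate)]"
    by (rule eqn_at[OF eqn_sym[OF p_q], of 0 1]) simp_all
  also have "eqn [k] \<dots> [(0, counit_gate K), (0, unit_gate H), (0, q_gate)]"
    by (rule eqn_at[OF p_i, of 0 0]) simp_all
  also have "eqn [k] \<dots> [(0, counit_gate K), (0, unitB)]"
    by (rule eqn_at[OF eqn_sym[OF unitB_unfold], of 0 1]) simp_all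
  finally show ?thesis .
qed

text \<open>The part of b k that survives the projection \<open>q\<close>. This form dualizes at
  once to \<open>coaction\<close>, which is nested to the right for the same reason as in
  \<open>B\<close>; the formula with the antipode is recovered in \<open>action_j\<close>.\<close>

definition action :: 'm where "action = q \<cdot> \<nabla>\<^bsub>H\<^esub> \<cdot> (j \<boxtimes> i)"

definition coaction :: 'm where "coaction = (q \<boxtimes> e) \<cdot> (\<Delta>\<^bsub>H\<^esub> \<cdot> j)"

lemma action_op: "split_projection.action (opc C) (opa H) e q j = coaction"
  by (simp add: split_projection.action_def[OF split_op] coaction_def)

abbreviation action_gate :: "('o, 'm) gate" where "action_gate \<equiv> ([b, k], action, [b])"

lemma action_read: "reads [b, k] action [(0, j_gate), (1, I.hom_gate), (0, mul_gate H), (0, q_gate)] [b]"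
  unfolding action_def
  by (rule back_subst[of "\<lambda>d. reads _ _ d _"], rule back_subst[of "\<lambda>ws. reads ws _ _ _"])
    (rule reading | simp)+

lemma action_Hom [simp]: "action \<in> Hom C (b \<odot> k) b"
  using reads_Hom[OF action_read] by simp

lemma reads_action [reading]: "reads [b, k] action [(0, action_gate)] [b]"
  by (simp add: reads_arrow2)

lemma action_unfold: "eqn [b, k] [(0, action_gate)] [(0, j_gate), (1, I.hom_gate), (0, mul_gate H),
    (0, q_gate)]"
  by (rule eqn_if_eq[OF refl reads_action action_read]) simp_all

text \<open>In elements, \<open>b \<triangleleft> k = S(k\<^sub>1) b k\<^sub>2\<close> up to braiding.\<close>

lemma action_j: "eqn [b, k] [(0, action_gate), (0, j_gate)]
  [(1, comul_gate K), (0, braid_gate b k), (0, K.antipode_gate), (0, I.hom_gate), (1, j_gate), (2, I.hom_gate),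
   (1, mul_gate H), (0, mul_gate H)]"
proof -
  let ?m = "mul_gate H" and ?c = "comul_gate H" and ?t = "braid_gate h h" and ?cK = "comul_gate K"
    and ?e = E.hom_gate and ?i = I.hom_gate and ?S = H.antipode_gate
  have n1: "eqn [b, h] [(0, j_gate), (0, ?t)] [(0, braid_gate b h), (1, j_gate)]"
    using eqn_braid_left[of h "[b]" j "[h]"] by simp
  have n2: "eqn [b, k] [(1, ?i), (0, braid_gate b h)] [(0, braid_gate b k), (0, ?i)]"
    using eqn_braid_right[of b "[k]" i "[h]"] by simp
  have "eqn [b, k] [(0, action_gate), (0, j_gate)] [(0, j_gate), (1, ?i), (0, ?m), (0, q_gate), (0, j_gate)]"
    by (rule eqn_at[OF action_unfold, of 0 0]) simp_all
  also have "eqn [b, k] \<dots> [(0, j_gate), (1, ?i), (0, ?m), (0, p_gate)]"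
    by (rule eqn_at[OF q_j, of 0 3]) simp_all
  also have "eqn [b, k] \<dots> [(0, j_gate), (1, ?i), (1, ?c), (0, ?t), (0, ?S), (0, ?e), (0, ?i),
      (1, p_gate), (1, ?m), (0, ?m)]"
    by (rule eqn_at[OF p_mul, of 0 2]) simp_all
  also have "eqn [b, k] \<dots> [(1, ?cK), (1, ?i), (2, ?i), (0, j_gate), (0, ?t), (0, ?S), (0, ?e),
      (0, ?i), (1, p_gate), (1, ?m), (0, ?m)]"
    by (rule eqn_at[OF I.hom_comul, of 1 1]) simp_all
  also have "eqn [b, k] \<dots> [(1, ?cK), (1, ?i), (0, braid_gate b h), (1, j_gate), (2, ?i), (0, ?S),
      (0, ?e), (0, ?i), (1, p_gate), (1, ?m), (0, ?m)]"
    by (rule eqn_at[OF n1, of 0 3]) simp_all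
  also have "eqn [b, k] \<dots> [(1, ?cK), (0, braid_gate b k), (0, ?i), (0, ?S), (0, ?e), (0, ?i), (2, ?i),
      (1, j_gate), (1, p_gate), (1, ?m), (0, ?m)]"
    by (rule eqn_at[OF n2, of 0 1]) simp_all
  also have "eqn [b, k] \<dots> [(1, ?cK), (0, braid_gate b k), (0, ?i), (0, ?S), (1, j_gate), (2, ?i),
      (0, ?e), (0, ?i), (1, ?m), (0, ?m)]"
    by (rule eqn_at[OF j_p, of 1 7]) simp_all
  also have "eqn [b, k] \<dots> [(1, ?cK), (0, braid_gate b k), (0, K.antipode_gate), (0, ?i), (0, ?e),
      (0, ?i), (1, j_gate), (2, ?i), (1, ?m), (0, ?m)]"
    by (rule eqn_at[OF eqn_sym[OF I.hom_antipode], of 0 2]) simp_all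
  also have "eqn [b, k] \<dots> [(1, ?cK), (0, braid_gate b k), (0, K.antipode_gate), (0, ?i), (1, j_gate),
      (2, ?i), (1, ?m), (0, ?m)]"
    by (rule eqn_at[OF retraction_eqn, of 0 3]) simp_all
  finally show ?thesis .
qed

sublocale P: convolution_algebra C K H
  by unfold_locales

abbreviation jaction :: 'm where "jaction \<equiv> j \<cdot> action"
abbreviation jmul :: 'm where "jmul \<equiv> \<nabla>\<^bsub>H\<^esub> \<cdot> (j \<boxtimes> i)"
abbreviation iS :: 'm where "iS \<equiv> i \<cdot> antipode K"

lemma pconv_typing [simp]:
  "jaction \<in> Hom C (b \<odot> k) h" "jmul \<in> Hom C (b \<odot> k) h" "iS \<in> Hom C k h"
  by (rule Hom_if_reads, (rule reading | simp)+)+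

text \<open>Reads \<open>action_j\<close> as a convolution over \<open>K\<close> with parameter
  \<open>b\<close>, so that the antipode can be cancelled by convolving with
  \<open>i\<close>.\<close>

lemma action_pconv: "jaction = P.pconv (UnitO C) b iS jmul"
  unfolding P.pconv_unit_left_param[OF b_Obj pconv_typing(3,2)]
  by (rule eq_if_eqn[OF action_j]) (rule reading | simp)+

lemma convolution_iS: "convolution C K H i iS = \<eta>\<^bsub>H\<^esub> \<cdot> \<epsilon>\<^bsub>K\<^esub>"
proof -
  let ?i = I.hom_gate
  have "eqn [k] [(0, comul_gate K), (1, K.antipode_gate), (0, ?i), (1, ?i), (0, mul_gate H)]
      [(0, comul_gate K), (1, K.antipode_gate), (0, mul_gate K), (0, ?i)]"
    by (rule eqn_at[OF eqn_sym[OF I.hom_mul], of 0 2]) simp_all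
  also have "eqn [k] \<dots> [(0, counit_gate K), (0, unit_gate K), (0, ?i)]"
    by (rule eqn_at[OF K.antipode_right, of 0 0]) simp_all
  also have "eqn [k] \<dots> [(0, counit_gate K), (0, unit_gate H)]"
    by (rule eqn_at[OF I.hom_unit, of 0 1]) simp_all
  finally show ?thesis unfolding convolution_def
    by (rule eq_if_eqn) (rule reading | simp)+
qed

text \<open>\<open>i\<close> is a convolution inverse of \<open>iS\<close>, so convolving with it
  removes the antipode from \<open>action_pconv\<close>. In elements: k1 (b \<triangleleft> k2) = b
  k up to braiding.\<close>

lemma pconv_i_action: "P.pconv (UnitO C) b i jaction = jmul"
proof -
  have "P.pconv (UnitO C) b i jaction = P.pconv (UnitO C) b (P.pconv (UnitO C) (UnitO C) i iS) jmul"
    using P.pconv_assoc[of "UnitO C" "UnitO C" b i iS jmul] by (simp add: action_pconv)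
  also have "\<dots> = P.pconv (UnitO C) b (\<eta>\<^bsub>H\<^esub> \<cdot> \<epsilon>\<^bsub>K\<^esub>) jmul"
    using P.convolution_eq_pconv[of i iS] by (simp add: convolution_iS)
  finally show ?thesis by (simp add: P.pconv_unit_left)
qed

text \<open>The commutation rule that carries an element of \<open>K\<close> to the left past an
  element of the split factor; it is the source of the semidirect product.\<close>

lemma action_straighten: "eqn [b, k]
   [(1, comul_gate K), (0, braid_gate b k), (0, I.hom_gate), (1, action_gate), (1, j_gate), (0, mul_gate H)]
   [(0, j_gate), (1, I.hom_gate), (0, mul_gate H)]"
  by (rule eqn_if_eq[OF pconv_i_action[unfolded P.pconv_unit_left_param[OF b_Obj I.hom_Hom pconv_typing(1)]]])
    (rule reading | simp)+

lemma pconv_jmul: "P.pconv b b jmul jaction = \<nabla>\<^bsub>H\<^esub> \<cdot> (j \<boxtimes> jmul)"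
proof -
  let ?cK = "comul_gate K" and ?t = "braid_gate b k" and ?m = "mul_gate H" and ?i = I.hom_gate
  have "eqn [b, b, k] [(2, ?cK), (1, ?t), (0, j_gate), (1, ?i), (2, action_gate), (2, j_gate), (0, ?m),
      (0, ?m)] [(0, j_gate), (2, ?cK), (1, ?t), (1, ?i), (2, action_gate), (2, j_gate), (1, ?m), (0, ?m)]"
    by (rule eqn_at[OF H.mul_assoc, of 0 6]) simp_all
  also have "eqn [b, b, k] \<dots> [(0, j_gate), (1, j_gate), (2, ?i), (1, ?m), (0, ?m)]"
    by (rule eqn_at[OF action_straighten, of 1 1]) simp_all
  finally show ?thesis unfolding P.pconv_def
    by (rule eq_if_eqn) (rule reading | simp)+
qed

text \<open>(b \<triangleleft> k1)(b' \<triangleleft> k2) = S(k1) (b k2)(b' \<triangleleft> k3) =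
  S(k1) b b' k2 up to braiding: associativity of \<open>pconv\<close> regroups the factors, and
  \<open>pconv_jmul\<close> absorbs the second action.\<close>

lemma pconv_action: "P.pconv b b jaction jaction = jaction \<cdot> (\<nabla>\<^bsub>B\<^esub> \<boxtimes> \<iota> k)"
proof -
  let ?cK = "comul_gate K" and ?t = "braid_gate b k" and ?m = "mul_gate H" and ?i = I.hom_gate
    and ?S = K.antipode_gate
  have jj: "\<nabla>\<^bsub>H\<^esub> \<cdot> (j \<boxtimes> jmul) \<in> Hom C ((b \<odot> b) \<odot> k) h"
    by (rule Hom_if_reads, (rule reading | simp)+)
  have "P.pconv b b jaction jaction = P.pconv (UnitO C) (b \<odot> b) iS (P.pconv b b jmul jaction)"
    using P.pconv_assoc[of "UnitO C" b b iS jmul jaction] unfolding action_pconv[symmetric] by simp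
  also have "\<dots> = \<nabla>\<^bsub>H\<^esub> \<cdot> (iS \<boxtimes> (\<nabla>\<^bsub>H\<^esub> \<cdot> (j \<boxtimes> jmul))) \<cdot> (\<tau> (b \<odot> b) k \<boxtimes> \<iota> k) \<cdot> (\<iota> (b \<odot> b) \<boxtimes> \<Delta>\<^bsub>K\<^esub>)"
    unfolding pconv_jmul by (rule P.pconv_unit_left_param) (use jj in auto)
  also have "\<dots> = \<nabla>\<^bsub>H\<^esub> \<cdot> (iS \<boxtimes> (\<nabla>\<^bsub>H\<^esub> \<cdot> (j \<boxtimes> jmul)))
     \<cdot> (((\<tau> b k \<boxtimes> \<iota> b) \<cdot> (\<iota> b \<boxtimes> \<tau> b k)) \<boxtimes> \<iota> k) \<cdot> (\<iota> b \<boxtimes> \<iota> b \<boxtimes> \<Delta>\<^bsub>K\<^esub>)"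
    using TensM_assoc[OF Ident_Hom Ident_Hom K.coalgebra_typing(2), of b b]
    by (simp add: hexagon_left TensM_Ident[symmetric])
  also have "\<dots> = jaction \<cdot> (\<nabla>\<^bsub>B\<^esub> \<boxtimes> \<iota> k)"
  proof -
    have n: "eqn [b, b, k] [(0, mulB), (0, ?t)] [(1, ?t), (0, ?t), (1, mulB)]"
      using eqn_braid_left[of k "[b, b]" "\<nabla>\<^bsub>B\<^esub>" "[b]"] by simp
    have "eqn [b, b, k] [(2, ?cK), (1, ?t), (0, ?t), (0, ?S), (0, ?i), (1, j_gate), (2, j_gate), (3, ?i),
        (2, ?m), (1, ?m), (0, ?m)] [(2, ?cK), (1, ?t), (0, ?t), (0, ?S), (0, ?i), (1, j_gate), (2, j_gate),
        (1, ?m), (2, ?i), (1, ?m), (0, ?m)]"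
      by (rule eqn_at[OF eqn_sym[OF H.mul_assoc], of 1 8]) simp_all
    also have "eqn [b, b, k] \<dots> [(2, ?cK), (1, ?t), (0, ?t), (1, mulB), (0, ?S), (0, ?i), (1, j_gate),
        (2, ?i), (1, ?m), (0, ?m)]"
      by (rule eqn_at[OF eqn_sym[OF mulB_j], of 1 5]) simp_all
    also have "eqn [b, b, k] \<dots> [(0, mulB), (1, ?cK), (0, ?t), (0, ?S), (0, ?i), (1, j_gate), (2, ?i),
        (1, ?m), (0, ?m)]"
      by (rule eqn_at[OF eqn_sym[OF n], of 0 1]) simp_all
    also have "eqn [b, b, k] \<dots> [(0, mulB), (0, action_gate), (0, j_gate)]"
      by (rule eqn_at[OF eqn_sym[OF action_j], of 0 1]) simp_all
    finally show ?thesis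
      by (rule eq_if_eqn) (rule reading | simp)+
  qed
  finally show ?thesis .
qed

lemma action_module_algebra: "module_algebra C K B action"
proof -
  let ?cK = "comul_gate K" and ?t = "braid_gate b k" and ?m = "mul_gate H" and ?i = I.hom_gate
    and ?a = action_gate
  have "eqn [b, k, k] [(0, ?a), (0, ?a)] [(0, ?a), (0, j_gate), (1, ?i), (0, ?m), (0, q_gate)]"
    by (rule eqn_at[OF action_unfold, of 0 1]) simp_all
  also have "eqn [b, k, k] \<dots> [(0, j_gate), (1, ?i), (0, ?m), (0, q_gate), (0, j_gate), (1, ?i),
      (0, ?m), (0, q_gate)]"
    by (rule eqn_at[OF action_unfold, of 0 0]) simp_all
  also have "eqn [b, k, k] \<dots> [(0, j_gate), (1, ?i), (0, ?m), (1, ?i), (0, p_gate), (0, ?m), (0, q_gate)]"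
    by (rule eqn_at[OF q_j, of 0 3]) simp_all
  \<comment> \<open>The inner action has produced p(b k), which \<open>q\<close> cannot distinguish
    from b k after multiplication by k'; the module law thereby becomes associativity in
    \<open>H\<close>.\<close>
  also have "eqn [b, k, k] \<dots> [(0, j_gate), (1, ?i), (2, ?i), (0, ?m), (0, ?m), (0, q_gate)]"
    by (rule eqn_at[OF q_p_mul, of 0 4]) simp_all
  also have "eqn [b, k, k] \<dots> [(0, j_gate), (1, ?i), (2, ?i), (1, ?m), (0, ?m), (0, q_gate)]"
    by (rule eqn_at[OF H.mul_assoc, of 0 3]) simp_all
  also have "eqn [b, k, k] \<dots> [(1, mul_gate K), (0, j_gate), (1, ?i), (0, ?m), (0, q_gate)]"
    by (rule eqn_at[OF eqn_sym[OF I.hom_mul], of 1 1]) simp_all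
  also have "eqn [b, k, k] \<dots> [(1, mul_gate K), (0, ?a)]"
    by (rule eqn_at[OF eqn_sym[OF action_unfold], of 0 1]) simp_all
  finally have a1: "action \<cdot> (action \<boxtimes> \<iota> k) = action \<cdot> (\<iota> b \<boxtimes> \<nabla>\<^bsub>K\<^esub>)"
    by (rule eq_if_eqn) (rule reading | simp)+
  have "eqn [b] [(1, unit_gate K), (0, ?a)] [(0, j_gate), (1, unit_gate K), (1, ?i), (0, ?m), (0, q_gate)]"
    by (rule eqn_at[OF action_unfold, of 0 1]) simp_all
  also have "eqn [b] \<dots> [(0, j_gate), (1, unit_gate H), (0, ?m), (0, q_gate)]"
    by (rule eqn_at[OF I.hom_unit, of 1 1]) simp_all
  also have "eqn [b] \<dots> [(0, j_gate), (0, q_gate)]"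
    by (rule eqn_at[OF H.mul_unit_right, of 0 1]) simp_all
  also note j_q
  finally have a2: "action \<cdot> (\<iota> b \<boxtimes> \<eta>\<^bsub>K\<^esub>) = \<iota> b"
    by (rule eq_if_eqn) (rule reading | simp)+
  have "eqn [k] [(0, unitB), (0, ?a)] [(0, unitB), (0, j_gate), (1, ?i), (0, ?m), (0, q_gate)]"
    by (rule eqn_at[OF action_unfold, of 0 1]) simp_all
  also have "eqn [k] \<dots> [(0, ?i), (0, unit_gate H), (0, ?m), (0, q_gate)]"
    by (rule eqn_at[OF unitB_j, of 0 0]) simp_all
  also have "eqn [k] \<dots> [(0, ?i), (0, q_gate)]"
    by (rule eqn_at[OF H.mul_unit_left, of 0 1]) simp_all
  also note i_q
  finally have a3: "action \<cdot> (\<eta>\<^bsub>B\<^esub> \<boxtimes> \<iota> k) = \<eta>\<^bsub>B\<^esub> \<cdot> \<epsilon>\<^bsub>K\<^esub>"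
    by (rule eq_if_eqn) (rule reading | simp)+
  \<comment> \<open>This identity holds in \<open>H\<close> only, after the inclusion
    \<open>j\<close>; composing it with \<open>q\<close> brings it back to the split factor.\<close>
  have J: "eqn [b, b, k] [(0, mulB), (0, ?a), (0, j_gate)]
      [(2, ?cK), (1, ?t), (0, ?a), (0, j_gate), (1, ?a), (1, j_gate), (0, ?m)]"
    by (rule eqn_if_eq[OF pconv_action[symmetric, unfolded P.pconv_def]])
      (rule reading reads_Ident | simp)+
  have "eqn [b, b, k] [(0, mulB), (0, ?a)] [(0, mulB), (0, ?a), (0, j_gate), (0, q_gate)]"
    by (rule eqn_at[OF eqn_sym[OF j_q], of 0 2]) simp_all
  also have "eqn [b, b, k] \<dots> [(2, ?cK), (1, ?t), (0, ?a), (1, ?a), (0, j_gate), (1, j_gate), (0, ?m),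
      (0, q_gate)]"
    by (rule eqn_at[OF J, of 0 0]) simp_all
  also have "eqn [b, b, k] \<dots> [(2, ?cK), (1, ?t), (0, ?a), (1, ?a), (0, mulB)]"
    by (rule eqn_at[OF eqn_sym[OF mulB_unfold], of 0 4]) simp_all
  finally have a4: "action \<cdot> (\<nabla>\<^bsub>B\<^esub> \<boxtimes> \<iota> k) = \<nabla>\<^bsub>B\<^esub> \<cdot> (action \<boxtimes> action) \<cdot> (\<iota> b \<boxtimes> \<tau> b k \<boxtimes> \<iota> k)
      \<cdot> (\<iota> b \<boxtimes> \<iota> b \<boxtimes> \<Delta>\<^bsub>K\<^esub>)"
    by (rule eq_if_eqn) (rule reading | simp)+
  show ?thesis using a1 a2 a3 a4 by (simp add: module_algebra_def)
qed

lemma q_mul: "eqn [k, b] [(1, j_gate), (0, I.hom_gate), (0, mul_gate H), (0, q_gate)] [(0, counit_gate K)]"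
proof -
  have "eqn [k, b] [(1, j_gate), (0, I.hom_gate), (0, mul_gate H), (0, q_gate)] [(0, counit_gate K),
      (0, j_gate), (0, q_gate)]"
    by (rule eqn_at[OF q_mul_i, of 0 1]) simp_all
  also have "eqn [k, b] \<dots> [(0, counit_gate K)]"
    by (rule eqn_at[OF j_q, of 0 1]) simp_all
  finally show ?thesis .
qed

text \<open>Coinvariance replaces e(b1), b2 by 1, b, which leaves k1 and q(k2 b); then q(k2 b) =
  \<epsilon>(k2) b.\<close>

lemma comult_mult: "((e \<boxtimes> q) \<cdot> \<Delta>\<^bsub>H\<^esub>) \<cdot> (\<nabla>\<^bsub>H\<^esub> \<cdot> (i \<boxtimes> j)) = \<iota> (k \<odot> b)"
proof -
  let ?m = "mul_gate H" and ?c = "comul_gate H" and ?t = "braid_gate h h"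
    and ?e = E.hom_gate and ?i = I.hom_gate and ?mK = "mul_gate K"
  have n: "eqn [h, h] [(0, ?t), (0, ?e)] [(1, ?e), (0, braid_gate h k)]"
    using eqn_sym[OF eqn_braid_right[of h "[h]" e "[k]"]] by simp
  have n': "eqn [h] [(1, unit_gate K), (0, braid_gate h k)] [(0, unit_gate K)]"
    using eqn_braid_right[of h "[]" "\<eta>\<^bsub>K\<^esub>" "[k]"] by simp
  have "eqn [k, b] [(0, ?i), (1, j_gate), (0, ?m), (0, ?c), (0, ?e), (1, q_gate)] [(0, ?i), (1, j_gate),
      (0, ?c), (2, ?c), (1, ?t), (0, ?m), (0, ?e), (1, ?m), (1, q_gate)]"
    by (rule eqn_at[OF H.comul_mul, of 0 2]) simp_all
  also have "eqn [k, b] \<dots> [(0, ?i), (1, j_gate), (0, ?c), (2, ?c), (1, ?t), (1, ?e), (0, ?e),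
      (0, ?mK), (1, ?m), (1, q_gate)]"
    by (rule eqn_at[OF E.hom_mul, of 0 5]) simp_all
  also have "eqn [k, b] \<dots> [(0, ?i), (0, ?c), (2, j_gate), (2, ?c), (2, ?e), (1, braid_gate h k),
      (0, ?e), (0, ?mK), (1, ?m), (1, q_gate)]"
    by (rule eqn_at[OF n, of 1 4]) simp_all
  also have "eqn [k, b] \<dots> [(0, ?i), (0, ?c), (2, unit_gate K), (1, braid_gate h k), (3, j_gate),
      (0, ?e), (0, ?mK), (1, ?m), (1, q_gate)]"
    by (rule eqn_at[OF comul_j, of 2 2]) simp_all
  also have "eqn [k, b] \<dots> [(0, ?i), (0, ?c), (0, ?e), (1, unit_gate K), (0, ?mK), (2, j_gate),
      (1, ?m), (1, q_gate)]"
    by (rule eqn_at[OF n', of 1 2]) simp_all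
  also have "eqn [k, b] \<dots> [(0, ?i), (0, ?c), (0, ?e), (2, j_gate), (1, ?m), (1, q_gate)]"
    by (rule eqn_at[OF K.mul_unit_right, of 0 3]) simp_all
  also have "eqn [k, b] \<dots> [(0, comul_gate K), (0, ?i), (0, ?e), (1, ?i), (2, j_gate), (1, ?m),
      (1, q_gate)]"
    by (rule eqn_at[OF I.hom_comul, of 0 0]) simp_all
  also have "eqn [k, b] \<dots> [(0, comul_gate K), (1, ?i), (2, j_gate), (1, ?m), (1, q_gate)]"
    by (rule eqn_at[OF retraction_eqn, of 0 1]) simp_all
  also have "eqn [k, b] \<dots> [(0, comul_gate K), (1, counit_gate K)]"
    by (rule eqn_at[OF q_mul, of 1 1]) simp_all
  also have "eqn [k, b] \<dots> []"
    by (rule eqn_at[OF K.comul_counit_right, of 0 0]) simp_all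
  finally show ?thesis
    by (rule eq_if_eqn) (rule reading reads_Ident_tensor | simp)+
qed

text \<open>The convolution identity \<pi> * p = id, in elements \<pi>(h1) \<pi>S(h2) h3 = h.
  Together with \<open>comult_mult\<close> it exhibits the inverse of the comparison map.\<close>

lemma mult_comult: "(\<nabla>\<^bsub>H\<^esub> \<cdot> (i \<boxtimes> j)) \<cdot> ((e \<boxtimes> q) \<cdot> \<Delta>\<^bsub>H\<^esub>) = \<iota> h"
proof -
  let ?m = "mul_gate H" and ?c = "comul_gate H" and ?e = E.hom_gate and ?i = I.hom_gate
    and ?S = H.antipode_gate and ?SK = K.antipode_gate
  have "eqn [h] [(0, ?c), (0, ?e), (0, ?i), (1, q_gate), (1, j_gate), (0, ?m)] [(0, ?c), (0, ?e), (0, ?i),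
      (1, p_gate), (0, ?m)]"
    by (rule eqn_at[OF q_j, of 1 3]) simp_all
  also have "eqn [h] \<dots> [(0, ?c), (1, ?c), (0, ?e), (0, ?i), (1, ?S), (1, ?e), (1, ?i), (1, ?m), (0, ?m)]"
    by (rule eqn_at[OF p_unfold, of 1 3]) simp_all
  also have "eqn [h] \<dots> [(0, ?c), (0, ?c), (0, ?e), (0, ?i), (1, ?S), (1, ?e), (1, ?i), (1, ?m), (0, ?m)]"
    by (rule eqn_at[OF eqn_sym[OF H.comul_assoc], of 0 0]) simp_all
  also have "eqn [h] \<dots> [(0, ?c), (0, ?c), (0, ?e), (1, ?S), (1, ?e), (0, ?i), (1, ?i), (0, ?m), (0, ?m)]"
    by (rule eqn_at[OF eqn_sym[OF H.mul_assoc], of 0 7]) simp_all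
  also have "eqn [h] \<dots> [(0, ?c), (0, ?c), (0, ?e), (1, ?S), (1, ?e), (0, mul_gate K), (0, ?i), (0, ?m)]"
    by (rule eqn_at[OF eqn_sym[OF I.hom_mul], of 0 5]) simp_all
  also have "eqn [h] \<dots> [(0, ?c), (0, ?c), (0, ?e), (1, ?e), (1, ?SK), (0, mul_gate K), (0, ?i), (0, ?m)]"
    by (rule eqn_at[OF E.hom_antipode, of 1 3]) simp_all
  also have "eqn [h] \<dots> [(0, ?c), (0, ?e), (0, comul_gate K), (1, ?SK), (0, mul_gate K), (0, ?i), (0, ?m)]"
    by (rule eqn_at[OF eqn_sym[OF E.hom_comul], of 0 1]) simp_all
  also have "eqn [h] \<dots> [(0, ?c), (0, ?e), (0, counit_gate K), (0, unit_gate K), (0, ?i), (0, ?m)]"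
    by (rule eqn_at[OF K.antipode_right, of 0 2]) simp_all
  also have "eqn [h] \<dots> [(0, ?c), (0, counit_gate H), (0, unit_gate K), (0, ?i), (0, ?m)]"
    by (rule eqn_at[OF E.hom_counit, of 0 1]) simp_all
  also have "eqn [h] \<dots> [(0, unit_gate K), (0, ?i), (0, ?m)]"
    by (rule eqn_at[OF H.comul_counit_left, of 0 0]) simp_all
  also have "eqn [h] \<dots> [(0, unit_gate H), (0, ?m)]"
    by (rule eqn_at[OF I.hom_unit, of 0 0]) simp_all
  also note H.mul_unit_left
  finally show ?thesis
    by (rule eq_if_eqn) (rule reading reads_Ident_tensor | simp)+
qed

lemma mult_map_Hom [simp]: "mult_map C H i j \<in> Hom C (k \<odot> b) h" "(e \<boxtimes> q) \<cdot> \<Delta>\<^bsub>H\<^esub> \<in> Hom C h (k \<odot> b)"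
  unfolding mult_map_def
  by (rule Hom_if_reads, (rule reading | simp)+)+

lemma mult_map_iso: "is_isomorphism C (mult_map C H i j)"
  unfolding is_isomorphism_def inverse_arrows_def
  using mult_map_Hom comult_mult mult_comult by (metis mult_map_def)

text \<open>In (k b)(k' b') the inner product b k' is straightened by
  \<open>action_straighten\<close>. The coaction is left arbitrary because the dual use of this
  lemma puts an arbitrary action in that place.\<close>

lemma semidirect_algebra_hom: "algebra_hom C (semidirect C K B action \<rho>) H (mult_map C H i j)"
proof -
  let ?m = "mul_gate H" and ?i = I.hom_gate and ?j = j_gate and ?a = action_gate
    and ?t = "braid_gate b k" and ?cK = "comul_gate K" and ?mK = "mul_gate K"
  have "eqn [k, b, k, b] [(2, ?cK), (1, ?t), (2, ?a), (0, ?mK), (0, ?i), (1, mulB), (1, ?j), (0, ?m)]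
      [(2, ?cK), (1, ?t), (2, ?a), (0, ?i), (1, ?i), (0, ?m), (1, mulB), (1, ?j), (0, ?m)]"
    by (rule eqn_at[OF I.hom_mul, of 0 3]) simp_all
  also have "eqn [k, b, k, b] \<dots> [(2, ?cK), (1, ?t), (2, ?a), (0, ?i), (1, ?i), (2, ?j), (3, ?j),
      (2, ?m), (0, ?m), (0, ?m)]"
    by (rule eqn_at[OF mulB_j, of 1 6]) simp_all
  also have "eqn [k, b, k, b] \<dots> [(2, ?cK), (1, ?t), (2, ?a), (0, ?i), (1, ?i), (2, ?j), (3, ?j),
      (2, ?m), (1, ?m), (0, ?m)]"
    by (rule eqn_at[OF H.mul_assoc, of 0 8]) simp_all
  also have "eqn [k, b, k, b] \<dots> [(0, ?i), (3, ?j), (2, ?cK), (1, ?t), (2, ?a), (1, ?i), (2, ?j),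
      (1, ?m), (1, ?m), (0, ?m)]"
    by (rule eqn_at[OF eqn_sym[OF H.mul_assoc], of 1 7]) simp_all
  also have "eqn [k, b, k, b] \<dots> [(0, ?i), (1, ?j), (2, ?i), (3, ?j), (1, ?m), (1, ?m), (0, ?m)]"
    by (rule eqn_at[OF action_straighten, of 1 2]) simp_all
  also have "eqn [k, b, k, b] \<dots> [(0, ?i), (1, ?j), (2, ?i), (3, ?j), (2, ?m), (1, ?m), (0, ?m)]"
    by (rule eqn_at[OF H.mul_assoc, of 1 4]) simp_all
  also have "eqn [k, b, k, b] \<dots> [(0, ?i), (1, ?j), (0, ?m), (1, ?i), (2, ?j), (1, ?m), (0, ?m)]"
    by (rule eqn_at[OF eqn_sym[OF H.mul_assoc], of 0 5]) simp_all
  finally have a1: "mult_map C H i j \<cdot> \<nabla>\<^bsub>semidirect C K B action \<rho>\<^esub>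
      = \<nabla>\<^bsub>H\<^esub> \<cdot> (mult_map C H i j \<boxtimes> mult_map C H i j)"
    unfolding mult_map_def semidirect_def alg_coalg.simps ob_B
    by (rule eq_if_eqn) (rule reading | simp)+
  have "eqn [] [(0, unit_gate K), (0, ?i), (1, unitB), (1, ?j), (0, ?m)] [(0, unit_gate H), (1, unitB),
      (1, ?j), (0, ?m)]"
    by (rule eqn_at[OF I.hom_unit, of 0 0]) simp_all
  also have "eqn [] \<dots> [(0, unit_gate H), (1, unit_gate H), (0, ?m)]"
    by (rule eqn_at[OF unitB_j, of 1 1]) simp_all
  also have "eqn [] \<dots> [(0, unit_gate H)]"
    by (rule eqn_at[OF H.mul_unit_right, of 0 1]) simp_all
  finally have a2: "mult_map C H i j \<cdot> \<eta>\<^bsub>semidirect C K B action \<rho>\<^esub> = \<eta>\<^bsub>H\<^esub>"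
    unfolding mult_map_def semidirect_def alg_coalg.simps
    by (rule eq_if_eqn) (rule reading | simp)+
  show ?thesis using a1 a2
    unfolding algebra_hom_def by (simp add: semidirect_def)
qed

end

section \<open>The coalgebra half of the biproduct by duality\<close>

context braided_tensor_category
begin

lemma comodule_coalgebra_op:
  assumes "is_hopf C K" "is_coalgebra C A" "\<rho> \<in> Hom C (ob A) (ob A \<odot> ob K)"
  shows "module_algebra (opc C) (opa K) (opa A) \<rho> \<longleftrightarrow> comodule_coalgebra C K A \<rho>"
proof -
  interpret K: braided_hopf C K by unfold_locales fact
  interpret A: braided_coalgebra C A by unfold_locales fact
  have r: "reads [ob A] \<rho> [(0, ([ob A], \<rho>, [ob A, ob K]))] [ob A, ob K]"
    using assms(3) by (intro reads_coarrow2) auto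
  let ?X = "\<iota> (ob A) \<boxtimes> \<iota> (ob A) \<boxtimes> \<nabla>\<^bsub>K\<^esub>"
    and ?Y = "\<iota> (ob A) \<boxtimes> \<tau> (ob K) (ob A) \<boxtimes> \<iota> (ob K)"
  have "?X \<cdot> (?Y \<cdot> ((\<rho> \<boxtimes> \<rho>) \<cdot> \<Delta>\<^bsub>A\<^esub>)) = ?X \<cdot> ?Y \<cdot> (\<rho> \<boxtimes> \<rho>) \<cdot> \<Delta>\<^bsub>A\<^esub>"
    by (rule eq_if_reads) (rule r reading | simp add: assms)+
  then show ?thesis
    by (simp add: module_algebra_def comodule_coalgebra_def)
qed

text \<open>Action and coaction change places. Typing of both is required to regroup the composites
  in the middle factors.\<close>

lemma semidirect_op:
  assumes "is_hopf C K" "is_coalgebra C A" "\<rho> \<in> Hom C (ob A) (ob A \<odot> ob K)"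
    "\<alpha> \<in> Hom C (ob A \<odot> ob K) (ob A)"
  shows "semidirect (opc C) (opa K) (opa A) \<rho> \<alpha> = opa (semidirect C K A \<alpha> \<rho>)"
proof -
  interpret K: braided_hopf C K by unfold_locales fact
  interpret A: braided_coalgebra C A by unfold_locales fact
  have r: "reads [ob A] \<rho> [(0, ([ob A], \<rho>, [ob A, ob K]))] [ob A, ob K]"
    using assms(3) by (intro reads_coarrow2) auto
  have r': "reads [ob A, ob K] \<alpha> [(0, ([ob A, ob K], \<alpha>, [ob A]))] [ob A]"
    using assms(4) by (intro reads_arrow2) auto
  have "(\<iota> (ob A) \<boxtimes> \<nabla>\<^bsub>K\<^esub>) \<cdot> ((\<tau> (ob K) (ob A) \<boxtimes> \<iota> (ob K)) \<cdot> (\<iota> (ob K) \<boxtimes> \<rho>))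
    = (\<iota> (ob A) \<boxtimes> \<nabla>\<^bsub>K\<^esub>) \<cdot> (\<tau> (ob K) (ob A) \<boxtimes> \<iota> (ob K)) \<cdot> (\<iota> (ob K) \<boxtimes> \<rho>)"
    by (rule eq_if_reads) (rule r reading | simp add: assms)+
  moreover have "(\<iota> (ob K) \<boxtimes> \<alpha>) \<cdot> ((\<tau> (ob A) (ob K) \<boxtimes> \<iota> (ob K)) \<cdot> (\<iota> (ob A) \<boxtimes> \<Delta>\<^bsub>K\<^esub>))
    = (\<iota> (ob K) \<boxtimes> \<alpha>) \<cdot> (\<tau> (ob A) (ob K) \<boxtimes> \<iota> (ob K)) \<cdot> (\<iota> (ob A) \<boxtimes> \<Delta>\<^bsub>K\<^esub>)"
    by (rule eq_if_reads) (rule r' reading | simp add: assms)+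
  ultimately show ?thesis
    by (simp add: semidirect_def opa_def)
qed

text \<open>Duality carries the comparison map to its inverse, so each dual statement has to be
  inverted. Only the types of the structure maps are assumed, since the coalgebra axioms for
  \<open>semidirect\<close> are not established separately.\<close>

lemma coalgebra_hom_inverse:
  assumes f: "coalgebra_hom C A A' f" and g: "g \<in> Hom C (ob A') (ob A)" "g \<cdot> f = \<iota> (ob A)" "f \<cdot> g = \<iota> (ob A')"
    and d: "\<Delta>\<^bsub>A\<^esub> \<in> Hom C (ob A) (ob A \<odot> ob A)" "\<Delta>\<^bsub>A'\<^esub> \<in> Hom C (ob A') (ob A' \<odot> ob A')"
      "\<epsilon>\<^bsub>A\<^esub> \<in> Hom C (ob A) (UnitO C)" "\<epsilon>\<^bsub>A'\<^esub> \<in> Hom C (ob A') (UnitO C)"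
  shows "coalgebra_hom C A' A g"
proof -
  have fh: "f \<in> Hom C (ob A) (ob A')" and fd: "\<Delta>\<^bsub>A'\<^esub> \<cdot> f = (f \<boxtimes> f) \<cdot> \<Delta>\<^bsub>A\<^esub>" and fe: "\<epsilon>\<^bsub>A'\<^esub> \<cdot> f = \<epsilon>\<^bsub>A\<^esub>"
    using f by (auto simp: coalgebra_hom_def)
  have o: "ob A \<in> Obj C" "ob A' \<in> Obj C" using Hom_Obj[OF fh] by auto
  have "\<Delta>\<^bsub>A\<^esub> \<cdot> g = \<iota> (ob A \<odot> ob A) \<cdot> (\<Delta>\<^bsub>A\<^esub> \<cdot> g)"
    using Ident_left[OF Comp_Hom[OF d(1) g(1)]] by simp
  also have "\<dots> = ((g \<boxtimes> g) \<cdot> (f \<boxtimes> f)) \<cdot> (\<Delta>\<^bsub>A\<^esub> \<cdot> g)"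
    using TensM_Comp[OF g(1) fh g(1) fh] g o by (simp add: TensM_Ident)
  also have "\<dots> = (g \<boxtimes> g) \<cdot> ((f \<boxtimes> f) \<cdot> (\<Delta>\<^bsub>A\<^esub> \<cdot> g))"
    by (rule Comp_assoc) (rule TensM_Hom fh g Comp_Hom d)+
  also have "(f \<boxtimes> f) \<cdot> (\<Delta>\<^bsub>A\<^esub> \<cdot> g) = ((f \<boxtimes> f) \<cdot> \<Delta>\<^bsub>A\<^esub>) \<cdot> g"
    by (rule Comp_assoc[symmetric]) (rule TensM_Hom fh g Comp_Hom d)+
  also have "\<dots> = \<Delta>\<^bsub>A'\<^esub> \<cdot> (f \<cdot> g)"
    unfolding fd[symmetric] by (rule Comp_assoc) (rule fh g d)+
  finally have "\<Delta>\<^bsub>A\<^esub> \<cdot> g = (g \<boxtimes> g) \<cdot> \<Delta>\<^bsub>A'\<^esub>"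
    using g d Ident_right by simp
  moreover have "\<epsilon>\<^bsub>A\<^esub> \<cdot> g = \<epsilon>\<^bsub>A'\<^esub>"
    using Comp_assoc[OF d(4) fh g(1)] fe g(3) Ident_right[OF d(4)] by simp
  ultimately show ?thesis using g by (simp add: coalgebra_hom_def)
qed

end

context split_projection
begin

lemma coaction_Hom [simp]: "coaction \<in> Hom C b (b \<odot> k)"
  using split_projection.action_Hom[OF split_op] by (simp add: action_op)

lemma coaction_comodule_coalgebra: "comodule_coalgebra C K B coaction"
  using split_projection.action_module_algebra[OF split_op]
    comodule_coalgebra_op[OF K.hopf B_coalgebra, of coaction]
  by (simp add: action_op B_op)

text \<open>The dual of \<open>semidirect_algebra_hom\<close> says that
  \<open>(e \<boxtimes> q) \<cdot> \<Delta>\<close> respects the coalgebra structures, and this is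
  the inverse of the comparison map.\<close>

lemma semidirect_coalgebra_hom:
  assumes \<alpha>: "\<alpha> \<in> Hom C (b \<odot> k) b"
  shows "coalgebra_hom C (semidirect C K B \<alpha> coaction) H (mult_map C H i j)"
proof -
  interpret B: braided_coalgebra C B by unfold_locales (rule B_coalgebra)
  have r: "reads [b] coaction [(0, ([b], coaction, [b, k]))] [b, k]"
    by (intro reads_coarrow2) auto
  note rB = B.reads_coalgebra[unfolded ob_B]
  let ?S = "semidirect C K B \<alpha> coaction"
  have S: "coalgebra_hom C H ?S ((e \<boxtimes> q) \<cdot> \<Delta>\<^bsub>H\<^esub>)"
    using split_projection.semidirect_algebra_hom[OF split_op, of \<alpha>]
    by (simp add: action_op B_op semidirect_op[OF K.hopf B_coalgebra] \<alpha> mult_map_def)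
  show ?thesis
  proof (rule coalgebra_hom_inverse[OF S])
    have "reads [k, b] \<Delta>\<^bsub>?S\<^esub> [(0, comul_gate K), (2, ([b], \<Delta>\<^bsub>B\<^esub>, [b, b])), (2, ([b], coaction, [b, k])),
      (1, braid_gate k b), (2, mul_gate K)] [k, b, k, b]"
      unfolding semidirect_def alg_coalg.simps ob_B
      apply (rule back_subst[of "\<lambda>d. reads _ _ d _"])
      apply (rule back_subst[of "\<lambda>ws. reads ws _ _ _"])
      apply (rule back_subst[of "\<lambda>us. reads _ _ _ us"])
      apply (rule r rB reading | simp)+
      done
    from reads_Hom[OF this] show "\<Delta>\<^bsub>?S\<^esub> \<in> Hom C (ob ?S) (ob ?S \<odot> ob ?S)"
      by (simp add: semidirect_def)
    show "\<epsilon>\<^bsub>?S\<^esub> \<in> Hom C (ob ?S) (UnitO C)"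
      using TensM_Hom[OF K.coalgebra_typing(3) B.coalgebra_typing(3)] by (simp add: semidirect_def)
  qed (use comult_mult mult_comult mult_map_Hom in \<open>auto simp: mult_map_def semidirect_def\<close>)
qed

end

section \<open>Transport of the Hopf algebra axioms along an epimorphism\<close>

context braided_tensor_category
begin

lemma epi_cancel:
  assumes "is_epi C r" "r \<in> Hom C X Y" "s \<in> Hom C Y T" "t \<in> Hom C Y T" "s \<cdot> r = t \<cdot> r"
  shows "s = t"
  using assms Hom_disjoint unfolding is_epi_def by metis

text \<open>Each axiom for \<open>Q\<close> holds after composition with as many copies of
  \<open>r\<close> as it has inputs, where it reduces to the axiom for \<open>H\<close>; then
  \<open>r\<close> is cancelled. The result serves for images of Hopf morphisms, for the split
  factor in the binormal case, and for the tensor product of the two factors.\<close>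

lemma hopf_quotientI:
  fixes H :: "('o, 'm, 'x) hopf_data_scheme" and Q :: "('o, 'm, 'y) hopf_data_scheme"
  assumes "is_hopf C H"
    and typing: "\<nabla>\<^bsub>Q\<^esub> \<in> Hom C (ob Q \<odot> ob Q) (ob Q)" "\<eta>\<^bsub>Q\<^esub> \<in> Hom C (UnitO C) (ob Q)"
      "\<Delta>\<^bsub>Q\<^esub> \<in> Hom C (ob Q) (ob Q \<odot> ob Q)" "\<epsilon>\<^bsub>Q\<^esub> \<in> Hom C (ob Q) (UnitO C)"
      "antipode Q \<in> Hom C (ob Q) (ob Q)"
    and hom: "hopf_hom C H Q r" "antipode Q \<cdot> r = r \<cdot> antipode H"
    and epi: "is_epi C r" "is_epi C (r \<boxtimes> r)" "is_epi C (r \<boxtimes> r \<boxtimes> r)"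
  shows "is_hopf C Q"
proof -
  interpret braided_hopf C H by unfold_locales fact
  let ?h = "ob H" and ?b = "ob Q"
  have r: "r \<in> Hom C ?h ?b" using hom by (simp add: hopf_hom_def algebra_hom_def)
  have o: "?b \<in> Obj C" using Hom_Obj[OF r] by simp
  let ?r = "([?h], r, [?b])" and ?M = "mul_gate Q" and ?U = "unit_gate Q" and ?C = "comul_gate Q"
    and ?E = "counit_gate Q" and ?A = "([?b], antipode Q, [?b])" and ?T = "braid_gate ?b ?b"
  let ?m = "mul_gate H" and ?u = "unit_gate H" and ?c = "comul_gate H" and ?e = "counit_gate H"
    and ?a = antipode_gate and ?t = "braid_gate ?h ?h"
  note [simp] = r o typing
  have rd: "reads [?h] r [(0, ?r)] [?b]" "reads [?b, ?b] \<nabla>\<^bsub>Q\<^esub> [(0, ?M)] [?b]" "reads [] \<eta>\<^bsub>Q\<^esub> [(0, ?U)] [?b]"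
    "reads [?b] \<Delta>\<^bsub>Q\<^esub> [(0, ?C)] [?b, ?b]" "reads [?b] \<epsilon>\<^bsub>Q\<^esub> [(0, ?E)] []"
    "reads [?b] (antipode Q) [(0, ?A)] [?b]" "reads [?b] (\<iota> ?b) [] [?b]"
    by (rule reads_gate reads_Ident; simp)+
  have rm: "eqn [?h, ?h] [(0, ?r), (1, ?r), (0, ?M)] [(0, ?m), (0, ?r)]"
    by (rule eqn_if_eq[of "\<nabla>\<^bsub>Q\<^esub> \<cdot> (r \<boxtimes> r)" "r \<cdot> \<nabla>\<^bsub>H\<^esub>"],
        use hom in \<open>simp add: hopf_hom_def algebra_hom_def; fail\<close>)
      (rule rd reading | simp)+
  have ru: "eqn [] [(0, ?U)] [(0, ?u), (0, ?r)]"
    by (rule eqn_if_eq[of "\<eta>\<^bsub>Q\<^esub>" "r \<cdot> \<eta>\<^bsub>H\<^esub>"], use hom in \<open>simp add: hopf_hom_def algebra_hom_def; fail\<close>)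
      (rule rd reading | simp)+
  have rc: "eqn [?h] [(0, ?r), (0, ?C)] [(0, ?c), (0, ?r), (1, ?r)]"
    by (rule eqn_if_eq[of "\<Delta>\<^bsub>Q\<^esub> \<cdot> r"], use hom in \<open>simp add: hopf_hom_def coalgebra_hom_def; fail\<close>)
      (rule rd reading | simp)+
  have re: "eqn [?h] [(0, ?r), (0, ?E)] [(0, ?e)]"
    by (rule eqn_if_eq[of "\<epsilon>\<^bsub>Q\<^esub> \<cdot> r"], use hom in \<open>simp add: hopf_hom_def coalgebra_hom_def; fail\<close>)
      (rule rd reading | simp)+
  have ra: "eqn [?h] [(0, ?r), (0, ?A)] [(0, ?a), (0, ?r)]"
    by (rule eqn_if_eq[OF hom(2)]) (rule rd reading | simp)+
  have r2: "r \<boxtimes> r \<in> Hom C (?h \<odot> ?h) (?b \<odot> ?b)"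
    and r3: "r \<boxtimes> r \<boxtimes> r \<in> Hom C (?h \<odot> ?h \<odot> ?h) (?b \<odot> ?b \<odot> ?b)"
    by (intro TensM_Hom r)+
  have mul: "\<nabla>\<^bsub>Q\<^esub> \<cdot> (\<nabla>\<^bsub>Q\<^esub> \<boxtimes> \<iota> ?b) = \<nabla>\<^bsub>Q\<^esub> \<cdot> (\<iota> ?b \<boxtimes> \<nabla>\<^bsub>Q\<^esub>)"
  proof (rule epi_cancel[OF epi(3) r3])
    have "eqn [?h, ?h, ?h] [(0, ?r), (1, ?r), (0, ?M), (1, ?r), (0, ?M)] [(0, ?m), (0, ?r), (1, ?r), (0, ?M)]"
      by (rule eqn_at[OF rm, of 0 0]) simp_all
    also have "eqn [?h, ?h, ?h] \<dots> [(0, ?m), (0, ?m), (0, ?r)]"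
      by (rule eqn_at[OF rm, of 0 1]) simp_all
    also have "eqn [?h, ?h, ?h] \<dots> [(1, ?m), (0, ?m), (0, ?r)]"
      by (rule eqn_at[OF mul_assoc, of 0 0]) simp_all
    also have "eqn [?h, ?h, ?h] \<dots> [(0, ?r), (1, ?m), (1, ?r), (0, ?M)]"
      by (rule eqn_at[OF eqn_sym[OF rm], of 0 1]) simp_all
    also have "eqn [?h, ?h, ?h] \<dots> [(0, ?r), (1, ?r), (2, ?r), (1, ?M), (0, ?M)]"
      by (rule eqn_at[OF eqn_sym[OF rm], of 1 1]) simp_all
    finally show "\<nabla>\<^bsub>Q\<^esub> \<cdot> (\<nabla>\<^bsub>Q\<^esub> \<boxtimes> \<iota> ?b) \<cdot> (r \<boxtimes> r \<boxtimes> r) = \<nabla>\<^bsub>Q\<^esub> \<cdot> (\<iota> ?b \<boxtimes> \<nabla>\<^bsub>Q\<^esub>) \<cdot> (r \<boxtimes> r \<boxtimes> r)"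
      by (rule eq_if_eqn) (rule rd reading | simp)+
  qed (rule Hom_if_reads, (rule rd reading | simp)+)+
  have unitl: "\<nabla>\<^bsub>Q\<^esub> \<cdot> (\<eta>\<^bsub>Q\<^esub> \<boxtimes> \<iota> ?b) = \<iota> ?b"
  proof (rule epi_cancel[OF epi(1) r])
    have "eqn [?h] [(0, ?r), (0, ?U), (0, ?M)] [(0, ?u), (0, ?r), (1, ?r), (0, ?M)]"
      by (rule eqn_at[OF ru, of 0 1]) simp_all
    also have "eqn [?h] \<dots> [(0, ?u), (0, ?m), (0, ?r)]"
      by (rule eqn_at[OF rm, of 0 1]) simp_all
    also have "eqn [?h] \<dots> [(0, ?r)]"
      by (rule eqn_at[OF mul_unit_left, of 0 0]) simp_all
    finally show "\<nabla>\<^bsub>Q\<^esub> \<cdot> (\<eta>\<^bsub>Q\<^esub> \<boxtimes> \<iota> ?b) \<cdot> r = \<iota> ?b \<cdot> r"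
      by (rule eq_if_eqn) (rule rd reading | simp)+
  qed (rule Hom_if_reads, (rule rd reading | simp)+)+
  have unitr: "\<nabla>\<^bsub>Q\<^esub> \<cdot> (\<iota> ?b \<boxtimes> \<eta>\<^bsub>Q\<^esub>) = \<iota> ?b"
  proof (rule epi_cancel[OF epi(1) r])
    have "eqn [?h] [(0, ?r), (1, ?U), (0, ?M)] [(1, ?u), (0, ?r), (1, ?r), (0, ?M)]"
      by (rule eqn_at[OF ru, of 1 1]) simp_all
    also have "eqn [?h] \<dots> [(1, ?u), (0, ?m), (0, ?r)]"
      by (rule eqn_at[OF rm, of 0 1]) simp_all
    also have "eqn [?h] \<dots> [(0, ?r)]"
      by (rule eqn_at[OF mul_unit_right, of 0 0]) simp_all
    finally show "\<nabla>\<^bsub>Q\<^esub> \<cdot> (\<iota> ?b \<boxtimes> \<eta>\<^bsub>Q\<^esub>) \<cdot> r = \<iota> ?b \<cdot> r"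
      by (rule eq_if_eqn) (rule rd reading | simp)+
  qed (rule Hom_if_reads, (rule rd reading | simp)+)+
  have comul: "(\<Delta>\<^bsub>Q\<^esub> \<boxtimes> \<iota> ?b) \<cdot> \<Delta>\<^bsub>Q\<^esub> = (\<iota> ?b \<boxtimes> \<Delta>\<^bsub>Q\<^esub>) \<cdot> \<Delta>\<^bsub>Q\<^esub>"
  proof (rule epi_cancel[OF epi(1) r])
    have "eqn [?h] [(0, ?r), (0, ?C), (0, ?C)] [(0, ?c), (0, ?r), (0, ?C), (2, ?r)]"
      by (rule eqn_at[OF rc, of 0 0]) simp_all
    also have "eqn [?h] \<dots> [(0, ?c), (0, ?c), (0, ?r), (1, ?r), (2, ?r)]"
      by (rule eqn_at[OF rc, of 0 1]) simp_all
    also have "eqn [?h] \<dots> [(0, ?c), (0, ?r), (1, ?c), (1, ?r), (2, ?r)]"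
      by (rule eqn_at[OF comul_assoc, of 0 0]) simp_all
    also have "eqn [?h] \<dots> [(0, ?c), (0, ?r), (1, ?r), (1, ?C)]"
      by (rule eqn_at[OF eqn_sym[OF rc], of 1 2]) simp_all
    also have "eqn [?h] \<dots> [(0, ?r), (0, ?C), (1, ?C)]"
      by (rule eqn_at[OF eqn_sym[OF rc], of 0 0]) simp_all
    finally show "(\<Delta>\<^bsub>Q\<^esub> \<boxtimes> \<iota> ?b) \<cdot> \<Delta>\<^bsub>Q\<^esub> \<cdot> r = (\<iota> ?b \<boxtimes> \<Delta>\<^bsub>Q\<^esub>) \<cdot> \<Delta>\<^bsub>Q\<^esub> \<cdot> r"
      by (rule eq_if_eqn) (rule rd reading | simp)+
  qed (rule Hom_if_reads, (rule rd reading | simp)+)+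
  have counitl: "(\<epsilon>\<^bsub>Q\<^esub> \<boxtimes> \<iota> ?b) \<cdot> \<Delta>\<^bsub>Q\<^esub> = \<iota> ?b"
  proof (rule epi_cancel[OF epi(1) r])
    have "eqn [?h] [(0, ?r), (0, ?C), (0, ?E)] [(0, ?c), (0, ?r), (0, ?E), (0, ?r)]"
      by (rule eqn_at[OF rc, of 0 0]) simp_all
    also have "eqn [?h] \<dots> [(0, ?c), (0, ?e), (0, ?r)]"
      by (rule eqn_at[OF re, of 0 1]) simp_all
    also have "eqn [?h] \<dots> [(0, ?r)]"
      by (rule eqn_at[OF comul_counit_left, of 0 0]) simp_all
    finally show "(\<epsilon>\<^bsub>Q\<^esub> \<boxtimes> \<iota> ?b) \<cdot> \<Delta>\<^bsub>Q\<^esub> \<cdot> r = \<iota> ?b \<cdot> r"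
      by (rule eq_if_eqn) (rule rd reading | simp)+
  qed (rule Hom_if_reads, (rule rd reading | simp)+)+
  have counitr: "(\<iota> ?b \<boxtimes> \<epsilon>\<^bsub>Q\<^esub>) \<cdot> \<Delta>\<^bsub>Q\<^esub> = \<iota> ?b"
  proof (rule epi_cancel[OF epi(1) r])
    have "eqn [?h] [(0, ?r), (0, ?C), (1, ?E)] [(0, ?c), (0, ?r), (1, ?r), (1, ?E)]"
      by (rule eqn_at[OF rc, of 0 0]) simp_all
    also have "eqn [?h] \<dots> [(0, ?c), (1, ?e), (0, ?r)]"
      by (rule eqn_at[OF re, of 1 2]) simp_all
    also have "eqn [?h] \<dots> [(0, ?r)]"
      by (rule eqn_at[OF comul_counit_right, of 0 0]) simp_all
    finally show "(\<iota> ?b \<boxtimes> \<epsilon>\<^bsub>Q\<^esub>) \<cdot> \<Delta>\<^bsub>Q\<^esub> \<cdot> r = \<iota> ?b \<cdot> r"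
      by (rule eq_if_eqn) (rule rd reading | simp)+
  qed (rule Hom_if_reads, (rule rd reading | simp)+)+
  let ?mulT = "(\<nabla>\<^bsub>Q\<^esub> \<boxtimes> \<nabla>\<^bsub>Q\<^esub>) \<cdot> (\<iota> ?b \<boxtimes> \<tau> ?b ?b \<boxtimes> \<iota> ?b)"
  have comul_mul: "\<Delta>\<^bsub>Q\<^esub> \<cdot> \<nabla>\<^bsub>Q\<^esub> = ?mulT \<cdot> (\<Delta>\<^bsub>Q\<^esub> \<boxtimes> \<Delta>\<^bsub>Q\<^esub>)"
  proof (rule epi_cancel[OF epi(2) r2])
    have n: "eqn [?h, ?b] [(0, ?r), (0, ?T)] [(0, braid_gate ?h ?b), (1, ?r)]"
      using eqn_braid_left[of ?b "[?h]" r "[?b]"] by simp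
    have n': "eqn [?h, ?h] [(1, ?r), (0, braid_gate ?h ?b)] [(0, ?t), (0, ?r)]"
      using eqn_braid_right[of ?h "[?h]" r "[?b]"] by simp
    have "eqn [?h, ?h] [(0, ?r), (1, ?r), (0, ?M), (0, ?C)] [(0, ?m), (0, ?r), (0, ?C)]"
      by (rule eqn_at[OF rm, of 0 0]) simp_all
    also have "eqn [?h, ?h] \<dots> [(0, ?m), (0, ?c), (0, ?r), (1, ?r)]"
      by (rule eqn_at[OF rc, of 0 1]) simp_all
    also have "eqn [?h, ?h] \<dots> [(0, ?c), (2, ?c), (1, ?t), (0, ?m), (0, ?r), (1, ?m), (1, ?r)]"
      by (rule eqn_at[OF comul_mul, of 0 0]) simp_all
    also have "eqn [?h, ?h] \<dots> [(0, ?c), (2, ?c), (1, ?t), (0, ?r), (1, ?r), (0, ?M), (1, ?m), (1, ?r)]"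
      by (rule eqn_at[OF eqn_sym[OF rm], of 0 3]) simp_all
    also have "eqn [?h, ?h] \<dots> [(0, ?c), (2, ?c), (1, ?t), (1, ?r), (0, ?r), (2, ?r), (3, ?r), (0, ?M),
        (1, ?M)]"
      by (rule eqn_at[OF eqn_sym[OF rm], of 1 6]) simp_all
    also have "eqn [?h, ?h] \<dots> [(0, ?c), (2, ?c), (2, ?r), (1, braid_gate ?h ?b), (2, ?r), (0, ?r),
        (3, ?r), (0, ?M), (1, ?M)]"
      by (rule eqn_at[OF eqn_sym[OF n'], of 1 2]) simp_all
    also have "eqn [?h, ?h] \<dots> [(0, ?c), (1, ?r), (0, ?r), (2, ?c), (2, ?r), (1, ?T), (3, ?r), (0, ?M),
        (1, ?M)]"
      by (rule eqn_at[OF eqn_sym[OF n], of 1 3]) simp_all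
    also have "eqn [?h, ?h] \<dots> [(0, ?r), (0, ?C), (2, ?c), (2, ?r), (3, ?r), (1, ?T), (0, ?M), (1, ?M)]"
      by (rule eqn_at[OF eqn_sym[OF rc], of 0 0]) simp_all
    also have "eqn [?h, ?h] \<dots> [(0, ?r), (1, ?r), (0, ?C), (2, ?C), (1, ?T), (0, ?M), (1, ?M)]"
      by (rule eqn_at[OF eqn_sym[OF rc], of 2 2]) simp_all
    finally show "\<Delta>\<^bsub>Q\<^esub> \<cdot> \<nabla>\<^bsub>Q\<^esub> \<cdot> (r \<boxtimes> r) = ?mulT \<cdot> (\<Delta>\<^bsub>Q\<^esub> \<boxtimes> \<Delta>\<^bsub>Q\<^esub>) \<cdot> (r \<boxtimes> r)"
      by (rule eq_if_eqn) (rule rd reading | simp)+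
  qed (rule Hom_if_reads, (rule rd reading | simp)+)+
  have "eqn [] [(0, ?U), (0, ?C)] [(0, ?u), (0, ?r), (0, ?C)]"
    by (rule eqn_at[OF ru, of 0 0]) simp_all
  also have "eqn [] \<dots> [(0, ?u), (0, ?c), (0, ?r), (1, ?r)]"
    by (rule eqn_at[OF rc, of 0 1]) simp_all
  also have "eqn [] \<dots> [(0, ?u), (0, ?r), (1, ?u), (1, ?r)]"
    by (rule eqn_at[OF comul_unit, of 0 0]) simp_all
  also have "eqn [] \<dots> [(0, ?U), (1, ?u), (1, ?r)]"
    by (rule eqn_at[OF eqn_sym[OF ru], of 0 0]) simp_all
  also have "eqn [] \<dots> [(0, ?U), (1, ?U)]"
    by (rule eqn_at[OF eqn_sym[OF ru], of 1 1]) simp_all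
  finally have comul_unit: "\<Delta>\<^bsub>Q\<^esub> \<cdot> \<eta>\<^bsub>Q\<^esub> = \<eta>\<^bsub>Q\<^esub> \<boxtimes> \<eta>\<^bsub>Q\<^esub>"
    by (rule eq_if_eqn) (rule rd reading | simp)+
  have counit_mul: "\<epsilon>\<^bsub>Q\<^esub> \<cdot> \<nabla>\<^bsub>Q\<^esub> = \<epsilon>\<^bsub>Q\<^esub> \<boxtimes> \<epsilon>\<^bsub>Q\<^esub>"
  proof (rule epi_cancel[OF epi(2) r2])
    have "eqn [?h, ?h] [(0, ?r), (1, ?r), (0, ?M), (0, ?E)] [(0, ?m), (0, ?r), (0, ?E)]"
      by (rule eqn_at[OF rm, of 0 0]) simp_all
    also have "eqn [?h, ?h] \<dots> [(0, ?m), (0, ?e)]"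
      by (rule eqn_at[OF re, of 0 1]) simp_all
    also have "eqn [?h, ?h] \<dots> [(0, ?e), (0, ?e)]"
      by (rule eqn_at[OF counit_mul, of 0 0]) simp_all
    also have "eqn [?h, ?h] \<dots> [(0, ?e), (0, ?r), (0, ?E)]"
      by (rule eqn_at[OF eqn_sym[OF re], of 0 1]) simp_all
    also have "eqn [?h, ?h] \<dots> [(0, ?r), (1, ?r), (0, ?E), (0, ?E)]"
      by (rule eqn_at[OF eqn_sym[OF re], of 0 0]) simp_all
    finally show "\<epsilon>\<^bsub>Q\<^esub> \<cdot> \<nabla>\<^bsub>Q\<^esub> \<cdot> (r \<boxtimes> r) = (\<epsilon>\<^bsub>Q\<^esub> \<boxtimes> \<epsilon>\<^bsub>Q\<^esub>) \<cdot> (r \<boxtimes> r)"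
      by (rule eq_if_eqn) (rule rd reading | simp)+
  qed (rule Hom_if_reads, (rule rd reading | simp)+)+
  have "eqn [] [(0, ?U), (0, ?E)] [(0, ?u), (0, ?r), (0, ?E)]"
    by (rule eqn_at[OF ru, of 0 0]) simp_all
  also have "eqn [] \<dots> [(0, ?u), (0, ?e)]"
    by (rule eqn_at[OF re, of 0 1]) simp_all
  also note counit_unit
  finally have counit_unit: "\<epsilon>\<^bsub>Q\<^esub> \<cdot> \<eta>\<^bsub>Q\<^esub> = \<iota> (UnitO C)"
  proof (rule eq_if_eqn)
    show "reads [] (\<iota> (UnitO C)) [] []" by (simp add: reads_def)
  qed (rule rd reads_Comp | simp)+
  have antil: "convolution C Q Q (antipode Q) (\<iota> ?b) = \<eta>\<^bsub>Q\<^esub> \<cdot> \<epsilon>\<^bsub>Q\<^esub>"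
    unfolding convolution_def
  proof (rule epi_cancel[OF epi(1) r])
    have "eqn [?h] [(0, ?r), (0, ?C), (0, ?A), (0, ?M)] [(0, ?c), (0, ?r), (0, ?A), (1, ?r), (0, ?M)]"
      by (rule eqn_at[OF rc, of 0 0]) simp_all
    also have "eqn [?h] \<dots> [(0, ?c), (0, ?a), (0, ?r), (1, ?r), (0, ?M)]"
      by (rule eqn_at[OF ra, of 0 1]) simp_all
    also have "eqn [?h] \<dots> [(0, ?c), (0, ?a), (0, ?m), (0, ?r)]"
      by (rule eqn_at[OF rm, of 0 2]) simp_all
    also have "eqn [?h] \<dots> [(0, ?e), (0, ?u), (0, ?r)]"
      by (rule eqn_at[OF antipode_left, of 0 0]) simp_all
    also have "eqn [?h] \<dots> [(0, ?e), (0, ?U)]"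
      by (rule eqn_at[OF eqn_sym[OF ru], of 0 1]) simp_all
    also have "eqn [?h] \<dots> [(0, ?r), (0, ?E), (0, ?U)]"
      by (rule eqn_at[OF eqn_sym[OF re], of 0 0]) simp_all
    finally show "\<nabla>\<^bsub>Q\<^esub> \<cdot> (antipode Q \<boxtimes> \<iota> ?b) \<cdot> \<Delta>\<^bsub>Q\<^esub> \<cdot> r = \<eta>\<^bsub>Q\<^esub> \<cdot> \<epsilon>\<^bsub>Q\<^esub> \<cdot> r"
      by (rule eq_if_eqn) (rule rd reading | simp)+
  qed (rule Hom_if_reads, (rule rd reading | simp)+)+
  have antir: "convolution C Q Q (\<iota> ?b) (antipode Q) = \<eta>\<^bsub>Q\<^esub> \<cdot> \<epsilon>\<^bsub>Q\<^esub>"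
    unfolding convolution_def
  proof (rule epi_cancel[OF epi(1) r])
    have "eqn [?h] [(0, ?r), (0, ?C), (1, ?A), (0, ?M)] [(0, ?c), (0, ?r), (1, ?r), (1, ?A), (0, ?M)]"
      by (rule eqn_at[OF rc, of 0 0]) simp_all
    also have "eqn [?h] \<dots> [(0, ?c), (1, ?a), (0, ?r), (1, ?r), (0, ?M)]"
      by (rule eqn_at[OF ra, of 1 2]) simp_all
    also have "eqn [?h] \<dots> [(0, ?c), (1, ?a), (0, ?m), (0, ?r)]"
      by (rule eqn_at[OF rm, of 0 2]) simp_all
    also have "eqn [?h] \<dots> [(0, ?e), (0, ?u), (0, ?r)]"
      by (rule eqn_at[OF antipode_right, of 0 0]) simp_all
    also have "eqn [?h] \<dots> [(0, ?e), (0, ?U)]"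
      by (rule eqn_at[OF eqn_sym[OF ru], of 0 1]) simp_all
    also have "eqn [?h] \<dots> [(0, ?r), (0, ?E), (0, ?U)]"
      by (rule eqn_at[OF eqn_sym[OF re], of 0 0]) simp_all
    finally show "\<nabla>\<^bsub>Q\<^esub> \<cdot> (\<iota> ?b \<boxtimes> antipode Q) \<cdot> \<Delta>\<^bsub>Q\<^esub> \<cdot> r = \<eta>\<^bsub>Q\<^esub> \<cdot> \<epsilon>\<^bsub>Q\<^esub> \<cdot> r"
      by (rule eq_if_eqn) (rule rd reading | simp)+
  qed (rule Hom_if_reads, (rule rd reading | simp)+)+
  show ?thesis
    unfolding is_hopf_def is_bialgebra_def is_algebra_def is_coalgebra_def algebra_hom_def
    using mul unitl unitr comul counitl counitr comul_mul comul_unit counit_mul counit_unit antil antir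
    by (simp add: tensor_def)
qed

end

section \<open>Uniqueness of the biproduct data and the effect of normality\<close>

context split_projection
begin

text \<open>Because \<open>q \<cdot> j\<close> is the identity, multiplication and unit are
  recovered from \<open>j\<close> being an algebra morphism, comultiplication and counit from
  \<open>q\<close> being a coalgebra morphism.\<close>

lemma B_unique:
  assumes "is_algebra C B'" "algebra_hom C B' H j" "is_coalgebra C B'" "coalgebra_hom C H B' q"
  shows "B' = B"
proof -
  have j': "j \<in> Hom C (ob B') h" "j \<cdot> \<nabla>\<^bsub>B'\<^esub> = \<nabla>\<^bsub>H\<^esub> \<cdot> (j \<boxtimes> j)" "j \<cdot> \<eta>\<^bsub>B'\<^esub> = \<eta>\<^bsub>H\<^esub>"
    using assms(2) by (simp_all add: algebra_hom_def)
  have q': "\<Delta>\<^bsub>B'\<^esub> \<cdot> q = (q \<boxtimes> q) \<cdot> \<Delta>\<^bsub>H\<^esub>" "\<epsilon>\<^bsub>B'\<^esub> \<cdot> q = \<epsilon>\<^bsub>H\<^esub>"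
    using assms(4) by (simp_all add: coalgebra_hom_def)
  have o: "ob B' = b" using Hom_disjoint[OF j'(1) j_Hom] by simp
  have t: "\<nabla>\<^bsub>B'\<^esub> \<in> Hom C (b \<odot> b) b" "\<eta>\<^bsub>B'\<^esub> \<in> Hom C (UnitO C) b"
    "\<Delta>\<^bsub>B'\<^esub> \<in> Hom C b (b \<odot> b)" "\<epsilon>\<^bsub>B'\<^esub> \<in> Hom C b (UnitO C)"
    using assms(1,3) by (auto simp: is_algebra_def is_coalgebra_def o)
  have "\<nabla>\<^bsub>B'\<^esub> = (q \<cdot> j) \<cdot> \<nabla>\<^bsub>B'\<^esub>" using section_p Ident_left[OF t(1)] by simp
  also have "\<dots> = q \<cdot> \<nabla>\<^bsub>H\<^esub> \<cdot> (j \<boxtimes> j)"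
    using Comp_assoc[OF q_Hom j_Hom t(1)] j'(2)
      Comp_assoc[OF q_Hom H.algebra_typing(2) TensM_Hom[OF j_Hom j_Hom]] by simp
  finally have 1: "\<nabla>\<^bsub>B'\<^esub> = q \<cdot> \<nabla>\<^bsub>H\<^esub> \<cdot> (j \<boxtimes> j)" .
  have 2: "\<eta>\<^bsub>B'\<^esub> = q \<cdot> \<eta>\<^bsub>H\<^esub>"
    using section_p Ident_left[OF t(2)] Comp_assoc[OF q_Hom j_Hom t(2)] j'(3) by simp
  have "\<Delta>\<^bsub>B'\<^esub> = \<Delta>\<^bsub>B'\<^esub> \<cdot> (q \<cdot> j)" using section_p Ident_right[OF t(3)] by simp
  also have "\<dots> = (q \<boxtimes> q) \<cdot> (\<Delta>\<^bsub>H\<^esub> \<cdot> j)"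
    using Comp_assoc[OF t(3) q_Hom j_Hom] q'(1)
      Comp_assoc[OF TensM_Hom[OF q_Hom q_Hom] H.coalgebra_typing(2) j_Hom] by simp
  finally have 3: "\<Delta>\<^bsub>B'\<^esub> = (q \<boxtimes> q) \<cdot> (\<Delta>\<^bsub>H\<^esub> \<cdot> j)" .
  have 4: "\<epsilon>\<^bsub>B'\<^esub> = \<epsilon>\<^bsub>H\<^esub> \<cdot> j"
    using section_p Ident_right[OF t(4)] Comp_assoc[OF t(4) q_Hom j_Hom] q'(2) by simp
  show ?thesis
    by (rule alg_coalg.equality) (simp_all add: B_def o 1 2 3 4)
qed

text \<open>The product of 1 \<otimes> b and k \<otimes> 1 in the semidirect product is k1 \<otimes>
  (b \<triangleleft> k2) up to braiding. Applying the counit to the first factor isolates the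
  action; after the comparison map this counit is \<open>q\<close>, by \<open>q_mul\<close>, so
  multiplicativity evaluates the same element as q(b k).\<close>

lemma action_unique:
  assumes \<alpha>: "\<alpha> \<in> Hom C (b \<odot> k) b"
    and hom: "algebra_hom C (semidirect C K B \<alpha> \<rho>) H (mult_map C H i j)"
  shows "\<alpha> = action"
proof -
  interpret B: braided_algebra C B by unfold_locales (rule B_algebra)
  let ?m = "mul_gate H" and ?i = I.hom_gate and ?j = j_gate and ?a = "([b, k], \<alpha>, [b])"
    and ?t = "braid_gate b k" and ?cK = "comul_gate K" and ?mK = "mul_gate K"
    and ?uK = "unit_gate K" and ?eK = "counit_gate K"
  note [simp] = \<alpha>
  have r: "reads [b, k] \<alpha> [(0, ?a)] [b]" by (simp add: reads_arrow2)
  have n: "eqn [b, k] [(0, ?t), (0, ?eK)] [(1, ?eK)]"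
    using eqn_sym[OF eqn_braid_right[of b "[k]" "\<epsilon>\<^bsub>K\<^esub>" "[]"]] by simp
  have E: "eqn [k, b, k, b] [(2, ?cK), (1, ?t), (2, ?a), (0, ?mK), (1, mulB), (0, ?i), (1, ?j), (0, ?m)]
     [(0, ?i), (1, ?j), (0, ?m), (1, ?i), (2, ?j), (1, ?m), (0, ?m)]"
  proof (rule eqn_if_eq)
    show "mult_map C H i j \<cdot> \<nabla>\<^bsub>semidirect C K B \<alpha> \<rho>\<^esub> = \<nabla>\<^bsub>H\<^esub> \<cdot> (mult_map C H i j \<boxtimes> mult_map C H i j)"
      using hom by (simp add: algebra_hom_def)
  qed (unfold mult_map_def semidirect_def alg_coalg.simps ob_B,
      (rule r reading | simp)+)
  have "eqn [b, k] [(0, ?a)] [(1, ?cK), (1, ?eK), (0, ?a)]"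
    by (rule eqn_at[OF eqn_sym[OF K.comul_counit_left], of 1 0]) simp_all
  also have "eqn [b, k] \<dots> [(1, ?cK), (0, ?t), (1, ?a), (0, ?eK)]"
    by (rule eqn_at[OF eqn_sym[OF n], of 0 1]) simp_all
  also have "eqn [b, k] \<dots> [(0, ?uK), (2, ?cK), (1, ?t), (2, ?a), (0, ?mK), (0, ?eK)]"
    by (rule eqn_at[OF eqn_sym[OF K.mul_unit_left], of 0 3]) simp_all
  also have "eqn [b, k] \<dots> [(0, ?uK), (3, unitB), (2, ?cK), (1, ?t), (2, ?a), (0, ?mK), (1, mulB),
      (0, ?eK)]"
    by (rule eqn_at[OF eqn_sym[OF B.mul_unit_right[unfolded ob_B]], of 1 5]) simp_all
  also have "eqn [b, k] \<dots> [(0, ?uK), (3, unitB), (2, ?cK), (1, ?t), (2, ?a), (0, ?mK), (1, mulB),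
      (0, ?i), (1, ?j), (0, ?m), (0, q_gate)]"
    by (rule eqn_at[OF eqn_sym[OF q_mul], of 0 7]) simp_all
  also have "eqn [b, k] \<dots> [(2, unitB), (0, ?uK), (0, ?i), (1, ?j), (0, ?m), (1, ?i), (2, ?j), (1, ?m),
      (0, ?m), (0, q_gate)]"
    by (rule eqn_at[OF E, of 0 2]) simp_all
  also have "eqn [b, k] \<dots> [(0, unit_gate H), (1, ?j), (0, ?m), (1, ?i), (2, unitB), (2, ?j), (1, ?m),
      (0, ?m), (0, q_gate)]"
    by (rule eqn_at[OF I.hom_unit, of 0 1]) simp_all
  also have "eqn [b, k] \<dots> [(0, ?j), (0, unit_gate H), (0, ?m), (1, ?i), (2, unit_gate H), (1, ?m),
      (0, ?m), (0, q_gate)]"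
    by (rule eqn_at[OF unitB_j, of 2 4]) simp_all
  also have "eqn [b, k] \<dots> [(0, ?j), (1, ?i), (2, unit_gate H), (1, ?m), (0, ?m), (0, q_gate)]"
    by (rule eqn_at[OF H.mul_unit_left, of 0 1]) simp_all
  also have "eqn [b, k] \<dots> [(0, ?j), (1, ?i), (0, ?m), (0, q_gate)]"
    by (rule eqn_at[OF H.mul_unit_right, of 1 2]) simp_all
  also have "eqn [b, k] \<dots> [(0, action_gate)]"
    by (rule eqn_sym[OF action_unfold])
  finally show ?thesis
    by (rule eq_if_eqn) (rule r reading | simp)+
qed

lemma semidirect_typing:
  assumes "\<rho> \<in> Hom C b (b \<odot> k)"
  shows "\<Delta>\<^bsub>semidirect C K B \<alpha> \<rho>\<^esub> \<in> Hom C (k \<odot> b) ((k \<odot> b) \<odot> (k \<odot> b))"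
    and "\<epsilon>\<^bsub>semidirect C K B \<alpha> \<rho>\<^esub> \<in> Hom C (k \<odot> b) (UnitO C)"
proof -
  interpret B: braided_coalgebra C B by unfold_locales (rule B_coalgebra)
  have r: "reads [b] \<rho> [(0, ([b], \<rho>, [b, k]))] [b, k]"
    using assms by (intro reads_coarrow2) auto
  note rB = B.reads_coalgebra[unfolded ob_B]
  show "\<Delta>\<^bsub>semidirect C K B \<alpha> \<rho>\<^esub> \<in> Hom C (k \<odot> b) ((k \<odot> b) \<odot> (k \<odot> b))"
    "\<epsilon>\<^bsub>semidirect C K B \<alpha> \<rho>\<^esub> \<in> Hom C (k \<odot> b) (UnitO C)"
    unfolding semidirect_def alg_coalg.simps ob_B
    by (rule Hom_if_reads, (rule r rB reading | simp)+)+
qed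

text \<open>The dual of \<open>action_unique\<close>, for which the comparison map is replaced by
  its inverse.\<close>

lemma coaction_unique:
  assumes \<rho>: "\<rho> \<in> Hom C b (b \<odot> k)" and \<alpha>: "\<alpha> \<in> Hom C (b \<odot> k) b"
    and hom: "coalgebra_hom C (semidirect C K B \<alpha> \<rho>) H (mult_map C H i j)"
  shows "\<rho> = coaction"
proof -
  let ?S = "semidirect C K B \<alpha> \<rho>"
  have ob: "ob ?S = k \<odot> b" by (simp add: semidirect_def)
  have "coalgebra_hom C H ?S ((e \<boxtimes> q) \<cdot> \<Delta>\<^bsub>H\<^esub>)"
    by (rule coalgebra_hom_inverse[OF hom])
      (use comult_mult mult_comult semidirect_typing[OF \<rho>] in \<open>auto simp: ob mult_map_def\<close>)
  then show ?thesis
    using split_projection.action_unique[OF split_op, of \<rho> \<alpha>] \<rho>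
    by (simp add: B_op semidirect_op[OF K.hopf B_coalgebra] \<alpha> action_op mult_map_def)
qed

text \<open>Up to braiding, b g(x) = ad(b1, g(x)) b2 = g(ad(b1, x)) b2 = g(b1) g(x) gS(b2) b3.
  Coinvariance of b under g removes g(b1) and then gS(b2), leaving g(x) b. Every k has the form
  required of g(x), because \<open>i\<close> factors through \<open>g\<close>.\<close>

lemma straighten_normal:
  assumes hom: "hopf_hom C H H g" and nml: "normal C H g"
    and gj: "(g \<boxtimes> \<iota> h) \<cdot> (\<Delta>\<^bsub>H\<^esub> \<cdot> j) = \<eta>\<^bsub>H\<^esub> \<boxtimes> j"
    and w: "w \<in> Hom C k h" "i = g \<cdot> w"
  shows "eqn [b, k] [(0, j_gate), (1, I.hom_gate), (0, mul_gate H)]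
    [(0, braid_gate b k), (0, I.hom_gate), (1, j_gate), (0, mul_gate H)]"
proof -
  interpret G: braided_hopf_morphism C H H g by unfold_locales fact
  let ?m = "mul_gate H" and ?c = "comul_gate H" and ?t = "braid_gate h h" and ?S = H.antipode_gate
    and ?g = G.hom_gate and ?j = j_gate and ?i = I.hom_gate and ?u = "unit_gate H" and ?e = "counit_gate H"
    and ?s = "braid_gate b h" and ?w = "([k], w, [h])"
  note [simp] = w(1)
  have rw: "reads [k] w [(0, ?w)] [h]" by (simp add: reads_arrow)
  have N: "eqn [h, h] [(0, ?c), (1, ?t), (2, ?S), (1, ?m), (0, ?m), (0, ?g)]
      [(1, ?g), (0, ?c), (1, ?t), (2, ?S), (1, ?m), (0, ?m)]"
    by (rule eqn_if_eq[OF nml[unfolded normal_def ad_def]])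
      (rule reading | simp)+
  have G: "eqn [b] [(0, ?j), (0, ?c), (0, ?g)] [(0, ?u), (1, ?j)]"
    by (rule eqn_if_eq[OF gj]) (rule reading | simp)+
  have W: "eqn [k] [(0, ?i)] [(0, ?w), (0, ?g)]"
    by (rule eqn_if_eq[OF w(2)]) (rule rw reading | simp)+
  have nc: "eqn [h, h] [(0, ?c), (1, ?t), (0, ?t)] [(0, ?t), (1, ?c)]"
    using eqn_braid_left[of h "[h]" "\<Delta>\<^bsub>H\<^esub>" "[h, h]"] by simp
  have ne: "eqn [h, h] [(0, ?t), (1, ?e)] [(0, ?e)]"
    using eqn_sym[OF eqn_braid_left[of h "[h]" "\<epsilon>\<^bsub>H\<^esub>" "[]"]] by simp
  have ng: "eqn [h, h] [(1, ?g), (0, ?t)] [(0, ?t), (0, ?g)]"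
    using eqn_braid_right[of h "[h]" g "[h]"] by simp
  have nj: "eqn [b, h] [(0, ?j), (0, ?t)] [(0, ?s), (1, ?j)]"
    using eqn_braid_left[of h "[b]" j "[h]"] by simp
  have nw: "eqn [b, k] [(1, ?w), (0, ?s)] [(0, braid_gate b k), (0, ?w)]"
    using eqn_braid_right[of b "[k]" w "[h]"] by simp
  \<comment> \<open>\<open>h x = ad (h\<^sub>1 \<otimes> x) h\<^sub>2\<close>\<close>
  have "eqn [h, h] [(0, ?c), (0, ?c), (2, ?t), (1, ?t), (2, ?S), (1, ?m), (0, ?m), (0, ?m)] [(0, ?c),
      (1, ?c), (2, ?t), (1, ?t), (2, ?S), (1, ?m), (0, ?m), (0, ?m)]"
    by (rule eqn_at[OF H.comul_assoc, of 0 0]) simp_all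
  also have "eqn [h, h] \<dots> [(0, ?c), (1, ?t), (2, ?c), (2, ?S), (1, ?m), (0, ?m), (0, ?m)]"
    by (rule eqn_at[OF nc, of 1 1]) simp_all
  also have "eqn [h, h] \<dots> [(0, ?c), (1, ?t), (2, ?c), (2, ?S), (1, ?m), (1, ?m), (0, ?m)]"
    by (rule eqn_at[OF H.mul_assoc, of 0 5]) simp_all
  also have "eqn [h, h] \<dots> [(0, ?c), (1, ?t), (2, ?c), (2, ?S), (2, ?m), (1, ?m), (0, ?m)]"
    by (rule eqn_at[OF H.mul_assoc, of 1 4]) simp_all
  also have "eqn [h, h] \<dots> [(0, ?c), (1, ?t), (2, ?e), (2, ?u), (1, ?m), (0, ?m)]"
    by (rule eqn_at[OF H.antipode_left, of 2 2]) simp_all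
  also have "eqn [h, h] \<dots> [(0, ?c), (1, ?t), (2, ?e), (0, ?m)]"
    by (rule eqn_at[OF H.mul_unit_right, of 1 3]) simp_all
  also have "eqn [h, h] \<dots> [(0, ?c), (1, ?e), (0, ?m)]"
    by (rule eqn_at[OF ne, of 1 1]) simp_all
  also have "eqn [h, h] \<dots> [(0, ?m)]"
    by (rule eqn_at[OF H.comul_counit_right, of 0 0]) simp_all
  finally have A: "eqn [h, h] [(0, ?c), (0, ?c), (2, ?t), (1, ?t), (2, ?S), (1, ?m), (0, ?m), (0, ?m)]
      [(0, ?m)]" .
  have "eqn [b, h] [(0, ?j), (1, ?g), (0, ?m)] [(0, ?j), (0, ?c), (2, ?g), (1, ?t), (0, ?c), (1, ?t),
      (2, ?S), (1, ?m), (0, ?m), (0, ?m)]"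
    by (rule eqn_at[OF eqn_sym[OF A], of 0 2]) simp_all
  also have "eqn [b, h] \<dots> [(0, ?j), (0, ?c), (1, ?t), (1, ?g), (0, ?c), (1, ?t), (2, ?S), (1, ?m),
      (0, ?m), (0, ?m)]"
    by (rule eqn_at[OF ng, of 1 2]) simp_all
  \<comment> \<open>Here normality moves \<open>g\<close> from the second argument to the outside of
    the adjoint action.\<close>
  also have "eqn [b, h] \<dots> [(0, ?j), (0, ?c), (1, ?t), (0, ?c), (1, ?t), (2, ?S), (1, ?m), (0, ?m),
      (0, ?g), (0, ?m)]"
    by (rule eqn_at[OF eqn_sym[OF N], of 0 3]) simp_all
  also have "eqn [b, h] \<dots> [(0, ?j), (0, ?c), (1, ?t), (0, ?c), (1, ?t), (2, ?S), (0, ?g), (1, ?m),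
      (1, ?g), (0, ?m), (0, ?m)]"
    by (rule eqn_at[OF G.hom_mul, of 0 7]) simp_all
  also have "eqn [b, h] \<dots> [(0, ?j), (0, ?c), (0, ?c), (2, ?t), (1, ?t), (2, ?S), (0, ?g), (1, ?g),
      (2, ?g), (1, ?m), (0, ?m), (0, ?m)]"
    by (rule eqn_at[OF G.hom_mul, of 1 7]) simp_all
  also have "eqn [b, h] \<dots> [(0, ?j), (0, ?c), (0, ?g), (1, ?c), (2, ?t), (1, ?t), (2, ?S), (1, ?g),
      (2, ?g), (1, ?m), (0, ?m), (0, ?m)]"
    by (rule eqn_at[OF H.comul_assoc, of 0 1]) simp_all
  \<comment> \<open>First use of coinvariance: the leftmost factor g(b1) becomes a unit, and the
    remaining legs are those of b itself.\<close>
  also have "eqn [b, h] \<dots> [(0, ?j), (0, ?c), (1, ?t), (0, ?t), (1, ?S), (0, ?g), (1, ?g), (0, ?m),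
      (0, ?u), (0, ?m), (0, ?m)]"
    by (rule eqn_at[OF G, of 0 0]) simp_all
  also have "eqn [b, h] \<dots> [(0, ?j), (0, ?c), (1, ?t), (0, ?t), (1, ?S), (0, ?g), (1, ?g), (0, ?m),
      (0, ?m)]"
    by (rule eqn_at[OF H.mul_unit_left, of 0 8]) simp_all
  also have "eqn [b, h] \<dots> [(0, ?j), (0, ?t), (1, ?c), (1, ?S), (0, ?g), (1, ?g), (0, ?m), (0, ?m)]"
    by (rule eqn_at[OF nc, of 0 1]) simp_all
  also have "eqn [b, h] \<dots> [(0, ?s), (1, ?j), (1, ?c), (1, ?S), (0, ?g), (1, ?g), (0, ?m), (0, ?m)]"
    by (rule eqn_at[OF nj, of 0 0]) simp_all
  also have "eqn [b, h] \<dots> [(0, ?s), (1, ?j), (1, ?c), (1, ?S), (1, ?g), (0, ?g), (1, ?m), (0, ?m)]"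
    by (rule eqn_at[OF H.mul_assoc, of 0 6]) simp_all
  also have "eqn [b, h] \<dots> [(0, ?s), (1, ?j), (1, ?c), (1, ?g), (1, ?S), (0, ?g), (1, ?m), (0, ?m)]"
    by (rule eqn_at[OF G.hom_antipode, of 1 3]) simp_all
  \<comment> \<open>Second use of coinvariance, possible after \<open>g\<close> has been moved in
    front of the antipode.\<close>
  also have "eqn [b, h] \<dots> [(0, ?s), (1, ?u), (1, ?S), (2, ?j), (0, ?g), (1, ?m), (0, ?m)]"
    by (rule eqn_at[OF G, of 1 1]) simp_all
  also have "eqn [b, h] \<dots> [(0, ?s), (0, ?g), (1, ?j), (1, ?u), (1, ?m), (0, ?m)]"
    by (rule eqn_at[OF H.antipode_unit, of 1 1]) simp_all
  also have "eqn [b, h] \<dots> [(0, ?s), (0, ?g), (1, ?j), (0, ?m)]"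
    by (rule eqn_at[OF H.mul_unit_left, of 1 3]) simp_all
  finally have M: "eqn [b, h] [(0, ?j), (1, ?g), (0, ?m)] [(0, ?s), (0, ?g), (1, ?j), (0, ?m)]" .
  have "eqn [b, k] [(0, ?j), (1, ?i), (0, ?m)] [(1, ?w), (0, ?j), (1, ?g), (0, ?m)]"
    by (rule eqn_at[OF W, of 1 1]) simp_all
  also have "eqn [b, k] \<dots> [(1, ?w), (0, ?s), (0, ?g), (1, ?j), (0, ?m)]"
    by (rule eqn_at[OF M, of 0 1]) simp_all
  also have "eqn [b, k] \<dots> [(0, braid_gate b k), (0, ?w), (0, ?g), (1, ?j), (0, ?m)]"
    by (rule eqn_at[OF nw, of 0 0]) simp_all
  also have "eqn [b, k] \<dots> [(0, braid_gate b k), (0, ?i), (1, ?j), (0, ?m)]"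
    by (rule eqn_at[OF eqn_sym[OF W], of 0 1]) simp_all
  finally show ?thesis .
qed

lemma commute_normal:
  assumes "hopf_hom C H H g" "normal C H g" "(g \<boxtimes> \<iota> h) \<cdot> (\<Delta>\<^bsub>H\<^esub> \<cdot> j) = \<eta>\<^bsub>H\<^esub> \<boxtimes> j"
    and "w \<in> Hom C k h" "i = g \<cdot> w"
  shows "\<nabla>\<^bsub>H\<^esub> \<cdot> (j \<boxtimes> i) = \<nabla>\<^bsub>H\<^esub> \<cdot> (i \<boxtimes> j) \<cdot> \<tau> b k"
  by (rule eq_if_eqn[OF straighten_normal[OF assms]])
    (rule reading | simp)+

text \<open>The coadjoint coaction is the adjoint action read backwards; the two composites agree up
  to sliding and nesting.\<close>

lemma normal_op: "normal (opc C) (opa H) g \<longleftrightarrow> conormal C H g"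
proof -
  have "ad (opc C) (opa H) = coad C H"
    unfolding ad_def coad_def opc_simps opa_simps
    by (rule eq_if_reads) (rule reading | simp)+
  then show ?thesis by (simp add: normal_def conormal_def)
qed

lemma commute_conormal:
  assumes "hopf_hom C H H g" "conormal C H g" "q \<cdot> \<nabla>\<^bsub>H\<^esub> \<cdot> (g \<boxtimes> \<iota> h) = \<epsilon>\<^bsub>H\<^esub> \<boxtimes> q"
    and "w \<in> Hom C h k" "e = w \<cdot> g"
  shows "(q \<boxtimes> e) \<cdot> \<Delta>\<^bsub>H\<^esub> = \<tau> k b \<cdot> ((e \<boxtimes> q) \<cdot> \<Delta>\<^bsub>H\<^esub>)"
  using split_projection.commute_normal[OF split_op, of g w] assms by (simp add: normal_op)

text \<open>If b k may be rewritten as k b, the projection \<open>q\<close> turns k into its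
  counit.\<close>

lemma trivial_action_if_commute:
  assumes "\<nabla>\<^bsub>H\<^esub> \<cdot> (j \<boxtimes> i) = \<nabla>\<^bsub>H\<^esub> \<cdot> (i \<boxtimes> j) \<cdot> \<tau> b k"
  shows "action = \<iota> b \<boxtimes> \<epsilon>\<^bsub>K\<^esub>"
proof -
  let ?m = "mul_gate H" and ?i = I.hom_gate and ?t = "braid_gate b k"
  have n: "eqn [b, k] [(0, ?t), (0, counit_gate K)] [(1, counit_gate K)]"
    using eqn_sym[OF eqn_braid_right[of b "[k]" "\<epsilon>\<^bsub>K\<^esub>" "[]"]] by simp
  have M: "eqn [b, k] [(0, j_gate), (1, ?i), (0, ?m)] [(0, ?t), (0, ?i), (1, j_gate), (0, ?m)]"
    by (rule eqn_if_eq[OF assms]) (rule reading | simp)+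
  have "eqn [b, k] [(0, action_gate)] [(0, j_gate), (1, ?i), (0, ?m), (0, q_gate)]"
    by (rule action_unfold)
  also have "eqn [b, k] \<dots> [(0, ?t), (0, ?i), (1, j_gate), (0, ?m), (0, q_gate)]"
    by (rule eqn_at[OF M, of 0 0]) simp_all
  also have "eqn [b, k] \<dots> [(0, ?t), (0, counit_gate K)]"
    by (rule eqn_at[OF q_mul, of 0 1]) simp_all
  also note n
  finally show ?thesis
    by (rule eq_if_eqn) (rule reading | simp)+
qed

lemma trivial_coaction_if_commute:
  assumes "(q \<boxtimes> e) \<cdot> \<Delta>\<^bsub>H\<^esub> = \<tau> k b \<cdot> ((e \<boxtimes> q) \<cdot> \<Delta>\<^bsub>H\<^esub>)"
  shows "coaction = \<iota> b \<boxtimes> \<eta>\<^bsub>K\<^esub>"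
  using split_projection.trivial_action_if_commute[OF split_op] assms by (simp add: action_op)

text \<open>The counit in the trivial action cancels one leg of the comultiplication of
  \<open>K\<close>, and only the crossing of the tensor product algebra remains.\<close>

lemma semidirect_trivial_nabla: "\<nabla>\<^bsub>semidirect C K B (\<iota> b \<boxtimes> \<epsilon>\<^bsub>K\<^esub>) \<rho>\<^esub> = \<nabla>\<^bsub>tensor C K B\<^esub>"
proof -
  let ?t = "braid_gate b k" and ?c = "comul_gate K" and ?mK = "mul_gate K"
  have "eqn [k, b, k, b] [(2, ?c), (3, counit_gate K), (1, ?t), (0, ?mK), (1, mulB)]
      [(1, ?t), (0, ?mK), (1, mulB)]"
    by (rule eqn_at[OF K.comul_counit_right, of 2 0])
      simp_all
  then show ?thesis
    unfolding semidirect_def tensor_def alg_coalg.simps ob_B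
    by (rule eq_if_eqn) (rule reading | simp)+
qed

lemma tensor_algebra_hom:
  assumes "action = \<iota> b \<boxtimes> \<epsilon>\<^bsub>K\<^esub>"
  shows "algebra_hom C (tensor C K B) H (mult_map C H i j)"
  using semidirect_algebra_hom[of coaction] semidirect_trivial_nabla[of coaction] assms
  by (simp add: algebra_hom_def) (simp add: semidirect_def tensor_def)

lemma tensor_op: "tensor (opc C) (opa K) (opa B) = opa (tensor C K B)"
  by (simp add: tensor_def opa_def)

lemma tensor_typing:
  "\<Delta>\<^bsub>tensor C K B\<^esub> \<in> Hom C (k \<odot> b) ((k \<odot> b) \<odot> (k \<odot> b))" "\<epsilon>\<^bsub>tensor C K B\<^esub> \<in> Hom C (k \<odot> b) (UnitO C)"
  "ob (tensor C K B) = k \<odot> b"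
  using tensor_coalgebra[OF K.coalgebra B_coalgebra] by (auto simp: is_coalgebra_def tensor_def)

text \<open>Dualizing \<open>tensor_algebra_hom\<close> gives the statement for the inverse of the
  comparison map.\<close>

lemma tensor_coalgebra_hom:
  assumes "coaction = \<iota> b \<boxtimes> \<eta>\<^bsub>K\<^esub>"
  shows "coalgebra_hom C (tensor C K B) H (mult_map C H i j)"
proof -
  have "coalgebra_hom C H (tensor C K B) ((e \<boxtimes> q) \<cdot> \<Delta>\<^bsub>H\<^esub>)"
    using split_projection.tensor_algebra_hom[OF split_op] assms
    by (simp add: action_op B_op tensor_op mult_map_def)
  then show ?thesis
    by (rule coalgebra_hom_inverse)
      (use comult_mult mult_comult tensor_typing mult_map_Hom in \<open>auto simp: mult_map_def\<close>)
qed

end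

section \<open>Split epimorphisms, composites and inverses of Hopf morphisms\<close>

context braided_tensor_category
begin

lemma split_epi:
  assumes "f \<in> Hom C X Y" "g \<in> Hom C Y X" "f \<cdot> g = \<iota> Y"
  shows "is_epi C f"
proof -
  have "s = t" if "s \<in> Hom C Y T" "t \<in> Hom C Y T" "s \<cdot> f = t \<cdot> f" for s t T
  proof -
    have "(s \<cdot> f) \<cdot> g = (t \<cdot> f) \<cdot> g" using that(3) by simp
    then show ?thesis
      using Comp_assoc[OF that(1) assms(1,2)] Comp_assoc[OF that(2) assms(1,2)] that(1,2) assms(3)
      by (simp add: Ident_right)
  qed
  then show ?thesis using assms(1) unfolding is_epi_def by blast
qed

lemma split_epi_tensor:
  assumes "f \<in> Hom C X Y" "g \<in> Hom C Y X" "f \<cdot> g = \<iota> Y"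
  shows "is_epi C f" "is_epi C (f \<boxtimes> f)" "is_epi C (f \<boxtimes> f \<boxtimes> f)"
proof -
  have o: "X \<in> Obj C" "Y \<in> Obj C" using Hom_Obj[OF assms(1)] by auto
  note f2 = TensM_Hom[OF assms(1,1)] and g2 = TensM_Hom[OF assms(2,2)]
  have e2: "(f \<boxtimes> f) \<cdot> (g \<boxtimes> g) = \<iota> (Y \<odot> Y)"
    using TensM_Comp[OF assms(1,2,1,2)] assms o by (simp add: TensM_Ident)
  then have "(f \<boxtimes> f \<boxtimes> f) \<cdot> (g \<boxtimes> g \<boxtimes> g) = \<iota> (Y \<odot> Y \<odot> Y)"
    using TensM_Comp[OF assms(1,2) f2 g2] assms o by (simp add: TensM_Ident)
  with e2 show "is_epi C f" "is_epi C (f \<boxtimes> f)" "is_epi C (f \<boxtimes> f \<boxtimes> f)"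
    using split_epi[OF assms] split_epi[OF f2 g2]
      split_epi[OF TensM_Hom[OF assms(1) f2] TensM_Hom[OF assms(2) g2]] by auto
qed

lemma algebra_hom_Comp:
  assumes "algebra_hom C A A' f" "algebra_hom C A' A'' g"
    and "is_algebra C A" "is_algebra C A'" "is_algebra C A''"
  shows "algebra_hom C A A'' (g \<cdot> f)"
proof -
  have f: "f \<in> Hom C (ob A) (ob A')" "f \<cdot> \<nabla>\<^bsub>A\<^esub> = \<nabla>\<^bsub>A'\<^esub> \<cdot> (f \<boxtimes> f)" "f \<cdot> \<eta>\<^bsub>A\<^esub> = \<eta>\<^bsub>A'\<^esub>"
    and g: "g \<in> Hom C (ob A') (ob A'')" "g \<cdot> \<nabla>\<^bsub>A'\<^esub> = \<nabla>\<^bsub>A''\<^esub> \<cdot> (g \<boxtimes> g)" "g \<cdot> \<eta>\<^bsub>A'\<^esub> = \<eta>\<^bsub>A''\<^esub>"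
    using assms(1,2) by (auto simp: algebra_hom_def)
  have t: "\<nabla>\<^bsub>A\<^esub> \<in> Hom C (ob A \<odot> ob A) (ob A)" "\<eta>\<^bsub>A\<^esub> \<in> Hom C (UnitO C) (ob A)"
    "\<nabla>\<^bsub>A'\<^esub> \<in> Hom C (ob A' \<odot> ob A') (ob A')" "\<nabla>\<^bsub>A''\<^esub> \<in> Hom C (ob A'' \<odot> ob A'') (ob A'')"
    using assms(3-5) by (auto simp: is_algebra_def)
  have "(g \<cdot> f) \<cdot> \<nabla>\<^bsub>A\<^esub> = (g \<cdot> \<nabla>\<^bsub>A'\<^esub>) \<cdot> (f \<boxtimes> f)"
    using Comp_assoc[OF g(1) f(1) t(1)] Comp_assoc[OF g(1) t(3) TensM_Hom[OF f(1,1)]] f(2) by simp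
  also have "\<dots> = \<nabla>\<^bsub>A''\<^esub> \<cdot> ((g \<cdot> f) \<boxtimes> (g \<cdot> f))"
    using Comp_assoc[OF t(4) TensM_Hom[OF g(1,1)] TensM_Hom[OF f(1,1)]]
      TensM_Comp[OF g(1) f(1) g(1) f(1)] g(2) by simp
  finally show ?thesis
    using Comp_assoc[OF g(1) f(1) t(2)] Comp_Hom[OF g(1) f(1)] f(3) g(3) by (simp add: algebra_hom_def)
qed

lemma hopf_hom_Comp:
  assumes "hopf_hom C A A' f" "hopf_hom C A' A'' g"
    and "is_algebra C A" "is_algebra C A'" "is_algebra C A''"
    and "is_coalgebra C A" "is_coalgebra C A'" "is_coalgebra C A''"
  shows "hopf_hom C A A'' (g \<cdot> f)"
proof -
  have "coalgebra_hom C A A'' (g \<cdot> f)"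
    using braided_tensor_category.algebra_hom_Comp[OF braided_op, of "opa A''" "opa A'" g "opa A" f] assms
    by (simp add: hopf_hom_def)
  with algebra_hom_Comp[of A A' f A'' g] assms show ?thesis by (simp add: hopf_hom_def)
qed

lemma algebra_hom_inverse:
  assumes "algebra_hom C A A' f" and g: "g \<in> Hom C (ob A') (ob A)" "g \<cdot> f = \<iota> (ob A)" "f \<cdot> g = \<iota> (ob A')"
    and "\<nabla>\<^bsub>A\<^esub> \<in> Hom C (ob A \<odot> ob A) (ob A)" "\<nabla>\<^bsub>A'\<^esub> \<in> Hom C (ob A' \<odot> ob A') (ob A')"
      "\<eta>\<^bsub>A\<^esub> \<in> Hom C (UnitO C) (ob A)" "\<eta>\<^bsub>A'\<^esub> \<in> Hom C (UnitO C) (ob A')"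
  shows "algebra_hom C A' A g"
proof -
  have f: "f \<in> Hom C (ob A) (ob A')" using assms(1) by (simp add: algebra_hom_def)
  have "coalgebra_hom (opc C) (opa A') (opa A) f" using assms(1) by simp
  from braided_tensor_category.coalgebra_hom_inverse[OF braided_op this, of g]
  show ?thesis using assms f by simp
qed

end

lemma with_antipode_simps [simp]:
  "ob (with_antipode A s) = ob A" "\<nabla>\<^bsub>with_antipode A s\<^esub> = \<nabla>\<^bsub>A\<^esub>" "\<eta>\<^bsub>with_antipode A s\<^esub> = \<eta>\<^bsub>A\<^esub>"
  "\<Delta>\<^bsub>with_antipode A s\<^esub> = \<Delta>\<^bsub>A\<^esub>" "\<epsilon>\<^bsub>with_antipode A s\<^esub> = \<epsilon>\<^bsub>A\<^esub>" "antipode (with_antipode A s) = s"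
  by (simp_all add: with_antipode_def alg_coalg.extend_def)

lemma tensor_with_antipode [simp]: "tensor C K (with_antipode B s) = tensor C K B"
  by (simp add: tensor_def)

section \<open>Inclusion and projection as Hopf morphisms\<close>

context split_projection
begin

text \<open>\<open>j\<close> is the comparison map restricted to 1 \<otimes> b. In the tensor
  product coalgebra the unit of \<open>K\<close> passes the crossing, so no trace of
  \<open>K\<close> remains.\<close>

lemma j_coalgebra_hom:
  assumes "coalgebra_hom C (tensor C K B) H (mult_map C H i j)"
  shows "coalgebra_hom C B H j"
proof -
  interpret B: braided_coalgebra C B by unfold_locales (rule B_coalgebra)
  note rB = B.reads_coalgebra[unfolded ob_B]
  note [simp] = B.coalgebra_typing[unfolded ob_B]
  let ?m = "mul_gate H" and ?c = "comul_gate H" and ?i = I.hom_gate and ?j = j_gate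
    and ?t = "braid_gate k b" and ?cK = "comul_gate K" and ?cB = "([b], \<Delta>\<^bsub>B\<^esub>, [b, b])" and ?uK = "unit_gate K"
    and ?u = "unit_gate H"
  have n: "eqn [b] [(0, ?uK), (0, ?t)] [(1, ?uK)]"
    using eqn_braid_left[of b "[]" "\<eta>\<^bsub>K\<^esub>" "[k]"] by simp
  have M: "eqn [k, b] [(0, ?i), (1, ?j), (0, ?m), (0, ?c)]
     [(0, ?cK), (2, ?cB), (1, ?t), (0, ?i), (1, ?j), (0, ?m), (1, ?i), (2, ?j), (1, ?m)]"
  proof (rule eqn_if_eq)
    show "\<Delta>\<^bsub>H\<^esub> \<cdot> mult_map C H i j = (mult_map C H i j \<boxtimes> mult_map C H i j) \<cdot> \<Delta>\<^bsub>tensor C K B\<^esub>"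
      using assms by (simp add: coalgebra_hom_def)
  qed (unfold mult_map_def tensor_def alg_coalg.simps ob_B,
      (rule rB reading | simp)+)
  have "eqn [b] [(0, ?j), (0, ?c)] [(0, ?u), (1, ?j), (0, ?m), (0, ?c)]"
    by (rule eqn_at[OF eqn_sym[OF H.mul_unit_left], of 0 1]) simp_all
  also have "eqn [b] \<dots> [(0, ?uK), (0, ?i), (1, ?j), (0, ?m), (0, ?c)]"
    by (rule eqn_at[OF eqn_sym[OF I.hom_unit], of 0 0]) simp_all
  also have "eqn [b] \<dots> [(0, ?uK), (0, ?cK), (2, ?cB), (1, ?t), (0, ?i), (1, ?j), (0, ?m), (1, ?i),
      (2, ?j), (1, ?m)]"
    by (rule eqn_at[OF M, of 0 1]) simp_all
  also have "eqn [b] \<dots> [(0, ?cB), (0, ?uK), (1, ?uK), (1, ?t), (0, ?i), (1, ?j), (0, ?m), (1, ?i),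
      (2, ?j), (1, ?m)]"
    by (rule eqn_at[OF K.comul_unit, of 0 0]) simp_all
  also have "eqn [b] \<dots> [(0, ?uK), (0, ?i), (1, ?cB), (1, ?j), (0, ?m), (1, ?uK), (1, ?i), (2, ?j),
      (1, ?m)]"
    by (rule eqn_at[OF n, of 1 2]) simp_all
  also have "eqn [b] \<dots> [(0, ?cB), (0, ?j), (0, ?u), (0, ?m), (1, ?uK), (1, ?i), (2, ?j), (1, ?m)]"
    by (rule eqn_at[OF I.hom_unit, of 0 0]) simp_all
  also have "eqn [b] \<dots> [(0, ?cB), (0, ?j), (1, ?uK), (1, ?i), (2, ?j), (1, ?m)]"
    by (rule eqn_at[OF H.mul_unit_left, of 0 2]) simp_all
  also have "eqn [b] \<dots> [(0, ?cB), (0, ?j), (1, ?j), (1, ?u), (1, ?m)]"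
    by (rule eqn_at[OF I.hom_unit, of 1 2]) simp_all
  also have "eqn [b] \<dots> [(0, ?cB), (0, ?j), (1, ?j)]"
    by (rule eqn_at[OF H.mul_unit_left, of 1 3]) simp_all
  finally have "\<Delta>\<^bsub>H\<^esub> \<cdot> j = (j \<boxtimes> j) \<cdot> \<Delta>\<^bsub>B\<^esub>"
    by (rule eq_if_eqn) (rule rB reading | simp)+
  then show ?thesis by (simp add: coalgebra_hom_def) (simp add: B_def)
qed

lemma q_algebra_hom:
  assumes "algebra_hom C (tensor C K B) H (mult_map C H i j)"
  shows "algebra_hom C H B q"
proof -
  have T: "\<nabla>\<^bsub>tensor C K B\<^esub> \<in> Hom C ((k \<odot> b) \<odot> (k \<odot> b)) (k \<odot> b)"
    "\<eta>\<^bsub>tensor C K B\<^esub> \<in> Hom C (UnitO C) (k \<odot> b)"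
    using split_projection.tensor_typing[OF split_op] by (auto simp: B_op tensor_op)
  have "algebra_hom C H (tensor C K B) ((e \<boxtimes> q) \<cdot> \<Delta>\<^bsub>H\<^esub>)"
    by (rule algebra_hom_inverse[OF assms])
      (use comult_mult mult_comult tensor_typing mult_map_Hom T in \<open>auto simp: mult_map_def\<close>)
  then show ?thesis
    using split_projection.j_coalgebra_hom[OF split_op] by (simp add: B_op tensor_op mult_map_def)
qed

section \<open>The binormal case: unbraided factors and their tensor product\<close>

context
  assumes mult: "\<nabla>\<^bsub>H\<^esub> \<cdot> (j \<boxtimes> i) = \<nabla>\<^bsub>H\<^esub> \<cdot> (i \<boxtimes> j) \<cdot> \<tau> b k"
    and comult: "(q \<boxtimes> e) \<cdot> \<Delta>\<^bsub>H\<^esub> = \<tau> k b \<cdot> ((e \<boxtimes> q) \<cdot> \<Delta>\<^bsub>H\<^esub>)"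
begin

lemma mult_eqn: "eqn [b, k] [(0, j_gate), (1, I.hom_gate), (0, mul_gate H)]
   [(0, braid_gate b k), (0, I.hom_gate), (1, j_gate), (0, mul_gate H)]"
  by (rule eqn_if_eq[OF mult]) (rule reading | simp)+

lemma comult_eqn: "eqn [h] [(0, comul_gate H), (0, q_gate), (1, E.hom_gate)]
   [(0, comul_gate H), (0, E.hom_gate), (1, q_gate), (0, braid_gate k b)]"
  by (rule eqn_if_eq[OF comult]) (rule reading | simp)+

text \<open>Compute \<open>(q \<otimes> e) \<Delta> \<nabla> (j \<otimes> i)\<close> once by commuting the factors and once by the bialgebra axiom.\<close>

lemma double_braiding: "\<tau> k b \<cdot> \<tau> b k = \<iota> (b \<odot> k)"
proof -
  let ?m = "mul_gate H" and ?c = "comul_gate H" and ?t = "braid_gate h h" and ?cK = "comul_gate K"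
    and ?e = E.hom_gate and ?i = I.hom_gate and ?j = j_gate and ?q = q_gate and ?E = "counit_gate K"
    and ?tb = "braid_gate b k" and ?tk = "braid_gate k b"
  have n: "eqn [h, k] [(1, ?i), (0, ?t)] [(0, braid_gate h k), (0, ?i)]"
    using eqn_braid_right[of h "[k]" i "[h]"] by simp
  have n': "eqn [h, k] [(0, braid_gate h k), (0, ?E)] [(1, ?E)]"
    using eqn_sym[OF eqn_braid_right[of h "[k]" "\<epsilon>\<^bsub>K\<^esub>" "[]"]] by simp
  have a: "eqn [b, k] [(0, action_gate)] [(1, ?E)]"
    by (rule eqn_if_eq[OF trivial_action_if_commute[OF mult]])
      (rule reading | simp)+
  have c: "eqn [b] [(0, ?j), (0, ?c), (0, ?q), (1, ?e)] [(1, unit_gate K)]"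
    by (rule eqn_if_eq[OF trivial_coaction_if_commute[OF comult, unfolded coaction_def]])
      (rule reading | simp)+
  have inv: "eqn [k, b] [(0, ?i), (1, ?j), (0, ?m), (0, ?c), (0, ?e), (1, ?q)] []"
    by (rule eqn_if_eq[OF comult_mult])
      (rule reading reads_Ident_tensor | simp)+
  \<comment> \<open>Under the trivial action \<open>q\<close> is invariant under \<open>K\<close>
    from the right as well: q(h k) = q(p(h) k) = q(h) \<epsilon>(k).\<close>
  have "eqn [h, k] [(1, ?i), (0, ?m), (0, ?q)] [(0, p_gate), (1, ?i), (0, ?m), (0, ?q)]"
    by (rule eqn_at[OF eqn_sym[OF q_p_mul], of 0 1]) simp_all
  also have "eqn [h, k] \<dots> [(0, ?q), (0, ?j), (1, ?i), (0, ?m), (0, ?q)]"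
    by (rule eqn_at[OF eqn_sym[OF q_j], of 0 0]) simp_all
  also have "eqn [h, k] \<dots> [(0, ?q), (0, action_gate)]"
    by (rule eqn_at[OF eqn_sym[OF action_unfold], of 0 1]) simp_all
  also have "eqn [h, k] \<dots> [(0, ?q), (1, ?E)]"
    by (rule eqn_at[OF a, of 0 1]) simp_all
  finally have Q: "eqn [h, k] [(1, ?i), (0, ?m), (0, ?q)] [(0, ?q), (1, ?E)]" .
  have "eqn [b, k] [(0, ?tb), (0, ?tk)] [(0, ?tb), (0, ?i), (1, ?j), (0, ?m), (0, ?c), (0, ?e), (1, ?q),
      (0, ?tk)]"
    by (rule eqn_at[OF eqn_sym[OF inv], of 0 1]) simp_all
  also have "eqn [b, k] \<dots> [(0, ?tb), (0, ?i), (1, ?j), (0, ?m), (0, ?c), (0, ?q), (1, ?e)]"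
    by (rule eqn_at[OF eqn_sym[OF comult_eqn], of 0 4]) simp_all
  also have "eqn [b, k] \<dots> [(0, ?j), (1, ?i), (0, ?m), (0, ?c), (0, ?q), (1, ?e)]"
    by (rule eqn_at[OF eqn_sym[OF mult_eqn], of 0 0]) simp_all
  also have "eqn [b, k] \<dots> [(0, ?j), (0, ?c), (2, ?i), (2, ?c), (1, ?t), (0, ?m), (1, ?m), (0, ?q),
      (1, ?e)]"
    by (rule eqn_at[OF H.comul_mul, of 0 2]) simp_all
  also have "eqn [b, k] \<dots> [(0, ?j), (0, ?c), (2, ?cK), (2, ?i), (1, ?t), (3, ?i), (0, ?m), (1, ?m),
      (0, ?q), (1, ?e)]"
    by (rule eqn_at[OF I.hom_comul, of 2 2]) simp_all
  also have "eqn [b, k] \<dots> [(0, ?j), (0, ?c), (2, ?cK), (1, braid_gate h k), (1, ?i), (0, ?m), (0, ?q),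
      (2, ?i), (1, ?m), (1, ?e)]"
    by (rule eqn_at[OF n, of 1 3]) simp_all
  also have "eqn [b, k] \<dots> [(0, ?j), (0, ?c), (2, ?cK), (1, braid_gate h k), (1, ?E), (0, ?q), (2, ?i),
      (1, ?m), (1, ?e)]"
    by (rule eqn_at[OF Q, of 0 4]) simp_all
  also have "eqn [b, k] \<dots> [(0, ?j), (0, ?c), (2, ?cK), (2, ?E), (0, ?q), (2, ?i), (1, ?m), (1, ?e)]"
    by (rule eqn_at[OF n', of 1 3]) simp_all
  also have "eqn [b, k] \<dots> [(0, ?j), (0, ?c), (0, ?q), (2, ?i), (1, ?m), (1, ?e)]"
    by (rule eqn_at[OF K.comul_counit_left, of 2 2]) simp_all
  also have "eqn [b, k] \<dots> [(0, ?j), (0, ?c), (0, ?q), (1, ?e), (2, ?i), (2, ?e), (1, mul_gate K)]"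
    by (rule eqn_at[OF E.hom_mul, of 1 4]) simp_all
  also have "eqn [b, k] \<dots> [(0, ?j), (0, ?c), (0, ?q), (1, ?e), (1, mul_gate K)]"
    by (rule eqn_at[OF retraction_eqn, of 2 4]) simp_all
  also have "eqn [b, k] \<dots> [(1, unit_gate K), (1, mul_gate K)]"
    by (rule eqn_at[OF c, of 0 0]) simp_all
  also have "eqn [b, k] \<dots> []"
    by (rule eqn_at[OF K.mul_unit_left, of 1 0]) simp_all
  finally show ?thesis
    by (rule eq_if_eqn) (rule reading reads_Ident_tensor reads_braid | simp)+
qed

text \<open>A one-sided inverse of the invertible braiding is two-sided.\<close>

lemma double_braiding': "\<tau> b k \<cdot> \<tau> k b = \<iota> (k \<odot> b)"
proof (rule iso_cancel[where t = "\<tau> k b" and X = "k \<odot> b" and Y = "b \<odot> k" and Z = "k \<odot> b"])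
  have "\<tau> k b \<cdot> (\<tau> b k \<cdot> \<tau> k b) = (\<tau> k b \<cdot> \<tau> b k) \<cdot> \<tau> k b"
    by (rule Comp_assoc[symmetric]) (rule Braid_Hom'; simp)+
  then show "\<tau> k b \<cdot> (\<tau> b k \<cdot> \<tau> k b) = \<tau> k b \<cdot> \<iota> (k \<odot> b)"
    using Ident_left[OF Braid_Hom'[of k b]] Ident_right[OF Braid_Hom'[of k b]] by (simp add: double_braiding)
qed (auto intro: Braid_iso Comp_Hom[OF Braid_Hom' Braid_Hom'])

lemma unbraided_factors: "unbraided C k b"
  unfolding unbraided_def inverse_arrows_def
  by (intro exI conjI, rule Braid_Hom'[of k b], simp, simp, rule Braid_Hom'[of b k], simp, simp,
      rule double_braiding', rule double_braiding)

lemma q_hopf_hom: "hopf_hom C H B q"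
  using q_coalgebra_hom q_algebra_hom[OF tensor_algebra_hom[OF trivial_action_if_commute[OF mult]]]
  by (simp add: hopf_hom_def)

lemma j_hopf_hom: "hopf_hom C B H j"
  using j_algebra_hom j_coalgebra_hom[OF tensor_coalgebra_hom[OF trivial_coaction_if_commute[OF comult]]]
  by (simp add: hopf_hom_def)

definition antipodeB :: 'm where "antipodeB = q \<cdot> antipode H \<cdot> j"

abbreviation antipodeB_gate :: "('o, 'm) gate" where "antipodeB_gate \<equiv> ([b], antipodeB, [b])"

lemma antipodeB_read: "reads [b] antipodeB [(0, j_gate), (0, H.antipode_gate), (0, q_gate)] [b]"
  unfolding antipodeB_def
  by (rule back_subst[of "\<lambda>d. reads _ _ d _"]) (rule reading | simp)+

lemma antipodeB_Hom [simp]: "antipodeB \<in> Hom C b b"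
  using reads_Hom[OF antipodeB_read] by simp

text \<open>With both commutations available \<open>j\<close> and \<open>q\<close> are Hopf
  morphisms, hence so is \<open>p\<close>, and Hopf morphisms commute with antipodes. This makes
  \<open>antipodeB\<close> compatible with both \<open>j\<close> and \<open>q\<close>.\<close>

lemma p_antipode: "eqn [h] [(0, H.antipode_gate), (0, p_gate)] [(0, p_gate), (0, H.antipode_gate)]"
proof -
  have "hopf_hom C H H (j \<cdot> q)"
    by (rule hopf_hom_Comp[OF q_hopf_hom j_hopf_hom H.algebra B_algebra H.algebra
          H.coalgebra B_coalgebra H.coalgebra])
  then interpret P: braided_hopf_morphism C H H p
    by unfold_locales (simp add: split_p)
  show ?thesis by (rule P.hom_antipode)
qed

lemma antipodeB_j: "eqn [b] [(0, antipodeB_gate), (0, j_gate)] [(0, j_gate), (0, H.antipode_gate)]"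
proof -
  let ?S = H.antipode_gate
  have S: "eqn [b] [(0, antipodeB_gate)] [(0, j_gate), (0, ?S), (0, q_gate)]"
    by (rule eqn_if_eq[OF refl reads_arrow[OF antipodeB_Hom b_Obj b_Obj] antipodeB_read]) simp_all
  have "eqn [b] [(0, antipodeB_gate), (0, j_gate)] [(0, j_gate), (0, ?S), (0, q_gate), (0, j_gate)]"
    by (rule eqn_at[OF S, of 0 0]) simp_all
  also have "eqn [b] \<dots> [(0, j_gate), (0, ?S), (0, p_gate)]"
    by (rule eqn_at[OF q_j, of 0 2]) simp_all
  also have "eqn [b] \<dots> [(0, j_gate), (0, p_gate), (0, ?S)]"
    by (rule eqn_at[OF p_antipode, of 0 1]) simp_all
  also have "eqn [b] \<dots> [(0, j_gate), (0, ?S)]"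
    by (rule eqn_at[OF j_p, of 0 0]) simp_all
  finally show ?thesis .
qed

lemma antipodeB_q: "antipodeB \<cdot> q = q \<cdot> antipode H"
proof -
  let ?S = H.antipode_gate
  have "eqn [h] [(0, q_gate), (0, j_gate), (0, ?S), (0, q_gate)] [(0, p_gate), (0, ?S), (0, q_gate)]"
    by (rule eqn_at[OF q_j, of 0 0]) simp_all
  also have "eqn [h] \<dots> [(0, ?S), (0, p_gate), (0, q_gate)]"
    by (rule eqn_at[OF eqn_sym[OF p_antipode], of 0 0]) simp_all
  also have "eqn [h] \<dots> [(0, ?S), (0, q_gate)]"
    by (rule eqn_at[OF p_q, of 0 1]) simp_all
  finally show ?thesis unfolding antipodeB_def
    by (rule eq_if_eqn) (rule reading | simp)+
qed

text \<open>The split factor is a quotient of \<open>H\<close> along the split epimorphism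
  \<open>q\<close>, whose tensor powers are split as well.\<close>

lemma B_hopf: "is_hopf C (with_antipode B antipodeB)"
proof (rule hopf_quotientI[OF H.hopf, where r = q])
  show "hopf_hom C H (with_antipode B antipodeB) q"
    using q_hopf_hom by (simp add: hopf_hom_def algebra_hom_def coalgebra_hom_def)
  show "is_epi C q" "is_epi C (q \<boxtimes> q)" "is_epi C (q \<boxtimes> q \<boxtimes> q)"
    using split_epi_tensor[OF q_Hom j_Hom section_p] by auto
qed (use B_algebra B_coalgebra antipodeB_q in \<open>auto simp: is_algebra_def is_coalgebra_def\<close>)

text \<open>The antipode of k b reverses the product and introduces one crossing; restoring the
  order with \<open>mult_eqn\<close> introduces the opposite one. The two crossings cancel because
  the factors are unbraided.\<close>

lemma mult_map_antipode:
  "mult_map C H i j \<cdot> (antipode K \<boxtimes> antipodeB) = antipode H \<cdot> mult_map C H i j"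
proof -
  let ?m = "mul_gate H" and ?S = H.antipode_gate and ?SK = K.antipode_gate and ?SB = antipodeB_gate
    and ?i = I.hom_gate and ?j = j_gate and ?t = "braid_gate h h"
    and ?tb = "braid_gate b k" and ?tk = "braid_gate k b"
  have r: "reads [b] antipodeB [(0, ?SB)] [b]" by (simp add: reads_arrow)
  have n1: "eqn [k, h] [(0, ?i), (0, ?t)] [(0, braid_gate k h), (1, ?i)]"
    using eqn_braid_left[of h "[k]" i "[h]"] by simp
  have n2: "eqn [k, b] [(1, ?j), (0, braid_gate k h)] [(0, ?tk), (0, ?j)]"
    using eqn_braid_right[of k "[b]" j "[h]"] by simp
  have n3: "eqn [b, k] [(0, ?SB), (0, ?tb)] [(0, ?tb), (1, ?SB)]"
    using eqn_braid_left[of k "[b]" antipodeB "[b]"] by simp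
  have n4: "eqn [b, k] [(1, ?SK), (0, ?tb)] [(0, ?tb), (0, ?SK)]"
    using eqn_braid_right[of b "[k]" "antipode K" "[k]"] by simp
  have d: "eqn [k, b] [(0, ?tk), (0, ?tb)] []"
    by (rule eqn_if_eq[OF double_braiding'])
      (rule reading reads_Ident_tensor reads_braid | simp)+
  have "eqn [k, b] [(0, ?i), (1, ?j), (0, ?m), (0, ?S)] [(1, ?j), (0, ?i), (0, ?t), (0, ?S), (1, ?S), (0, ?m)]"
    by (rule eqn_at[OF H.antipode_mul, of 0 2]) simp_all
  also have "eqn [k, b] \<dots> [(1, ?j), (0, braid_gate k h), (1, ?i), (0, ?S), (1, ?S), (0, ?m)]"
    by (rule eqn_at[OF n1, of 0 1]) simp_all
  also have "eqn [k, b] \<dots> [(0, ?tk), (0, ?j), (0, ?S), (1, ?i), (1, ?S), (0, ?m)]"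
    by (rule eqn_at[OF n2, of 0 0]) simp_all
  also have "eqn [k, b] \<dots> [(0, ?tk), (0, ?SB), (0, ?j), (1, ?i), (1, ?S), (0, ?m)]"
    by (rule eqn_at[OF eqn_sym[OF antipodeB_j], of 0 1]) simp_all
  also have "eqn [k, b] \<dots> [(0, ?tk), (0, ?SB), (1, ?SK), (0, ?j), (1, ?i), (0, ?m)]"
    by (rule eqn_at[OF eqn_sym[OF I.hom_antipode], of 1 3]) simp_all
  also have "eqn [k, b] \<dots> [(0, ?tk), (0, ?SB), (1, ?SK), (0, ?tb), (0, ?i), (1, ?j), (0, ?m)]"
    by (rule eqn_at[OF mult_eqn, of 0 3]) simp_all
  also have "eqn [k, b] \<dots> [(0, ?tk), (0, ?SB), (0, ?tb), (0, ?SK), (0, ?i), (1, ?j), (0, ?m)]"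
    by (rule eqn_at[OF n4, of 0 2]) simp_all
  also have "eqn [k, b] \<dots> [(0, ?tk), (0, ?tb), (0, ?SK), (1, ?SB), (0, ?i), (1, ?j), (0, ?m)]"
    by (rule eqn_at[OF n3, of 0 1]) simp_all
  also have "eqn [k, b] \<dots> [(0, ?SK), (1, ?SB), (0, ?i), (1, ?j), (0, ?m)]"
    by (rule eqn_at[OF d, of 0 0]) simp_all
  finally show ?thesis unfolding mult_map_def
    by (rule eq_if_eqn[OF eqn_sym]) (rule r reading | simp)+
qed

lemma tensor_hopf_hom: "hopf_hom C (tensor_hopf C K (with_antipode B antipodeB)) H (mult_map C H i j)"
  using tensor_algebra_hom[OF trivial_action_if_commute[OF mult]]
    tensor_coalgebra_hom[OF trivial_coaction_if_commute[OF comult]]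
  by (simp add: tensor_hopf_def hopf_hom_def algebra_hom_def coalgebra_hom_def)

text \<open>The axioms are not computed in the tensor product but transported from \<open>H\<close>
  along the inverse of the comparison map.\<close>

lemma tensor_is_hopf: "is_hopf C (tensor_hopf C K (with_antipode B antipodeB))"
proof -
  let ?T = "tensor_hopf C K (with_antipode B antipodeB)" and ?m = "mult_map C H i j"
    and ?n = "(e \<boxtimes> q) \<cdot> \<Delta>\<^bsub>H\<^esub>"
  have ob: "ob ?T = k \<odot> b" "antipode ?T = antipode K \<boxtimes> antipodeB"
    by (simp_all add: tensor_hopf_def tensor_typing)
  have iso: "?n \<cdot> ?m = \<iota> (k \<odot> b)" "?m \<cdot> ?n = \<iota> h"
    using comult_mult mult_comult by (simp_all add: mult_map_def)
  have t: "\<nabla>\<^bsub>?T\<^esub> \<in> Hom C (ob ?T \<odot> ob ?T) (ob ?T)" "\<eta>\<^bsub>?T\<^esub> \<in> Hom C (UnitO C) (ob ?T)"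
      "\<Delta>\<^bsub>?T\<^esub> \<in> Hom C (ob ?T) (ob ?T \<odot> ob ?T)" "\<epsilon>\<^bsub>?T\<^esub> \<in> Hom C (ob ?T) (UnitO C)"
    using tensor_typing split_projection.tensor_typing[OF split_op]
    by (auto simp: tensor_hopf_def B_op tensor_op)
  have S: "antipode ?T \<in> Hom C (ob ?T) (ob ?T)"
    using TensM_Hom[OF K.antipode_Hom antipodeB_Hom] by (simp add: ob)
  have "hopf_hom C H ?T ?n"
    unfolding hopf_hom_def
  proof
    show "algebra_hom C H ?T ?n"
      by (rule algebra_hom_inverse[of ?T H ?m])
        (use tensor_hopf_hom t iso in \<open>auto simp: hopf_hom_def ob\<close>)
    show "coalgebra_hom C H ?T ?n"
      by (rule coalgebra_hom_inverse[of ?T H ?m])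
        (use tensor_hopf_hom t iso in \<open>auto simp: hopf_hom_def ob\<close>)
  qed
  moreover have "antipode ?T \<cdot> ?n = ?n \<cdot> antipode H"
  proof -
    have S': "antipode ?T \<in> Hom C (k \<odot> b) (k \<odot> b)" using S by (simp add: ob)
    have "antipode ?T \<cdot> ?n = ?n \<cdot> (?m \<cdot> (antipode ?T \<cdot> ?n))"
      using Comp_assoc[OF mult_map_Hom(2,1) Comp_Hom[OF S' mult_map_Hom(2)]]
        Ident_left[OF Comp_Hom[OF S' mult_map_Hom(2)]] iso by simp
    also have "?m \<cdot> (antipode ?T \<cdot> ?n) = (antipode H \<cdot> ?m) \<cdot> ?n"
      using Comp_assoc[OF mult_map_Hom(1) S' mult_map_Hom(2)] mult_map_antipode by (simp add: ob)
    also have "\<dots> = antipode H"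
      using Comp_assoc[OF H.antipode_Hom mult_map_Hom] Ident_right[OF H.antipode_Hom] iso by simp
    finally show ?thesis .
  qed
  ultimately show ?thesis
    by (rule hopf_quotientI[OF H.hopf t S]) (rule split_epi_tensor[OF mult_map_Hom(2,1) iso(1)])+
qed

end

end

section \<open>Images of Hopf algebra morphisms\<close>

context abelian_category
begin

lemma Zero_Hom [simp]: "\<lbrakk>X \<in> Obj C; Y \<in> Obj C\<rbrakk> \<Longrightarrow> Zero C X Y \<in> Hom C X Y"
proof -
  assume o: "X \<in> Obj C" "Y \<in> Obj C"
  interpret G: comm_group "\<lparr>carrier = Hom C X Y, monoid.mult = Add C, one = Zero C X Y\<rparr>"
    by (rule Hom_group[OF o])
  show ?thesis using G.one_closed by simp
qed

lemma Add_idem_Zero: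
  assumes "f \<in> Hom C X Y" "f \<boxplus> f = f"
  shows "f = Zero C X Y"
proof -
  interpret G: comm_group "\<lparr>carrier = Hom C X Y, monoid.mult = Add C, one = Zero C X Y\<rparr>"
    using Hom_Obj[OF assms(1)] by (intro Hom_group) auto
  show ?thesis using G.l_cancel_one[of f f] assms by simp
qed

lemma Zero_Add_Zero: "\<lbrakk>X \<in> Obj C; Y \<in> Obj C\<rbrakk> \<Longrightarrow> Zero C X Y \<boxplus> Zero C X Y = Zero C X Y"
proof -
  assume o: "X \<in> Obj C" "Y \<in> Obj C"
  interpret G: comm_group "\<lparr>carrier = Hom C X Y, monoid.mult = Add C, one = Zero C X Y\<rparr>"
    by (rule Hom_group[OF o])
  show ?thesis using G.l_one[OF G.one_closed] by simp
qed

text \<open>\<open>d\<close> is s - t. It turns an equality of parallel morphisms into the vanishing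
  of one morphism, so that kernels can be applied to it.\<close>

lemma difference:
  assumes "s \<in> Hom C X Y" "t \<in> Hom C X Y"
  obtains d where "d \<in> Hom C X Y" "d = Zero C X Y \<longleftrightarrow> s = t"
    "\<And>T e. e \<in> Hom C T X \<Longrightarrow> s \<cdot> e = t \<cdot> e \<Longrightarrow> d \<cdot> e = Zero C T Y"
proof -
  interpret G: comm_group "\<lparr>carrier = Hom C X Y, monoid.mult = Add C, one = Zero C X Y\<rparr>"
    using Hom_Obj[OF assms(1)] by (intro Hom_group) auto
  let ?G = "\<lparr>carrier = Hom C X Y, monoid.mult = Add C, one = Zero C X Y\<rparr>"
  define d where "d = s \<boxplus> inv\<^bsub>?G\<^esub> t"
  have d: "d \<in> Hom C X Y"
    using G.m_closed[of s "inv\<^bsub>?G\<^esub> t"] G.inv_closed[of t] assms by (simp add: d_def)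
  have s: "s = d \<boxplus> t"
    using G.m_assoc[of s "inv\<^bsub>?G\<^esub> t" t] G.l_inv[of t] G.r_one[of s] G.inv_closed[of t] assms
    by (simp add: d_def)
  show thesis
  proof (rule that[OF d])
    show "d = Zero C X Y \<longleftrightarrow> s = t"
    proof
      assume "d = Zero C X Y"
      then show "s = t" using s G.l_one[of t] assms by simp
    next
      assume "s = t"
      then show "d = Zero C X Y" using G.r_inv[of t] assms by (simp add: d_def)
    qed
    fix T e
    assume e: "e \<in> Hom C T X" "s \<cdot> e = t \<cdot> e"
    interpret T: comm_group "\<lparr>carrier = Hom C T Y, monoid.mult = Add C, one = Zero C T Y\<rparr>"
      using Hom_Obj[OF assms(1)] Hom_Obj[OF e(1)] by (intro Hom_group) auto
    have "(d \<cdot> e) \<boxplus> (t \<cdot> e) = t \<cdot> e"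
      using e Comp_Add_left[OF d assms(2) e(1)] s by simp
    then show "d \<cdot> e = Zero C T Y"
      using T.right_cancel[of "t \<cdot> e" "d \<cdot> e" "Zero C T Y"] T.l_one[of "t \<cdot> e"] T.one_closed
        Comp_Hom[OF d e(1)] Comp_Hom[OF assms(2) e(1)] by simp
  qed
qed

lemma Comp_Zero_right:
  assumes "h \<in> Hom C Y Z" "X \<in> Obj C"
  shows "h \<cdot> Zero C X Y = Zero C X Z"
proof -
  have o: "Y \<in> Obj C" using Hom_Obj[OF assms(1)] by simp
  note z = Zero_Hom[OF assms(2) o]
  show ?thesis
    by (rule Add_idem_Zero[OF Comp_Hom[OF assms(1) z]])
      (use Comp_Add_right[OF assms(1) z z] Zero_Add_Zero[OF assms(2) o] in simp)
qed

lemma Comp_Zero_left: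
  assumes "h \<in> Hom C X Y" "Z \<in> Obj C"
  shows "Zero C Y Z \<cdot> h = Zero C X Z"
proof -
  have o: "Y \<in> Obj C" using Hom_Obj[OF assms(1)] by simp
  note z = Zero_Hom[OF o assms(2)]
  show ?thesis
    by (rule Add_idem_Zero[OF Comp_Hom[OF z assms(1)]])
      (use Comp_Add_left[OF z z assms(1)] Zero_Add_Zero[OF o assms(2)] in simp)
qed

text \<open>\<open>is_kernel\<close> hides source and target behind existential quantifiers.
  Disjointness of the Hom-sets identifies them with the given ones, and composites with the zero
  morphism are replaced by zero.\<close>

lemma kernel_iff:
  assumes f: "f \<in> Hom C X Y"
  shows "is_kernel C f m \<longleftrightarrow> (\<exists>E. m \<in> Hom C E X \<and> f \<cdot> m = Zero C E Y \<and>
    (\<forall>T. \<forall>t \<in> Hom C T X. f \<cdot> t = Zero C T Y \<longrightarrow> (\<exists>!u. u \<in> Hom C T E \<and> m \<cdot> u = t)))"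
proof -
  have o: "X \<in> Obj C" "Y \<in> Obj C" using Hom_Obj[OF f] by auto
  have z: "Zero C X Y \<cdot> t = Zero C T Y" if "t \<in> Hom C T X" for t T
    using Comp_Zero_left[OF that o(2)] .
  show ?thesis
  proof
    assume "is_kernel C f m"
    then obtain X1 Y1 X2 Y2 E where f': "f \<in> Hom C X1 Y1" "f \<in> Hom C X2 Y2" and m: "m \<in> Hom C E X2"
        "f \<cdot> m = Zero C X1 Y1 \<cdot> m"
      and U: "\<forall>T. \<forall>t \<in> Hom C T X2. f \<cdot> t = Zero C X1 Y1 \<cdot> t \<longrightarrow> (\<exists>!u. u \<in> Hom C T E \<and> m \<cdot> u = t)"
      unfolding is_kernel_def is_equalizer_def by (elim exE conjE)
    have e: "X1 = X" "Y1 = Y" "X2 = X" using Hom_disjoint[OF f f'(1)] Hom_disjoint[OF f f'(2)] by auto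
    show "\<exists>E. m \<in> Hom C E X \<and> f \<cdot> m = Zero C E Y \<and>
      (\<forall>T. \<forall>t \<in> Hom C T X. f \<cdot> t = Zero C T Y \<longrightarrow> (\<exists>!u. u \<in> Hom C T E \<and> m \<cdot> u = t))"
      using m U z unfolding e by (intro exI[of _ E]) simp
  next
    assume "\<exists>E. m \<in> Hom C E X \<and> f \<cdot> m = Zero C E Y \<and>
      (\<forall>T. \<forall>t \<in> Hom C T X. f \<cdot> t = Zero C T Y \<longrightarrow> (\<exists>!u. u \<in> Hom C T E \<and> m \<cdot> u = t))"
    then obtain E where m: "m \<in> Hom C E X" "f \<cdot> m = Zero C E Y"
      and U: "\<forall>T. \<forall>t \<in> Hom C T X. f \<cdot> t = Zero C T Y \<longrightarrow> (\<exists>!u. u \<in> Hom C T E \<and> m \<cdot> u = t)"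
      by (elim exE conjE)
    have "is_equalizer C f (Zero C X Y) m"
      unfolding is_equalizer_def
      by (intro exI[of _ E] exI[of _ X] exI[of _ Y]) (use f m U z o in simp)
    then show "is_kernel C f m" unfolding is_kernel_def using f by (intro exI conjI)
  qed
qed

lemma cokernel_iff:
  assumes f: "f \<in> Hom C X Y"
  shows "is_cokernel C f c \<longleftrightarrow> (\<exists>Q. c \<in> Hom C Y Q \<and> c \<cdot> f = Zero C X Q \<and>
    (\<forall>T. \<forall>t \<in> Hom C Y T. t \<cdot> f = Zero C X T \<longrightarrow> (\<exists>!u. u \<in> Hom C Q T \<and> u \<cdot> c = t)))"
proof -
  have o: "X \<in> Obj C" "Y \<in> Obj C" using Hom_Obj[OF f] by auto
  have z: "t \<cdot> Zero C X Y = Zero C X T" if "t \<in> Hom C Y T" for t T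
    using Comp_Zero_right[OF that o(1)] .
  show ?thesis
  proof
    assume "is_cokernel C f c"
    then obtain X1 Y1 X2 Y2 Q where f': "f \<in> Hom C X1 Y1" "f \<in> Hom C X2 Y2" and m: "c \<in> Hom C Y2 Q"
        "c \<cdot> f = c \<cdot> Zero C X1 Y1"
      and U: "\<forall>T. \<forall>t \<in> Hom C Y2 T. t \<cdot> f = t \<cdot> Zero C X1 Y1 \<longrightarrow> (\<exists>!u. u \<in> Hom C Q T \<and> u \<cdot> c = t)"
      unfolding is_cokernel_def is_coequalizer_def by (elim exE conjE)
    have e: "X1 = X" "Y1 = Y" "Y2 = Y" using Hom_disjoint[OF f f'(1)] Hom_disjoint[OF f f'(2)] by auto
    show "\<exists>Q. c \<in> Hom C Y Q \<and> c \<cdot> f = Zero C X Q \<and>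
      (\<forall>T. \<forall>t \<in> Hom C Y T. t \<cdot> f = Zero C X T \<longrightarrow> (\<exists>!u. u \<in> Hom C Q T \<and> u \<cdot> c = t))"
      using m U z unfolding e by (intro exI[of _ Q]) simp
  next
    assume "\<exists>Q. c \<in> Hom C Y Q \<and> c \<cdot> f = Zero C X Q \<and>
      (\<forall>T. \<forall>t \<in> Hom C Y T. t \<cdot> f = Zero C X T \<longrightarrow> (\<exists>!u. u \<in> Hom C Q T \<and> u \<cdot> c = t))"
    then obtain Q where m: "c \<in> Hom C Y Q" "c \<cdot> f = Zero C X Q"
      and U: "\<forall>T. \<forall>t \<in> Hom C Y T. t \<cdot> f = Zero C X T \<longrightarrow> (\<exists>!u. u \<in> Hom C Q T \<and> u \<cdot> c = t)"
      by (elim exE conjE)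
    have "is_coequalizer C f (Zero C X Y) c"
      unfolding is_coequalizer_def
      by (intro exI[of _ X] exI[of _ Y] exI[of _ Q]) (use f m U z o in simp)
    then show "is_cokernel C f c" unfolding is_cokernel_def using f by (intro exI conjI)
  qed
qed

lemma mono_cancel:
  assumes "is_mono C m" "m \<in> Hom C X Y" "s \<in> Hom C T X" "t \<in> Hom C T X" "m \<cdot> s = m \<cdot> t"
  shows "s = t"
  using assms Hom_disjoint unfolding is_mono_def by metis

lemma epi_cancel':
  assumes "is_epi C r" "r \<in> Hom C X Y" "s \<in> Hom C Y T" "t \<in> Hom C Y T" "s \<cdot> r = t \<cdot> r"
  shows "s = t"
  using assms Hom_disjoint unfolding is_epi_def by metis

lemma kernel_mono:
  assumes "is_kernel C f m"
  shows "is_mono C m"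
proof -
  obtain X Y where f: "f \<in> Hom C X Y" using assms unfolding is_kernel_def by blast
  obtain E where m: "m \<in> Hom C E X" "f \<cdot> m = Zero C E Y"
    and u: "\<And>T t. t \<in> Hom C T X \<Longrightarrow> f \<cdot> t = Zero C T Y \<Longrightarrow> \<exists>!u. u \<in> Hom C T E \<and> m \<cdot> u = t"
    using assms unfolding kernel_iff[OF f] by blast
  have "s = t" if st: "s \<in> Hom C T E" "t \<in> Hom C T E" "m \<cdot> s = m \<cdot> t" for s t T
  proof -
    have "f \<cdot> (m \<cdot> s) = Zero C T Y"
      using Comp_assoc[OF f m(1) st(1)] m(2) Comp_Zero_left[OF st(1)] Hom_Obj[OF f] by simp
    then show ?thesis using u[OF Comp_Hom[OF m(1) st(1)]] st by metis
  qed
  then show ?thesis unfolding is_mono_def using m(1) by blast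
qed

lemma cokernel_epi:
  assumes "is_cokernel C f c"
  shows "is_epi C c"
proof -
  obtain X Y where f: "f \<in> Hom C X Y" using assms unfolding is_cokernel_def by blast
  obtain Q where c: "c \<in> Hom C Y Q" "c \<cdot> f = Zero C X Q"
    and u: "\<And>T t. t \<in> Hom C Y T \<Longrightarrow> t \<cdot> f = Zero C X T \<Longrightarrow> \<exists>!u. u \<in> Hom C Q T \<and> u \<cdot> c = t"
    using assms unfolding cokernel_iff[OF f] by blast
  have "s = t" if st: "s \<in> Hom C Q T" "t \<in> Hom C Q T" "s \<cdot> c = t \<cdot> c" for s t T
  proof -
    have "(s \<cdot> c) \<cdot> f = Zero C X T"
      using Comp_assoc[OF st(1) c(1) f] c(2) Comp_Zero_right[OF st(1)] Hom_Obj[OF f] by simp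
    then show ?thesis using u[OF Comp_Hom[OF st(1) c(1)]] st by metis
  qed
  then show ?thesis unfolding is_epi_def using c(1) by blast
qed

lemma mono_Comp:
  assumes "is_mono C m" "m \<in> Hom C Y Z" "is_mono C n" "n \<in> Hom C X Y"
  shows "is_mono C (m \<cdot> n)"
proof -
  have "s = t" if "s \<in> Hom C T X" "t \<in> Hom C T X" "(m \<cdot> n) \<cdot> s = (m \<cdot> n) \<cdot> t" for s t T
    by (rule mono_cancel[OF assms(3,4) that(1,2)], rule mono_cancel[OF assms(1,2)])
      (use that Comp_assoc[OF assms(2,4)] Comp_Hom[OF assms(4)] in auto)
  then show ?thesis unfolding is_mono_def using Comp_Hom[OF assms(2,4)] by blast
qed

lemma epi_Comp:
  assumes "is_epi C m" "m \<in> Hom C Y Z" "is_epi C n" "n \<in> Hom C X Y"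
  shows "is_epi C (m \<cdot> n)"
proof -
  have "s = t" if "s \<in> Hom C Z T" "t \<in> Hom C Z T" "s \<cdot> (m \<cdot> n) = t \<cdot> (m \<cdot> n)" for s t T
    by (rule epi_cancel'[OF assms(1,2) that(1,2)], rule epi_cancel'[OF assms(3,4)])
      (use that Comp_assoc[OF _ assms(2,4)] Comp_Hom[OF _ assms(2)] in auto)
  then show ?thesis unfolding is_epi_def using Comp_Hom[OF assms(2,4)] by blast
qed

lemma mono_of_Comp:
  assumes "is_mono C (m \<cdot> n)" "m \<in> Hom C Y Z" "n \<in> Hom C X Y"
  shows "is_mono C n"
proof -
  have "s = t" if "s \<in> Hom C T X" "t \<in> Hom C T X" "n \<cdot> s = n \<cdot> t" for s t T
    by (rule mono_cancel[OF assms(1) Comp_Hom[OF assms(2,3)] that(1,2)])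
      (use that Comp_assoc[OF assms(2,3)] in simp)
  then show ?thesis unfolding is_mono_def using assms(3) by blast
qed

lemma epi_of_Comp:
  assumes "is_epi C (m \<cdot> n)" "m \<in> Hom C Y Z" "n \<in> Hom C X Y"
  shows "is_epi C m"
proof -
  have "s = t" if "s \<in> Hom C Z T" "t \<in> Hom C Z T" "s \<cdot> m = t \<cdot> m" for s t T
    by (rule epi_cancel'[OF assms(1) Comp_Hom[OF assms(2,3)] that(1,2)])
      (use that Comp_assoc[OF _ assms(2,3)] in metis)
  then show ?thesis unfolding is_epi_def using assms(2) by blast
qed

text \<open>That \<open>e\<close> is epi is the substantial part. If d = s - t vanishes on
  \<open>e\<close>, then f factors through i m, where m is a kernel of d. This monomorphism is the
  kernel of some g, and g kills f, hence factors through the cokernel of f, hence kills i. So i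
  factors through i m, which makes m a split epimorphism and d zero.\<close>

lemma image_factor:
  assumes f: "f \<in> Hom C X Y" and im: "is_image C f i"
  obtains E e where "i \<in> Hom C E Y" "e \<in> Hom C X E" "f = i \<cdot> e" "is_mono C i" "is_epi C e"
proof -
  obtain c where c: "is_cokernel C f c" "is_kernel C c i" using im unfolding is_image_def by blast
  obtain Q where ch: "c \<in> Hom C Y Q" "c \<cdot> f = Zero C X Q"
    and cu: "\<And>T t. t \<in> Hom C Y T \<Longrightarrow> t \<cdot> f = Zero C X T \<Longrightarrow> \<exists>!u. u \<in> Hom C Q T \<and> u \<cdot> c = t"
    using c(1) unfolding cokernel_iff[OF f] by blast
  obtain E where i: "i \<in> Hom C E Y" "c \<cdot> i = Zero C E Q"
    and iu: "\<And>T t. t \<in> Hom C T Y \<Longrightarrow> c \<cdot> t = Zero C T Q \<Longrightarrow> \<exists>!u. u \<in> Hom C T E \<and> i \<cdot> u = t"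
    using c(2) unfolding kernel_iff[OF ch(1)] by blast
  have im: "is_mono C i" using c(2) by (rule kernel_mono)
  obtain e where e: "e \<in> Hom C X E" "i \<cdot> e = f" using iu[OF f ch(2)] by blast
  have oE: "E \<in> Obj C" using Hom_Obj[OF i(1)] by simp
  have "s = t" if st: "s \<in> Hom C E T" "t \<in> Hom C E T" "s \<cdot> e = t \<cdot> e" for s t T
  proof -
    obtain d where d: "d \<in> Hom C E T" "d = Zero C E T \<longleftrightarrow> s = t" "d \<cdot> e = Zero C X T"
      using difference[OF st(1,2)] e(1) st(3) by metis
    obtain m where m: "is_kernel C d m" using kernels[OF d(1)] by blast
    obtain E' where mh: "m \<in> Hom C E' E" "d \<cdot> m = Zero C E' T"
      and mu: "\<exists>!u. u \<in> Hom C X E' \<and> m \<cdot> u = e"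
      using m d(3) e(1) unfolding kernel_iff[OF d(1)] by blast
    obtain e' where e': "e' \<in> Hom C X E'" "m \<cdot> e' = e" using mu by blast
    have mono: "is_mono C (i \<cdot> m)" by (rule mono_Comp[OF im i(1) kernel_mono[OF m] mh(1)])
    note imh = Comp_Hom[OF i(1) mh(1)]
    \<comment> \<open>In an abelian category the monomorphism \<open>i \<cdot> m\<close> is itself a
      kernel; its test morphism \<open>g\<close> is compared with the cokernel of
      \<open>f\<close>.\<close>
    obtain g where g: "is_kernel C g (i \<cdot> m)" using mono_kernel[OF mono] by blast
    obtain Z where gh: "g \<in> Hom C Y Z"
    proof -
      obtain Y' Z E'' where "g \<in> Hom C Y' Z" "i \<cdot> m \<in> Hom C E'' Y'"
        using g unfolding is_kernel_def is_equalizer_def by metis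
      then show thesis using that Hom_disjoint[OF imh] by blast
    qed
    have oT: "Z \<in> Obj C" using Hom_Obj[OF gh] by simp
    obtain gm: "g \<cdot> (i \<cdot> m) = Zero C E' Z"
      and gu: "\<And>T t. t \<in> Hom C T Y \<Longrightarrow> g \<cdot> t = Zero C T Z \<Longrightarrow> \<exists>u. u \<in> Hom C T E' \<and> (i \<cdot> m) \<cdot> u = t"
      using g Hom_disjoint[OF imh] unfolding kernel_iff[OF gh] by blast
    have "f = (i \<cdot> m) \<cdot> e'" using Comp_assoc[OF i(1) mh(1) e'(1)] e e' by simp
    then have "g \<cdot> f = Zero C X Z"
      using Comp_assoc[OF gh imh e'(1)] gm Comp_Zero_left[OF e'(1) oT] by simp
    then obtain g' where g': "g' \<in> Hom C Q Z" "g' \<cdot> c = g" using cu[OF gh] by blast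
    have "g \<cdot> i = Zero C E Z"
      using Comp_assoc[OF g'(1) ch(1) i(1)] g'(2) i(2) Comp_Zero_right[OF g'(1) oE] by simp
    then obtain v where v: "v \<in> Hom C E E'" "(i \<cdot> m) \<cdot> v = i" using gu[OF i(1)] by blast
    have "m \<cdot> v = \<iota> E"
      by (rule mono_cancel[OF im i(1) Comp_Hom[OF mh(1) v(1)] Ident_Hom[OF oE]])
        (use v Comp_assoc[OF i(1) mh(1) v(1)] Ident_right[OF i(1)] in simp)
    then have "d = Zero C E T"
      using Comp_assoc[OF d(1) mh(1) v(1)] mh(2) Comp_Zero_left[OF v(1)] Hom_Obj[OF d(1)]
        Ident_right[OF d(1)] by simp
    then show ?thesis using d(2) by simp
  qed
  then have "is_epi C e" unfolding is_epi_def using e(1) by blast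
  then show thesis using that i(1) e im by metis
qed

text \<open>Since \<open>e\<close> is epi, the cokernel c of \<open>i \<cdot> e\<close> kills
  \<open>i\<close>. Conversely \<open>i\<close> is the kernel of some g, and g factors through c; so
  whatever c kills is killed by g and lifts along \<open>i\<close>.\<close>

lemma image_if_factor:
  assumes i: "i \<in> Hom C E Y" "is_mono C i" and e: "e \<in> Hom C X E" "is_epi C e"
  shows "is_image C (i \<cdot> e) i"
proof -
  note f = Comp_Hom[OF i(1) e(1)]
  have o: "X \<in> Obj C" "E \<in> Obj C" using Hom_Obj[OF e(1)] by auto
  obtain c where c: "is_cokernel C (i \<cdot> e) c" using cokernels[OF f] by blast
  obtain Q where ch: "c \<in> Hom C Y Q" "c \<cdot> (i \<cdot> e) = Zero C X Q"
    and cu: "\<And>T t. t \<in> Hom C Y T \<Longrightarrow> t \<cdot> (i \<cdot> e) = Zero C X T \<Longrightarrow> \<exists>!u. u \<in> Hom C Q T \<and> u \<cdot> c = t"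
    using c unfolding cokernel_iff[OF f] by blast
  have oQ: "Q \<in> Obj C" using Hom_Obj[OF ch(1)] by simp
  have ci: "c \<cdot> i = Zero C E Q"
    by (rule epi_cancel'[OF e(2,1) Comp_Hom[OF ch(1) i(1)] Zero_Hom[OF o(2) oQ]])
      (use Comp_assoc[OF ch(1) i(1) e(1)] ch(2) Comp_Zero_left[OF e(1) oQ] in simp)
  obtain g where g: "is_kernel C g i" using mono_kernel[OF i(2)] by blast
  obtain Z where gh: "g \<in> Hom C Y Z"
  proof -
    obtain Y' Z E'' where "g \<in> Hom C Y' Z" "i \<in> Hom C E'' Y'"
      using g unfolding is_kernel_def is_equalizer_def by metis
    then show thesis using that Hom_disjoint[OF i(1)] by blast
  qed
  have oZ: "Z \<in> Obj C" using Hom_Obj[OF gh] by simp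
  have gi: "g \<cdot> i = Zero C E Z"
    and gu: "\<And>T t. t \<in> Hom C T Y \<Longrightarrow> g \<cdot> t = Zero C T Z \<Longrightarrow> \<exists>!u. u \<in> Hom C T E \<and> i \<cdot> u = t"
    using g Hom_disjoint[OF i(1)] unfolding kernel_iff[OF gh] by blast+
  have "g \<cdot> (i \<cdot> e) = Zero C X Z"
    using Comp_assoc[OF gh i(1) e(1)] gi Comp_Zero_left[OF e(1) oZ] by simp
  then obtain g' where g': "g' \<in> Hom C Q Z" "g' \<cdot> c = g" using cu[OF gh] by blast
  have "\<exists>!u. u \<in> Hom C T E \<and> i \<cdot> u = t" if t: "t \<in> Hom C T Y" "c \<cdot> t = Zero C T Q" for t T
  proof (rule gu[OF t(1)])
    show "g \<cdot> t = Zero C T Z"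
      using Comp_assoc[OF g'(1) ch(1) t(1)] g'(2) t(2) Comp_Zero_right[OF g'(1)] Hom_Obj[OF t(1)] by simp
  qed
  then have "is_kernel C c i"
    unfolding kernel_iff[OF ch(1)] using i(1) ci by blast
  then show ?thesis unfolding is_image_def using c by blast
qed

lemma image_exists:
  assumes "f \<in> Hom C X Y"
  shows "\<exists>i. is_image C f i"
proof -
  obtain c where c: "is_cokernel C f c" using cokernels[OF assms] by blast
  then obtain Q where "c \<in> Hom C Y Q" unfolding cokernel_iff[OF assms] by blast
  then show ?thesis using kernels c unfolding is_image_def by blast
qed

text \<open>Orthogonality of epis and monos: \<open>e\<close> is a cokernel of some g, and v g
  vanishes because it does so after the monomorphism \<open>i\<close>. Fillers of this kind give the
  structure maps of images and the comparison maps between images.\<close>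

lemma diagonal:
  assumes e: "e \<in> Hom C X E" "is_epi C e" and i: "i \<in> Hom C M Y" "is_mono C i"
    and v: "v \<in> Hom C X M" and u: "u \<in> Hom C E Y" and sq: "u \<cdot> e = i \<cdot> v"
  obtains d where "d \<in> Hom C E M" "d \<cdot> e = v" "i \<cdot> d = u"
proof -
  obtain g where g: "is_cokernel C g e" using epi_cokernel[OF e(2)] by blast
  obtain W where gh: "g \<in> Hom C W X"
  proof -
    obtain X' W E'' where "g \<in> Hom C W X'" "e \<in> Hom C X' E''"
      using g unfolding is_cokernel_def is_coequalizer_def by metis
    then show thesis using that Hom_disjoint[OF e(1)] by blast
  qed
  have o: "W \<in> Obj C" "E \<in> Obj C" "M \<in> Obj C" "Y \<in> Obj C"
    using Hom_Obj[OF gh] Hom_Obj[OF e(1)] Hom_Obj[OF i(1)] by auto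
  have ge: "e \<cdot> g = Zero C W E"
    and gu: "\<And>T t. t \<in> Hom C X T \<Longrightarrow> t \<cdot> g = Zero C W T \<Longrightarrow> \<exists>d. d \<in> Hom C E T \<and> d \<cdot> e = t"
    using g Hom_disjoint[OF e(1)] unfolding cokernel_iff[OF gh] by blast+
  have "v \<cdot> g = Zero C W M"
  proof (rule mono_cancel[OF i(2,1) Comp_Hom[OF v gh] Zero_Hom[OF o(1,3)]])
    have "i \<cdot> (v \<cdot> g) = u \<cdot> (e \<cdot> g)"
      using Comp_assoc[OF i(1) v gh] Comp_assoc[OF u e(1) gh] sq by simp
    then show "i \<cdot> (v \<cdot> g) = i \<cdot> Zero C W M"
      using ge Comp_Zero_right[OF u o(1)] Comp_Zero_right[OF i(1) o(1)] by simp
  qed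
  then obtain d where d: "d \<in> Hom C E M" "d \<cdot> e = v" using gu[OF v] by blast
  moreover have "i \<cdot> d = u"
    by (rule epi_cancel'[OF e(2,1) Comp_Hom[OF i(1) d(1)] u]) (use Comp_assoc[OF i(1) d(1) e(1)] d sq in simp)
  ultimately show thesis using that by blast
qed

end

section \<open>Hopf algebra structure on images\<close>

context abelian_braided_category
begin

text \<open>Write the tensor product as a composite of two maps with one identity factor each; every
  mono is a kernel, and exactness preserves kernels.\<close>

lemma mono_tensor:
  assumes f: "f \<in> Hom C X Y" "is_mono C f" and g: "g \<in> Hom C X' Y'" "is_mono C g"
  shows "is_mono C (f \<boxtimes> g)"
proof -
  have o: "X \<in> Obj C" "Y \<in> Obj C" "X' \<in> Obj C" "Y' \<in> Obj C" using Hom_Obj f(1) g(1) by auto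
  have "is_mono C (f \<boxtimes> \<iota> Y')" "is_mono C (\<iota> X \<boxtimes> g)"
    using mono_kernel[OF f(2)] mono_kernel[OF g(2)] kernel_TensM_left[OF o(4)] kernel_TensM_right[OF o(1)]
      kernel_mono by blast+
  moreover have "(f \<boxtimes> \<iota> Y') \<cdot> (\<iota> X \<boxtimes> g) = f \<boxtimes> g"
    using TensM_Comp[OF f(1) Ident_Hom[OF o(1)] Ident_Hom[OF o(4)] g(1)]
    by (simp add: Ident_left[OF g(1)] Ident_right[OF f(1)])
  ultimately show ?thesis
    using mono_Comp[OF _ TensM_Hom[OF f(1) Ident_Hom[OF o(4)]] _ TensM_Hom[OF Ident_Hom[OF o(1)] g(1)]] by metis
qed

lemma epi_tensor:
  assumes f: "f \<in> Hom C X Y" "is_epi C f" and g: "g \<in> Hom C X' Y'" "is_epi C g"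
  shows "is_epi C (f \<boxtimes> g)"
proof -
  have o: "X \<in> Obj C" "Y \<in> Obj C" "X' \<in> Obj C" "Y' \<in> Obj C" using Hom_Obj f(1) g(1) by auto
  have "is_epi C (f \<boxtimes> \<iota> Y')" "is_epi C (\<iota> X \<boxtimes> g)"
    using epi_cokernel[OF f(2)] epi_cokernel[OF g(2)] cokernel_TensM_left[OF o(4)]
      cokernel_TensM_right[OF o(1)] cokernel_epi by blast+
  moreover have "(f \<boxtimes> \<iota> Y') \<cdot> (\<iota> X \<boxtimes> g) = f \<boxtimes> g"
    using TensM_Comp[OF f(1) Ident_Hom[OF o(1)] Ident_Hom[OF o(4)] g(1)]
    by (simp add: Ident_left[OF g(1)] Ident_right[OF f(1)])
  ultimately show ?thesis
    using epi_Comp[OF _ TensM_Hom[OF f(1) Ident_Hom[OF o(4)]] _ TensM_Hom[OF Ident_Hom[OF o(1)] g(1)]] by metis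
qed

text \<open>Multiplication, comultiplication and antipode are diagonal fillers for squares whose
  sides are tensor powers of \<open>e\<close> and \<open>i\<close>, epi and mono by exactness. The
  axioms are then inherited from \<open>H\<close> along \<open>e\<close>.\<close>

lemma hopf_image:
  fixes H G :: "('o, 'm) hopf_data"
  assumes H: "is_hopf C H" and G: "is_hopf C G" and f: "hopf_hom C H G f" "f = i \<cdot> e"
    and e: "e \<in> Hom C (ob H) X" "is_epi C e" and i: "i \<in> Hom C X (ob G)" "is_mono C i"
  obtains K :: "('o, 'm) hopf_data" where "is_hopf C K" "hopf_hom C H K e" "hopf_hom C K G i"
proof -
  interpret f: braided_hopf_morphism C H G f by unfold_locales fact+
  have o: "X \<in> Obj C" using Hom_Obj[OF i(1)] by simp
  note fh = f.hom_Hom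
  have fe: "f \<cdot> \<nabla>\<^bsub>H\<^esub> = \<nabla>\<^bsub>G\<^esub> \<cdot> (f \<boxtimes> f)" "f \<cdot> \<eta>\<^bsub>H\<^esub> = \<eta>\<^bsub>G\<^esub>" "\<Delta>\<^bsub>G\<^esub> \<cdot> f = (f \<boxtimes> f) \<cdot> \<Delta>\<^bsub>H\<^esub>" "\<epsilon>\<^bsub>G\<^esub> \<cdot> f = \<epsilon>\<^bsub>H\<^esub>"
    using f(1) by (auto simp: hopf_hom_def algebra_hom_def coalgebra_hom_def)
  have ff: "f \<boxtimes> f = (i \<boxtimes> i) \<cdot> (e \<boxtimes> e)" using TensM_Comp[OF i(1) e(1) i(1) e(1)] f(2) by simp
  note e2 = TensM_Hom[OF e(1,1)] epi_tensor[OF e e] and i2 = TensM_Hom[OF i(1,1)] mono_tensor[OF i i]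
  note m = f.H.algebra_typing(2) and u = f.H.algebra_typing(3) and c = f.H.coalgebra_typing(2) and S = f.H.antipode_Hom
  note m' = f.G.algebra_typing(2) and c' = f.G.coalgebra_typing(2) and c0 = f.G.coalgebra_typing(3) and S' = f.G.antipode_Hom
  obtain M where M: "M \<in> Hom C (X \<odot> X) X" "M \<cdot> (e \<boxtimes> e) = e \<cdot> \<nabla>\<^bsub>H\<^esub>" "i \<cdot> M = \<nabla>\<^bsub>G\<^esub> \<cdot> (i \<boxtimes> i)"
  proof (rule diagonal[OF e2 i Comp_Hom[OF e(1) m] Comp_Hom[OF m' i2(1)]])
    show "\<nabla>\<^bsub>G\<^esub> \<cdot> (i \<boxtimes> i) \<cdot> (e \<boxtimes> e) = i \<cdot> (e \<cdot> \<nabla>\<^bsub>H\<^esub>)"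
      using Comp_assoc[OF m' i2(1) e2(1)] Comp_assoc[OF i(1) e(1) m] fe(1) ff f(2) by simp
  qed
  obtain D where D: "D \<in> Hom C X (X \<odot> X)" "D \<cdot> e = (e \<boxtimes> e) \<cdot> \<Delta>\<^bsub>H\<^esub>" "(i \<boxtimes> i) \<cdot> D = \<Delta>\<^bsub>G\<^esub> \<cdot> i"
  proof (rule diagonal[OF e i2 Comp_Hom[OF e2(1) c] Comp_Hom[OF c' i(1)]])
    show "\<Delta>\<^bsub>G\<^esub> \<cdot> i \<cdot> e = (i \<boxtimes> i) \<cdot> ((e \<boxtimes> e) \<cdot> \<Delta>\<^bsub>H\<^esub>)"
      using Comp_assoc[OF c' i(1) e(1)] Comp_assoc[OF i2(1) e2(1) c] fe(3) ff f(2) by simp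
  qed
  obtain A where A: "A \<in> Hom C X X" "A \<cdot> e = e \<cdot> antipode H" "i \<cdot> A = antipode G \<cdot> i"
  proof (rule diagonal[OF e i Comp_Hom[OF e(1) S] Comp_Hom[OF S' i(1)]])
    show "antipode G \<cdot> i \<cdot> e = i \<cdot> (e \<cdot> antipode H)"
      using Comp_assoc[OF S' i(1) e(1)] Comp_assoc[OF i(1) e(1) S] f.hom_antipode_eq f(2) by simp
  qed
  let ?K = "\<lparr>ob = X, nabla = M, eta = e \<cdot> \<eta>\<^bsub>H\<^esub>, delta = D, eps = \<epsilon>\<^bsub>G\<^esub> \<cdot> i, antipode = A\<rparr> :: ('o, 'm) hopf_data"
  have eK: "hopf_hom C H ?K e"
    using e(1) M(2) D(2) Comp_assoc[OF c0 i(1) e(1)] fe(4) f(2)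
    by (simp add: hopf_hom_def algebra_hom_def coalgebra_hom_def)
  have iK: "hopf_hom C ?K G i"
    using i(1) M(3) D(3) Comp_assoc[OF i(1) e(1) u] fe(2) f(2)
    by (simp add: hopf_hom_def algebra_hom_def coalgebra_hom_def)
  have "is_hopf C ?K"
    by (rule hopf_quotientI[OF H, where r = e])
      (use M D A eK e Comp_Hom[OF e(1) u] Comp_Hom[OF c0 i(1)] e2 epi_tensor[OF e e2] in simp_all)
  then show thesis using that eK iK by blast
qed

lemma algebra_hom_cancel_mono:
  assumes "algebra_hom C A G (i \<cdot> u)" "algebra_hom C K G i" "is_mono C i" "u \<in> Hom C (ob A) (ob K)"
    and "is_algebra C A" "is_algebra C K" "is_algebra C G"
  shows "algebra_hom C A K u"
proof -
  have i: "i \<in> Hom C (ob K) (ob G)" "i \<cdot> \<nabla>\<^bsub>K\<^esub> = \<nabla>\<^bsub>G\<^esub> \<cdot> (i \<boxtimes> i)" "i \<cdot> \<eta>\<^bsub>K\<^esub> = \<eta>\<^bsub>G\<^esub>"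
    using assms(2) by (auto simp: algebra_hom_def)
  have iu: "(i \<cdot> u) \<cdot> \<nabla>\<^bsub>A\<^esub> = \<nabla>\<^bsub>G\<^esub> \<cdot> ((i \<cdot> u) \<boxtimes> (i \<cdot> u))" "(i \<cdot> u) \<cdot> \<eta>\<^bsub>A\<^esub> = \<eta>\<^bsub>G\<^esub>"
    using assms(1) by (auto simp: algebra_hom_def)
  note u = assms(4)
  have t: "\<nabla>\<^bsub>A\<^esub> \<in> Hom C (ob A \<odot> ob A) (ob A)" "\<eta>\<^bsub>A\<^esub> \<in> Hom C (UnitO C) (ob A)"
    "\<nabla>\<^bsub>K\<^esub> \<in> Hom C (ob K \<odot> ob K) (ob K)" "\<eta>\<^bsub>K\<^esub> \<in> Hom C (UnitO C) (ob K)"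
    "\<nabla>\<^bsub>G\<^esub> \<in> Hom C (ob G \<odot> ob G) (ob G)"
    using assms(5-7) by (auto simp: is_algebra_def)
  note uu = TensM_Hom[OF u u] and ii = TensM_Hom[OF i(1,1)]
  have "u \<cdot> \<nabla>\<^bsub>A\<^esub> = \<nabla>\<^bsub>K\<^esub> \<cdot> (u \<boxtimes> u)"
    by (rule mono_cancel[OF assms(3) i(1) Comp_Hom[OF u t(1)] Comp_Hom[OF t(3) uu]])
      (use Comp_assoc[OF i(1) u t(1)] Comp_assoc[OF i(1) t(3) uu] Comp_assoc[OF t(5) ii uu]
        TensM_Comp[OF i(1) u i(1) u] i iu in simp)
  moreover have "u \<cdot> \<eta>\<^bsub>A\<^esub> = \<eta>\<^bsub>K\<^esub>"
    by (rule mono_cancel[OF assms(3) i(1) Comp_Hom[OF u t(2)] t(4)])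
      (use Comp_assoc[OF i(1) u t(2)] i iu in simp)
  ultimately show ?thesis using u by (simp add: algebra_hom_def)
qed

text \<open>Comultiplicativity is tested after \<open>i \<boxtimes> i\<close>, which is mono by
  exactness of the tensor product.\<close>

lemma coalgebra_hom_cancel_mono:
  assumes "coalgebra_hom C A G (i \<cdot> u)" "coalgebra_hom C K G i" "is_mono C i" "u \<in> Hom C (ob A) (ob K)"
    and "is_coalgebra C A" "is_coalgebra C K" "is_coalgebra C G"
  shows "coalgebra_hom C A K u"
proof -
  have i: "i \<in> Hom C (ob K) (ob G)" "\<Delta>\<^bsub>G\<^esub> \<cdot> i = (i \<boxtimes> i) \<cdot> \<Delta>\<^bsub>K\<^esub>" "\<epsilon>\<^bsub>G\<^esub> \<cdot> i = \<epsilon>\<^bsub>K\<^esub>"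
    using assms(2) by (auto simp: coalgebra_hom_def)
  have iu: "\<Delta>\<^bsub>G\<^esub> \<cdot> (i \<cdot> u) = ((i \<cdot> u) \<boxtimes> (i \<cdot> u)) \<cdot> \<Delta>\<^bsub>A\<^esub>" "\<epsilon>\<^bsub>G\<^esub> \<cdot> (i \<cdot> u) = \<epsilon>\<^bsub>A\<^esub>"
    using assms(1) by (auto simp: coalgebra_hom_def)
  note u = assms(4)
  have t: "\<Delta>\<^bsub>A\<^esub> \<in> Hom C (ob A) (ob A \<odot> ob A)" "\<Delta>\<^bsub>K\<^esub> \<in> Hom C (ob K) (ob K \<odot> ob K)"
    "\<Delta>\<^bsub>G\<^esub> \<in> Hom C (ob G) (ob G \<odot> ob G)" "\<epsilon>\<^bsub>G\<^esub> \<in> Hom C (ob G) (UnitO C)"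
    using assms(5-7) by (auto simp: is_coalgebra_def)
  note uu = TensM_Hom[OF u u] and ii = TensM_Hom[OF i(1,1)]
  have "\<Delta>\<^bsub>K\<^esub> \<cdot> u = (u \<boxtimes> u) \<cdot> \<Delta>\<^bsub>A\<^esub>"
    by (rule mono_cancel[OF mono_tensor[OF i(1) assms(3) i(1) assms(3)] ii Comp_Hom[OF t(2) u] Comp_Hom[OF uu t(1)]])
      (use Comp_assoc[OF t(3) i(1) u] Comp_assoc[OF ii t(2) u] Comp_assoc[OF ii uu t(1)]
        TensM_Comp[OF i(1) u i(1) u] i iu in simp)
  moreover have "\<epsilon>\<^bsub>K\<^esub> \<cdot> u = \<epsilon>\<^bsub>A\<^esub>"
    using Comp_assoc[OF t(4) i(1) u] i iu by simp
  ultimately show ?thesis using u by (simp add: coalgebra_hom_def)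
qed

lemma hopf_hom_cancel_mono:
  assumes "hopf_hom C A G (i \<cdot> u)" "hopf_hom C K G i" "is_mono C i" "u \<in> Hom C (ob A) (ob K)"
    and "is_hopf C A" "is_hopf C K" "is_hopf C G"
  shows "hopf_hom C A K u"
proof -
  have "is_algebra C A" "is_algebra C K" "is_algebra C G" "is_coalgebra C A" "is_coalgebra C K" "is_coalgebra C G"
    using assms(5-7) by (simp_all add: is_hopf_def is_bialgebra_def)
  then show ?thesis
    using assms(1,2) algebra_hom_cancel_mono[OF _ _ assms(3,4)] coalgebra_hom_cancel_mono[OF _ _ assms(3,4)]
    unfolding hopf_hom_def by blast
qed

lemma hopf_hom_cancel_epi:
  assumes "hopf_hom C A G (u \<cdot> e)" "hopf_hom C A K e" "is_epi C e" "u \<in> Hom C (ob K) (ob G)"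
    and "is_hopf C A" "is_hopf C K" "is_hopf C G"
  shows "hopf_hom C K G u"
proof -
  have e: "e \<in> Hom C (ob A) (ob K)" "e \<cdot> \<nabla>\<^bsub>A\<^esub> = \<nabla>\<^bsub>K\<^esub> \<cdot> (e \<boxtimes> e)" "e \<cdot> \<eta>\<^bsub>A\<^esub> = \<eta>\<^bsub>K\<^esub>"
    "\<Delta>\<^bsub>K\<^esub> \<cdot> e = (e \<boxtimes> e) \<cdot> \<Delta>\<^bsub>A\<^esub>" "\<epsilon>\<^bsub>K\<^esub> \<cdot> e = \<epsilon>\<^bsub>A\<^esub>"
    using assms(2) by (auto simp: hopf_hom_def algebra_hom_def coalgebra_hom_def)
  have ue: "(u \<cdot> e) \<cdot> \<nabla>\<^bsub>A\<^esub> = \<nabla>\<^bsub>G\<^esub> \<cdot> ((u \<cdot> e) \<boxtimes> (u \<cdot> e))" "(u \<cdot> e) \<cdot> \<eta>\<^bsub>A\<^esub> = \<eta>\<^bsub>G\<^esub>"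
    "\<Delta>\<^bsub>G\<^esub> \<cdot> (u \<cdot> e) = ((u \<cdot> e) \<boxtimes> (u \<cdot> e)) \<cdot> \<Delta>\<^bsub>A\<^esub>" "\<epsilon>\<^bsub>G\<^esub> \<cdot> (u \<cdot> e) = \<epsilon>\<^bsub>A\<^esub>"
    using assms(1) by (auto simp: hopf_hom_def algebra_hom_def coalgebra_hom_def)
  interpret A: braided_hopf C A by unfold_locales fact
  interpret K: braided_hopf C K by unfold_locales fact
  interpret G: braided_hopf C G by unfold_locales fact
  note u = assms(4)
  note uu = TensM_Hom[OF u u] and ee = TensM_Hom[OF e(1,1)]
  note tA = A.algebra_typing(2,3) A.coalgebra_typing(2,3) and tK = K.algebra_typing(2,3) K.coalgebra_typing(2,3)
    and tG = G.algebra_typing(2,3) G.coalgebra_typing(2,3)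
  have "u \<cdot> \<nabla>\<^bsub>K\<^esub> = \<nabla>\<^bsub>G\<^esub> \<cdot> (u \<boxtimes> u)"
    by (rule epi_cancel'[OF epi_tensor[OF e(1) assms(3) e(1) assms(3)] ee Comp_Hom[OF u tK(1)] Comp_Hom[OF tG(1) uu]])
      (use Comp_assoc[OF u tK(1) ee] Comp_assoc[OF u e(1) tA(1)] Comp_assoc[OF tG(1) uu ee]
        TensM_Comp[OF u e(1) u e(1)] e ue in simp)
  moreover have "u \<cdot> \<eta>\<^bsub>K\<^esub> = \<eta>\<^bsub>G\<^esub>"
    using Comp_assoc[OF u e(1) tA(2)] e ue by simp
  moreover have "\<Delta>\<^bsub>G\<^esub> \<cdot> u = (u \<boxtimes> u) \<cdot> \<Delta>\<^bsub>K\<^esub>"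
    by (rule epi_cancel'[OF assms(3) e(1) Comp_Hom[OF tG(3) u] Comp_Hom[OF uu tK(3)]])
      (use Comp_assoc[OF tG(3) u e(1)] Comp_assoc[OF uu tK(3) e(1)] Comp_assoc[OF uu ee tA(3)]
        TensM_Comp[OF u e(1) u e(1)] e ue in simp)
  moreover have "\<epsilon>\<^bsub>G\<^esub> \<cdot> u = \<epsilon>\<^bsub>K\<^esub>"
    by (rule epi_cancel'[OF assms(3) e(1) Comp_Hom[OF tG(4) u] tK(4)])
      (use Comp_assoc[OF tG(4) u e(1)] e ue in simp)
  ultimately show ?thesis using u by (simp add: hopf_hom_def algebra_hom_def coalgebra_hom_def)
qed

end

section \<open>Fitting's lemma\<close>

context category
begin

lemma cpow_Hom:
  assumes "f \<in> Hom C X X"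
  shows "cpow C X f n \<in> Hom C X X"
  by (induction n) (use assms Hom_Obj[OF assms] in \<open>auto intro: Comp_Hom Ident_Hom\<close>)

lemma cpow_add:
  assumes "f \<in> Hom C X X"
  shows "cpow C X f (m + n) = cpow C X f m \<cdot> cpow C X f n"
  by (induction m)
    (simp_all add: Ident_left[OF cpow_Hom[OF assms]] Comp_assoc[OF assms cpow_Hom[OF assms] cpow_Hom[OF assms]])

end

context braided_hopf
begin

lemma hopf_hom_Ident: "hopf_hom C H H (\<iota> (ob H))"
  using Ident_left[OF algebra_typing(2)] Ident_left[OF algebra_typing(3)] Ident_right[OF algebra_typing(2)]
    Ident_left[OF coalgebra_typing(2)] Ident_right[OF coalgebra_typing(2)] Ident_right[OF coalgebra_typing(3)]
  by (simp add: hopf_hom_def algebra_hom_def coalgebra_hom_def TensM_Ident)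

lemma cpow_hopf_hom:
  assumes "hopf_hom C H H f"
  shows "hopf_hom C H H (cpow C (ob H) f n)"
proof (induction n)
  case 0
  then show ?case by (simp add: hopf_hom_Ident)
next
  case (Suc n)
  show ?case
    using hopf_hom_Comp[OF Suc assms algebra algebra algebra coalgebra coalgebra coalgebra] by simp
qed

end

context braided_tensor_category
begin

context
  fixes H :: "('o, 'm) hopf_data"
  assumes hopf: "is_hopf C H"
begin

interpretation braided_hopf C H
  by unfold_locales (rule hopf)

lemma ad_Hom: "ad C H \<in> Hom C (ob H \<odot> ob H) (ob H)"
  unfolding ad_def by (rule Hom_if_reads, (rule reading | simp)+)

lemma coad_Hom: "coad C H \<in> Hom C (ob H) (ob H \<odot> ob H)"
  unfolding coad_def by (rule Hom_if_reads, (rule reading | simp)+)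

lemma cpow_normal:
  assumes f: "f \<in> Hom C (ob H) (ob H)" and nml: "normal C H f"
  shows "normal C H (cpow C (ob H) f n)"
proof (induction n)
  case 0
  then show ?case
    using Ident_left[OF ad_Hom] Ident_right[OF ad_Hom] by (simp add: normal_def TensM_Ident)
next
  case (Suc n)
  let ?g = "cpow C (ob H) f n" and ?I = "\<iota> (ob H)"
  note g = cpow_Hom[OF f, of n]
  note If = TensM_Hom[OF Ident_Hom[OF algebra_typing(1)] f] and Ig = TensM_Hom[OF Ident_Hom[OF algebra_typing(1)] g]
  have "(f \<cdot> ?g) \<cdot> ad C H = f \<cdot> (ad C H \<cdot> (?I \<boxtimes> ?g))"
    using Comp_assoc[OF f g ad_Hom] Suc by (simp add: normal_def)
  also have "\<dots> = ad C H \<cdot> ((?I \<boxtimes> f) \<cdot> (?I \<boxtimes> ?g))"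
    using Comp_assoc[OF f ad_Hom Ig] Comp_assoc[OF ad_Hom If Ig] nml by (simp add: normal_def)
  also have "(?I \<boxtimes> f) \<cdot> (?I \<boxtimes> ?g) = ?I \<boxtimes> (f \<cdot> ?g)"
    using TensM_Comp[OF Ident_Hom Ident_Hom f g, of "ob H"] by (simp add: Ident_left[OF Ident_Hom])
  finally show ?case by (simp add: normal_def)
qed

lemma cpow_conormal:
  assumes f: "f \<in> Hom C (ob H) (ob H)" and nml: "conormal C H f"
  shows "conormal C H (cpow C (ob H) f n)"
proof (induction n)
  case 0
  then show ?case
    using Ident_left[OF coad_Hom] Ident_right[OF coad_Hom] by (simp add: conormal_def TensM_Ident)
next
  case (Suc n)
  let ?g = "cpow C (ob H) f n" and ?I = "\<iota> (ob H)"
  note g = cpow_Hom[OF f, of n]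
  note If = TensM_Hom[OF Ident_Hom[OF algebra_typing(1)] f] and Ig = TensM_Hom[OF Ident_Hom[OF algebra_typing(1)] g]
  have "coad C H \<cdot> (f \<cdot> ?g) = (?I \<boxtimes> f) \<cdot> (coad C H \<cdot> ?g)"
    using Comp_assoc[OF coad_Hom f g] Comp_assoc[OF If coad_Hom g] nml by (simp add: conormal_def)
  also have "\<dots> = ((?I \<boxtimes> f) \<cdot> (?I \<boxtimes> ?g)) \<cdot> coad C H"
    using Comp_assoc[OF If Ig coad_Hom] Suc by (simp add: conormal_def)
  also have "(?I \<boxtimes> f) \<cdot> (?I \<boxtimes> ?g) = ?I \<boxtimes> (f \<cdot> ?g)"
    using TensM_Comp[OF Ident_Hom Ident_Hom f g, of "ob H"] by (simp add: Ident_left[OF Ident_Hom])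
  finally show ?case by (simp add: conormal_def)
qed

end

end

section \<open>Isomorphisms\<close>

context category
begin

lemma isoE:
  assumes "is_isomorphism C f" "f \<in> Hom C X Y"
  obtains g where "g \<in> Hom C Y X" "g \<cdot> f = \<iota> X" "f \<cdot> g = \<iota> Y"
proof -
  obtain g X1 Y1 where g: "f \<in> Hom C X1 Y1" "g \<in> Hom C Y1 X1" "g \<cdot> f = \<iota> X1" "f \<cdot> g = \<iota> Y1"
    using assms(1) unfolding is_isomorphism_def inverse_arrows_def by (elim exE conjE)
  then have "X1 = X" "Y1 = Y" using Hom_disjoint[OF assms(2) g(1)] by auto
  then show thesis using that g by simp
qed

lemma isoI: "\<lbrakk>f \<in> Hom C X Y; g \<in> Hom C Y X; g \<cdot> f = \<iota> X; f \<cdot> g = \<iota> Y\<rbrakk> \<Longrightarrow> is_isomorphism C f"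
  unfolding is_isomorphism_def inverse_arrows_def by (intro exI conjI)

lemma iso_Ident: "X \<in> Obj C \<Longrightarrow> is_isomorphism C (\<iota> X)"
  by (rule isoI[OF Ident_Hom Ident_Hom]) (simp_all add: Ident_left[OF Ident_Hom])

lemma iso_Comp:
  assumes f: "is_isomorphism C f" "f \<in> Hom C X Y" and g: "is_isomorphism C g" "g \<in> Hom C Y Z"
  shows "is_isomorphism C (g \<cdot> f)"
proof -
  obtain f' where f': "f' \<in> Hom C Y X" "f' \<cdot> f = \<iota> X" "f \<cdot> f' = \<iota> Y" using isoE[OF f] .
  obtain g' where g': "g' \<in> Hom C Z Y" "g' \<cdot> g = \<iota> Y" "g \<cdot> g' = \<iota> Z" using isoE[OF g] .
  show ?thesis
  proof (rule isoI[OF Comp_Hom[OF g(2) f(2)] Comp_Hom[OF f'(1) g'(1)]])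
    have "f' \<cdot> g' \<cdot> (g \<cdot> f) = f' \<cdot> ((g' \<cdot> g) \<cdot> f)"
      using Comp_assoc[OF f'(1) g'(1) Comp_Hom[OF g(2) f(2)]] Comp_assoc[OF g'(1) g(2) f(2)] by simp
    then show "f' \<cdot> g' \<cdot> (g \<cdot> f) = \<iota> X" using g'(2) f'(2) Ident_left[OF f(2)] by simp
    have "g \<cdot> f \<cdot> (f' \<cdot> g') = g \<cdot> ((f \<cdot> f') \<cdot> g')"
      using Comp_assoc[OF g(2) f(2) Comp_Hom[OF f'(1) g'(1)]] Comp_assoc[OF f(2) f'(1) g'(1)] by simp
    then show "g \<cdot> f \<cdot> (f' \<cdot> g') = \<iota> Z" using f'(3) g'(3) Ident_left[OF g'(1)] by simp
  qed
qed

end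

section \<open>Stabilization of the images of the powers\<close>

context abelian_braided_category
begin

lemma split_mono:
  assumes "f \<in> Hom C X Y" "g \<in> Hom C Y X" "g \<cdot> f = \<iota> X"
  shows "is_mono C f"
proof -
  have "s = t" if st: "s \<in> Hom C T X" "t \<in> Hom C T X" "f \<cdot> s = f \<cdot> t" for s t T
  proof -
    have "g \<cdot> (f \<cdot> s) = g \<cdot> (f \<cdot> t)" using st(3) by simp
    then show ?thesis
      using Comp_assoc[OF assms(2,1) st(1)] Comp_assoc[OF assms(2,1) st(2)] assms(3)
      by (simp add: Ident_left[OF st(1)] Ident_left[OF st(2)])
  qed
  then show ?thesis using assms(1) unfolding is_mono_def by blast
qed

text \<open>The images of the powers form a descending chain of Hopf subalgebras, since f^(n+1) =
  f^n f, and a chain of quotients, since f^(n+1) = f f^n. Beyond both thresholds the image of f^(2n)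
  is identified with that of f^n both as a subobject and as a quotient, and comparing the two
  factorizations of f^(2n) shows that \<open>e \<cdot> i\<close> is invertible.\<close>

lemma fitting_index:
  fixes H :: "('o, 'm) hopf_data"
  assumes H: "is_hopf C H" and f: "hopf_hom C H H f"
    and dcc: "dcc_hopf_sub C H" "dcc_hopf_quotient C H"
  obtains n and K :: "('o, 'm) hopf_data" and i e where "n \<ge> 1" "is_hopf C K" "hopf_hom C K H i"
    "hopf_hom C H K e" "is_mono C i" "is_epi C e" "cpow C (ob H) f n = i \<cdot> e" "is_isomorphism C (e \<cdot> i)"
proof -
  interpret H: braided_hopf C H by unfold_locales fact
  let ?F = "cpow C (ob H) f"
  have fh: "f \<in> Hom C (ob H) (ob H)" using f by (simp add: hopf_hom_def algebra_hom_def)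
  \<comment> \<open>The last clause fixes the choice for n = 0, because the chain conditions speak
    of chains that start at \<open>H\<close> itself.\<close>
  define P where "P n K i e \<longleftrightarrow> is_hopf C K \<and> hopf_hom C K H i \<and> hopf_hom C H K e \<and> is_mono C i \<and> is_epi C e
    \<and> ?F n = i \<cdot> e \<and> (n = 0 \<longrightarrow> K = H)" for n and K :: "('o, 'm) hopf_data" and i e
  have "\<exists>K i e. P n K i e" for n
  proof (cases n)
    case 0
    have "P n H (\<iota> (ob H)) (\<iota> (ob H))"
      unfolding P_def
      using H H.hopf_hom_Ident 0 split_mono[of "\<iota> (ob H)" "ob H" "ob H" "\<iota> (ob H)"]
        split_epi[of "\<iota> (ob H)" "ob H" "ob H" "\<iota> (ob H)"]
      by (simp add: Ident_left[OF Ident_Hom])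
    then show ?thesis by blast
  next
    case (Suc m)
    note F = cpow_Hom[OF fh, of n]
    obtain i where "is_image C (?F n) i" using image_exists[OF F] by blast
    then obtain E e where E: "i \<in> Hom C E (ob H)" "e \<in> Hom C (ob H) E" "?F n = i \<cdot> e" "is_mono C i" "is_epi C e"
      by (rule image_factor[OF F])
    obtain K :: "('o, 'm) hopf_data" where "is_hopf C K" "hopf_hom C H K e" "hopf_hom C K H i"
      by (rule hopf_image[OF H H H.cpow_hopf_hom[OF f] E(3,2,5,1,4)])
    then show ?thesis unfolding P_def using E Suc by blast
  qed
  then have "\<forall>n. \<exists>X. P n (fst X) (fst (snd X)) (snd (snd X))" by simp
  then obtain X where "\<forall>n. P n (fst (X n)) (fst (snd (X n))) (snd (snd (X n)))" using choice by metis
  then obtain K i e where KP: "\<And>n. P n (K n) (i n) (e n)"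
    using that[of "\<lambda>n. fst (X n)" "\<lambda>n. fst (snd (X n))" "\<lambda>n. snd (snd (X n))"] by blast
  have K: "is_hopf C (K n)" "hopf_hom C (K n) H (i n)" "hopf_hom C H (K n) (e n)" "is_mono C (i n)"
    "is_epi C (e n)" "?F n = i n \<cdot> e n" for n
    using KP[of n] by (simp_all add: P_def)
  have K0: "K 0 = H" using KP[of 0] by (simp add: P_def)
  have ih: "i n \<in> Hom C (ob (K n)) (ob H)" and eh: "e n \<in> Hom C (ob H) (ob (K n))" for n
    using K(2,3)[of n] by (simp_all add: hopf_hom_def algebra_hom_def)
  have "\<exists>u. u \<in> Hom C (ob (K (Suc n))) (ob (K n)) \<and> i n \<cdot> u = i (Suc n) \<and> hopf_sub C (K n) (K (Suc n)) u" for n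
  proof -
    have "i (Suc n) \<cdot> e (Suc n) = i n \<cdot> (e n \<cdot> f)"
      using cpow_add[OF fh, of n 1] K(6)[of "Suc n"] K(6)[of n] Comp_assoc[OF ih eh fh]
      by (simp add: Ident_right[OF fh])
    then obtain u where u: "u \<in> Hom C (ob (K (Suc n))) (ob (K n))" "i n \<cdot> u = i (Suc n)"
      using diagonal[OF eh K(5) ih K(4) Comp_Hom[OF eh fh] ih] by metis
    have "hopf_hom C (K (Suc n)) (K n) u"
      by (rule hopf_hom_cancel_mono[OF _ K(2,4) u(1) K(1,1) H]) (use u(2) K(2)[of "Suc n"] in simp)
    moreover have "is_mono C u"
      by (rule mono_of_Comp[OF _ ih u(1)]) (use u(2) K(4)[of "Suc n"] in simp)
    ultimately show ?thesis using u K(1) unfolding hopf_sub_def by blast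
  qed
  then obtain u where u: "\<And>n. u n \<in> Hom C (ob (K (Suc n))) (ob (K n))" "\<And>n. i n \<cdot> u n = i (Suc n)"
      "\<And>n. hopf_sub C (K n) (K (Suc n)) (u n)"
    by metis
  have "\<exists>v. v \<in> Hom C (ob (K n)) (ob (K (Suc n))) \<and> v \<cdot> e n = e (Suc n) \<and> hopf_quotient C (K n) (K (Suc n)) v" for n
  proof -
    have "f \<cdot> i n \<cdot> e n = i (Suc n) \<cdot> e (Suc n)"
      using K(6)[of "Suc n"] K(6)[of n] Comp_assoc[OF fh ih eh] by simp
    then obtain v where v: "v \<in> Hom C (ob (K n)) (ob (K (Suc n)))" "v \<cdot> e n = e (Suc n)"
      using diagonal[OF eh K(5) ih K(4) eh Comp_Hom[OF fh ih]] by metis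
    have "hopf_hom C (K n) (K (Suc n)) v"
      by (rule hopf_hom_cancel_epi[OF _ K(3,5) v(1) H K(1,1)]) (use v(2) K(3)[of "Suc n"] in simp)
    moreover have "is_epi C v"
      by (rule epi_of_Comp[OF _ v(1) eh]) (use v(2) K(5)[of "Suc n"] in simp)
    ultimately show ?thesis using v K(1) unfolding hopf_quotient_def by blast
  qed
  then obtain v where v: "\<And>n. v n \<in> Hom C (ob (K n)) (ob (K (Suc n)))" "\<And>n. v n \<cdot> e n = e (Suc n)"
      "\<And>n. hopf_quotient C (K n) (K (Suc n)) (v n)"
    by metis
  obtain N1 where N1: "\<And>n. n \<ge> N1 \<Longrightarrow> is_isomorphism C (u n)"
    using dcc(1) K0 u(3) unfolding dcc_hopf_sub_def by blast
  obtain N2 where N2: "\<And>n. n \<ge> N2 \<Longrightarrow> is_isomorphism C (v n)"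
    using dcc(2) K0 v(3) unfolding dcc_hopf_quotient_def by blast
  \<comment> \<open>The sum lies beyond both thresholds; the successor makes the exponent
    positive.\<close>
  define n where "n = Suc (N1 + N2)"
  have U: "\<exists>U. U \<in> Hom C (ob (K (n + m))) (ob (K n)) \<and> is_isomorphism C U \<and> i n \<cdot> U = i (n + m)" for m
  proof (induction m)
    case 0
    show ?case
      using Hom_Obj[OF ih[of n]] Ident_right[OF ih[of n]]
      by (intro exI[of _ "\<iota> (ob (K n))"]) (simp add: iso_Ident)
  next
    case (Suc m)
    then obtain U where U: "U \<in> Hom C (ob (K (n + m))) (ob (K n))" "is_isomorphism C U" "i n \<cdot> U = i (n + m)"
      by blast
    have "is_isomorphism C (u (n + m))" by (rule N1) (simp add: n_def)
    then have "is_isomorphism C (U \<cdot> u (n + m))" by (rule iso_Comp[OF _ u(1) U(2,1)])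
    moreover have "i n \<cdot> (U \<cdot> u (n + m)) = i (n + Suc m)"
      using Comp_assoc[OF ih U(1) u(1)] U(3) u(2)[of "n + m"] by simp
    moreover have "U \<cdot> u (n + m) \<in> Hom C (ob (K (n + Suc m))) (ob (K n))"
      using Comp_Hom[OF U(1) u(1)] by simp
    ultimately show ?case by blast
  qed
  have V: "\<exists>V. V \<in> Hom C (ob (K n)) (ob (K (n + m))) \<and> is_isomorphism C V \<and> V \<cdot> e n = e (n + m)" for m
  proof (induction m)
    case 0
    show ?case
      using Hom_Obj[OF ih[of n]] Ident_left[OF eh[of n]]
      by (intro exI[of _ "\<iota> (ob (K n))"]) (simp add: iso_Ident)
  next
    case (Suc m)
    then obtain V where V: "V \<in> Hom C (ob (K n)) (ob (K (n + m)))" "is_isomorphism C V" "V \<cdot> e n = e (n + m)"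
      by blast
    have "is_isomorphism C (v (n + m))" by (rule N2) (simp add: n_def)
    then have "is_isomorphism C (v (n + m) \<cdot> V)" by (rule iso_Comp[OF V(2,1) _ v(1)])
    moreover have "v (n + m) \<cdot> V \<cdot> e n = e (n + Suc m)"
      using Comp_assoc[OF v(1) V(1) eh] V(3) v(2)[of "n + m"] by simp
    moreover have "v (n + m) \<cdot> V \<in> Hom C (ob (K n)) (ob (K (n + Suc m)))"
      using Comp_Hom[OF v(1) V(1)] by simp
    ultimately show ?case by blast
  qed
  obtain U where U: "U \<in> Hom C (ob (K (n + n))) (ob (K n))" "is_isomorphism C U" "i n \<cdot> U = i (n + n)"
    using U by blast
  obtain V where V: "V \<in> Hom C (ob (K n)) (ob (K (n + n)))" "is_isomorphism C V" "V \<cdot> e n = e (n + n)"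
    using V by blast
  note UV = Comp_Hom[OF U(1) V(1)] and ei = Comp_Hom[OF eh ih]
  \<comment> \<open>Both sides become f^(2n) between \<open>i n\<close> and \<open>e n\<close>,
    which are cancelled as a mono and an epi.\<close>
  have "e n \<cdot> i n = U \<cdot> V"
  proof (rule mono_cancel[OF K(4) ih ei UV], rule epi_cancel'[OF K(5) eh Comp_Hom[OF ih ei] Comp_Hom[OF ih UV]])
    have "i n \<cdot> (e n \<cdot> i n) \<cdot> e n = (i n \<cdot> e n) \<cdot> (i n \<cdot> e n)"
      using Comp_assoc[OF ih ei eh] Comp_assoc[OF eh ih eh] Comp_assoc[OF ih eh Comp_Hom[OF ih eh]] by simp
    also have "\<dots> = i (n + n) \<cdot> e (n + n)"
      using cpow_add[OF fh, of n n] K(6) by metis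
    also have "\<dots> = (i n \<cdot> U) \<cdot> (V \<cdot> e n)" using U(3) V(3) by simp
    also have "\<dots> = i n \<cdot> (U \<cdot> V) \<cdot> e n"
      using Comp_assoc[OF ih U(1) Comp_Hom[OF V(1) eh]] Comp_assoc[OF ih UV eh] Comp_assoc[OF U(1) V(1) eh] by simp
    finally show "i n \<cdot> (e n \<cdot> i n) \<cdot> e n = i n \<cdot> (U \<cdot> V) \<cdot> e n" .
  qed
  then have iso: "is_isomorphism C (e n \<cdot> i n)" using iso_Comp[OF V(2,1) U(2,1)] by simp
  show thesis
    by (rule that[OF _ K(1)[of n] K(2)[of n] K(3)[of n] K(4)[of n] K(5)[of n] K(6)[of n] iso]) (simp add: n_def)
qed

end

section \<open>Coinvariants of a power and of its idempotent\<close>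

context split_projection
begin

text \<open>\<open>g\<close> and \<open>e\<close> are obtained from each other by composing with
  maps that preserve units, so both have the same coinvariants; for \<open>e\<close> these are the
  part on which \<open>p\<close> is the identity. The lemma is applied to the idempotent and to the
  power of \<open>f\<close>.\<close>

lemma coinvariants:
  assumes g: "g \<in> Hom C h h" "g = y \<cdot> e" "e = z \<cdot> g"
    and y: "y \<in> Hom C k h" "y \<cdot> \<eta>\<^bsub>K\<^esub> = \<eta>\<^bsub>H\<^esub>"
    and z: "z \<in> Hom C h k" "z \<cdot> \<eta>\<^bsub>H\<^esub> = \<eta>\<^bsub>K\<^esub>"
  shows "is_coinvariants C H H g j"
proof -
  let ?c = "comul_gate H" and ?e = E.hom_gate and ?g = "([h], g, [h])" and ?y = "([k], y, [h])"
    and ?z = "([h], z, [k])" and ?u = "unit_gate H" and ?uK = "unit_gate K" and ?i = I.hom_gate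
  note [simp] = g(1) y(1) z(1)
  have rg: "reads [h] g [(0, ?g)] [h]" "reads [k] y [(0, ?y)] [h]" "reads [h] z [(0, ?z)] [k]"
    by (simp_all add: reads_arrow)
  have G: "eqn [h] [(0, ?g)] [(0, ?e), (0, ?y)]"
    by (rule eqn_if_eq[OF g(2)]) (rule rg reading | simp)+
  have E: "eqn [h] [(0, ?e)] [(0, ?g), (0, ?z)]"
    by (rule eqn_if_eq[OF g(3)]) (rule rg reading | simp)+
  have Y: "eqn [] [(0, ?uK), (0, ?y)] [(0, ?u)]"
    by (rule eqn_if_eq[OF y(2)]) (rule rg reading | simp)+
  have Z: "eqn [] [(0, ?u), (0, ?z)] [(0, ?uK)]"
    by (rule eqn_if_eq[OF z(2)]) (rule rg reading | simp)+
  have "eqn [b] [(0, j_gate), (0, ?c), (0, ?g)] [(0, j_gate), (0, ?c), (0, ?e), (0, ?y)]"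
    by (rule eqn_at[OF G, of 0 2]) simp_all
  also have "eqn [b] \<dots> [(0, ?uK), (0, ?y), (1, j_gate)]"
    by (rule eqn_at[OF comul_j, of 0 0]) simp_all
  also have "eqn [b] \<dots> [(0, ?u), (1, j_gate)]"
    by (rule eqn_at[OF Y, of 0 0]) simp_all
  finally have J: "(g \<boxtimes> \<iota> h) \<cdot> \<Delta>\<^bsub>H\<^esub> \<cdot> j = (\<eta>\<^bsub>H\<^esub> \<boxtimes> \<iota> h) \<cdot> j"
    by (rule eq_if_eqn) (rule rg reading | simp)+
  have U: "\<exists>!u. u \<in> Hom C T b \<and> j \<cdot> u = t"
    if t: "t \<in> Hom C T h" "(g \<boxtimes> \<iota> h) \<cdot> \<Delta>\<^bsub>H\<^esub> \<cdot> t = (\<eta>\<^bsub>H\<^esub> \<boxtimes> \<iota> h) \<cdot> t" for T t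
  proof
    have o: "T \<in> Obj C" using Hom_Obj[OF t(1)] by simp
    note [simp] = t(1) o
    let ?t = "([T], t, [h])"
    have rt: "reads [T] t [(0, ?t)] [h]" by (simp add: reads_arrow)
    have D: "eqn [T] [(0, ?t), (0, ?c), (0, ?g)] [(0, ?t), (0, ?u)]"
      by (rule eqn_if_eq[OF t(2)]) (rule rt rg reading | simp)+
    \<comment> \<open>p(t) = i(S(e(t1))) t2, and the hypothesis on t, transported from
      \<open>g\<close> to \<open>e\<close> by \<open>z\<close>, replaces e(t1), t2 by 1, t.\<close>
    have "eqn [T] [(0, ?t), (0, p_gate)] [(0, ?t), (0, ?c), (0, H.antipode_gate), (0, ?e), (0, ?i),
        (0, mul_gate H)]"
      by (rule eqn_at[OF p_unfold, of 0 1]) simp_all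
    also have "eqn [T] \<dots> [(0, ?t), (0, ?c), (0, ?e), (0, K.antipode_gate), (0, ?i), (0, mul_gate H)]"
      by (rule eqn_at[OF E.hom_antipode, of 0 2]) simp_all
    also have "eqn [T] \<dots> [(0, ?t), (0, ?c), (0, ?g), (0, ?z), (0, K.antipode_gate), (0, ?i),
        (0, mul_gate H)]"
      by (rule eqn_at[OF E, of 0 2]) simp_all
    also have "eqn [T] \<dots> [(0, ?t), (0, ?u), (0, ?z), (0, K.antipode_gate), (0, ?i), (0, mul_gate H)]"
      by (rule eqn_at[OF D, of 0 0]) simp_all
    also have "eqn [T] \<dots> [(0, ?t), (0, ?uK), (0, K.antipode_gate), (0, ?i), (0, mul_gate H)]"
      by (rule eqn_at[OF Z, of 0 1]) simp_all
    also have "eqn [T] \<dots> [(0, ?t), (0, ?uK), (0, ?i), (0, mul_gate H)]"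
      by (rule eqn_at[OF K.antipode_unit, of 0 1]) simp_all
    also have "eqn [T] \<dots> [(0, ?t), (0, ?u), (0, mul_gate H)]"
      by (rule eqn_at[OF I.hom_unit, of 0 1]) simp_all
    also have "eqn [T] \<dots> [(0, ?t)]"
      by (rule eqn_at[OF H.mul_unit_left, of 0 1]) simp_all
    finally have "p \<cdot> t = t"
      by (rule eq_if_eqn) (rule rt reading | simp)+
    then show "q \<cdot> t \<in> Hom C T b \<and> j \<cdot> (q \<cdot> t) = t"
      using Comp_assoc[OF j_Hom q_Hom t(1)] Comp_Hom[OF q_Hom t(1)] by (simp add: split_p)
    show "u = q \<cdot> t" if "u \<in> Hom C T b \<and> j \<cdot> u = t" for u
      using that Comp_assoc[OF q_Hom j_Hom, of u T] Ident_left[of u T b] by (auto simp: section_p)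
  qed
  have t: "(g \<boxtimes> \<iota> h) \<cdot> \<Delta>\<^bsub>H\<^esub> \<in> Hom C h (h \<odot> h)" "\<eta>\<^bsub>H\<^esub> \<boxtimes> \<iota> h \<in> Hom C h (h \<odot> h)"
    by (rule Hom_if_reads, (rule rg reading | simp)+)+
  show ?thesis
    unfolding is_coinvariants_def is_equalizer_def
    by (intro exI[of _ b] exI[of _ h] exI[of _ "h \<odot> h"] conjI t j_Hom J allI ballI impI U)
qed

lemma unit_p_eq: "p \<cdot> \<eta>\<^bsub>H\<^esub> = \<eta>\<^bsub>H\<^esub>"
  by (rule eq_if_eqn[OF unit_p]) (rule reading | simp)+

lemma p_counit: "eqn [h] [(0, p_gate), (0, counit_gate H)] [(0, counit_gate H)]"
proof (rule eqn_if_eq)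
  show "\<epsilon>\<^bsub>H\<^esub> \<cdot> p = \<epsilon>\<^bsub>H\<^esub>"
    using split_projection.unit_p_eq[OF split_op] by (simp add: p_op)
qed (rule reading | simp)+

text \<open>Coinvariance gives g(b) = \<epsilon>(b) 1 on the split factor. Applying \<open>g\<close>
  to h = \<pi>(h1) p(h2) therefore yields g(\<pi>(h)).\<close>

lemma factor_through_e:
  assumes hom: "hopf_hom C H H g" and gj: "(g \<boxtimes> \<iota> h) \<cdot> (\<Delta>\<^bsub>H\<^esub> \<cdot> j) = \<eta>\<^bsub>H\<^esub> \<boxtimes> j"
  shows "g = g \<cdot> (i \<cdot> e)"
proof -
  interpret G: braided_hopf_morphism C H H g by unfold_locales fact
  let ?m = "mul_gate H" and ?c = "comul_gate H" and ?g = G.hom_gate and ?j = j_gate and ?i = I.hom_gate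
    and ?e = E.hom_gate and ?u = "unit_gate H" and ?E = "counit_gate H" and ?q = q_gate
  have G: "eqn [b] [(0, ?j), (0, ?c), (0, ?g)] [(0, ?u), (1, ?j)]"
    by (rule eqn_if_eq[OF gj]) (rule reading | simp)+
  have inv: "eqn [h] [(0, ?c), (0, ?e), (1, ?q), (0, ?i), (1, ?j), (0, ?m)] []"
    by (rule eqn_if_eq[OF mult_comult])
      (rule reading | simp)+
  have "eqn [b] [(0, ?j), (0, ?g)] [(0, ?j), (0, ?c), (0, ?g), (1, ?E)]"
    by (rule eqn_at[OF eqn_sym[OF H.comul_counit_right], of 0 1]) simp_all
  also have "eqn [b] \<dots> [(0, ?u), (1, ?j), (1, ?E)]"
    by (rule eqn_at[OF G, of 0 0]) simp_all
  finally have J: "eqn [b] [(0, ?j), (0, ?g)] [(0, ?u), (1, ?j), (1, ?E)]" .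
  have "eqn [h] [(0, ?g)] [(0, ?c), (0, ?e), (1, ?q), (0, ?i), (1, ?j), (0, ?m), (0, ?g)]"
    by (rule eqn_at[OF eqn_sym[OF inv], of 0 0]) simp_all
  also have "eqn [h] \<dots> [(0, ?c), (0, ?e), (1, ?q), (0, ?i), (0, ?g), (1, ?j), (1, ?g), (0, ?m)]"
    by (rule eqn_at[OF G.hom_mul, of 0 5]) simp_all
  also have "eqn [h] \<dots> [(0, ?c), (0, ?e), (1, ?q), (0, ?i), (0, ?g), (1, ?j), (1, ?E), (1, ?u), (0, ?m)]"
    by (rule eqn_at[OF J, of 1 5]) simp_all
  also have "eqn [h] \<dots> [(0, ?c), (0, ?e), (0, ?i), (0, ?g), (1, ?q), (1, ?j), (1, ?E)]"
    by (rule eqn_at[OF H.mul_unit_right, of 0 7]) simp_all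
  also have "eqn [h] \<dots> [(0, ?c), (0, ?e), (0, ?i), (0, ?g), (1, p_gate), (1, ?E)]"
    by (rule eqn_at[OF q_j, of 1 4]) simp_all
  also have "eqn [h] \<dots> [(0, ?c), (1, ?E), (0, ?e), (0, ?i), (0, ?g)]"
    by (rule eqn_at[OF p_counit, of 1 4]) simp_all
  also have "eqn [h] \<dots> [(0, ?e), (0, ?i), (0, ?g)]"
    by (rule eqn_at[OF H.comul_counit_right, of 0 0]) simp_all
  finally show ?thesis
    by (rule eq_if_eqn) (rule reading | simp)+
qed

text \<open>The dual of the coinvariance of \<open>j\<close> under \<open>g\<close>, as conormality
  requires it. It follows from \<open>q_mul_i\<close>, because \<open>g\<close> takes its values in
  the image of \<open>i\<close> and \<epsilon>(e'(h)) = \<epsilon>(h).\<close>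

lemma q_mul_g:
  assumes e': "hopf_hom C H K e'" and g: "g = i \<cdot> e'"
  shows "q \<cdot> \<nabla>\<^bsub>H\<^esub> \<cdot> (g \<boxtimes> \<iota> h) = \<epsilon>\<^bsub>H\<^esub> \<boxtimes> q"
proof -
  interpret E': braided_hopf_morphism C H K e' by unfold_locales fact
  have "eqn [h, h] [(0, E'.hom_gate), (0, I.hom_gate), (0, mul_gate H), (0, q_gate)] [(0, E'.hom_gate),
      (0, counit_gate K), (0, q_gate)]"
    by (rule eqn_at[OF q_mul_i, of 0 1]) simp_all
  also have "eqn [h, h] \<dots> [(0, counit_gate H), (0, q_gate)]"
    by (rule eqn_at[OF E'.hom_counit, of 0 0]) simp_all
  finally show ?thesis unfolding g
    by (rule eq_if_eqn) (rule reading | simp)+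
qed

end

section \<open>Existence of the biproduct and analysis of an arbitrary one\<close>

context abelian_braided_category
begin

lemma hopf_projectionI:
  assumes "is_hopf C H" "is_hopf C K" "hopf_hom C K H i" "hopf_hom C H K e" "e \<cdot> i = \<iota> (ob K)"
  shows "hopf_projection C H K i e"
  by unfold_locales (use assms in auto)

lemma radford_if_split:
  assumes "split_projection C H K i e b j q"
  shows "\<exists>B \<alpha> \<rho>. radford_biproduct C H (i \<cdot> e) K i B j \<alpha> \<rho>"
proof -
  interpret S: split_projection C H K i e b j q by fact
  have k: "is_algebra C H" "is_coalgebra C H" "is_algebra C K" "is_coalgebra C K"
    by (rule S.H.algebra S.H.coalgebra S.K.algebra S.K.coalgebra)+
  have hom: "hopf_hom C H H (i \<cdot> e)"
    by (rule hopf_hom_Comp[OF S.E.hom S.I.hom]) (rule k)+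
  have idem: "i \<cdot> e \<cdot> (i \<cdot> e) = i \<cdot> e"
    using Comp_assoc[OF S.I.hom_Hom S.E.hom_Hom Comp_Hom[OF S.I.hom_Hom S.E.hom_Hom]]
      Comp_assoc[OF S.E.hom_Hom S.I.hom_Hom S.E.hom_Hom] S.retraction
    by (simp add: Ident_left[OF S.E.hom_Hom])
  have im: "is_image C (i \<cdot> e) i"
    by (rule image_if_factor[OF S.I.hom_Hom split_mono[OF S.I.hom_Hom S.E.hom_Hom S.retraction]
          S.E.hom_Hom split_epi[OF S.E.hom_Hom S.I.hom_Hom S.retraction]])
  have "is_image C (j \<cdot> q) j"
    by (rule image_if_factor[OF S.j_Hom split_mono[OF S.j_Hom S.q_Hom S.section_p]
          S.q_Hom split_epi[OF S.q_Hom S.j_Hom S.section_p]])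
  then have imp: "is_image C S.p j" by (simp add: S.split_p)
  have co: "is_coinvariants C H H (i \<cdot> e) j"
  proof (rule S.coinvariants[where y = i and z = e])
    show "e = e \<cdot> (i \<cdot> e)"
      using Comp_assoc[OF S.E.hom_Hom S.I.hom_Hom S.E.hom_Hom] S.retraction
      by (simp add: Ident_left[OF S.E.hom_Hom])
  qed (use S.I.hom S.E.hom Comp_Hom[OF S.I.hom_Hom S.E.hom_Hom] in \<open>auto simp: hopf_hom_def algebra_hom_def\<close>)
  have "radford_biproduct C H (i \<cdot> e) K i S.B j S.action S.coaction"
    unfolding radford_biproduct_def Let_def S.p_def[symmetric]
    using hom idem im imp co S.K.hopf S.I.hom S.B_algebra S.j_algebra_hom S.B_coalgebra S.q_coalgebra_hom S.split_p
      S.action_module_algebra S.coaction_comodule_coalgebra S.mult_map_iso S.semidirect_algebra_hom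
      S.semidirect_coalgebra_hom[OF S.action_Hom] by blast
  then show ?thesis by blast
qed

lemma fitting_biproduct_exists:
  assumes H: "is_hopf C H" and f: "hopf_hom C H H f"
    and dcc: "dcc_hopf_sub C H" "dcc_hopf_quotient C H"
  shows "\<exists>n\<ge>1. \<exists>\<pi> K i B j \<alpha> \<rho>. fitting_biproduct C H f n \<pi> K i B j \<alpha> \<rho>"
proof -
  interpret H: braided_hopf C H by unfold_locales fact
  obtain n and K :: "('o, 'm) hopf_data" and i e where n: "n \<ge> 1" and K: "is_hopf C K"
    and i: "hopf_hom C K H i" "is_mono C i" and e: "hopf_hom C H K e" "is_epi C e"
    and F: "cpow C (ob H) f n = i \<cdot> e" and iso: "is_isomorphism C (e \<cdot> i)"
    using fitting_index[OF assms] by metis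
  interpret K: braided_hopf C K by unfold_locales fact
  let ?h = "ob H" and ?k = "ob K" and ?g = "cpow C (ob H) f n"
  have ih: "i \<in> Hom C ?k ?h" and eh: "e \<in> Hom C ?h ?k" and eta: "i \<cdot> \<eta>\<^bsub>K\<^esub> = \<eta>\<^bsub>H\<^esub>" "e \<cdot> \<eta>\<^bsub>H\<^esub> = \<eta>\<^bsub>K\<^esub>"
    using i(1) e(1) by (simp_all add: hopf_hom_def algebra_hom_def)
  note ah = Comp_Hom[OF eh ih]
  have a: "hopf_hom C K K (e \<cdot> i)"
    by (rule hopf_hom_Comp[OF i(1) e(1)]) (rule K.algebra H.algebra K.coalgebra H.coalgebra)+
  obtain a' where a': "a' \<in> Hom C ?k ?k" "a' \<cdot> (e \<cdot> i) = \<iota> ?k" "(e \<cdot> i) \<cdot> a' = \<iota> ?k"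
    using isoE[OF iso ah] .
  have "algebra_hom C K K a'"
    by (rule algebra_hom_inverse[OF _ a']) (use a K.algebra_typing in \<open>auto simp: hopf_hom_def\<close>)
  moreover have "coalgebra_hom C K K a'"
    by (rule coalgebra_hom_inverse[OF _ a']) (use a K.coalgebra_typing in \<open>auto simp: hopf_hom_def\<close>)
  ultimately have a'hom: "hopf_hom C K K a'" by (simp add: hopf_hom_def)
  then have a'eta: "a' \<cdot> \<eta>\<^bsub>K\<^esub> = \<eta>\<^bsub>K\<^esub>" by (simp add: hopf_hom_def algebra_hom_def)
  \<comment> \<open>The factorization f^n = i e need not have e i = id; dividing by this
    automorphism of \<open>K\<close> yields a retraction of \<open>i\<close>, and \<pi> = i r is
    idempotent with the same image.\<close>
  define r where "r = a' \<cdot> e"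
  have rh: "r \<in> Hom C ?h ?k" unfolding r_def by (rule Comp_Hom[OF a'(1) eh])
  have r: "hopf_hom C H K r"
    unfolding r_def
    by (rule hopf_hom_Comp[OF e(1) a'hom]) (rule K.algebra H.algebra K.coalgebra H.coalgebra)+
  have ri: "r \<cdot> i = \<iota> ?k"
    using Comp_assoc[OF a'(1) eh ih] a'(2) by (simp add: r_def)
  interpret R: hopf_projection C H K i r
    by (rule hopf_projectionI[OF H K i(1) r ri])
  obtain j where "is_image C R.p j" using image_exists[OF R.p_Hom] by blast
  then obtain b q where j: "j \<in> Hom C b ?h" "is_mono C j" and q: "q \<in> Hom C ?h b" "is_epi C q" and p: "R.p = j \<cdot> q"
    using image_factor[OF R.p_Hom] by metis
  \<comment> \<open>An epi-mono factorization of an idempotent splits it: cancel \<open>j\<close>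
    and \<open>q\<close> in p p = p.\<close>
  have qj: "q \<cdot> j = \<iota> b"
  proof (rule mono_cancel[OF j(2,1) Comp_Hom[OF q(1) j(1)] Ident_Hom], use Hom_Obj[OF j(1)] in simp)
    have "j \<cdot> (q \<cdot> j) \<cdot> q = R.p \<cdot> R.p"
      using Comp_assoc[OF j(1) Comp_Hom[OF q(1) j(1)] q(1)] Comp_assoc[OF q(1) j(1) q(1)]
        Comp_assoc[OF j(1) q(1) Comp_Hom[OF j(1) q(1)]] p by simp
    also have "\<dots> = j \<cdot> q" using R.p_idem p by simp
    finally have "j \<cdot> (q \<cdot> j) \<cdot> q = j \<cdot> q" .
    then show "j \<cdot> (q \<cdot> j) = j \<cdot> \<iota> b"
      using epi_cancel'[OF q(2,1) Comp_Hom[OF j(1) Comp_Hom[OF q(1) j(1)]] j(1)] Ident_right[OF j(1)] by simp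
  qed
  interpret S: split_projection C H K i r b j q
    by unfold_locales (use j q qj p in auto)
  obtain B \<alpha> \<rho> where rad: "radford_biproduct C H (i \<cdot> r) K i B j \<alpha> \<rho>"
    using radford_if_split[OF S.split_projection_axioms] by blast
  have "is_image C ?g i" unfolding F by (rule image_if_factor[OF ih i(2) eh e(2)])
  moreover have "is_coinvariants C H H ?g j"
  \<comment> \<open>With a = e i and a' its inverse: f^n = i e = (i a) r, and conversely a' a' e f^n
    = a' a' a e = a' e = r.\<close>
  proof (rule S.coinvariants[where y = "i \<cdot> (e \<cdot> i)" and z = "a' \<cdot> (a' \<cdot> e)"])
    show "?g \<in> Hom C ?h ?h" unfolding F by (rule Comp_Hom[OF ih eh])
    have "(e \<cdot> i) \<cdot> r = e"
      using Comp_assoc[OF ah a'(1) eh] a'(3) Ident_left[OF eh] by (simp add: r_def)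
    then show "?g = i \<cdot> (e \<cdot> i) \<cdot> r"
      using Comp_assoc[OF ih ah rh] F by simp
    have "e \<cdot> (i \<cdot> e) = (e \<cdot> i) \<cdot> e" using Comp_assoc[OF eh ih eh] by simp
    then have "a' \<cdot> (e \<cdot> (i \<cdot> e)) = e"
      using Comp_assoc[OF a'(1) ah eh] a'(2) Ident_left[OF eh] by simp
    then show "r = a' \<cdot> (a' \<cdot> e) \<cdot> ?g"
      using Comp_assoc[OF a'(1) Comp_Hom[OF a'(1) eh] Comp_Hom[OF ih eh]]
        Comp_assoc[OF a'(1) eh Comp_Hom[OF ih eh]] F by (simp add: r_def)
    show "i \<cdot> (e \<cdot> i) \<in> Hom C ?k ?h" "a' \<cdot> (a' \<cdot> e) \<in> Hom C ?h ?k"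
      by (rule Comp_Hom[OF ih ah] Comp_Hom[OF a'(1) Comp_Hom[OF a'(1) eh]])+
    show "i \<cdot> (e \<cdot> i) \<cdot> \<eta>\<^bsub>K\<^esub> = \<eta>\<^bsub>H\<^esub>"
      using Comp_assoc[OF ih ah K.algebra_typing(3)] Comp_assoc[OF eh ih K.algebra_typing(3)] eta by simp
    show "a' \<cdot> (a' \<cdot> e) \<cdot> \<eta>\<^bsub>H\<^esub> = \<eta>\<^bsub>K\<^esub>"
      using Comp_assoc[OF a'(1) Comp_Hom[OF a'(1) eh] H.algebra_typing(3)]
        Comp_assoc[OF a'(1) eh H.algebra_typing(3)] eta a'eta by simp
  qed
  ultimately have "fitting_biproduct C H f n (i \<cdot> r) K i B j \<alpha> \<rho>"
    using rad by (simp add: fitting_biproduct_def)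
  then show ?thesis using n by blast
qed

text \<open>Reconstructs, from an arbitrary decomposition, the split projection behind it and
  expresses \<open>i\<close> and \<open>e\<close> through the power of \<open>f\<close>. The
  retractions \<open>e\<close> and \<open>q\<close> come from the image factorizations of \<pi> and
  p, and the remaining structure is forced by uniqueness.\<close>

lemma fitting_split:
  assumes H: "is_hopf C H" and f: "hopf_hom C H H f" and dcc: "dcc_hopf_quotient C H"
    and fb: "fitting_biproduct C H f n \<pi> K i B j \<alpha> \<rho>"
  obtains e q w z e' where "split_projection C H K i e (ob B) j q" "B = split_projection.B C H (ob B) j q"
    "\<alpha> = split_projection.action C H i j q" "\<rho> = split_projection.coaction C H e j q"
    "w \<in> Hom C (ob K) (ob H)" "i = cpow C (ob H) f n \<cdot> w"
    "z \<in> Hom C (ob H) (ob K)" "e = z \<cdot> cpow C (ob H) f n"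
    "hopf_hom C H K e'" "cpow C (ob H) f n = i \<cdot> e'"
    "(cpow C (ob H) f n \<boxtimes> \<iota> (ob H)) \<cdot> (\<Delta>\<^bsub>H\<^esub> \<cdot> j) = \<eta>\<^bsub>H\<^esub> \<boxtimes> j"
proof -
  interpret H: braided_hopf C H by unfold_locales fact
  let ?h = "ob H" and ?k = "ob K" and ?g = "cpow C (ob H) f n" and ?b = "ob B"
  let ?p = "convolution C H H (\<pi> \<cdot> antipode H) (\<iota> ?h)"
  have rad: "radford_biproduct C H \<pi> K i B j \<alpha> \<rho>" and gi: "is_image C ?g i" and gco: "is_coinvariants C H H ?g j"
    using fb by (simp_all add: fitting_biproduct_def)
  obtain q where \<pi>: "hopf_hom C H H \<pi>" "\<pi> \<cdot> \<pi> = \<pi>" and im: "is_image C \<pi> i" and K: "is_hopf C K"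
    and i: "hopf_hom C K H i" and imp: "is_image C ?p j"
    and B: "is_algebra C B" "algebra_hom C B H j" "is_coalgebra C B" "coalgebra_hom C H B q"
    and p: "j \<cdot> q = ?p" and mod: "module_algebra C K B \<alpha>" and comod: "comodule_coalgebra C K B \<rho>"
    and alg: "algebra_hom C (semidirect C K B \<alpha> \<rho>) H (mult_map C H i j)"
    and coalg: "coalgebra_hom C (semidirect C K B \<alpha> \<rho>) H (mult_map C H i j)"
    using rad unfolding radford_biproduct_def Let_def by (elim exE conjE)
  interpret K: braided_hopf C K by unfold_locales fact
  have fh: "f \<in> Hom C ?h ?h" and \<pi>h: "\<pi> \<in> Hom C ?h ?h" and ih: "i \<in> Hom C ?k ?h"
    and jh: "j \<in> Hom C ?b ?h" and qh: "q \<in> Hom C ?h ?b"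
    using f \<pi> i B by (simp_all add: hopf_hom_def algebra_hom_def coalgebra_hom_def)
  note gh = cpow_Hom[OF fh, of n] and ghom = H.cpow_hopf_hom[OF f, of n]
  note alg_facts = H.algebra K.algebra H.coalgebra K.coalgebra
  obtain E0 e where e0: "i \<in> Hom C E0 ?h" "e \<in> Hom C ?h E0" "\<pi> = i \<cdot> e" "is_mono C i" "is_epi C e"
    using image_factor[OF \<pi>h im] .
  have "E0 = ?k" using Hom_disjoint[OF ih e0(1)] by simp
  then have eh: "e \<in> Hom C ?h ?k" using e0(2) by simp
  have ei: "e \<cdot> i = \<iota> ?k"
  proof (rule mono_cancel[OF e0(4) ih Comp_Hom[OF eh ih] Ident_Hom], simp,
      rule epi_cancel'[OF e0(5) eh Comp_Hom[OF ih Comp_Hom[OF eh ih]]])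
    show "i \<cdot> \<iota> ?k \<in> Hom C ?k ?h" using ih Ident_right[OF ih] by simp
    show "i \<cdot> (e \<cdot> i) \<cdot> e = i \<cdot> \<iota> ?k \<cdot> e"
      using Comp_assoc[OF ih Comp_Hom[OF eh ih] eh] Comp_assoc[OF eh ih eh]
        Comp_assoc[OF ih eh Comp_Hom[OF ih eh]] \<pi>(2) e0(3) Ident_right[OF ih] by simp
  qed
  have ehom: "hopf_hom C H K e"
    by (rule hopf_hom_cancel_mono[OF _ i e0(4) eh H K H]) (use \<pi>(1) e0(3) in simp)
  interpret R: hopf_projection C H K i e
    by (rule hopf_projectionI[OF H K i ehom ei])
  have Rp: "R.p = ?p" by (simp add: R.p_def e0(3))
  obtain E1 q1 where q1: "j \<in> Hom C E1 ?h" "q1 \<in> Hom C ?h E1" "R.p = j \<cdot> q1" "is_mono C j" "is_epi C q1"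
    using image_factor[OF R.p_Hom imp[folded Rp]] .
  have "E1 = ?b" using Hom_disjoint[OF jh q1(1)] by simp
  \<comment> \<open>The given \<open>q\<close> is only known to satisfy j q = p; comparison with the
    image factorization along the mono \<open>j\<close> shows that it is epi.\<close>
  then have "q = q1"
    using mono_cancel[OF q1(4) jh qh] q1(2,3) p Rp by simp
  then have qepi: "is_epi C q" using q1(5) by simp
  have qj: "q \<cdot> j = \<iota> ?b"
  proof (rule mono_cancel[OF q1(4) jh Comp_Hom[OF qh jh] Ident_Hom], use Hom_Obj[OF jh] in simp,
      rule epi_cancel'[OF qepi qh Comp_Hom[OF jh Comp_Hom[OF qh jh]]])
    show "j \<cdot> \<iota> ?b \<in> Hom C ?b ?h" using jh Ident_right[OF jh] by simp
    show "j \<cdot> (q \<cdot> j) \<cdot> q = j \<cdot> \<iota> ?b \<cdot> q"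
      using Comp_assoc[OF jh Comp_Hom[OF qh jh] qh] Comp_assoc[OF qh jh qh]
        Comp_assoc[OF jh qh Comp_Hom[OF jh qh]] R.p_idem p Rp Ident_right[OF jh] by simp
  qed
  interpret S: split_projection C H K i e ?b j q
    by unfold_locales (use jh qh qj p Rp in auto)
  have BS: "B = S.B" by (rule S.B_unique[OF B])
  have \<alpha>h: "\<alpha> \<in> Hom C (?b \<odot> ?k) ?b" using mod by (simp add: module_algebra_def)
  have \<rho>h: "\<rho> \<in> Hom C ?b (?b \<odot> ?k)" using comod by (simp add: comodule_coalgebra_def)
  have \<alpha>: "\<alpha> = S.action"
    by (rule S.action_unique[OF \<alpha>h alg[unfolded arg_cong[OF BS, of "\<lambda>B. semidirect C K B \<alpha> \<rho>"]]])
  have \<rho>: "\<rho> = S.coaction"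
    by (rule S.coaction_unique[OF \<rho>h \<alpha>h coalg[unfolded arg_cong[OF BS, of "\<lambda>B. semidirect C K B \<alpha> \<rho>"]]])
  have gj: "(?g \<boxtimes> \<iota> ?h) \<cdot> (\<Delta>\<^bsub>H\<^esub> \<cdot> j) = \<eta>\<^bsub>H\<^esub> \<boxtimes> j"
  proof -
    have eq: "(?g \<boxtimes> \<iota> ?h) \<cdot> \<Delta>\<^bsub>H\<^esub> \<cdot> j = (\<eta>\<^bsub>H\<^esub> \<boxtimes> \<iota> ?h) \<cdot> j"
      using gco unfolding is_coinvariants_def is_equalizer_def by (elim exE conjE)
    have "(\<eta>\<^bsub>H\<^esub> \<boxtimes> \<iota> ?h) \<cdot> j = \<eta>\<^bsub>H\<^esub> \<boxtimes> j"
      by (rule eq_if_reads) (rule reading | simp)+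
    then show ?thesis
      using eq Comp_assoc[OF TensM_Hom[OF gh Ident_Hom[OF H.algebra_typing(1)]] H.coalgebra_typing(2) jh] by simp
  qed
  obtain E2 e' where e'0: "i \<in> Hom C E2 ?h" "e' \<in> Hom C ?h E2" "?g = i \<cdot> e'" "is_epi C e'"
    using image_factor[OF gh gi] by metis
  have "E2 = ?k" using Hom_disjoint[OF ih e'0(1)] by simp
  then have e'h: "e' \<in> Hom C ?h ?k" using e'0(2) by simp
  have e'hom: "hopf_hom C H K e'"
    by (rule hopf_hom_cancel_mono[OF _ i e0(4) e'h H K H]) (use ghom e'0(3) in simp)
  note ah = Comp_Hom[OF e'h ih]
  \<comment> \<open>The link between the power and \<pi>: they have common coinvariants, so the
    power factors through \<pi> by \<open>factor_through_e\<close>, and the mono \<open>i\<close> is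
    cancelled.\<close>
  have e'a: "e' = (e' \<cdot> i) \<cdot> e"
  proof (rule mono_cancel[OF e0(4) ih e'h Comp_Hom[OF ah eh]])
    have "i \<cdot> e' = (i \<cdot> e') \<cdot> (i \<cdot> e)"
      using S.factor_through_e[OF ghom gj] e'0(3) by simp
    then show "i \<cdot> e' = i \<cdot> (e' \<cdot> i \<cdot> e)"
      using Comp_assoc[OF ih e'h Comp_Hom[OF ih eh]] Comp_assoc[OF e'h ih eh] by simp
  qed
  have aepi: "is_epi C (e' \<cdot> i)"
    by (rule epi_of_Comp[OF _ ah eh]) (use e'a e'0(4) in simp)
  have ahom: "hopf_hom C K K (e' \<cdot> i)"
    by (rule hopf_hom_Comp[OF i e'hom]) (rule alg_facts)+
  \<comment> \<open>an epimorphic endomorphism of a quotient of \<open>H\<close> is invertible by the chain condition\<close>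
  have "is_isomorphism C (e' \<cdot> i)"
  proof -
    \<comment> \<open>The chain has to start at \<open>H\<close>, so its initial quotient map is
      \<open>e\<close>; from then on it stays at \<open>K\<close> and repeats
      \<open>e' \<cdot> i\<close>.\<close>
    define Q where "Q m = (case m of 0 \<Rightarrow> H | Suc _ \<Rightarrow> K)" for m :: nat
    define r where "r m = (case m of 0 \<Rightarrow> e | Suc _ \<Rightarrow> e' \<cdot> i)" for m :: nat
    have "hopf_quotient C (Q m) (Q (Suc m)) (r m)" for m
      using K ehom e0(5) ahom aepi by (cases m) (simp_all add: Q_def r_def hopf_quotient_def)
    moreover have "Q 0 = H" by (simp add: Q_def)
    ultimately obtain N where "\<forall>m\<ge>N. is_isomorphism C (r m)"
      using dcc unfolding dcc_hopf_quotient_def by blast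
    then have "is_isomorphism C (r (Suc N))" by simp
    then show ?thesis by (simp add: r_def)
  qed
  then obtain a' where a': "a' \<in> Hom C ?k ?k" "a' \<cdot> (e' \<cdot> i) = \<iota> ?k" "(e' \<cdot> i) \<cdot> a' = \<iota> ?k"
    using isoE[OF _ ah] by blast
  show thesis
  \<comment> \<open>The witnesses are w = i a' and z = a' e, where a' is the inverse of e'
    i.\<close>
  proof (rule that[OF S.split_projection_axioms BS \<alpha> \<rho> Comp_Hom[OF ih a'(1)] _ Comp_Hom[OF a'(1) eh] _ e'hom e'0(3) gj])
    have "(i \<cdot> e') \<cdot> (i \<cdot> a') = i \<cdot> ((e' \<cdot> i) \<cdot> a')"
      using Comp_assoc[OF ih e'h Comp_Hom[OF ih a'(1)]] Comp_assoc[OF e'h ih a'(1)] by simp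
    then show "i = ?g \<cdot> (i \<cdot> a')" using a'(3) e'0(3) Ident_right[OF ih] by simp
    have "a' \<cdot> e \<cdot> (i \<cdot> e') = a' \<cdot> ((e \<cdot> i) \<cdot> e')"
      using Comp_assoc[OF a'(1) eh Comp_Hom[OF ih e'h]] Comp_assoc[OF eh ih e'h] by simp
    also have "\<dots> = a' \<cdot> e'" using ei Ident_left[OF e'h] by simp
    also have "\<dots> = (a' \<cdot> (e' \<cdot> i)) \<cdot> e" using e'a Comp_assoc[OF a'(1) ah eh] by simp
    also have "\<dots> = e" using a'(2) Ident_left[OF eh] by simp
    finally show "e = a' \<cdot> e \<cdot> ?g" using e'0(3) by simp
  qed
qed

text \<open>Normality and conormality pass to the power of \<open>f\<close> and become the two
  commutation rules between the factors. In the binormal case the antipode of \<open>B\<close> is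
  \<open>antipodeB\<close>, that is q S j.\<close>

lemma fitting_normal:
  assumes H: "is_hopf C H" and f: "hopf_hom C H H f" and dcc: "dcc_hopf_quotient C H"
    and fb: "fitting_biproduct C H f n \<pi> K i B j \<alpha> \<rho>"
  shows "(normal C H f \<longrightarrow>
         trivial_action C K B \<alpha> \<and>
         is_isomorphism C (mult_map C H i j) \<and> algebra_hom C (tensor C K B) H (mult_map C H i j)) \<and>
      (conormal C H f \<longrightarrow>
         trivial_coaction C K B \<rho> \<and>
         is_isomorphism C (mult_map C H i j) \<and> coalgebra_hom C (tensor C K B) H (mult_map C H i j)) \<and>
      (binormal C H f \<longrightarrow>
         (\<exists>s. is_hopf C K \<and> is_hopf C (with_antipode B s) \<and> unbraided C (ob K) (ob B) \<and>
              is_hopf C (tensor_hopf C K (with_antipode B s)) \<and>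
              is_isomorphism C (mult_map C H i j) \<and>
              hopf_hom C (tensor_hopf C K (with_antipode B s)) H (mult_map C H i j)))"
proof -
  obtain e q w z e' where S: "split_projection C H K i e (ob B) j q"
    and BS: "B = split_projection.B C H (ob B) j q" and \<alpha>S: "\<alpha> = split_projection.action C H i j q"
    and \<rho>S: "\<rho> = split_projection.coaction C H e j q"
    and w: "w \<in> Hom C (ob K) (ob H)" "i = cpow C (ob H) f n \<cdot> w"
    and z: "z \<in> Hom C (ob H) (ob K)" "e = z \<cdot> cpow C (ob H) f n"
    and e': "hopf_hom C H K e'" "cpow C (ob H) f n = i \<cdot> e'"
    and gj: "(cpow C (ob H) f n \<boxtimes> \<iota> (ob H)) \<cdot> (\<Delta>\<^bsub>H\<^esub> \<cdot> j) = \<eta>\<^bsub>H\<^esub> \<boxtimes> j"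
    using fitting_split[OF assms] .
  interpret H: braided_hopf C H by unfold_locales fact
  interpret S: split_projection C H K i e "ob B" j q by fact
  have fh: "f \<in> Hom C (ob H) (ob H)" using f by (simp add: hopf_hom_def algebra_hom_def)
  note ghom = H.cpow_hopf_hom[OF f, of n]
  have mult: "\<nabla>\<^bsub>H\<^esub> \<cdot> (j \<boxtimes> i) = \<nabla>\<^bsub>H\<^esub> \<cdot> (i \<boxtimes> j) \<cdot> \<tau> (ob B) (ob K)" if "normal C H f"
    by (rule S.commute_normal[OF ghom cpow_normal[OF H fh that] gj w])
  have comult: "(q \<boxtimes> e) \<cdot> \<Delta>\<^bsub>H\<^esub> = \<tau> (ob K) (ob B) \<cdot> ((e \<boxtimes> q) \<cdot> \<Delta>\<^bsub>H\<^esub>)" if "conormal C H f"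
    by (rule S.commute_conormal[OF ghom cpow_conormal[OF H fh that] S.q_mul_g[OF e'] z])
  have T: "tensor C K B = tensor C K S.B" "with_antipode B s = with_antipode S.B s" for s
    using BS by simp_all
  have "trivial_action C K B \<alpha> \<and> is_isomorphism C (mult_map C H i j) \<and>
      algebra_hom C (tensor C K B) H (mult_map C H i j)" if "normal C H f"
    unfolding trivial_action_def T \<alpha>S
    using S.trivial_action_if_commute[OF mult[OF that]] S.mult_map_iso S.tensor_algebra_hom by blast
  moreover have "trivial_coaction C K B \<rho> \<and> is_isomorphism C (mult_map C H i j) \<and>
      coalgebra_hom C (tensor C K B) H (mult_map C H i j)" if "conormal C H f"
    unfolding trivial_coaction_def T \<rho>S
    using S.trivial_coaction_if_commute[OF comult[OF that]] S.mult_map_iso S.tensor_coalgebra_hom by blast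
  moreover have "\<exists>s. is_hopf C K \<and> is_hopf C (with_antipode B s) \<and> unbraided C (ob K) (ob B) \<and>
              is_hopf C (tensor_hopf C K (with_antipode B s)) \<and>
              is_isomorphism C (mult_map C H i j) \<and>
              hopf_hom C (tensor_hopf C K (with_antipode B s)) H (mult_map C H i j)" if "binormal C H f"
  proof -
    have "normal C H f" "conormal C H f" using that by (simp_all add: binormal_def)
    note m = mult[OF this(1)] comult[OF this(2)]
    show ?thesis
      unfolding T
      using S.K.hopf S.B_hopf[OF m] S.unbraided_factors[OF m] S.tensor_is_hopf[OF m] S.mult_map_iso
        S.tensor_hopf_hom[OF m] by blast
  qed
  ultimately show ?thesis by blast
qed

end

theorem proposition5p1:
  fixes C :: "('o, 'm, 'e) tensor_category_scheme"
    and H :: "('o, 'm) hopf_data" and f :: 'm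
  assumes "abelian_braided_category C"
    and "is_hopf C H"
    and "hopf_hom C H H f"
    and "dcc_hopf_sub C H" and "dcc_hopf_quotient C H"
  shows "(\<exists>n\<ge>1. \<exists>\<pi> K i B j \<alpha> \<rho>. fitting_biproduct C H f n \<pi> K i B j \<alpha> \<rho>) \<and>
    (\<forall>n\<ge>1. \<forall>\<pi> K i B j \<alpha> \<rho>. fitting_biproduct C H f n \<pi> K i B j \<alpha> \<rho> \<longrightarrow>
      (normal C H f \<longrightarrow>
         trivial_action C K B \<alpha> \<and>
         is_isomorphism C (mult_map C H i j) \<and> algebra_hom C (tensor C K B) H (mult_map C H i j)) \<and>
      (conormal C H f \<longrightarrow>
         trivial_coaction C K B \<rho> \<and>
         is_isomorphism C (mult_map C H i j) \<and> coalgebra_hom C (tensor C K B) H (mult_map C H i j)) \<and>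
      (binormal C H f \<longrightarrow>
         (\<exists>s. is_hopf C K \<and> is_hopf C (with_antipode B s) \<and> unbraided C (ob K) (ob B) \<and>
              is_hopf C (tensor_hopf C K (with_antipode B s)) \<and>
              is_isomorphism C (mult_map C H i j) \<and>
              hopf_hom C (tensor_hopf C K (with_antipode B s)) H (mult_map C H i j))))"
proof -
  interpret abelian_braided_category C by fact
  show ?thesis
    using fitting_biproduct_exists[OF assms(2-5)] fitting_normal[OF assms(2,3,5)] by blast
qed

end
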